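(* Let $G$ be a totally torsion free profinite $l$-group. Then the action of $\pi_0K^G(k)\cong R[G]$ on $\pi_*K^G(\mathcal{E}G)$ satisfies $I_G\cdot\pi_*K^G(\mathcal{E}G)=\{0\}$.
   Context: Throughout $k$ is a fixed algebraically closed field and $l$ is a prime different from the characteristic of $k$. A profinite $l$-group (pro-$l$ group) $G$ is totally torsion free if for every closed subgroup $K\subseteq G$ the profinite abelianization $K^{ab}=K/\overline{[K,K]}$ is torsion free. \emph{Equivariant $K$-theory.} A ring $A$ is coherent if the kernel of any homomorphism of finitely generated free $A$-modules is finitely generated. For a commutative coherent $k$-algebra $A$ with discrete topology and continuous action of $G$ by $k$-algebra automorphisms, $\mathrm{Mod}^G(A)$ is the abelian category of finitely presented $A$-modules $M$ (discrete topology) with a continuous $G$-action satisfying $g(\alpha m)=\alpha^g\,gm$; $K^G(\mathrm{Spec}A)=K^G(A)$ is the Waldhausen $K$-theory spectrum of $\mathrm{Mod}^G(A)$. $R[G]=\pi_0K^G(k)$ is the representation ring of finite dimensional continuous $k$-linear representations of $G$, and $I_G=\ker(R[G]\to\mathbb{Z})$ is its augmentation ideal (kernel of dimension). $R[G]$ acts on $\pi_*K^G(A)$ via $(V,M)\mapsto V\otimes_kM$. The coordinate ring of $\mathcal{E}G$ below is coherent. \emph{$l$-BARs.} A based affine $\mathbb{Z}_l$-module is $(F,X,B)$ with $F$ a finitely generated free $\mathbb{Z}_l$-module, $X$ a continuous simply transitive $F$-space (each map $F\to X$, $f\mapsto f\cdot x$, is a homeomorphism) and $B$ a basis of $F$.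 Its automorphism group $\mathfrak{A}$ consists of pairs $(\varphi,\chi)$ with $\varphi$ a continuous $\mathbb{Z}_l$-automorphism of $F$ permuting $B$ and $\chi$ a homeomorphism of $X$ with $\chi(f\cdot x)=\varphi(f)\cdot\chi(x)$; choosing a base point, $\mathfrak{A}\cong\Sigma_B\ltimes F$. An $l$-BAR of a pro-$l$ group $G$ is a continuous homomorphism $\eta:G\to\mathfrak{A}$. For a closed subgroup $K\subseteq G$, $\eta$ is $K$-principal if the stabilizer in $G$ of every $x\in X$ equals $K$. Fix compatible primitive $l^s$-th roots of unity $\zeta_s\in k$, $\zeta_{s+1}^l=\zeta_s$. Let $\rho_s$ be the representation of $\mathfrak{A}$ on the $k$-vector space with basis $\{e_b\}_{b\in B}$ where $f=\sum f_b b\in F$ acts by $e_b\mapsto\zeta_s^{f_b}e_b$ and $\sigma\in\Sigma_B$ by $e_b\mapsto e_{\sigma(b)}$. Let $\mathcal{T}_\eta=\mathrm{Spec}\bigcup_s k[t_b^{\pm 1/l^s};b\in B]$ with $G$ acting through $\eta$ and the $\mathfrak A$-action $f\cdot t_b^{1/l^s}=\zeta_s^{f_b}t_b^{1/l^s}$, $\sigma\cdot t_b^{1/l^s}=t_{\sigma(b)}^{1/l^s}$. \emph{$\mathcal{E}G$.} For each closed normal subgroup $N$ of finite index in $G$ choose an $l$-BAR $\eta_N$ of $G$ which is $N'$-principal for some closed normal subgroup $N'\subseteq N$ of $G$. For each isomorphism class $\alpha$ of finite dimensional continuous $k$-linear representations of $G$ choose an $l$-BAR $\eta_\alpha$ with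 $\rho_s\circ\eta_\alpha\in\alpha$ for some $s$. (Such choices exist.) Then $\mathcal{E}G=\prod_N\mathcal{T}_{\eta_N}\times\prod_\alpha\mathcal{T}_{\eta_\alpha}$, the (possibly infinite) product of affine $k$-schemes with diagonal $G$-action. *)

theory Defs
  imports
    "HOL-Homology.Simplices"
    "HOL-Algebra.Generated_Groups"
    "HOL-Computational_Algebra.Computational_Algebra"
    "Jordan_Normal_Form.Matrix"
begin

section \<open>Profinite l-groups\<close>

text \<open>A topological group is an algebraic group \<open>G\<close> with a topology \<open>T\<close> on its carrier.\<close>

definition topological_grp :: "'g monoid \<Rightarrow> 'g topology \<Rightarrow> bool" where
  "topological_grp G T \<longleftrightarrow> group G \<and> topspace T = carrier G
     \<and> continuous_map (prod_topology T T) T (\<lambda>(x, y). x \<otimes>\<^bsub>G\<^esub> y)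
     \<and> continuous_map T T (\<lambda>x. inv\<^bsub>G\<^esub> x)"

definition profinite_grp :: "'g monoid \<Rightarrow> 'g topology \<Rightarrow> bool" where
  "profinite_grp G T \<longleftrightarrow> topological_grp G T \<and> compact_space T \<and> Hausdorff_space T
     \<and> (\<forall>S. connectedin T S \<longrightarrow> (\<exists>x. S \<subseteq> {x}))"

definition profinite_l_grp :: "nat \<Rightarrow> 'g monoid \<Rightarrow> 'g topology \<Rightarrow> bool" where
  "profinite_l_grp l G T \<longleftrightarrow> profinite_grp G T
     \<and> (\<forall>N. N \<lhd> G \<and> openin T N \<longrightarrow> (\<exists>r. card (rcosets\<^bsub>G\<^esub> N) = l ^ r))"

definition torsion_free_grp :: "('g, 'z) monoid_scheme \<Rightarrow> bool" where
  "torsion_free_grp H \<longleftrightarrow>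
     (\<forall>x\<in>carrier H. \<forall>n::nat. n > 0 \<and> x [^]\<^bsub>H\<^esub> n = \<one>\<^bsub>H\<^esub> \<longrightarrow> x = \<one>\<^bsub>H\<^esub>)"

definition totally_torsion_free :: "'g monoid \<Rightarrow> 'g topology \<Rightarrow> bool" where
  "totally_torsion_free G T \<longleftrightarrow>
     (\<forall>K. subgroup K G \<and> closedin T K \<longrightarrow>
        torsion_free_grp (G\<lparr>carrier := K\<rparr> Mod (T closure_of (derived G K))))"

definition closed_finite_index_normals :: "'g monoid \<Rightarrow> 'g topology \<Rightarrow> 'g set set" where
  "closed_finite_index_normals G T = {N. N \<lhd> G \<and> closedin T N \<and> finite (rcosets\<^bsub>G\<^esub> N)}"


section \<open>The l-adic integers\<close>

text \<open>The inverse limit of the rings of integers modulo \<open>l ^ n\<close>: an element \<open>x\<close> is the sequence of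
  its least nonnegative residues \<open>x n\<close> modulo \<open>l ^ n\<close>.\<close>

definition Zl :: "nat \<Rightarrow> (nat \<Rightarrow> int) ring" where
  "Zl l = \<lparr>carrier = {x. \<forall>n. 0 \<le> x n \<and> x n < int l ^ n \<and> x (Suc n) mod int l ^ n = x n},
     monoid.mult = (\<lambda>x y n. (x n * y n) mod int l ^ n), one = (\<lambda>n. 1 mod int l ^ n),
     zero = (\<lambda>n. 0), add = (\<lambda>x y n. (x n + y n) mod int l ^ n)\<rparr>"

definition Zl_top :: "nat \<Rightarrow> (nat \<Rightarrow> int) topology" where
  "Zl_top l = subtopology (product_topology (\<lambda>_. discrete_topology UNIV) UNIV) (carrier (Zl l))"

lemma Zl_cong_le:
  assumes "x \<in> carrier (Zl l)" "m \<le> n"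
  shows "x n mod int l ^ m = x m"
  using assms(2)
proof (induction n rule: dec_induct)
  case base
  then show ?case using assms(1) by (simp add: Zl_def)
next
  case (step n)
  have "x (Suc n) mod int l ^ m = (x (Suc n) mod int l ^ n) mod int l ^ m"
    using step.hyps by (simp add: mod_mod_cancel le_imp_power_dvd)
  also have "\<dots> = x n mod int l ^ m" using assms(1) by (simp add: Zl_def)
  finally show ?case using step.IH by simp
qed

lemma cring_Zl:
  assumes "l > 0"
  shows "cring (Zl l)"
proof (rule cringI)
  have p: "int l ^ n > 0" for n using assms by simp
  have m: "z mod int l ^ Suc n mod int l ^ n = z mod int l ^ n" for z n
    by (intro mod_mod_cancel) simp
  have x: "x (Suc n) mod int l ^ n = x n" if "x \<in> carrier (Zl l)" for x n
    using that by (simp add: Zl_def)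
  have clo: "(\<lambda>n. f n mod int l ^ n) \<in> carrier (Zl l)"
    if "\<And>n. f (Suc n) mod int l ^ n = f n mod int l ^ n" for f
    using p that m by (simp add: Zl_def del: power_Suc)
  have add: "(\<lambda>n. (x n + y n) mod int l ^ n) \<in> carrier (Zl l)"
    if "x \<in> carrier (Zl l)" "y \<in> carrier (Zl l)" for x y
    by (rule clo) (metis mod_add_eq x[OF that(1)] x[OF that(2)])
  have mul: "(\<lambda>n. (x n * y n) mod int l ^ n) \<in> carrier (Zl l)"
    if "x \<in> carrier (Zl l)" "y \<in> carrier (Zl l)" for x y
    by (rule clo) (metis mod_mult_eq x[OF that(1)] x[OF that(2)])
  have neg: "(\<lambda>n. (- x n) mod int l ^ n) \<in> carrier (Zl l)" if "x \<in> carrier (Zl l)" for x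
    by (rule clo) (metis mod_minus_eq x[OF that])
  have red: "x n mod int l ^ n = x n" if "x \<in> carrier (Zl l)" for x n
    using that by (simp add: Zl_def)
  show "abelian_group (Zl l)"
  proof (rule abelian_groupI)
    fix x assume "x \<in> carrier (Zl l)"
    then show "\<exists>y\<in>carrier (Zl l). y \<oplus>\<^bsub>Zl l\<^esub> x = \<zero>\<^bsub>Zl l\<^esub>"
      by (intro bexI[OF _ neg]) (auto simp: Zl_def mod_add_left_eq)
  qed (use add p red in \<open>auto simp: Zl_def mod_add_left_eq mod_add_right_eq ac_simps\<close>)
  show "comm_monoid (Zl l)"
  proof (rule comm_monoidI)
    show "\<one>\<^bsub>Zl l\<^esub> \<in> carrier (Zl l)" using clo[of "\<lambda>_. 1"] by (simp add: Zl_def)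
  qed (use mul red in \<open>auto simp: Zl_def mod_mult_left_eq mod_mult_right_eq ac_simps\<close>)
  fix x y z
  assume "x \<in> carrier (Zl l)" "y \<in> carrier (Zl l)" "z \<in> carrier (Zl l)"
  show "(x \<oplus>\<^bsub>Zl l\<^esub> y) \<otimes>\<^bsub>Zl l\<^esub> z = x \<otimes>\<^bsub>Zl l\<^esub> z \<oplus>\<^bsub>Zl l\<^esub> y \<otimes>\<^bsub>Zl l\<^esub> z"
    by (auto simp: Zl_def mod_mult_left_eq mod_add_eq distrib_right)
qed


section \<open>Based affine modules and l-BARs\<close>

record ('f, 'x) based_affine =
  bF :: "(nat \<Rightarrow> int, 'f) module"
  bX :: "'x topology"
  bact :: "'f \<Rightarrow> 'x \<Rightarrow> 'x"
  bB :: "'f set"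

definition free_basis :: "nat \<Rightarrow> (nat \<Rightarrow> int, 'f) module \<Rightarrow> 'f set \<Rightarrow> bool" where
  "free_basis l F B \<longleftrightarrow> finite B \<and> B \<subseteq> carrier F
     \<and> (\<forall>f\<in>carrier F. \<exists>!c. c \<in> B \<rightarrow>\<^sub>E carrier (Zl l) \<and> f = (\<Oplus>\<^bsub>F\<^esub>b\<in>B. c b \<odot>\<^bsub>F\<^esub> b))"

definition basis_coord :: "nat \<Rightarrow> (nat \<Rightarrow> int, 'f) module \<Rightarrow> 'f set \<Rightarrow> 'f \<Rightarrow> 'f \<Rightarrow> nat \<Rightarrow> int" where
  "basis_coord l F B f =
     (THE c. c \<in> B \<rightarrow>\<^sub>E carrier (Zl l) \<and> f = (\<Oplus>\<^bsub>F\<^esub>b\<in>B. c b \<odot>\<^bsub>F\<^esub> b))"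

text \<open>The canonical (l-adic) topology of a finitely generated free module.\<close>

definition free_top :: "nat \<Rightarrow> (nat \<Rightarrow> int, 'f) module \<Rightarrow> 'f set \<Rightarrow> 'f topology" where
  "free_top l F B =
     pullback_topology (carrier F) (basis_coord l F B) (product_topology (\<lambda>_. Zl_top l) B)"

definition based_affine_module :: "nat \<Rightarrow> ('f, 'x, 'z) based_affine_scheme \<Rightarrow> bool" where
  "based_affine_module l E \<longleftrightarrow>
     module (Zl l) (bF E) \<and> free_basis l (bF E) (bB E) \<and> topspace (bX E) \<noteq> {}
     \<and> (\<forall>x\<in>topspace (bX E). bact E \<zero>\<^bsub>bF E\<^esub> x = x)
     \<and> (\<forall>f\<in>carrier (bF E). \<forall>f'\<in>carrier (bF E). \<forall>x\<in>topspace (bX E).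
          bact E (f \<oplus>\<^bsub>bF E\<^esub> f') x = bact E f (bact E f' x))
     \<and> continuous_map (prod_topology (free_top l (bF E) (bB E)) (bX E)) (bX E) (\<lambda>(f, x). bact E f x)
     \<and> (\<forall>x\<in>topspace (bX E). homeomorphic_map (free_top l (bF E) (bB E)) (bX E) (\<lambda>f. bact E f x))"

definition aff_aut_set ::
    "nat \<Rightarrow> ('f, 'x, 'z) based_affine_scheme \<Rightarrow> (('f \<Rightarrow> 'f) \<times> ('x \<Rightarrow> 'x)) set" where
  "aff_aut_set l E = {(\<phi>, \<xi>).
     \<phi> \<in> extensional (carrier (bF E)) \<and> \<xi> \<in> extensional (topspace (bX E))
     \<and> bij_betw \<phi> (carrier (bF E)) (carrier (bF E))
     \<and> (\<forall>f\<in>carrier (bF E). \<forall>f'\<in>carrier (bF E). \<phi> (f \<oplus>\<^bsub>bF E\<^esub> f') = \<phi> f \<oplus>\<^bsub>bF E\<^esub> \<phi> f')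
     \<and> (\<forall>a\<in>carrier (Zl l). \<forall>f\<in>carrier (bF E). \<phi> (a \<odot>\<^bsub>bF E\<^esub> f) = a \<odot>\<^bsub>bF E\<^esub> \<phi> f)
     \<and> homeomorphic_map (free_top l (bF E) (bB E)) (free_top l (bF E) (bB E)) \<phi>
     \<and> bij_betw \<phi> (bB E) (bB E)
     \<and> homeomorphic_map (bX E) (bX E) \<xi>
     \<and> (\<forall>f\<in>carrier (bF E). \<forall>x\<in>topspace (bX E). \<xi> (bact E f x) = bact E (\<phi> f) (\<xi> x))}"

definition aff_aut ::
    "nat \<Rightarrow> ('f, 'x, 'z) based_affine_scheme \<Rightarrow> (('f \<Rightarrow> 'f) \<times> ('x \<Rightarrow> 'x)) monoid" where
  "aff_aut l E = \<lparr>carrier = aff_aut_set l E,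
     monoid.mult = (\<lambda>(\<phi>, \<xi>) (\<phi>', \<xi>'). (compose (carrier (bF E)) \<phi> \<phi>', compose (topspace (bX E)) \<xi> \<xi>')),
     one = (\<lambda>f\<in>carrier (bF E). f, \<lambda>x\<in>topspace (bX E). x)\<rparr>"

text \<open>An l-BAR carries, besides the homomorphism, the base point that identifies the automorphism
  group with the semidirect product of the permutations of \<open>B\<close> with \<open>F\<close>: the pair \<open>(\<phi>, \<xi>)\<close>
  corresponds to the permutation \<open>\<phi>\<close> of \<open>B\<close> (fixing the base point) followed by translation by
  the \<open>f\<close> with \<open>\<xi> base = f \<cdot> base\<close>. The topology on the automorphism group is the product
  topology under this identification.\<close>

record ('g, 'f, 'x) lbar = "('f, 'x) based_affine" +
  bpt :: 'x
  bhom :: "'g \<Rightarrow> ('f \<Rightarrow> 'f) \<times> ('x \<Rightarrow> 'x)"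

definition transl_part :: "('g, 'f, 'x) lbar \<Rightarrow> ('x \<Rightarrow> 'x) \<Rightarrow> 'f" where
  "transl_part \<eta> \<xi> = (THE f. f \<in> carrier (bF \<eta>) \<and> \<xi> (bpt \<eta>) = bact \<eta> f (bpt \<eta>))"

definition aff_aut_top ::
    "nat \<Rightarrow> ('g, 'f, 'x) lbar \<Rightarrow> (('f \<Rightarrow> 'f) \<times> ('x \<Rightarrow> 'x)) topology" where
  "aff_aut_top l \<eta> = pullback_topology (aff_aut_set l \<eta>)
     (\<lambda>(\<phi>, \<xi>). (restrict \<phi> (bB \<eta>), transl_part \<eta> \<xi>))
     (prod_topology (discrete_topology UNIV) (free_top l (bF \<eta>) (bB \<eta>)))"

definition is_lbar :: "nat \<Rightarrow> 'g monoid \<Rightarrow> 'g topology \<Rightarrow> ('g, 'f, 'x) lbar \<Rightarrow> bool" where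
  "is_lbar l G T \<eta> \<longleftrightarrow> based_affine_module l \<eta> \<and> bpt \<eta> \<in> topspace (bX \<eta>)
     \<and> bhom \<eta> \<in> hom G (aff_aut l \<eta>) \<and> continuous_map T (aff_aut_top l \<eta>) (bhom \<eta>)"

definition principal_lbar :: "'g monoid \<Rightarrow> ('g, 'f, 'x) lbar \<Rightarrow> 'g set \<Rightarrow> bool" where
  "principal_lbar G \<eta> K \<longleftrightarrow>
     (\<forall>x\<in>topspace (bX \<eta>). {g \<in> carrier G. snd (bhom \<eta> g) x = x} = K)"

definition lbar_perm :: "('g, 'f, 'x) lbar \<Rightarrow> 'g \<Rightarrow> 'f \<Rightarrow> 'f" where
  "lbar_perm \<eta> g = fst (bhom \<eta> g)"

definition lbar_coord :: "nat \<Rightarrow> ('g, 'f, 'x) lbar \<Rightarrow> 'g \<Rightarrow> 'f \<Rightarrow> nat \<Rightarrow> int" where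
  "lbar_coord l \<eta> g = basis_coord l (bF \<eta>) (bB \<eta>) (transl_part \<eta> (snd (bhom \<eta> g)))"


section \<open>Representations and the representation ring\<close>

text \<open>A finite dimensional continuous representation is given by matrices with respect to a basis.
  As the vector space is discrete, continuity of the action means that the matrix-valued map
  is locally constant.\<close>

definition rep_dim :: "'g monoid \<Rightarrow> ('g \<Rightarrow> 'k mat) \<Rightarrow> nat" where
  "rep_dim G \<rho> = dim_row (\<rho> \<one>\<^bsub>G\<^esub>)"

definition reps :: "'g monoid \<Rightarrow> 'g topology \<Rightarrow> ('g \<Rightarrow> 'k::field mat) set" where
  "reps G T = {\<rho>. (\<forall>g\<in>carrier G. \<rho> g \<in> carrier_mat (rep_dim G \<rho>) (rep_dim G \<rho>))
     \<and> \<rho> \<one>\<^bsub>G\<^esub> = 1\<^sub>m (rep_dim G \<rho>)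
     \<and> (\<forall>g\<in>carrier G. \<forall>h\<in>carrier G. \<rho> (g \<otimes>\<^bsub>G\<^esub> h) = \<rho> g * \<rho> h)
     \<and> continuous_map T (discrete_topology UNIV) \<rho>}"

definition intertwiner ::
    "'g monoid \<Rightarrow> ('g \<Rightarrow> 'k::field mat) \<Rightarrow> ('g \<Rightarrow> 'k mat) \<Rightarrow> 'k mat \<Rightarrow> bool" where
  "intertwiner G \<rho> \<sigma> P \<longleftrightarrow> P \<in> carrier_mat (rep_dim G \<sigma>) (rep_dim G \<rho>)
     \<and> (\<forall>g\<in>carrier G. P * \<rho> g = \<sigma> g * P)"

definition rep_iso ::
    "'g monoid \<Rightarrow> 'g topology \<Rightarrow> (('g \<Rightarrow> 'k::field mat) \<times> ('g \<Rightarrow> 'k mat)) set" where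
  "rep_iso G T = {(\<rho>, \<sigma>). \<rho> \<in> reps G T \<and> \<sigma> \<in> reps G T
     \<and> (\<exists>P. intertwiner G \<rho> \<sigma> P \<and> invertible_mat P)}"

definition rep_classes :: "'g monoid \<Rightarrow> 'g topology \<Rightarrow> ('g \<Rightarrow> 'k::field mat) set set" where
  "rep_classes G T = reps G T // rep_iso G T"

definition rep_ses ::
    "'g monoid \<Rightarrow> ('g \<Rightarrow> 'k::field mat) \<Rightarrow> ('g \<Rightarrow> 'k mat) \<Rightarrow> ('g \<Rightarrow> 'k mat) \<Rightarrow> bool" where
  "rep_ses G \<rho>' \<rho> \<rho>'' \<longleftrightarrow> (\<exists>P Q. intertwiner G \<rho>' \<rho> P \<and> intertwiner G \<rho> \<rho>'' Q
     \<and> inj_on (\<lambda>v. P *\<^sub>v v) (carrier_vec (rep_dim G \<rho>'))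
     \<and> (\<lambda>v. Q *\<^sub>v v) ` carrier_vec (rep_dim G \<rho>) = carrier_vec (rep_dim G \<rho>'')
     \<and> (\<lambda>v. P *\<^sub>v v) ` carrier_vec (rep_dim G \<rho>')
         = {v \<in> carrier_vec (rep_dim G \<rho>). Q *\<^sub>v v = 0\<^sub>v (rep_dim G \<rho>'')})"

text \<open>\<open>R[G]\<close> is the Grothendieck ring of representations: its elements are the cosets of virtual
  representations modulo short exact sequences. Isomorphic representations are identified by the
  short exact sequences with a zero-dimensional end.\<close>

definition ses_relations ::
    "'g monoid \<Rightarrow> 'g topology \<Rightarrow> (('g \<Rightarrow> 'k::field mat) \<Rightarrow>\<^sub>0 int) set" where
  "ses_relations G T = generate (free_Abelian_group (reps G T))
     {frag_of \<rho> - frag_of \<rho>' - frag_of \<rho>'' | \<rho> \<rho>' \<rho>''.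
        \<rho> \<in> reps G T \<and> \<rho>' \<in> reps G T \<and> \<rho>'' \<in> reps G T \<and> rep_ses G \<rho>' \<rho> \<rho>''}"

definition rep_tensor ::
    "'g monoid \<Rightarrow> ('g \<Rightarrow> 'k::field mat) \<Rightarrow> ('g \<Rightarrow> 'k mat) \<Rightarrow> 'g \<Rightarrow> 'k mat" where
  "rep_tensor G \<rho> \<sigma> g = (let d = rep_dim G \<rho>; e = rep_dim G \<sigma> in
     mat (d * e) (d * e) (\<lambda>(i, j). \<rho> g $$ (i div e, j div e) * \<sigma> g $$ (i mod e, j mod e)))"

definition virtual_tensor ::
    "'g monoid \<Rightarrow> (('g \<Rightarrow> 'k::field mat) \<Rightarrow>\<^sub>0 int) \<Rightarrow> (('g \<Rightarrow> 'k mat) \<Rightarrow>\<^sub>0 int) \<Rightarrow> (('g \<Rightarrow> 'k mat) \<Rightarrow>\<^sub>0 int)" where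
  "virtual_tensor G c d =
     frag_extend (\<lambda>\<rho>. frag_extend (\<lambda>\<sigma>. frag_of (rep_tensor G \<rho> \<sigma>)) d) c"

definition rep_ring ::
    "'g monoid \<Rightarrow> 'g topology \<Rightarrow> (('g \<Rightarrow> 'k::field mat) \<Rightarrow>\<^sub>0 int) set ring" where
  "rep_ring G T = (let A = free_Abelian_group (reps G T); S = ses_relations G T in
     \<lparr>carrier = carrier (A Mod S),
      monoid.mult = (\<lambda>r r'. \<Union>c\<in>r. \<Union>d\<in>r'. S #>\<^bsub>A\<^esub> virtual_tensor G c d),
      one = S #>\<^bsub>A\<^esub> frag_of (\<lambda>_. 1\<^sub>m 1),
      zero = \<one>\<^bsub>A Mod S\<^esub>, add = (\<lambda>r r'. r \<otimes>\<^bsub>A Mod S\<^esub> r')\<rparr>)"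

definition virtual_dim :: "'g monoid \<Rightarrow> (('g \<Rightarrow> 'k::field mat) \<Rightarrow>\<^sub>0 int) \<Rightarrow> int" where
  "virtual_dim G c = (\<Sum>\<rho>\<in>Poly_Mapping.keys c. Poly_Mapping.lookup c \<rho> * int (rep_dim G \<rho>))"

definition augmentation_ideal ::
    "'g monoid \<Rightarrow> 'g topology \<Rightarrow> (('g \<Rightarrow> 'k::field mat) \<Rightarrow>\<^sub>0 int) set set" where
  "augmentation_ideal G T = {r \<in> carrier (rep_ring G T). the_elem (virtual_dim G ` r) = 0}"


section \<open>Homotopy groups of the geometric realization of a simplicial set\<close>

text \<open>\<open>sop X m n \<theta>\<close> is the operation \<open>X\<^sub>n \<rightarrow> X\<^sub>m\<close> of a monotone map \<open>\<theta> : [m] \<rightarrow> [n]\<close>.\<close>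

record 's sset =
  simp :: "nat \<Rightarrow> 's set"
  sop :: "nat \<Rightarrow> nat \<Rightarrow> (nat \<Rightarrow> nat) \<Rightarrow> 's \<Rightarrow> 's"

definition monotone_maps :: "nat \<Rightarrow> nat \<Rightarrow> (nat \<Rightarrow> nat) set" where
  "monotone_maps m n = {\<theta>. \<theta> ` {..m} \<subseteq> {..n} \<and> mono_on {..m} \<theta>}"

definition simplex_push :: "nat \<Rightarrow> (nat \<Rightarrow> nat) \<Rightarrow> (nat \<Rightarrow> real) \<Rightarrow> nat \<Rightarrow> real" where
  "simplex_push m \<theta> t = (\<lambda>i. \<Sum>j | j \<le> m \<and> \<theta> j = i. t j)"

type_synonym 's cell_pt = "nat \<times> 's \<times> (nat \<Rightarrow> real)"

definition cell_pts :: "'s sset \<Rightarrow> 's cell_pt set" where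
  "cell_pts X = {(n, s, t). s \<in> simp X n \<and> t \<in> standard_simplex n}"

definition cell_glue :: "'s sset \<Rightarrow> ('s cell_pt \<times> 's cell_pt) set" where
  "cell_glue X = {((m, sop X m n \<theta> s, t), (n, s, simplex_push m \<theta> t)) | m n \<theta> s t.
     \<theta> \<in> monotone_maps m n \<and> s \<in> simp X n \<and> t \<in> standard_simplex m}"

definition cell_equiv :: "'s sset \<Rightarrow> ('s cell_pt \<times> 's cell_pt) set" where
  "cell_equiv X = (cell_glue X \<union> (cell_glue X)\<inverse>)\<^sup>*"

definition realization_open :: "'s sset \<Rightarrow> 's cell_pt set set \<Rightarrow> bool" where
  "realization_open X U \<longleftrightarrow> U \<subseteq> cell_pts X // cell_equiv X
     \<and> (\<forall>n. \<forall>s\<in>simp X n. openin (subtopology (powertop_real UNIV) (standard_simplex n))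
          {t \<in> standard_simplex n. cell_equiv X `` {(n, s, t)} \<in> U})"

definition realization :: "'s sset \<Rightarrow> 's cell_pt set topology" where
  "realization X = topology (realization_open X)"

lemma openin_realization: "openin (realization X) = realization_open X"
proof -
  have "istopology (realization_open X)"
    unfolding istopology_def
  proof (intro conjI allI impI)
    fix S T assume ST: "realization_open X S" "realization_open X T"
    have "{t \<in> A. f t \<in> S \<inter> T} = {t \<in> A. f t \<in> S} \<inter> {t \<in> A. f t \<in> T}"
      for A and f :: "(nat \<Rightarrow> real) \<Rightarrow> _" by auto
    then show "realization_open X (S \<inter> T)"
      using ST unfolding realization_open_def by (auto intro!: openin_Int)
  next
    fix \<K> assume K: "\<forall>K\<in>\<K>. realization_open X K"
    have "{t \<in> A. f t \<in> \<Union>\<K>} = (\<Union>K\<in>\<K>. {t \<in> A. f t \<in> K})"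
      for A and f :: "(nat \<Rightarrow> real) \<Rightarrow> _" by auto
    then show "realization_open X (\<Union>\<K>)"
      using K unfolding realization_open_def by (auto intro!: openin_Union)
  qed
  then show ?thesis unfolding realization_def by (rule topology_inverse')
qed

definition realization_map ::
    "'s2 sset \<Rightarrow> (nat \<Rightarrow> 's1 \<Rightarrow> 's2) \<Rightarrow> 's1 cell_pt set \<Rightarrow> 's2 cell_pt set" where
  "realization_map Y \<Phi> c = cell_equiv Y `` ((\<lambda>(n, s, t). (n, \<Phi> n s, t)) ` c)"

definition cube_top :: "nat \<Rightarrow> (nat \<Rightarrow> real) topology" where
  "cube_top n = product_topology (\<lambda>_. top_of_set {0..1}) {..<n}"

definition cube_boundary :: "nat \<Rightarrow> (nat \<Rightarrow> real) set" where
  "cube_boundary n = {x \<in> topspace (cube_top n). \<exists>i<n. x i = 0 \<or> x i = 1}"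

definition cube_loops :: "nat \<Rightarrow> 'x topology \<Rightarrow> 'x \<Rightarrow> ((nat \<Rightarrow> real) \<Rightarrow> 'x) set" where
  "cube_loops n X x0 = {f. continuous_map (cube_top n) X f \<and> f ` cube_boundary n \<subseteq> {x0}}"

definition cube_homotopic ::
    "nat \<Rightarrow> 'x topology \<Rightarrow> 'x \<Rightarrow> (((nat \<Rightarrow> real) \<Rightarrow> 'x) \<times> ((nat \<Rightarrow> real) \<Rightarrow> 'x)) set" where
  "cube_homotopic n X x0 =
     {(f, g). homotopic_with (\<lambda>h. h ` cube_boundary n \<subseteq> {x0}) (cube_top n) X f g}"

definition cube_concat :: "((nat \<Rightarrow> real) \<Rightarrow> 'x) \<Rightarrow> ((nat \<Rightarrow> real) \<Rightarrow> 'x) \<Rightarrow> (nat \<Rightarrow> real) \<Rightarrow> 'x" where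
  "cube_concat f g = (\<lambda>x. if x 0 \<le> 1/2 then f (x(0 := 2 * x 0)) else g (x(0 := 2 * x 0 - 1)))"

text \<open>Meaningful for \<open>n \<ge> 1\<close>.\<close>

definition homotopy_group :: "nat \<Rightarrow> 'x topology \<Rightarrow> 'x \<Rightarrow> ((nat \<Rightarrow> real) \<Rightarrow> 'x) set monoid" where
  "homotopy_group n X x0 = \<lparr>carrier = cube_loops n X x0 // cube_homotopic n X x0,
     monoid.mult = (\<lambda>A B. cube_homotopic n X x0 `` {cube_concat f g | f g. f \<in> A \<and> g \<in> B}),
     one = cube_homotopic n X x0 `` {\<lambda>_. x0}\<rparr>"

definition homotopy_group_map ::
    "nat \<Rightarrow> 'y topology \<Rightarrow> 'y \<Rightarrow> ('x \<Rightarrow> 'y) \<Rightarrow> ((nat \<Rightarrow> real) \<Rightarrow> 'x) set \<Rightarrow> ((nat \<Rightarrow> real) \<Rightarrow> 'y) set" where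
  "homotopy_group_map n Y y0 \<phi> A = cube_homotopic n Y y0 `` ((\<lambda>f. \<phi> \<circ> f) ` A)"


section \<open>Waldhausen K-theory\<close>

text \<open>The data entering Waldhausen's construction for an abelian category: cofibrations are the
  monomorphisms, recorded together with their quotients as short exact sequences \<open>ses\<close>; weak
  equivalences are the isomorphisms; \<open>zob\<close> is the distinguished zero object. \<open>cmp X Y Z g f\<close> is the
  composite of \<open>f : X \<rightarrow> Y\<close> and \<open>g : Y \<rightarrow> Z\<close>.\<close>

record ('o, 'm) wcat =
  obj :: "'o set"
  hm :: "'o \<Rightarrow> 'o \<Rightarrow> 'm set"
  cmp :: "'o \<Rightarrow> 'o \<Rightarrow> 'o \<Rightarrow> 'm \<Rightarrow> 'm \<Rightarrow> 'm"
  idn :: "'o \<Rightarrow> 'm"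
  zob :: 'o
  ses :: "'o \<Rightarrow> 'o \<Rightarrow> 'o \<Rightarrow> 'm \<Rightarrow> 'm \<Rightarrow> bool"

definition iso_in :: "('o, 'm) wcat \<Rightarrow> 'o \<Rightarrow> 'o \<Rightarrow> 'm \<Rightarrow> bool" where
  "iso_in C X Y f \<longleftrightarrow> f \<in> hm C X Y \<and>
     (\<exists>g\<in>hm C Y X. cmp C X Y X g f = idn C X \<and> cmp C Y X Y f g = idn C Y)"

text \<open>The diagonal of the nerve of the simplicial category \<open>wS\<^sub>\<bullet>C\<close>. An n-simplex is a chain of n
  isomorphisms between objects of \<open>S\<^sub>nC\<close>, that is, a functor to \<open>C\<close> on the poset of the triples
  \<open>(p, i, j)\<close> with \<open>p \<le> n\<close> (position in the chain) and \<open>i \<le> j \<le> n\<close> (object of the arrow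
  category of \<open>[n]\<close>).\<close>

type_synonym sindex = "nat \<times> nat \<times> nat"
type_synonym ('o, 'm) sdiagram = "(sindex \<Rightarrow> 'o) \<times> (sindex \<times> sindex \<Rightarrow> 'm)"

definition sindices :: "nat \<Rightarrow> sindex set" where
  "sindices n = {(p, i, j). p \<le> n \<and> i \<le> j \<and> j \<le> n}"

definition sarrows :: "nat \<Rightarrow> (sindex \<times> sindex) set" where
  "sarrows n = {((p, i, j), (p', i', j')). (p, i, j) \<in> sindices n \<and> (p', i', j') \<in> sindices n
     \<and> p \<le> p' \<and> i \<le> i' \<and> j \<le> j'}"

definition wS_simp :: "('o, 'm) wcat \<Rightarrow> nat \<Rightarrow> ('o, 'm) sdiagram set" where
  "wS_simp C n = {(A, a).
     A \<in> sindices n \<rightarrow>\<^sub>E obj C \<and> a \<in> extensional (sarrows n)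
     \<and> (\<forall>(x, y)\<in>sarrows n. a (x, y) \<in> hm C (A x) (A y))
     \<and> (\<forall>x\<in>sindices n. a (x, x) = idn C (A x))
     \<and> (\<forall>x y z. (x, y) \<in> sarrows n \<and> (y, z) \<in> sarrows n \<longrightarrow>
          a (x, z) = cmp C (A x) (A y) (A z) (a (y, z)) (a (x, y)))
     \<and> (\<forall>p q i j. p \<le> q \<and> q \<le> n \<and> i \<le> j \<and> j \<le> n \<longrightarrow>
          iso_in C (A (p, i, j)) (A (q, i, j)) (a ((p, i, j), (q, i, j))))
     \<and> (\<forall>p i. p \<le> n \<and> i \<le> n \<longrightarrow> A (p, i, i) = zob C)
     \<and> (\<forall>p i j k. p \<le> n \<and> i \<le> j \<and> j \<le> k \<and> k \<le> n \<longrightarrow>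
          ses C (A (p, i, j)) (A (p, i, k)) (A (p, j, k))
            (a ((p, i, j), (p, i, k))) (a ((p, i, k), (p, j, k))))}"

definition wS_op :: "nat \<Rightarrow> (nat \<Rightarrow> nat) \<Rightarrow> ('o, 'm) sdiagram \<Rightarrow> ('o, 'm) sdiagram" where
  "wS_op m \<theta> = (\<lambda>(A, a).
     (\<lambda>(p, i, j)\<in>sindices m. A (\<theta> p, \<theta> i, \<theta> j),
      \<lambda>((p, i, j), (p', i', j'))\<in>sarrows m. a ((\<theta> p, \<theta> i, \<theta> j), (\<theta> p', \<theta> i', \<theta> j'))))"

definition wS :: "('o, 'm) wcat \<Rightarrow> ('o, 'm) sdiagram sset" where
  "wS C = \<lparr>simp = wS_simp C, sop = (\<lambda>m n. wS_op m)\<rparr>"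

definition wS_base :: "('o, 'm) wcat \<Rightarrow> ('o, 'm) sdiagram cell_pt set" where
  "wS_base C = cell_equiv (wS C) ``
     {(0, (\<lambda>x\<in>sindices 0. zob C, \<lambda>x\<in>sarrows 0. idn C (zob C)), \<lambda>i. if i = 0 then 1 else 0)}"

text \<open>The n-th homotopy group of the K-theory spectrum, \<open>n \<ge> 0\<close>, which is the \<open>(n+1)\<close>-st homotopy
  group of \<open>|wS\<^sub>\<bullet>C|\<close>; the spectrum is connective. The group is written multiplicatively.\<close>

definition K_group ::
    "('o, 'm) wcat \<Rightarrow> nat \<Rightarrow> ((nat \<Rightarrow> real) \<Rightarrow> ('o, 'm) sdiagram cell_pt set) set monoid" where
  "K_group C n = homotopy_group (Suc n) (realization (wS C)) (wS_base C)"

definition wS_map ::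
    "('o1 \<Rightarrow> 'o2) \<Rightarrow> ('o1 \<Rightarrow> 'o1 \<Rightarrow> 'm1 \<Rightarrow> 'm2) \<Rightarrow> nat \<Rightarrow> ('o1, 'm1) sdiagram \<Rightarrow> ('o2, 'm2) sdiagram" where
  "wS_map Fo Fm n = (\<lambda>(A, a).
     (\<lambda>x\<in>sindices n. Fo (A x), \<lambda>(x, y)\<in>sarrows n. Fm (A x) (A y) (a (x, y))))"

text \<open>The map on homotopy groups induced by an exact functor to \<open>D\<close> (preserving the distinguished
  zero object), with object part \<open>Fo\<close> and morphism part \<open>Fm\<close>.\<close>

definition K_map ::
    "('o2, 'm2) wcat \<Rightarrow> ('o1 \<Rightarrow> 'o2) \<Rightarrow> ('o1 \<Rightarrow> 'o1 \<Rightarrow> 'm1 \<Rightarrow> 'm2) \<Rightarrow> nat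
      \<Rightarrow> ((nat \<Rightarrow> real) \<Rightarrow> ('o1, 'm1) sdiagram cell_pt set) set
      \<Rightarrow> ((nat \<Rightarrow> real) \<Rightarrow> ('o2, 'm2) sdiagram cell_pt set) set" where
  "K_map D Fo Fm n =
     homotopy_group_map (Suc n) (realization (wS D)) (wS_base D) (realization_map (wS D) (wS_map Fo Fm))"


section \<open>Equivariant finitely presented modules\<close>

text \<open>The set-theoretic universe for the elements of modules over a ring with elements in \<open>'a\<close>. It is
  large enough: a module generated by \<open>x\<^sub>0, \<dots>, x\<^sub>n\<close> is isomorphic to one whose elements are
  \<open>Coset S\<close>, with \<open>S\<close> running through the sets of coefficient vectors of the elements. It is closed
  under finite direct sums by means of \<open>Tup\<close>.\<close>

datatype 'a muniv = Coset "(nat \<Rightarrow> 'a) set" | Tup "'a muniv list"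

text \<open>Equivariant modules; the ring multiplication and unit of the module record are unused.\<close>

record ('a, 'b, 'g) gmodule = "('a, 'b) module" +
  gact :: "'g \<Rightarrow> 'b \<Rightarrow> 'b"

definition coeff_vectors :: "('a, 'r) ring_scheme \<Rightarrow> nat \<Rightarrow> (nat \<Rightarrow> 'a) set" where
  "coeff_vectors R n = {..<n} \<rightarrow>\<^sub>E carrier R"

definition lin_comb ::
    "('a, 'b, 'z) module_scheme \<Rightarrow> nat \<Rightarrow> (nat \<Rightarrow> 'b) \<Rightarrow> (nat \<Rightarrow> 'a) \<Rightarrow> 'b" where
  "lin_comb M n x a = (\<Oplus>\<^bsub>M\<^esub>i\<in>{..<n}. a i \<odot>\<^bsub>M\<^esub> x i)"

definition finitely_presented ::
    "('a, 'r) ring_scheme \<Rightarrow> ('a, 'b, 'z) module_scheme \<Rightarrow> bool" where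
  "finitely_presented R M \<longleftrightarrow> (\<exists>n x m y.
     x \<in> {..<n} \<rightarrow> carrier M \<and> lin_comb M n x ` coeff_vectors R n = carrier M
     \<and> y \<in> {..<m} \<rightarrow> coeff_vectors R n
     \<and> {a \<in> coeff_vectors R n. lin_comb M n x a = \<zero>\<^bsub>M\<^esub>}
         = {\<lambda>i\<in>{..<n}. \<Oplus>\<^bsub>R\<^esub>j\<in>{..<m}. c j \<otimes>\<^bsub>R\<^esub> y j i | c. c \<in> coeff_vectors R m})"

definition gmodules ::
    "'g monoid \<Rightarrow> 'g topology \<Rightarrow> 'a ring \<Rightarrow> ('g \<Rightarrow> 'a \<Rightarrow> 'a) \<Rightarrow> ('a, 'b, 'g) gmodule set" where
  "gmodules G T R ract = {M. module R M \<and> finitely_presented R M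
     \<and> (\<forall>g\<in>carrier G. \<forall>x\<in>carrier M. gact M g x \<in> carrier M)
     \<and> (\<forall>x\<in>carrier M. gact M \<one>\<^bsub>G\<^esub> x = x)
     \<and> (\<forall>g\<in>carrier G. \<forall>h\<in>carrier G. \<forall>x\<in>carrier M. gact M (g \<otimes>\<^bsub>G\<^esub> h) x = gact M g (gact M h x))
     \<and> (\<forall>g\<in>carrier G. \<forall>x\<in>carrier M. \<forall>y\<in>carrier M. gact M g (x \<oplus>\<^bsub>M\<^esub> y) = gact M g x \<oplus>\<^bsub>M\<^esub> gact M g y)
     \<and> (\<forall>g\<in>carrier G. \<forall>a\<in>carrier R. \<forall>x\<in>carrier M. gact M g (a \<odot>\<^bsub>M\<^esub> x) = ract g a \<odot>\<^bsub>M\<^esub> gact M g x)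
     \<and> continuous_map (prod_topology T (discrete_topology (carrier M)))
         (discrete_topology (carrier M)) (\<lambda>(g, x). gact M g x)}"

definition gmodule_hom ::
    "'g monoid \<Rightarrow> 'a ring \<Rightarrow> ('a, 'b, 'g) gmodule \<Rightarrow> ('a, 'b, 'g) gmodule \<Rightarrow> ('b \<Rightarrow> 'b) set" where
  "gmodule_hom G R M N = {f \<in> carrier M \<rightarrow>\<^sub>E carrier N.
     (\<forall>x\<in>carrier M. \<forall>y\<in>carrier M. f (x \<oplus>\<^bsub>M\<^esub> y) = f x \<oplus>\<^bsub>N\<^esub> f y)
     \<and> (\<forall>a\<in>carrier R. \<forall>x\<in>carrier M. f (a \<odot>\<^bsub>M\<^esub> x) = a \<odot>\<^bsub>N\<^esub> f x)
     \<and> (\<forall>g\<in>carrier G. \<forall>x\<in>carrier M. f (gact M g x) = gact N g (f x))}"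

definition zero_gmodule :: "('a, 'a muniv, 'g) gmodule" where
  "zero_gmodule = \<lparr>carrier = {Tup []}, monoid.mult = (\<lambda>_ _. Tup []), one = Tup [], zero = Tup [],
     add = (\<lambda>_ _. Tup []), smult = (\<lambda>_ _. Tup []), gact = (\<lambda>_ _. Tup [])\<rparr>"

definition Mod_cat ::
    "'g monoid \<Rightarrow> 'g topology \<Rightarrow> 'a ring \<Rightarrow> ('g \<Rightarrow> 'a \<Rightarrow> 'a)
      \<Rightarrow> (('a, 'a muniv, 'g) gmodule, 'a muniv \<Rightarrow> 'a muniv) wcat" where
  "Mod_cat G T R ract = \<lparr>obj = gmodules G T R ract, hm = gmodule_hom G R,
     cmp = (\<lambda>L M N g f. compose (carrier L) g f), idn = (\<lambda>M. \<lambda>x\<in>carrier M. x),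
     zob = zero_gmodule,
     ses = (\<lambda>L M N f g. f \<in> gmodule_hom G R L M \<and> g \<in> gmodule_hom G R M N
       \<and> inj_on f (carrier L) \<and> g ` carrier M = carrier N
       \<and> f ` carrier L = {x \<in> carrier M. g x = \<zero>\<^bsub>N\<^esub>})\<rparr>"

text \<open>\<open>V \<otimes>\<^sub>k M\<close> for a representation \<open>V\<close> with basis \<open>e\<^sub>0, \<dots>, e\<^sub>d\<^sub>-\<^sub>1\<close>: the element
  \<open>\<Sum>i. e\<^sub>i \<otimes> x\<^sub>i\<close> is the tuple \<open>(x\<^sub>0, \<dots>, x\<^sub>d\<^sub>-\<^sub>1)\<close> and \<open>g (e\<^sub>j \<otimes> x) = \<Sum>i. \<rho> g\<^sub>i\<^sub>j e\<^sub>i \<otimes> g x\<close>. Tuples of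
  \<open>Tup []\<close> are encoded by \<open>Tup []\<close>, so that the functor preserves the distinguished zero module.
  \<open>\<iota>\<close> is the structure map from \<open>k\<close> to the ring.\<close>

definition tup :: "'a muniv list \<Rightarrow> 'a muniv" where
  "tup xs = (if set xs \<subseteq> {Tup []} then Tup [] else Tup xs)"

definition untup :: "nat \<Rightarrow> 'a muniv \<Rightarrow> 'a muniv list" where
  "untup d u = (case u of Tup xs \<Rightarrow> if xs = [] then replicate d (Tup []) else xs | Coset _ \<Rightarrow> [])"

lemma untup_tup: "length xs = d \<Longrightarrow> untup d (tup xs) = xs"
  by (auto simp: untup_def tup_def intro!: replicate_eqI[symmetric])

definition tensor_obj ::
    "'g monoid \<Rightarrow> ('k \<Rightarrow> 'a) \<Rightarrow> ('g \<Rightarrow> 'k mat) \<Rightarrow> ('a, 'a muniv, 'g) gmodule \<Rightarrow> ('a, 'a muniv, 'g) gmodule" where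
  "tensor_obj G \<iota> \<rho> M = (let d = rep_dim G \<rho> in
     if M = zero_gmodule then zero_gmodule else
     \<lparr>carrier = tup ` {xs. length xs = d \<and> set xs \<subseteq> carrier M},
      monoid.mult = undefined, one = undefined,
      zero = tup (replicate d \<zero>\<^bsub>M\<^esub>),
      add = (\<lambda>u v. tup (map2 (\<lambda>x y. x \<oplus>\<^bsub>M\<^esub> y) (untup d u) (untup d v))),
      smult = (\<lambda>a u. tup (map (\<lambda>x. a \<odot>\<^bsub>M\<^esub> x) (untup d u))),
      gact = (\<lambda>g u. tup (map (\<lambda>i. \<Oplus>\<^bsub>M\<^esub>j\<in>{..<d}. \<iota> (\<rho> g $$ (i, j)) \<odot>\<^bsub>M\<^esub> gact M g (untup d u ! j)) [0..<d]))\<rparr>)"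

definition tensor_mor ::
    "'g monoid \<Rightarrow> ('k \<Rightarrow> 'a) \<Rightarrow> ('g \<Rightarrow> 'k mat) \<Rightarrow> ('a, 'a muniv, 'g) gmodule \<Rightarrow> ('a, 'a muniv, 'g) gmodule
      \<Rightarrow> ('a muniv \<Rightarrow> 'a muniv) \<Rightarrow> 'a muniv \<Rightarrow> 'a muniv" where
  "tensor_mor G \<iota> \<rho> M N f =
     (\<lambda>u\<in>carrier (tensor_obj G \<iota> \<rho> M). tup (map f (untup (rep_dim G \<rho>) u)))"

type_synonym ('a, 'g) KG_elem =
  "((nat \<Rightarrow> real) \<Rightarrow> (('a, 'a muniv, 'g) gmodule, 'a muniv \<Rightarrow> 'a muniv) sdiagram cell_pt set) set"

definition KG_group ::
    "'g monoid \<Rightarrow> 'g topology \<Rightarrow> 'a ring \<Rightarrow> ('g \<Rightarrow> 'a \<Rightarrow> 'a) \<Rightarrow> nat \<Rightarrow> ('a, 'g) KG_elem monoid" where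
  "KG_group G T R ract n = K_group (Mod_cat G T R ract) n"

text \<open>The action of \<open>R[G]\<close>: a virtual representation \<open>\<Sum>\<rho>. c \<rho> \<cdot> [\<rho>]\<close> acts as the corresponding integral
  combination of the maps induced by the functors \<open>\<rho> \<otimes>\<^sub>k _\<close>, and a class through its
  representatives.\<close>

definition virtual_rep_act ::
    "'g monoid \<Rightarrow> 'g topology \<Rightarrow> 'a ring \<Rightarrow> ('k::field \<Rightarrow> 'a) \<Rightarrow> ('g \<Rightarrow> 'a \<Rightarrow> 'a) \<Rightarrow> nat
      \<Rightarrow> (('g \<Rightarrow> 'k mat) \<Rightarrow>\<^sub>0 int) \<Rightarrow> ('a, 'g) KG_elem \<Rightarrow> ('a, 'g) KG_elem" where
  "virtual_rep_act G T R \<iota> ract n c y =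
     (\<Otimes>\<^bsub>KG_group G T R ract n\<^esub>\<rho>\<in>Poly_Mapping.keys c.
        K_map (Mod_cat G T R ract) (tensor_obj G \<iota> \<rho>) (tensor_mor G \<iota> \<rho>) n y
          [^]\<^bsub>KG_group G T R ract n\<^esub> Poly_Mapping.lookup c \<rho>)"

definition rep_ring_act ::
    "'g monoid \<Rightarrow> 'g topology \<Rightarrow> 'a ring \<Rightarrow> ('k::field \<Rightarrow> 'a) \<Rightarrow> ('g \<Rightarrow> 'a \<Rightarrow> 'a) \<Rightarrow> nat
      \<Rightarrow> (('g \<Rightarrow> 'k mat) \<Rightarrow>\<^sub>0 int) set \<Rightarrow> ('a, 'g) KG_elem \<Rightarrow> ('a, 'g) KG_elem" where
  "rep_ring_act G T R \<iota> ract n r y = the_elem ((\<lambda>c. virtual_rep_act G T R \<iota> ract n c y) ` r)"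

text \<open>The subgroup \<open>I \<cdot> \<pi>\<^sub>n K\<^sup>G(R)\<close> for a set \<open>I\<close> of elements of \<open>R[G]\<close>.\<close>

definition ideal_times_KG ::
    "'g monoid \<Rightarrow> 'g topology \<Rightarrow> 'a ring \<Rightarrow> ('k::field \<Rightarrow> 'a) \<Rightarrow> ('g \<Rightarrow> 'a \<Rightarrow> 'a) \<Rightarrow> nat
      \<Rightarrow> (('g \<Rightarrow> 'k mat) \<Rightarrow>\<^sub>0 int) set set \<Rightarrow> ('a, 'g) KG_elem set" where
  "ideal_times_KG G T R \<iota> ract n I = generate (KG_group G T R ract n)
     {rep_ring_act G T R \<iota> ract n r y | r y. r \<in> I \<and> y \<in> carrier (KG_group G T R ract n)}"


section \<open>The tori and \<open>EG\<close>\<close>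

definition compatible_roots :: "nat \<Rightarrow> (nat \<Rightarrow> 'k::field) \<Rightarrow> bool" where
  "compatible_roots l \<zeta> \<longleftrightarrow> (\<forall>s. \<zeta> s ^ (l ^ s) = 1 \<and> (\<forall>j. 0 < j \<and> j < l ^ s \<longrightarrow> \<zeta> s ^ j \<noteq> 1)
     \<and> \<zeta> (Suc s) ^ l = \<zeta> s)"

text \<open>The representation \<open>\<rho>\<^sub>s \<circ> \<eta>\<close> in the basis \<open>(e\<^sub>b)\<close> enumerated by the list \<open>bs\<close>; the permutation
  acts first, then the translation, so that \<open>e\<^sub>b\<close> goes to \<open>\<zeta>\<^sub>s ^ (f\<^sub>\<sigma>\<^sub>b) e\<^sub>\<sigma>\<^sub>b\<close>.\<close>

definition lbar_rep ::
    "nat \<Rightarrow> (nat \<Rightarrow> 'k::field) \<Rightarrow> ('g, 'f, 'x) lbar \<Rightarrow> nat \<Rightarrow> 'f list \<Rightarrow> 'g \<Rightarrow> 'k mat" where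
  "lbar_rep l \<zeta> \<eta> s bs g = mat (length bs) (length bs) (\<lambda>(i, j).
     if bs ! i = lbar_perm \<eta> g (bs ! j) then \<zeta> s powi (lbar_coord l \<eta> g (bs ! i) s) else 0)"

text \<open>\<open>laurent_ring l V\<close> is \<open>\<Union>s. k[t\<^sub>v\<^sup>\<plusminus>\<^sup>1\<^sup>/\<^sup>l\<^sup>^\<^sup>s; v \<in> V]\<close>: polynomials are finitely supported functions on
  exponents, and an exponent is a finitely supported function on variables with values in
  the rationals with denominator a power of \<open>l\<close>.\<close>

type_synonym ('v, 'k) laurent = "('v \<Rightarrow>\<^sub>0 rat) \<Rightarrow>\<^sub>0 'k"

definition laurent_exponents :: "nat \<Rightarrow> 'v set \<Rightarrow> ('v \<Rightarrow>\<^sub>0 rat) set" where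
  "laurent_exponents l V = {e. Poly_Mapping.keys e \<subseteq> V
     \<and> (\<forall>v. \<exists>s. Poly_Mapping.lookup e v * of_nat (l ^ s) \<in> \<int>)}"

definition laurent_ring :: "nat \<Rightarrow> 'v set \<Rightarrow> ('v, 'k::field) laurent ring" where
  "laurent_ring l V = \<lparr>carrier = {p. Poly_Mapping.keys p \<subseteq> laurent_exponents l V},
     monoid.mult = (*), one = 1, zero = 0, add = (+)\<rparr>"

lemma laurent_exponents_add:
  assumes "a \<in> laurent_exponents l V" "b \<in> laurent_exponents l V"
  shows "a + b \<in> laurent_exponents l V"
proof -
  have "\<exists>s. Poly_Mapping.lookup (a + b) v * of_nat (l ^ s) \<in> \<int>" for v
  proof -
    obtain s s' where s: "Poly_Mapping.lookup a v * of_nat (l ^ s) \<in> \<int>"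
      and s': "Poly_Mapping.lookup b v * of_nat (l ^ s') \<in> \<int>"
      using assms unfolding laurent_exponents_def by blast
    have "Poly_Mapping.lookup (a + b) v * of_nat (l ^ (s + s'))
        = Poly_Mapping.lookup a v * of_nat (l ^ s) * of_nat (l ^ s')
          + Poly_Mapping.lookup b v * of_nat (l ^ s') * of_nat (l ^ s)"
      by (simp add: lookup_add power_add algebra_simps)
    also have "\<dots> \<in> \<int>"
      by (intro Ints_add Ints_mult[OF s] Ints_mult[OF s'] Ints_of_nat)
    finally show ?thesis by blast
  qed
  moreover have "Poly_Mapping.keys (a + b) \<subseteq> V"
    using assms Poly_Mapping.keys_add[of a b] unfolding laurent_exponents_def by blast
  ultimately show ?thesis unfolding laurent_exponents_def by blast
qed

lemma cring_laurent_ring: "cring (laurent_ring l V :: ('v, 'k::field) laurent ring)"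
proof (rule cringI)
  let ?R = "laurent_ring l V :: ('v, 'k) laurent ring"
  have add: "p + q \<in> carrier ?R" if "p \<in> carrier ?R" "q \<in> carrier ?R" for p q :: "('v, 'k) laurent"
    using that Poly_Mapping.keys_add[of p q] by (auto simp: laurent_ring_def)
  have mul: "p * q \<in> carrier ?R" if "p \<in> carrier ?R" "q \<in> carrier ?R" for p q :: "('v, 'k) laurent"
    using that keys_mult[of p q] laurent_exponents_add[of _ l V]
    by (fastforce simp: laurent_ring_def)
  have neg: "- p \<in> carrier ?R" if "p \<in> carrier ?R" for p :: "('v, 'k) laurent"
    using that by (simp add: laurent_ring_def)
  show "abelian_group ?R"
  proof (rule abelian_groupI)
    fix p :: "('v, 'k) laurent" assume "p \<in> carrier ?R"
    then show "\<exists>q\<in>carrier ?R. q \<oplus>\<^bsub>?R\<^esub> p = \<zero>\<^bsub>?R\<^esub>"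
      by (intro bexI[OF _ neg]) (auto simp: laurent_ring_def)
  qed (use add in \<open>auto simp: laurent_ring_def ac_simps\<close>)
  show "comm_monoid ?R"
    by (rule comm_monoidI)
      (use mul in \<open>auto simp: laurent_ring_def laurent_exponents_def ac_simps\<close>)
qed (auto simp: laurent_ring_def distrib_right)

definition laurent_const :: "'k::field \<Rightarrow> ('v, 'k) laurent" where
  "laurent_const c = Poly_Mapping.single 0 c"

text \<open>\<open>root_char l \<zeta> q x = \<zeta>\<^sub>s ^ (m x)\<close> for \<open>q = m / l ^ s\<close> and an l-adic integer \<open>x\<close>.\<close>

definition root_char :: "nat \<Rightarrow> (nat \<Rightarrow> 'k::field) \<Rightarrow> rat \<Rightarrow> (nat \<Rightarrow> int) \<Rightarrow> 'k" where
  "root_char l \<zeta> q x = (let s = (LEAST s. q * of_nat (l ^ s) \<in> \<int>)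
     in \<zeta> s powi (\<lfloor>q * of_nat (l ^ s)\<rfloor> * x s))"

text \<open>The k-algebra automorphism that sends \<open>t\<^sub>v\<^sup>1\<^sup>/\<^sup>l\<^sup>^\<^sup>s\<close> to \<open>\<zeta>\<^sub>s ^ (c (\<sigma> v)) t\<^sub>\<sigma>\<^sub>v\<^sup>1\<^sup>/\<^sup>l\<^sup>^\<^sup>s\<close> (first permute the variables,
  then translate).\<close>

definition laurent_act ::
    "nat \<Rightarrow> (nat \<Rightarrow> 'k::field) \<Rightarrow> ('v \<Rightarrow> 'v) \<Rightarrow> ('v \<Rightarrow> nat \<Rightarrow> int) \<Rightarrow> ('v, 'k) laurent \<Rightarrow> ('v, 'k) laurent" where
  "laurent_act l \<zeta> \<sigma> c p = (\<Sum>e\<in>Poly_Mapping.keys p.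
     Poly_Mapping.single
       (\<Sum>v\<in>Poly_Mapping.keys e. Poly_Mapping.single (\<sigma> v) (Poly_Mapping.lookup e v))
       (Poly_Mapping.lookup p e
          * (\<Prod>v\<in>Poly_Mapping.keys e. root_char l \<zeta> (Poly_Mapping.lookup e v) (c (\<sigma> v)))))"

text \<open>The coordinate ring of \<open>T\<^sub>\<eta>\<close> with its \<open>G\<close>-action.\<close>

definition torus_ring :: "nat \<Rightarrow> ('g, 'f, 'x) lbar \<Rightarrow> ('f, 'k::field) laurent ring" where
  "torus_ring l \<eta> = laurent_ring l (bB \<eta>)"

definition torus_act ::
    "nat \<Rightarrow> (nat \<Rightarrow> 'k::field) \<Rightarrow> ('g, 'f, 'x) lbar \<Rightarrow> 'g \<Rightarrow> ('f, 'k) laurent \<Rightarrow> ('f, 'k) laurent" where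
  "torus_act l \<zeta> \<eta> g = laurent_act l \<zeta> (lbar_perm \<eta> g) (lbar_coord l \<eta> g)"

text \<open>The coordinate ring of the product of the schemes \<open>T\<^sub>\<eta>\<^sub>i\<close>, \<open>i \<in> I\<close>, with the diagonal action: the
  tensor product over \<open>k\<close> of their coordinate rings, whose monomials are finite products of
  monomials in the variables \<open>t\<^sub>(\<^sub>i\<^sub>,\<^sub>b\<^sub>)\<close> with \<open>b\<close> in the basis of \<open>\<eta>\<^sub>i\<close>.\<close>

definition torus_prod_ring ::
    "nat \<Rightarrow> 'i set \<Rightarrow> ('i \<Rightarrow> ('g, 'f, 'x) lbar) \<Rightarrow> ('i \<times> 'f, 'k::field) laurent ring" where
  "torus_prod_ring l I \<eta> = laurent_ring l (SIGMA i:I. bB (\<eta> i))"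

definition torus_prod_act ::
    "nat \<Rightarrow> (nat \<Rightarrow> 'k::field) \<Rightarrow> ('i \<Rightarrow> ('g, 'f, 'x) lbar) \<Rightarrow> 'g
      \<Rightarrow> ('i \<times> 'f, 'k) laurent \<Rightarrow> ('i \<times> 'f, 'k) laurent" where
  "torus_prod_act l \<zeta> \<eta> g = laurent_act l \<zeta>
     (\<lambda>(i, b). (i, lbar_perm (\<eta> i) g b)) (\<lambda>(i, b). lbar_coord l (\<eta> i) g b)"

type_synonym ('g, 'k) EG_index = "'g set + ('g \<Rightarrow> 'k mat) set"

definition EG_indices :: "'g monoid \<Rightarrow> 'g topology \<Rightarrow> ('g, 'k::field) EG_index set" where
  "EG_indices G T = Inl ` closed_finite_index_normals G T \<union> Inr ` rep_classes G T"

text \<open>The family of the chosen l-BARs that defines \<open>EG\<close>.\<close>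

definition EG_choice ::
    "nat \<Rightarrow> 'g monoid \<Rightarrow> 'g topology \<Rightarrow> (nat \<Rightarrow> 'k::field)
      \<Rightarrow> (('g, 'k) EG_index \<Rightarrow> ('g, 'f, 'x) lbar) \<Rightarrow> bool" where
  "EG_choice l G T \<zeta> \<eta> \<longleftrightarrow>
     (\<forall>N\<in>closed_finite_index_normals G T. is_lbar l G T (\<eta> (Inl N))
        \<and> (\<exists>N'. N' \<lhd> G \<and> closedin T N' \<and> N' \<subseteq> N \<and> principal_lbar G (\<eta> (Inl N)) N'))
     \<and> (\<forall>\<alpha>\<in>rep_classes G T. is_lbar l G T (\<eta> (Inr \<alpha>))
        \<and> (\<exists>s bs. distinct bs \<and> set bs = bB (\<eta> (Inr \<alpha>)) \<and> lbar_rep l \<zeta> (\<eta> (Inr \<alpha>)) s bs \<in> \<alpha>))"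

definition EG_ring ::
    "nat \<Rightarrow> 'g monoid \<Rightarrow> 'g topology \<Rightarrow> (('g, 'k) EG_index \<Rightarrow> ('g, 'f, 'x) lbar)
      \<Rightarrow> (('g, 'k) EG_index \<times> 'f, 'k::field) laurent ring" where
  "EG_ring l G T \<eta> = torus_prod_ring l (EG_indices G T) \<eta>"

definition EG_act ::
    "nat \<Rightarrow> (nat \<Rightarrow> 'k::field) \<Rightarrow> (('g, 'k) EG_index \<Rightarrow> ('g, 'f, 'x) lbar) \<Rightarrow> 'g
      \<Rightarrow> (('g, 'k) EG_index \<times> 'f, 'k) laurent \<Rightarrow> (('g, 'k) EG_index \<times> 'f, 'k) laurent" where
  "EG_act l \<zeta> \<eta> = torus_prod_act l \<zeta> \<eta>"

end

theory Submission
  imports Defs "HOL-Analysis.Abstract_Topological_Spaces" "HOL-Analysis.Sum_Topology" "Jordan_Normal_Form.Determinant"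
begin

text \<open>A representation of \<open>G\<close> acts on \<open>K\<^sup>G(\<E>G)\<close> as its dimension, by induction on the dimension. It is
  isomorphic to a monomial representation \<open>\<rho>\<^sub>s \<circ> \<eta>\<^sub>\<alpha>\<close>, and over \<open>\<E>G\<close> the units \<open>t\<^sub>b\<^sup>1\<^sup>/\<^sup>l\<^sup>^\<^sup>s\<close> rescale the
  basis so that this becomes a permutation representation. Its image is a finite \<open>l\<close>-group, and \<open>l\<close> is
  invertible in \<open>k\<close>, so the line spanned by the sum of the basis vectors has an invariant complement of
  smaller dimension. Tensoring with a direct sum acts as the sum of the actions: the direct sum of
  modules induces a pairing of the realization of the \<open>wS\<close>-construction with itself, which computes the group
  structure of the homotopy groups by the Eckmann--Hilton argument. Products of points in two cells are
  formed by monotone couplings of their barycentric coordinates.\<close>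

section \<open>Pairings of simplicial sets\<close>

text \<open>A product of two realizations need not carry the quotient topology of its cells. The
  pairing is therefore a function on pairs of points, and its continuity is shown only after one
  argument has been composed with a map from a compact Hausdorff space. Loops and homotopies have
  cubes as sources, so this suffices.

  Commutativity has to be proved in all degrees, since the lowest K-group is a fundamental group.

  Exact functors have to preserve the chosen zero object literally, because it provides the base
  point. This is the origin of the collapse of tuples of \<open>Tup []\<close> and of the case
  distinctions on \<open>zero_gmodule\<close>; working in coordinates hides them.

  A class in \<open>R[G]\<close> acts through its representatives. That the result does not depend
  on them comes out of the same computation as the theorem: each representation acts through its
  dimension, and dimension is additive on short exact sequences.\<close>

locale simplicial =
  fixes X :: "'s sset"
  assumes sop_closed: "\<theta> \<in> monotone_maps m n \<Longrightarrow> s \<in> simp X n \<Longrightarrow> sop X m n \<theta> s \<in> simp X m"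
    and sop_comp: "\<theta> \<in> monotone_maps m n \<Longrightarrow> \<theta>' \<in> monotone_maps k m \<Longrightarrow> s \<in> simp X n
      \<Longrightarrow> sop X k m \<theta>' (sop X m n \<theta> s) = sop X k n (\<theta> \<circ> \<theta>') s"
    and sop_cong: "(\<And>i. i \<le> m \<Longrightarrow> \<theta> i = \<theta>' i) \<Longrightarrow> sop X m n \<theta> s = sop X m n \<theta>' s"
    and sop_id: "s \<in> simp X n \<Longrightarrow> sop X n n id s = s"

definition cls :: "'s sset \<Rightarrow> nat \<Rightarrow> 's \<Rightarrow> (nat \<Rightarrow> real) \<Rightarrow> 's cell_pt set" where
  "cls X n s t = cell_equiv X `` {(n, s, t)}"

abbreviation simplex_top :: "nat \<Rightarrow> (nat \<Rightarrow> real) topology" where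
  "simplex_top n \<equiv> subtopology (powertop_real UNIV) (standard_simplex n)"

lemma monotone_maps_le: "\<theta> \<in> monotone_maps m n \<Longrightarrow> i \<le> m \<Longrightarrow> \<theta> i \<le> n"
  by (auto simp: monotone_maps_def)

lemma monotone_maps_mono: "\<theta> \<in> monotone_maps m n \<Longrightarrow> i \<le> j \<Longrightarrow> j \<le> m \<Longrightarrow> \<theta> i \<le> \<theta> j"
  by (auto simp: monotone_maps_def mono_on_def)

lemma monotone_mapsI:
  "(\<And>i. i \<le> m \<Longrightarrow> \<theta> i \<le> n) \<Longrightarrow> (\<And>i j. i \<le> j \<Longrightarrow> j \<le> m \<Longrightarrow> \<theta> i \<le> \<theta> j) \<Longrightarrow> \<theta> \<in> monotone_maps m n"
  by (auto simp: monotone_maps_def mono_on_def)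

lemma monotone_maps_comp:
  assumes "\<theta> \<in> monotone_maps m n" "\<theta>' \<in> monotone_maps k m"
  shows "\<theta> \<circ> \<theta>' \<in> monotone_maps k n"
  by (intro monotone_mapsI) (simp_all add: monotone_maps_le[OF assms(1)] monotone_maps_le[OF assms(2)]
      monotone_maps_mono[OF assms(1)] monotone_maps_mono[OF assms(2)])

lemma id_monotone_maps: "id \<in> monotone_maps n n"
  by (auto simp: monotone_maps_def mono_on_def)

lemma simplex_push_in:
  assumes "\<theta> \<in> monotone_maps m n" "t \<in> standard_simplex m"
  shows "simplex_push m \<theta> t \<in> standard_simplex n"
proof -
  have nn: "t i \<ge> 0" for i using assms by (auto simp: standard_simplex_def)
  have tot: "(\<Sum>i\<le>n. simplex_push m \<theta> t i) = (\<Sum>i\<le>m. t i)"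
  proof -
    have "(\<Sum>i\<le>n. \<Sum>j | j \<in> {..m} \<and> \<theta> j = i. t j) = (\<Sum>j\<in>{..m}. t j)"
      by (rule sum.group) (use assms monotone_maps_le in auto)
    then show ?thesis by (simp add: simplex_push_def)
  qed
  have ge: "simplex_push m \<theta> t i \<ge> 0" for i
    unfolding simplex_push_def by (intro sum_nonneg) (use nn in auto)
  have zero: "simplex_push m \<theta> t i = 0" if "i > n" for i
    unfolding simplex_push_def using that monotone_maps_le[OF assms(1)]
    by (intro sum.neutral) fastforce
  have one: "(\<Sum>i\<le>n. simplex_push m \<theta> t i) = 1"
    using tot assms by (simp add: standard_simplex_def)
  have "simplex_push m \<theta> t i \<le> 1" for i
  proof (cases "i \<le> n")
    case True
    then have "simplex_push m \<theta> t i \<le> (\<Sum>i\<le>n. simplex_push m \<theta> t i)"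
      by (intro member_le_sum) (use ge in auto)
    then show ?thesis using one by simp
  qed (use zero in simp)
  then show ?thesis using ge zero one by (auto simp: standard_simplex_def)
qed

lemma simplex_push_comp:
  assumes "\<theta>' \<in> monotone_maps k m"
  shows "simplex_push m \<theta> (simplex_push k \<theta>' t) = simplex_push k (\<theta> \<circ> \<theta>') t"
proof
  fix i
  have "(\<Sum>j | j \<le> m \<and> \<theta> j = i. \<Sum>j' | j' \<in> {j'. j' \<le> k \<and> \<theta> (\<theta>' j') = i} \<and> \<theta>' j' = j. t j')
      = (\<Sum>j' | j' \<le> k \<and> \<theta> (\<theta>' j') = i. t j')"
    by (rule sum.group) (use assms monotone_maps_le in auto)
  moreover have "(\<Sum>j' | j' \<le> k \<and> \<theta>' j' = j. t j')
     = (\<Sum>j' | j' \<in> {j'. j' \<le> k \<and> \<theta> (\<theta>' j') = i} \<and> \<theta>' j' = j. t j')" if "\<theta> j = i" for j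
    by (rule sum.cong) (use that in auto)
  then have "(\<Sum>j | j \<le> m \<and> \<theta> j = i. \<Sum>j' | j' \<le> k \<and> \<theta>' j' = j. t j')
     = (\<Sum>j | j \<le> m \<and> \<theta> j = i. \<Sum>j' | j' \<in> {j'. j' \<le> k \<and> \<theta> (\<theta>' j') = i} \<and> \<theta>' j' = j. t j')"
    by (intro sum.cong) auto
  ultimately show "simplex_push m \<theta> (simplex_push k \<theta>' t) i = simplex_push k (\<theta> \<circ> \<theta>') t i"
    by (simp add: simplex_push_def)
qed

lemma simplex_push_id: "t \<in> standard_simplex n \<Longrightarrow> simplex_push n id t = t"
proof
  fix i assume t: "t \<in> standard_simplex n"
  have "{j. j \<le> n \<and> id j = i} = (if i \<le> n then {i} else {})" by auto
  then show "simplex_push n id t i = t i"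
    using t by (auto simp: simplex_push_def standard_simplex_def)
qed

text \<open>A vertex of mass zero contributes nothing to any push. Couplings are compared only on
  the support of their weights, and this is what allows it.\<close>

lemma simplex_push_cong:
  "(\<And>j. j \<le> m \<Longrightarrow> t j \<noteq> 0 \<Longrightarrow> \<theta> j = \<theta>' j) \<Longrightarrow> simplex_push m \<theta> t = simplex_push m \<theta>' t"
  unfolding simplex_push_def
  by (rule ext, rule sum.mono_neutral_cong) (auto, metis+)

lemma simplex_push_const:
  assumes "t \<in> standard_simplex n"
  shows "simplex_push n (\<lambda>_. k) t = (\<lambda>j. if j = k then 1 else 0)"
proof
  fix i
  have "(\<Sum>j | j \<le> n. t j) = 1"
    using assms by (simp add: standard_simplex_def atMost_def)
  then show "simplex_push n (\<lambda>_. k) t i = (if i = k then 1 else 0)"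
    by (auto simp: simplex_push_def)
qed

lemma continuous_map_simplex_push:
  assumes "\<theta> \<in> monotone_maps m n"
  shows "continuous_map (simplex_top m) (simplex_top n) (simplex_push m \<theta>)"
  unfolding continuous_map_in_subtopology
proof
  have "continuous_map (simplex_top m) euclideanreal (\<lambda>t. \<Sum>j | j \<le> m \<and> \<theta> j = i. t j)" for i
    by (intro continuous_map_sum continuous_map_from_subtopology continuous_map_product_projection) auto
  then show "continuous_map (simplex_top m) (powertop_real UNIV) (simplex_push m \<theta>)"
    unfolding continuous_map_componentwise_UNIV simplex_push_def by blast
  show "simplex_push m \<theta> \<in> topspace (simplex_top m) \<rightarrow> standard_simplex n"
    using assms simplex_push_in by auto
qed

lemma compact_simplex_top: "compact_space (simplex_top n)"
  using compactin_standard_simplex compact_space_subtopology by blast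

lemma Hausdorff_simplex_top: "Hausdorff_space (simplex_top n)"
  by (intro Hausdorff_space_subtopology) (simp add: Hausdorff_space_product_topology)

context simplicial
begin

lemma equiv_cell_equiv: "equiv UNIV (cell_equiv X)"
proof -
  have "sym ((cell_glue X \<union> (cell_glue X)\<inverse>)\<^sup>*)"
    by (intro sym_rtrancl) (auto simp: sym_def)
  then show ?thesis
    unfolding cell_equiv_def by (intro equivI) (auto simp: refl_rtrancl trans_rtrancl)
qed

lemma cls_eq_iff: "cls X n s t = cls X m s' t' \<longleftrightarrow> ((n, s, t), (m, s', t')) \<in> cell_equiv X"
  unfolding cls_def using equiv_cell_equiv by (simp add: eq_equiv_class_iff)

lemma cls_glue:
  assumes "\<theta> \<in> monotone_maps m n" "s \<in> simp X n" "t \<in> standard_simplex m"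
  shows "cls X m (sop X m n \<theta> s) t = cls X n s (simplex_push m \<theta> t)"
  unfolding cls_eq_iff cell_equiv_def cell_glue_def using assms by (intro r_into_rtrancl) blast

text \<open>The gluing relation generates the equivalence, and an equation is insensitive to the
  direction of a generator, so single gluings suffice.\<close>

lemma cell_equiv_invariant:
  assumes eq: "\<And>m n \<theta> s t. \<lbrakk>\<theta> \<in> monotone_maps m n; s \<in> simp X n; t \<in> standard_simplex m\<rbrakk>
      \<Longrightarrow> F (m, sop X m n \<theta> s, t) = F (n, s, simplex_push m \<theta> t)"
    and "(x, y) \<in> cell_equiv X"
  shows "F x = F y"
  using assms(2) unfolding cell_equiv_def
proof (induction rule: rtrancl_induct)
  case (step y z)
  have "F y = F z" using step(2) eq unfolding cell_glue_def by auto
  then show ?case using step by simp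
qed simp

lemma cls_invariant:
  assumes "\<And>m n \<theta> s t. \<lbrakk>\<theta> \<in> monotone_maps m n; s \<in> simp X n; t \<in> standard_simplex m\<rbrakk>
      \<Longrightarrow> F m (sop X m n \<theta> s) t = F n s (simplex_push m \<theta> t)"
    and "cls X n s t = cls X m s' t'"
  shows "F n s t = F m s' t'"
  using cell_equiv_invariant[of "\<lambda>(n, s, t). F n s t" "(n, s, t)" "(m, s', t')"] assms cls_eq_iff
  by simp

lemma topspace_realization:
  "topspace (realization X) = {cls X n s t | n s t. s \<in> simp X n \<and> t \<in> standard_simplex n}"
proof -
  \<comment> \<open>\<open>topspace\<close> is the union of the open sets, so the set of all classes
    has to be shown open; its preimage in each cell is the whole simplex.\<close>
  have "{t \<in> standard_simplex n. cell_equiv X `` {(n, s, t)} \<in> cell_pts X // cell_equiv X} = standard_simplex n"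
    if "s \<in> simp X n" for n s
    using that by (auto simp: cell_pts_def intro!: quotientI)
  then have "realization_open X (cell_pts X // cell_equiv X)"
    unfolding realization_open_def by (metis (no_types, lifting) openin_topspace order_refl topspace_standard_simplex)
  then have "topspace (realization X) = cell_pts X // cell_equiv X"
    unfolding topspace_def openin_realization by (auto simp: realization_open_def)
  then show ?thesis
    by (auto simp: quotient_def cell_pts_def cls_def)
qed

lemma cls_in: "s \<in> simp X n \<Longrightarrow> t \<in> standard_simplex n \<Longrightarrow> cls X n s t \<in> topspace (realization X)"
  unfolding topspace_realization by blast

lemma cls_cases:
  assumes "c \<in> topspace (realization X)"
  obtains n s t where "s \<in> simp X n" "t \<in> standard_simplex n" "c = cls X n s t"
  using assms unfolding topspace_realization by blast

text \<open>The disjoint union of all cells, of which the realization is the quotient. In this form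
  the general theorem on products of quotient maps applies to it.\<close>

definition cell_sum :: "((nat \<times> 's) \<times> (nat \<Rightarrow> real)) topology" where
  "cell_sum = sum_topology (\<lambda>(n, s). simplex_top n) (Sigma UNIV (simp X))"

lemma quotient_map_cells:
  "quotient_map cell_sum (realization X) (\<lambda>((n, s), t). cls X n s t)"
  unfolding quotient_map_def
proof (intro conjI allI impI)
  show "(\<lambda>((n, s), t). cls X n s t) ` topspace cell_sum = topspace (realization X)"
    unfolding topspace_realization cell_sum_def
    by (auto simp: image_iff Bex_def split: prod.splits) blast+
next
  fix U assume U: "U \<subseteq> topspace (realization X)"
  have "openin cell_sum {x \<in> topspace cell_sum. (case x of (x, xa) \<Rightarrow> (case x of (n, s) \<Rightarrow> cls X n s) xa) \<in> U}
    \<longleftrightarrow> (\<forall>n. \<forall>s\<in>simp X n. openin (simplex_top n) {t \<in> standard_simplex n. cls X n s t \<in> U})"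
    unfolding cell_sum_def openin_sum_topology
    by (auto 4 4 intro!: arg_cong[where f = "openin _"] elim!: back_subst[where P = "openin _"])
  also have "\<dots> \<longleftrightarrow> openin (realization X) U"
    unfolding openin_realization realization_open_def cls_def
    using U unfolding topspace_realization by (auto simp: quotient_def cell_pts_def cls_def) blast
  finally show "openin cell_sum {x \<in> topspace cell_sum. (case x of (x, xa) \<Rightarrow> (case x of (n, s) \<Rightarrow> cls X n s) xa) \<in> U}
     = openin (realization X) U" .
qed

lemma continuous_map_cls:
  assumes "s \<in> simp X n"
  shows "continuous_map (simplex_top n) (realization X) (cls X n s)"
proof -
  have "continuous_map (simplex_top n) cell_sum (\<lambda>t. ((n, s), t))"
    unfolding cell_sum_def
    using continuous_map_component_injection[of "(n, s)" "Sigma UNIV (simp X)" "\<lambda>(n, s). simplex_top n"] assms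
    by simp
  from continuous_map_compose[OF this quotient_imp_continuous_map[OF quotient_map_cells]]
  show ?thesis by (simp add: o_def)
qed

text \<open>The product of a quotient map with the identity of a locally compact regular space is
  again a quotient map, and compact Hausdorff spaces qualify. Continuity may therefore be tested on
  one cell at a time.\<close>

lemma continuous_map_from_prod_realization:
  assumes K: "compact_space K" "Hausdorff_space K"
    and h: "\<And>n s. s \<in> simp X n \<Longrightarrow> continuous_map (prod_topology K (simplex_top n)) W (\<lambda>(x, t). h x (cls X n s t))"
  shows "continuous_map (prod_topology K (realization X)) W (\<lambda>(x, c). h x c)"
proof -
  let ?q = "\<lambda>((n, s), t). cls X n s t"
  have q: "quotient_map (prod_topology K cell_sum) (prod_topology K (realization X)) (\<lambda>(x, y). (x, ?q y))"
    using K quotient_map_cells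
    by (intro quotient_map_prod_right) (auto simp: compact_imp_locally_compact_space compact_Hausdorff_imp_regular_space)
  have "continuous_map (prod_topology K cell_sum) W (\<lambda>(x, y). h x (?q y))"
    unfolding continuous_map
  proof (intro conjI allI impI)
    have "h x (cls X n s t) \<in> topspace W" if "s \<in> simp X n" "t \<in> standard_simplex n" "x \<in> topspace K" for x n s t
      using continuous_map_image_subset_topspace[OF h[OF that(1)]] that(2,3) by (auto simp: image_subset_iff)
    then show "(\<lambda>(x, y). h x (?q y)) ` topspace (prod_topology K cell_sum) \<subseteq> topspace W"
      by (auto simp: cell_sum_def)
    fix U assume U: "openin W U"
    let ?V = "{z \<in> topspace (prod_topology K cell_sum). (case z of (x, y) \<Rightarrow> h x (?q y)) \<in> U}"
    \<comment> \<open>A point of the disjoint union lies in one summand, which is open, so a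
      neighbourhood found over that single simplex is a neighbourhood over the disjoint
      union.\<close>
    show "openin (prod_topology K cell_sum) ?V"
      unfolding openin_prod_topology_alt
    proof (intro allI impI)
      fix x y assume xy: "(x, y) \<in> ?V"
      obtain n s t where y: "y = ((n, s), t)" by (metis surj_pair)
      have s: "s \<in> simp X n" "t \<in> standard_simplex n" "x \<in> topspace K"
        using xy by (auto simp: y cell_sum_def)
      have "openin (prod_topology K (simplex_top n)) {z \<in> topspace (prod_topology K (simplex_top n)). (case z of (x, t) \<Rightarrow> h x (cls X n s t)) \<in> U}"
        using h[OF s(1)] U unfolding continuous_map by blast
      then obtain A B where AB: "openin K A" "openin (simplex_top n) B" "x \<in> A" "t \<in> B"
        "A \<times> B \<subseteq> {z \<in> topspace (prod_topology K (simplex_top n)). (case z of (x, t) \<Rightarrow> h x (cls X n s t)) \<in> U}"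
        unfolding openin_prod_topology_alt using s xy by (auto simp: y dest!: spec[where x = x] spec[where x = t])
      have "openin cell_sum (Pair (n, s) ` B)"
        using open_map_component_injection[of "(n, s)" "Sigma UNIV (simp X)" "\<lambda>(n, s). simplex_top n"] AB s
        by (auto simp: open_map_def cell_sum_def)
      moreover have "A \<times> Pair (n, s) ` B \<subseteq> ?V"
        using AB(5) s by (auto simp: cell_sum_def)
      ultimately show "\<exists>U. \<exists>V. openin K U \<and> openin cell_sum V \<and> x \<in> U \<and> y \<in> V \<and> U \<times> V \<subseteq> ?V"
        using AB y by blast
    qed
  qed
  then show ?thesis
    using continuous_compose_quotient_map_eq[OF q, of W "\<lambda>(x, c). h x c"] by (simp add: o_def case_prod_unfold)
qed

end

section \<open>Monotone couplings of barycentric coordinates\<close>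

definition pre_coupling ::
    "nat \<Rightarrow> nat \<Rightarrow> (nat \<Rightarrow> real) \<Rightarrow> (nat \<Rightarrow> real) \<Rightarrow> nat \<Rightarrow> (nat \<Rightarrow> nat) \<Rightarrow> (nat \<Rightarrow> nat) \<Rightarrow> (nat \<Rightarrow> real) \<Rightarrow> bool" where
  "pre_coupling n m t t' N \<alpha> \<beta> w \<longleftrightarrow> \<alpha> \<in> monotone_maps N n \<and> \<beta> \<in> monotone_maps N m
     \<and> (\<forall>i\<le>N. w i \<ge> 0) \<and> (\<forall>i\<le>n. simplex_push N \<alpha> w i = t i) \<and> (\<forall>i\<le>m. simplex_push N \<beta> w i = t' i)"

lemma pre_coupling_swap: "pre_coupling n m t t' N \<alpha> \<beta> w \<Longrightarrow> pre_coupling m n t' t N \<beta> \<alpha> w"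
  by (auto simp: pre_coupling_def)

text \<open>The new vertex lies over the last vertices of both factors and carries the whole mass
  \<open>t (Suc n)\<close>; what is left of \<open>t' m\<close> is distributed by the old coupling.
  Masses are not normalized in \<open>pre_coupling\<close> because this subtraction leaves the
  standard simplex.\<close>

lemma pre_coupling_extend:
  assumes p: "pre_coupling n m t (t'(m := t' m - t (Suc n))) N \<alpha> \<beta> w" and "t (Suc n) \<ge> 0"
  shows "pre_coupling (Suc n) m t t' (Suc N) (\<alpha>(Suc N := Suc n)) (\<beta>(Suc N := m)) (w(Suc N := t (Suc n)))"
proof -
  let ?\<alpha> = "\<alpha>(Suc N := Suc n)" and ?\<beta> = "\<beta>(Suc N := m)" and ?w = "w(Suc N := t (Suc n))"
  have \<alpha>: "\<alpha> \<in> monotone_maps N n" and \<beta>: "\<beta> \<in> monotone_maps N m" using p by (auto simp: pre_coupling_def)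
  have split: "simplex_push (Suc N) (\<gamma>(Suc N := z)) ?w i = simplex_push N \<gamma> w i + (if i = z then t (Suc n) else 0)" for \<gamma> z i
  proof -
    have "{j. j \<le> Suc N \<and> (\<gamma>(Suc N := z)) j = i} = {j. j \<le> N \<and> \<gamma> j = i} \<union> (if i = z then {Suc N} else {})"
      by (auto simp: le_Suc_eq)
    then have "simplex_push (Suc N) (\<gamma>(Suc N := z)) ?w i
        = (\<Sum>j | j \<le> N \<and> \<gamma> j = i. ?w j) + (\<Sum>j\<in>(if i = z then {Suc N} else {}). ?w j)"
      unfolding simplex_push_def by (simp only:) (rule sum.union_disjoint, auto)
    also have "(\<Sum>j | j \<le> N \<and> \<gamma> j = i. ?w j) = (\<Sum>j | j \<le> N \<and> \<gamma> j = i. w j)"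
      by (rule sum.cong) auto
    finally show ?thesis by (simp add: simplex_push_def)
  qed
  have top: "simplex_push N \<alpha> w (Suc n) = 0"
    unfolding simplex_push_def using monotone_maps_le[OF \<alpha>] by (intro sum.neutral) fastforce
  have "?\<alpha> \<in> monotone_maps (Suc N) (Suc n)"
    using monotone_maps_le[OF \<alpha>] monotone_maps_mono[OF \<alpha>]
    by (intro monotone_mapsI) (auto simp: le_Suc_eq)
  moreover have "?\<beta> \<in> monotone_maps (Suc N) m"
    using monotone_maps_le[OF \<beta>] monotone_maps_mono[OF \<beta>]
    by (intro monotone_mapsI) (auto simp: le_Suc_eq)
  ultimately show ?thesis
    using p assms(2) top by (auto simp: pre_coupling_def split le_Suc_eq)
qed

text \<open>Induction on \<open>n + m\<close>: the smaller of the two last masses is used up, which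
  removes one vertex of one factor. When one factor is a point, the other factor itself is the
  coupling. The length \<open>n + m\<close> is the dimension of the top cells of a triangulated
  product.\<close>

lemma pre_coupling_exists:
  assumes "\<And>i. i \<le> n \<Longrightarrow> t i \<ge> 0" "\<And>i. i \<le> m \<Longrightarrow> t' i \<ge> 0" "sum t {..n} = sum t' {..m}"
  shows "\<exists>\<alpha> \<beta> w. pre_coupling n m t t' (n + m) \<alpha> \<beta> w"
  using assms
proof (induction "n + m" arbitrary: n m t t')
  case 0
  have "{j. j = (0::nat)} = {0}" by auto
  then show ?case using 0
    by (intro exI[of _ id] exI[of _ t]) (auto simp: pre_coupling_def simplex_push_def intro: monotone_mapsI)
next
  case (Suc N)
  have single: "{j. j \<le> m \<and> id j = i} = {i}" if "i \<le> m" for i m :: nat using that by auto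
  have base: "\<exists>\<alpha> \<beta> w. pre_coupling 0 m t t' m \<alpha> \<beta> w"
    if "\<And>i. i \<le> m \<Longrightarrow> t' i \<ge> 0" "t 0 = sum t' {..m}" for t t' m
  proof -
    have "simplex_push m (\<lambda>_. 0) t' 0 = t 0"
      using that(2) by (simp add: simplex_push_def atMost_def)
    moreover have "simplex_push m id t' i = t' i" if "i \<le> m" for i
      unfolding simplex_push_def single[OF that] by simp
    ultimately have "pre_coupling 0 m t t' m (\<lambda>_. 0) id t'"
      using that(1) by (simp add: pre_coupling_def id_monotone_maps monotone_mapsI)
    then show ?thesis by blast
  qed
  have step: "\<exists>\<alpha> \<beta> w. pre_coupling (Suc n) m t t' (Suc N) \<alpha> \<beta> w"
    if nm: "n + m = N" "\<And>i. i \<le> Suc n \<Longrightarrow> t i \<ge> 0" "\<And>i. i \<le> m \<Longrightarrow> t' i \<ge> 0" "sum t {..Suc n} = sum t' {..m}"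
      "t (Suc n) \<le> t' m" for n m t t'
  proof -
    let ?t' = "t'(m := t' m - t (Suc n))"
    have "sum ?t' {..m} = sum t' {..m} - t (Suc n)"
      by (subst (1 2) sum.remove[of _ m]) (auto intro!: sum.cong)
    then have "sum t {..n} = sum ?t' {..m}" using nm(4) by simp
    then have "\<exists>\<alpha> \<beta> w. pre_coupling n m t ?t' (n + m) \<alpha> \<beta> w"
      using nm by (intro Suc.hyps(1)) auto
    then show ?thesis using pre_coupling_extend nm by blast
  qed
  show ?case
  proof (cases n)
    case 0 then show ?thesis using base[of m t' t] Suc.prems by simp
  next
    case n: (Suc n')
    show ?thesis
    proof (cases m)
      case 0
      then show ?thesis using base[of n t t'] Suc.prems pre_coupling_swap by fastforce
    next
      case m: (Suc m')
      show ?thesis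
      proof (cases "t n \<le> t' m")
        case True
        then show ?thesis using step[of n' m t t'] Suc n by simp
      next
        case False
        then have "\<exists>\<alpha> \<beta> w. pre_coupling (Suc m') n t' t (Suc N) \<alpha> \<beta> w"
          using step[of m' n t' t] Suc m by simp
        then show ?thesis using pre_coupling_swap Suc.hyps(2) m by metis
      qed
    qed
  qed
qed

text \<open>A coupling locates the point \<open>(t, t')\<close> of a product of two simplices in a cell of the standard
  triangulation of the product.\<close>

definition coupling ::
    "nat \<Rightarrow> nat \<Rightarrow> (nat \<Rightarrow> real) \<Rightarrow> (nat \<Rightarrow> real) \<Rightarrow> nat \<Rightarrow> (nat \<Rightarrow> nat) \<Rightarrow> (nat \<Rightarrow> nat) \<Rightarrow> (nat \<Rightarrow> real) \<Rightarrow> bool" where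
  "coupling n m t t' N \<alpha> \<beta> w \<longleftrightarrow> \<alpha> \<in> monotone_maps N n \<and> \<beta> \<in> monotone_maps N m
     \<and> w \<in> standard_simplex N \<and> simplex_push N \<alpha> w = t \<and> simplex_push N \<beta> w = t'"

lemma coupling_exists:
  assumes t: "t \<in> standard_simplex n" and t': "t' \<in> standard_simplex m"
  obtains \<alpha> \<beta> w where "coupling n m t t' (n + m) \<alpha> \<beta> w"
proof -
  obtain \<alpha> \<beta> w where p: "pre_coupling n m t t' (n + m) \<alpha> \<beta> w"
    using pre_coupling_exists[of n t m t'] t t' by (auto simp: standard_simplex_def)
  \<comment> \<open>Beyond \<open>n + m\<close> the weights of a pre-coupling are arbitrary, whereas
    points of the standard simplex vanish there.\<close>
  let ?w = "\<lambda>i. if i \<le> n + m then w i else 0"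
  have push: "simplex_push (n + m) \<gamma> ?w = simplex_push (n + m) \<gamma> w" for \<gamma>
    unfolding simplex_push_def by (intro ext sum.cong) auto
  have \<alpha>: "\<alpha> \<in> monotone_maps (n + m) n" and \<beta>: "\<beta> \<in> monotone_maps (n + m) m"
    using p by (auto simp: pre_coupling_def)
  have out: "simplex_push (n + m) \<gamma> w i = 0" if "\<gamma> \<in> monotone_maps (n + m) k" "i > k" for \<gamma> i k
    unfolding simplex_push_def using monotone_maps_le[OF that(1)] that(2) by (intro sum.neutral) fastforce
  have \<alpha>w: "simplex_push (n + m) \<alpha> w = t"
  proof
    fix i show "simplex_push (n + m) \<alpha> w i = t i"
      by (cases "i \<le> n") (use p t out[OF \<alpha>, of i] in \<open>simp_all add: pre_coupling_def standard_simplex_def\<close>)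
  qed
  have \<beta>w: "simplex_push (n + m) \<beta> w = t'"
  proof
    fix i show "simplex_push (n + m) \<beta> w i = t' i"
      by (cases "i \<le> m") (use p t' out[OF \<beta>, of i] in \<open>simp_all add: pre_coupling_def standard_simplex_def\<close>)
  qed
  have "(\<Sum>i\<le>n. \<Sum>j | j \<in> {..n+m} \<and> \<alpha> j = i. w j) = (\<Sum>j\<in>{..n+m}. w j)"
    by (rule sum.group) (use \<alpha> monotone_maps_le in auto)
  then have "(\<Sum>i\<le>n. simplex_push (n + m) \<alpha> w i) = (\<Sum>j\<le>n+m. w j)"
    by (simp add: simplex_push_def)
  then have sum: "(\<Sum>i\<le>n+m. w i) = 1"
    using t unfolding \<alpha>w by (simp add: standard_simplex_def)
  have nn: "w i \<ge> 0" if "i \<le> n + m" for i using p that by (simp add: pre_coupling_def)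
  have "w i \<le> 1" if "i \<le> n + m" for i
    using member_le_sum[of i "{..n+m}" w] that nn sum by auto
  then have "?w \<in> standard_simplex (n + m)"
    using nn sum by (auto simp: standard_simplex_def)
  then show ?thesis using that \<alpha> \<beta> \<alpha>w \<beta>w push by (auto simp: coupling_def)
qed

text \<open>Both conditions cut out initial segments of \<open>{..N}\<close> because \<alpha> and
  \<beta> are monotone. Of two initial segments one contains the other, so the mass of the
  intersection is the smaller of the two masses. This is the comonotone coupling, which attains the
  upper Frechet-Hoeffding bound.\<close>

lemma coupling_joint_cdf:
  assumes "coupling n m t t' N \<alpha> \<beta> w"
  shows "(\<Sum>i | i \<le> N \<and> \<alpha> i < a \<and> \<beta> i < b. w i) = min (\<Sum>c<a. t c) (\<Sum>c<b. t' c)"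
proof -
  have \<alpha>: "\<alpha> \<in> monotone_maps N n" and \<beta>: "\<beta> \<in> monotone_maps N m"
    and t: "t = simplex_push N \<alpha> w" "t' = simplex_push N \<beta> w" and w: "\<And>i. w i \<ge> 0"
    using assms by (auto simp: coupling_def standard_simplex_def)
  let ?A = "{i. i \<le> N \<and> \<alpha> i < a}" and ?B = "{i. i \<le> N \<and> \<beta> i < b}"
  have marg: "(\<Sum>i | i \<le> N \<and> \<gamma> i < a. w i) = (\<Sum>c<a. simplex_push N \<gamma> w c)" for \<gamma> a
  proof -
    have "(\<Sum>c<a. \<Sum>i | i \<in> {i. i \<le> N \<and> \<gamma> i < a} \<and> \<gamma> i = c. w i) = (\<Sum>i | i \<le> N \<and> \<gamma> i < a. w i)"
      by (rule sum.group) auto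
    moreover have "(\<Sum>i | i \<in> {i. i \<le> N \<and> \<gamma> i < a} \<and> \<gamma> i = c. w i) = simplex_push N \<gamma> w c" if "c < a" for c
      unfolding simplex_push_def by (rule sum.cong) (use that in auto)
    ultimately show ?thesis by simp
  qed
  have eq: "{i. i \<le> N \<and> \<alpha> i < a \<and> \<beta> i < b} = ?A \<inter> ?B" by auto
  have "?A \<subseteq> ?B \<or> ?B \<subseteq> ?A"
    using monotone_maps_mono[OF \<alpha>] monotone_maps_mono[OF \<beta>]
    by (auto simp: subset_iff) (meson le_less_trans linear)
  then show ?thesis
  proof
    assume "?A \<subseteq> ?B"
    then have "sum w (?A \<inter> ?B) = sum w ?A" "sum w ?A \<le> sum w ?B"
      using w by (auto simp: Int_absorb2 intro!: sum_mono2)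
    then show ?thesis unfolding eq t marg[symmetric] by simp
  next
    assume "?B \<subseteq> ?A"
    then have "sum w (?A \<inter> ?B) = sum w ?B" "sum w ?B \<le> sum w ?A"
      using w by (auto simp: Int_absorb1 intro!: sum_mono2)
    then show ?thesis unfolding eq t marg[symmetric] by simp
  qed
qed

text \<open>The mass of one point is the rectangle difference of the joint distribution function.
  Since the latter depends only on the marginals, so does the joint mass.\<close>

lemma coupling_joint_mass:
  assumes "coupling n m t t' N \<alpha> \<beta> w"
  shows "(\<Sum>i | i \<le> N \<and> \<alpha> i = a \<and> \<beta> i = b. w i)
    = (let F = (\<lambda>a b. min (\<Sum>c<a. t c) (\<Sum>c<b. t' c)) in F (Suc a) (Suc b) - F a (Suc b) - F (Suc a) b + F a b)"
proof -
  let ?S = "\<lambda>P. \<Sum>i | i \<le> N \<and> P i. w i"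
  have s: "?S P = ?S Q + ?S R" if "\<And>i. P i \<longleftrightarrow> Q i \<or> R i" "\<And>i. \<not> (Q i \<and> R i)" for P Q R
  proof -
    have "{i. i \<le> N \<and> P i} = {i. i \<le> N \<and> Q i} \<union> {i. i \<le> N \<and> R i}" using that by auto
    then show ?thesis using that by (simp add: sum.union_disjoint disjoint_iff)
  qed
  have "?S (\<lambda>i. \<alpha> i < Suc a \<and> \<beta> i < Suc b) = ?S (\<lambda>i. \<alpha> i < a \<and> \<beta> i < Suc b) + ?S (\<lambda>i. \<alpha> i = a \<and> \<beta> i < Suc b)"
    by (rule s) auto
  moreover have "?S (\<lambda>i. \<alpha> i < Suc a \<and> \<beta> i < b) = ?S (\<lambda>i. \<alpha> i < a \<and> \<beta> i < b) + ?S (\<lambda>i. \<alpha> i = a \<and> \<beta> i < b)"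
    by (rule s) auto
  moreover have "?S (\<lambda>i. \<alpha> i = a \<and> \<beta> i < Suc b) = ?S (\<lambda>i. \<alpha> i = a \<and> \<beta> i < b) + ?S (\<lambda>i. \<alpha> i = a \<and> \<beta> i = b)"
    by (rule s) auto
  ultimately show ?thesis
    unfolding Let_def by (simp only: coupling_joint_cdf[OF assms])
qed

lemma support_retraction:
  assumes "w \<in> standard_simplex N"
  obtains \<rho> where "\<rho> \<in> monotone_maps N N" "\<And>i. i \<le> N \<Longrightarrow> w (\<rho> i) \<noteq> 0" "\<And>i. i \<le> N \<Longrightarrow> w i \<noteq> 0 \<Longrightarrow> \<rho> i = i"
proof -
  obtain j0 where j0: "w j0 \<noteq> 0" using assms by (force simp: standard_simplex_def)
  define l where "l = (LEAST j. w j \<noteq> 0)"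
  have l: "w l \<noteq> 0" "l \<le> N"
    using j0 LeastI[of "\<lambda>j. w j \<noteq> 0"] assms unfolding l_def
    by (auto simp: standard_simplex_def) (metis linorder_not_le)
  have lmin: "l \<le> j" if "w j \<noteq> 0" for j unfolding l_def using that by (rule Least_le)
  \<comment> \<open>Each vertex is sent to the last vertex of the support at or below it. Inserting
    \<open>l\<close>, the first vertex of the support, serves the vertices below it and keeps the
    set nonempty.\<close>
  define \<rho> where "\<rho> i = Max (insert l {j. j \<le> i \<and> w j \<noteq> 0})" for i
  have in_S: "\<rho> i \<in> insert l {j. j \<le> i \<and> w j \<noteq> 0}" for i
    unfolding \<rho>_def by (intro Max_in) auto
  show ?thesis
  proof
    show "\<rho> \<in> monotone_maps N N"
    proof (rule monotone_mapsI)
      show "\<rho> i \<le> N" if "i \<le> N" for i using in_S[of i] l that by auto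
      show "\<rho> i \<le> \<rho> j" if "i \<le> j" "j \<le> N" for i j
        unfolding \<rho>_def by (rule Max_mono) (use that in auto)
    qed
    show "w (\<rho> i) \<noteq> 0" for i using in_S[of i] l by auto
    show "\<rho> i = i" if "w i \<noteq> 0" for i
      unfolding \<rho>_def by (rule Max_eqI) (use that lmin in auto)
  qed
qed

section \<open>Pairings and their effect on realizations\<close>

locale pairing = X: simplicial X + Z: simplicial Z + Y: simplicial Y
  for X :: "'s sset" and Z :: "'z sset" and Y :: "'y sset" +
  fixes \<Phi> :: "nat \<Rightarrow> 's \<Rightarrow> 'z \<Rightarrow> 'y"
  assumes Phi_in: "s \<in> simp X n \<Longrightarrow> s' \<in> simp Z n \<Longrightarrow> \<Phi> n s s' \<in> simp Y n"
    and Phi_sop: "\<theta> \<in> monotone_maps m n \<Longrightarrow> s \<in> simp X n \<Longrightarrow> s' \<in> simp Z n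
      \<Longrightarrow> sop Y m n \<theta> (\<Phi> n s s') = \<Phi> m (sop X m n \<theta> s) (sop Z m n \<theta> s')"
begin

text \<open>The candidate for the paired point: both simplices are pulled back along the coupling to
  a common dimension, where \<Phi> applies. Here \<Phi> is a simplicial map on the levelwise
  product, in curried form.\<close>

definition val :: "nat \<Rightarrow> 's \<Rightarrow> nat \<Rightarrow> 'z \<Rightarrow> nat \<Rightarrow> (nat \<Rightarrow> nat) \<Rightarrow> (nat \<Rightarrow> nat) \<Rightarrow> (nat \<Rightarrow> real) \<Rightarrow> 'y cell_pt set" where
  "val n s m s' N \<alpha> \<beta> w = cls Y N (\<Phi> N (sop X N n \<alpha> s) (sop Z N m \<beta> s')) w"

lemma val_push:
  assumes "s \<in> simp X n" "s' \<in> simp Z m" "\<alpha> \<in> monotone_maps N n" "\<beta> \<in> monotone_maps N m"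
    "\<rho> \<in> monotone_maps M N" "w \<in> standard_simplex M"
  shows "val n s m s' N \<alpha> \<beta> (simplex_push M \<rho> w) = val n s m s' M (\<alpha> \<circ> \<rho>) (\<beta> \<circ> \<rho>) w"
proof -
  have S: "sop X N n \<alpha> s \<in> simp X N" "sop Z N m \<beta> s' \<in> simp Z N"
    using assms X.sop_closed Z.sop_closed by auto
  then have "val n s m s' N \<alpha> \<beta> (simplex_push M \<rho> w)
      = cls Y M (sop Y M N \<rho> (\<Phi> N (sop X N n \<alpha> s) (sop Z N m \<beta> s'))) w"
    unfolding val_def using assms by (intro Y.cls_glue[symmetric] Phi_in)
  also have "\<dots> = val n s m s' M (\<alpha> \<circ> \<rho>) (\<beta> \<circ> \<rho>) w"
    unfolding val_def using assms S by (simp add: Phi_sop X.sop_comp Z.sop_comp)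
  finally show ?thesis .
qed

lemma val_cong:
  assumes "\<And>i. i \<le> N \<Longrightarrow> \<alpha> i = \<alpha>' i" "\<And>i. i \<le> N \<Longrightarrow> \<beta> i = \<beta>' i"
  shows "val n s m s' N \<alpha> \<beta> w = val n s m s' N \<alpha>' \<beta>' w"
  unfolding val_def using X.sop_cong[of N \<alpha> \<alpha>'] Z.sop_cong[of N \<beta> \<beta>'] assms by metis

text \<open>Pushing \<open>w\<close> along the retraction onto its support changes nothing, and by
  \<open>val_push\<close> it replaces \<alpha> and \<beta> by composites that see the support
  only.\<close>

lemma val_support:
  assumes s: "s \<in> simp X n" "s' \<in> simp Z m" and ab: "\<alpha> \<in> monotone_maps N n" "\<beta> \<in> monotone_maps N m"
    "\<alpha>' \<in> monotone_maps N n" "\<beta>' \<in> monotone_maps N m" and w: "w \<in> standard_simplex N"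
    and eq: "\<And>i. i \<le> N \<Longrightarrow> w i \<noteq> 0 \<Longrightarrow> \<alpha> i = \<alpha>' i \<and> \<beta> i = \<beta>' i"
  shows "val n s m s' N \<alpha> \<beta> w = val n s m s' N \<alpha>' \<beta>' w"
proof -
  obtain \<rho> where \<rho>: "\<rho> \<in> monotone_maps N N" "\<And>i. i \<le> N \<Longrightarrow> w (\<rho> i) \<noteq> 0" "\<And>i. i \<le> N \<Longrightarrow> w i \<noteq> 0 \<Longrightarrow> \<rho> i = i"
    using support_retraction[OF w] by blast
  have "simplex_push N \<rho> w = simplex_push N id w"
    by (rule simplex_push_cong) (simp add: \<rho>)
  then have "simplex_push N \<rho> w = w" using w by (simp add: simplex_push_id)
  then have "val n s m s' N \<gamma> \<delta> w = val n s m s' N (\<gamma> \<circ> \<rho>) (\<delta> \<circ> \<rho>) w"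
    if "\<gamma> \<in> monotone_maps N n" "\<delta> \<in> monotone_maps N m" for \<gamma> \<delta>
    using val_push[OF s that \<rho>(1) w] by simp
  moreover have "val n s m s' N (\<alpha> \<circ> \<rho>) (\<beta> \<circ> \<rho>) w = val n s m s' N (\<alpha>' \<circ> \<rho>) (\<beta>' \<circ> \<rho>) w"
    by (rule val_cong) (use eq \<rho>(2) monotone_maps_le[OF \<rho>(1)] in auto)
  ultimately show ?thesis using ab by simp
qed

text \<open>The joint distribution of a coupling along monotone maps is determined by the marginals and
  supported on a chain, whose elements are told apart by the sum of their coordinates.\<close>

lemma val_unique:
  assumes s: "s \<in> simp X n" "s' \<in> simp Z m"
    and c: "coupling n m t t' N \<alpha> \<beta> w" and c': "coupling n m t t' N' \<alpha>' \<beta>' w'"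
  shows "val n s m s' N \<alpha> \<beta> w = val n s m s' N' \<alpha>' \<beta>' w'"
proof -
  \<comment> \<open>The joint mass in terms of the marginals alone, hence the same for every
    coupling.\<close>
  define P where "P a b = (let F = (\<lambda>a b. min (\<Sum>c<a. t c) (\<Sum>c<b. t' c)) in F (Suc a) (Suc b) - F a (Suc b) - F (Suc a) b + F a b)" for a b
  \<comment> \<open>Candidates for the coordinates of the atom with coordinate sum \<open>c\<close>:
    the largest coordinates among atoms whose sum is at most \<open>c\<close>. The inserted 0 is a
    default for sums below the first atom.\<close>
  define \<gamma>1 where "\<gamma>1 c = Max (insert 0 {a. a \<le> n \<and> (\<exists>b. P a b \<noteq> 0 \<and> a + b \<le> c)})" for c
  define \<gamma>2 where "\<gamma>2 c = Max (insert 0 {b. b \<le> m \<and> (\<exists>a. P a b \<noteq> 0 \<and> a + b \<le> c)})" for c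
  have fin1: "finite {a. a \<le> n \<and> Q a}" for n :: nat and Q by simp
  have \<gamma>1: "\<gamma>1 \<in> monotone_maps (n + m) n"
    unfolding \<gamma>1_def by (intro monotone_mapsI Max_mono) (auto simp: Max_le_iff)
  have \<gamma>2: "\<gamma>2 \<in> monotone_maps (n + m) m"
    unfolding \<gamma>2_def by (intro monotone_mapsI Max_mono) (auto simp: Max_le_iff)
  have "val n s m s' N \<alpha> \<beta> w = val n s m s' (n + m) \<gamma>1 \<gamma>2 (\<lambda>c. \<Sum>(a, b) | a \<le> n \<and> b \<le> m \<and> a + b = c. P a b)"
    if c: "coupling n m t t' N \<alpha> \<beta> w" for N \<alpha> \<beta> w
  proof -
    have \<alpha>: "\<alpha> \<in> monotone_maps N n" and \<beta>: "\<beta> \<in> monotone_maps N m" and w: "w \<in> standard_simplex N"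
      using c by (auto simp: coupling_def)
    have w0: "w i \<ge> 0" for i using w by (auto simp: standard_simplex_def)
    have P: "P a b = (\<Sum>i | i \<le> N \<and> \<alpha> i = a \<and> \<beta> i = b. w i)" for a b
      unfolding P_def coupling_joint_mass[OF c] ..
    have Ppos: "P a b \<noteq> 0 \<longleftrightarrow> (\<exists>i\<le>N. \<alpha> i = a \<and> \<beta> i = b \<and> w i \<noteq> 0)" for a b
      unfolding P by (subst sum_nonneg_eq_0_iff) (use w0 in auto)
    \<comment> \<open>The sum of the coordinates pushes every coupling to one and the same point of
      the simplex of dimension \<open>n + m\<close>, from which \<open>\<gamma>1\<close> and
      \<open>\<gamma>2\<close> recover \<alpha> and \<beta> on the support.\<close>
    define \<pi> where "\<pi> i = \<alpha> i + \<beta> i" for i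
    have \<pi>: "\<pi> \<in> monotone_maps N (n + m)"
      unfolding \<pi>_def by (rule monotone_mapsI)
        (simp_all add: add_mono monotone_maps_le[OF \<alpha>] monotone_maps_le[OF \<beta>] monotone_maps_mono[OF \<alpha>] monotone_maps_mono[OF \<beta>])
    have chain: "\<alpha> j \<le> \<alpha> i" "\<beta> j \<le> \<beta> i" if "\<pi> j \<le> \<pi> i" "i \<le> N" "j \<le> N" for i j
    proof -
      show "\<alpha> j \<le> \<alpha> i"
        using that monotone_maps_mono[OF \<alpha>, of j i] monotone_maps_mono[OF \<alpha>, of i j] monotone_maps_mono[OF \<beta>, of i j]
        unfolding \<pi>_def by linarith
      show "\<beta> j \<le> \<beta> i"
        using that monotone_maps_mono[OF \<beta>, of j i] monotone_maps_mono[OF \<beta>, of i j] monotone_maps_mono[OF \<alpha>, of i j]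
        unfolding \<pi>_def by linarith
    qed
    have \<gamma>: "\<gamma>1 (\<pi> i) = \<alpha> i" "\<gamma>2 (\<pi> i) = \<beta> i" if "i \<le> N" "w i \<noteq> 0" for i
    proof -
      have Pi: "P (\<alpha> i) (\<beta> i) \<noteq> 0" using Ppos that by blast
      show "\<gamma>1 (\<pi> i) = \<alpha> i" unfolding \<gamma>1_def
      proof (rule Max_eqI)
        fix y assume "y \<in> insert 0 {a. a \<le> n \<and> (\<exists>b. P a b \<noteq> 0 \<and> a + b \<le> \<pi> i)}"
        then show "y \<le> \<alpha> i" using chain(1) that by (auto simp: Ppos \<pi>_def)
      qed (use Pi that monotone_maps_le[OF \<alpha>] in \<open>auto simp: \<pi>_def\<close>)
      show "\<gamma>2 (\<pi> i) = \<beta> i" unfolding \<gamma>2_def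
      proof (rule Max_eqI)
        fix y assume "y \<in> insert 0 {b. b \<le> m \<and> (\<exists>a. P a b \<noteq> 0 \<and> a + b \<le> \<pi> i)}"
        then show "y \<le> \<beta> i" using chain(2) that by (auto simp: Ppos \<pi>_def)
      qed (use Pi that monotone_maps_le[OF \<beta>] in \<open>auto simp: \<pi>_def\<close>)
    qed
    have push: "simplex_push N \<pi> w = (\<lambda>c. \<Sum>(a, b) | a \<le> n \<and> b \<le> m \<and> a + b = c. P a b)"
    proof
      fix c
      have "(\<Sum>ab\<in>{(a, b). a \<le> n \<and> b \<le> m \<and> a + b = c}. \<Sum>i | i \<in> {i. i \<le> N \<and> \<pi> i = c} \<and> (\<alpha> i, \<beta> i) = ab. w i)
          = (\<Sum>i | i \<le> N \<and> \<pi> i = c. w i)"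
      proof (rule sum.group)
        show "finite {(a, b). a \<le> n \<and> b \<le> m \<and> a + b = c}"
          by (rule finite_subset[of _ "{..n} \<times> {..m}"]) auto
      qed (use monotone_maps_le[OF \<alpha>] monotone_maps_le[OF \<beta>] in \<open>auto simp: \<pi>_def\<close>)
      moreover have "(\<Sum>i | i \<in> {i. i \<le> N \<and> \<pi> i = c} \<and> (\<alpha> i, \<beta> i) = ab. w i) = (case ab of (a, b) \<Rightarrow> P a b)"
        if "ab \<in> {(a, b). a \<le> n \<and> b \<le> m \<and> a + b = c}" for ab
      proof (cases ab)
        case (Pair a b)
        have "{i. i \<in> {i. i \<le> N \<and> \<pi> i = c} \<and> (\<alpha> i, \<beta> i) = ab} = {i. i \<le> N \<and> \<alpha> i = a \<and> \<beta> i = b}"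
          using that by (auto simp: \<pi>_def Pair)
        then show ?thesis by (simp add: Pair P)
      qed
      ultimately show "simplex_push N \<pi> w c = (\<Sum>(a, b) | a \<le> n \<and> b \<le> m \<and> a + b = c. P a b)"
        unfolding simplex_push_def by simp
    qed
    have "val n s m s' (n + m) \<gamma>1 \<gamma>2 (simplex_push N \<pi> w) = val n s m s' N (\<gamma>1 \<circ> \<pi>) (\<gamma>2 \<circ> \<pi>) w"
      by (rule val_push[OF s \<gamma>1 \<gamma>2 \<pi> w])
    also have "\<dots> = val n s m s' N \<alpha> \<beta> w"
      by (rule val_support[OF s monotone_maps_comp[OF \<gamma>1 \<pi>] monotone_maps_comp[OF \<gamma>2 \<pi>] \<alpha> \<beta> w]) (simp add: \<gamma>)
    finally show ?thesis unfolding push by simp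
  qed
  from this[OF c] this[OF c'] show ?thesis by simp
qed

text \<open>The value is chosen among those of all representatives and couplings.
  \<open>val_classes\<close> shows that there is at most one, and \<open>coupling_exists\<close>
  that there is one for points of the realizations.\<close>

definition mu :: "'s cell_pt set \<Rightarrow> 'z cell_pt set \<Rightarrow> 'y cell_pt set" where
  "mu c d = (SOME v. \<exists>n s t m s' t' N \<alpha> \<beta> w. s \<in> simp X n \<and> s' \<in> simp Z m \<and> t \<in> standard_simplex n \<and> t' \<in> standard_simplex m
     \<and> c = cls X n s t \<and> d = cls Z m s' t' \<and> coupling n m t t' N \<alpha> \<beta> w \<and> v = val n s m s' N \<alpha> \<beta> w)"

text \<open>The two arguments are changed one after the other, so that each step is the invariance
  of a function of one class. A coupling of \<open>(t, t1')\<close> composed with a monotone map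
  \<theta> becomes a coupling of the pushed point and selects the same simplex of
  \<open>Y\<close>.\<close>

lemma val_classes:
  assumes s: "s1 \<in> simp X n1" "s1' \<in> simp Z m1" "s2 \<in> simp X n2" "s2' \<in> simp Z m2"
    and c1: "coupling n1 m1 t1 t1' N1 \<alpha>1 \<beta>1 w1" and c2: "coupling n2 m2 t2 t2' N2 \<alpha>2 \<beta>2 w2"
    and eq: "cls X n1 s1 t1 = cls X n2 s2 t2" "cls Z m1 s1' t1' = cls Z m2 s2' t2'"
  shows "val n1 s1 m1 s1' N1 \<alpha>1 \<beta>1 w1 = val n2 s2 m2 s2' N2 \<alpha>2 \<beta>2 w2"
proof -
  \<comment> \<open>By \<open>val_unique\<close> the choice does not depend on the coupling, so
    \<open>F\<close> is a function of the representatives.\<close>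
  define F where "F n s t m s' t' = (SOME v. \<exists>N \<alpha> \<beta> w. coupling n m t t' N \<alpha> \<beta> w \<and> v = val n s m s' N \<alpha> \<beta> w)"
    for n s t m s' t'
  have F: "F n s t m s' t' = val n s m s' N \<alpha> \<beta> w"
    if "s \<in> simp X n" "s' \<in> simp Z m" "coupling n m t t' N \<alpha> \<beta> w" for n s t m s' t' N \<alpha> \<beta> w
    unfolding F_def using that val_unique by (intro some_equality) blast+
  have simpl: "t1 \<in> standard_simplex n1" "t1' \<in> standard_simplex m1" "t2 \<in> standard_simplex n2" "t2' \<in> standard_simplex m2"
    using c1 c2 simplex_push_in by (auto simp: coupling_def)
  have "F n1 s1 t1 m1 s1' t1' = F n2 s2 t2 m1 s1' t1'"
  proof (rule X.cls_invariant[OF _ eq(1)])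
    fix m n \<theta> s t assume a: "\<theta> \<in> monotone_maps m n" "s \<in> simp X n" "t \<in> standard_simplex m"
    obtain \<alpha> \<beta> w where c: "coupling m m1 t t1' (m + m1) \<alpha> \<beta> w"
      using coupling_exists[OF a(3) simpl(2)] by blast
    have "coupling n m1 (simplex_push m \<theta> t) t1' (m + m1) (\<theta> \<circ> \<alpha>) \<beta> w"
      using c a monotone_maps_comp simplex_push_comp by (auto simp: coupling_def)
    from F[OF a(2) s(2) this] F[OF X.sop_closed[OF a(1,2)] s(2) c]
    show "F m (sop X m n \<theta> s) t m1 s1' t1' = F n s (simplex_push m \<theta> t) m1 s1' t1'"
      using c a by (simp add: val_def X.sop_comp coupling_def)
  qed
  also have "\<dots> = F n2 s2 t2 m2 s2' t2'"
  proof (rule Z.cls_invariant[OF _ eq(2)])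
    fix m n \<theta> s t assume a: "\<theta> \<in> monotone_maps m n" "s \<in> simp Z n" "t \<in> standard_simplex m"
    obtain \<alpha> \<beta> w where c: "coupling n2 m t2 t (n2 + m) \<alpha> \<beta> w"
      using coupling_exists[OF simpl(3) a(3)] by blast
    have "coupling n2 n t2 (simplex_push m \<theta> t) (n2 + m) \<alpha> (\<theta> \<circ> \<beta>) w"
      using c a monotone_maps_comp simplex_push_comp by (auto simp: coupling_def)
    from F[OF s(3) a(2) this] F[OF s(3) Z.sop_closed[OF a(1,2)] c]
    show "F n2 s2 t2 m (sop Z m n \<theta> s) t = F n2 s2 t2 n s (simplex_push m \<theta> t)"
      using c a by (simp add: val_def Z.sop_comp coupling_def)
  qed
  finally show ?thesis using F s c1 c2 by simp
qed

lemma mu_eq: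
  assumes "s \<in> simp X n" "s' \<in> simp Z m" "coupling n m t t' N \<alpha> \<beta> w"
  shows "mu (cls X n s t) (cls Z m s' t') = cls Y N (\<Phi> N (sop X N n \<alpha> s) (sop Z N m \<beta> s')) w"
proof -
  have "t \<in> standard_simplex n" "t' \<in> standard_simplex m"
    using assms simplex_push_in by (auto simp: coupling_def)
  then have "mu (cls X n s t) (cls Z m s' t') = val n s m s' N \<alpha> \<beta> w"
    unfolding mu_def
  proof (intro some_equality)
    fix v assume "\<exists>n' s1 t1 m' s1' t1' N \<alpha> \<beta> w. s1 \<in> simp X n' \<and> s1' \<in> simp Z m' \<and> t1 \<in> standard_simplex n'
       \<and> t1' \<in> standard_simplex m' \<and> cls X n s t = cls X n' s1 t1 \<and> cls Z m s' t' = cls Z m' s1' t1'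
       \<and> coupling n' m' t1 t1' N \<alpha> \<beta> w \<and> v = val n' s1 m' s1' N \<alpha> \<beta> w"
    then show "v = val n s m s' N \<alpha> \<beta> w"
      by (elim exE conjE) (simp only:, rule val_classes[symmetric, OF assms(1,2) _ _ assms(3)])
  qed (use assms in blast)
  then show ?thesis by (simp add: val_def)
qed

lemma mu_same:
  assumes "s \<in> simp X n" "s' \<in> simp Z n" "t \<in> standard_simplex n"
  shows "mu (cls X n s t) (cls Z n s' t) = cls Y n (\<Phi> n s s') t"
proof -
  have "coupling n n t t n id id t"
    using assms by (simp add: coupling_def id_monotone_maps simplex_push_id)
  then show ?thesis using mu_eq[OF assms(1,2)] X.sop_id Z.sop_id assms by simp
qed

text \<open>The product of two simplices is covered by images of finitely many simplices of
  dimension \<open>n + m\<close>, one for each pair of monotone maps, and on each of these the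
  pairing is the characteristic map of a cell. The covering maps go from compact to Hausdorff spaces
  and are closed, so the pieces fit together.\<close>

lemma continuous_map_mu_cells:
  assumes s: "s \<in> simp X n" "s' \<in> simp Z m"
  shows "continuous_map (prod_topology (simplex_top n) (simplex_top m)) (realization Y)
    (\<lambda>(t, t'). mu (cls X n s t) (cls Z m s' t'))"
proof -
  let ?P = "prod_topology (simplex_top n) (simplex_top m)" and ?N = "n + m"
  let ?f = "\<lambda>(t, t'). mu (cls X n s t) (cls Z m s' t')"
  \<comment> \<open>Only the values on \<open>{..n + m}\<close> matter; requiring the maps to be
    extensional makes the index set finite.\<close>
  let ?I = "(monotone_maps ?N n \<inter> extensional {..?N}) \<times> (monotone_maps ?N m \<inter> extensional {..?N})"
  define e where "e \<alpha> \<beta> w = (simplex_push ?N \<alpha> w, simplex_push ?N \<beta> w)" for \<alpha> \<beta> w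
  have fin: "finite ?I"
  proof -
    have "finite (monotone_maps ?N k \<inter> extensional {..?N})" for k
      by (rule finite_subset[OF _ finite_PiE[of "{..?N}" "\<lambda>_. {..k}"]]) (auto simp: monotone_maps_def PiE_iff extensional_def)
    then show ?thesis by blast
  qed
  have e: "continuous_map (simplex_top ?N) ?P (e \<alpha> \<beta>)"
    if "\<alpha> \<in> monotone_maps ?N n" "\<beta> \<in> monotone_maps ?N m" for \<alpha> \<beta>
    unfolding e_def using that by (simp add: continuous_map_paired continuous_map_simplex_push)
  have fe: "?f (e \<alpha> \<beta> w) = cls Y ?N (\<Phi> ?N (sop X ?N n \<alpha> s) (sop Z ?N m \<beta> s')) w"
    if "\<alpha> \<in> monotone_maps ?N n" "\<beta> \<in> monotone_maps ?N m" "w \<in> standard_simplex ?N" for \<alpha> \<beta> w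
    unfolding e_def using that by (simp add: mu_eq[OF s] coupling_def)
  have cfe: "continuous_map (simplex_top ?N) (realization Y) (?f \<circ> e \<alpha> \<beta>)"
    if "\<alpha> \<in> monotone_maps ?N n" "\<beta> \<in> monotone_maps ?N m" for \<alpha> \<beta>
  proof (rule continuous_map_eq)
    show "continuous_map (simplex_top ?N) (realization Y) (cls Y ?N (\<Phi> ?N (sop X ?N n \<alpha> s) (sop Z ?N m \<beta> s')))"
      using that s by (intro Y.continuous_map_cls Phi_in X.sop_closed Z.sop_closed)
  qed (use fe that in auto)
  have surj: "\<exists>(\<alpha>, \<beta>)\<in>?I. \<exists>w\<in>standard_simplex ?N. z = e \<alpha> \<beta> w" if z: "z \<in> topspace ?P" for z
  proof -
    obtain t t' where tt: "z = (t, t')" "t \<in> standard_simplex n" "t' \<in> standard_simplex m" using z by auto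
    obtain \<alpha> \<beta> w where c: "coupling n m t t' ?N \<alpha> \<beta> w" using coupling_exists[OF tt(2,3)] by blast
    let ?r = "\<lambda>\<gamma>. restrict \<gamma> {..?N}"
    have "simplex_push ?N (?r \<gamma>) w = simplex_push ?N \<gamma> w" for \<gamma>
      by (rule simplex_push_cong) auto
    moreover have "?r \<gamma> \<in> monotone_maps ?N k" if "\<gamma> \<in> monotone_maps ?N k" for \<gamma> k
      using that by (intro monotone_mapsI) (auto simp: monotone_maps_le monotone_maps_mono)
    ultimately have "z = e (?r \<alpha>) (?r \<beta>) w" "(?r \<alpha>, ?r \<beta>) \<in> ?I" "w \<in> standard_simplex ?N"
      using c tt by (auto simp: coupling_def e_def)
    then show ?thesis by blast
  qed
  have HP: "Hausdorff_space ?P" by (simp add: Hausdorff_space_prod_topology Hausdorff_simplex_top)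
  show ?thesis
    unfolding continuous_map_closedin
  proof (intro conjI allI impI)
    show "?f \<in> topspace ?P \<rightarrow> topspace (realization Y)"
    proof
      fix z assume "z \<in> topspace ?P"
      from surj[OF this] obtain \<alpha> \<beta> w where "\<alpha> \<in> monotone_maps ?N n" "\<beta> \<in> monotone_maps ?N m"
        "w \<in> standard_simplex ?N" "z = e \<alpha> \<beta> w" by blast
      then show "?f z \<in> topspace (realization Y)"
        using continuous_map_image_subset_topspace[OF cfe] by (auto simp: image_subset_iff)
    qed
    fix C assume C: "closedin (realization Y) C"
    \<comment> \<open>The preimage of \<open>C\<close> is the union of these finitely many images of
      compact sets.\<close>
    let ?D = "\<lambda>(\<alpha>, \<beta>). e \<alpha> \<beta> ` {w \<in> topspace (simplex_top ?N). (?f \<circ> e \<alpha> \<beta>) w \<in> C}"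
    have "closedin ?P (?D (\<alpha>, \<beta>))" if "(\<alpha>, \<beta>) \<in> ?I" for \<alpha> \<beta>
    proof -
      have "closedin (simplex_top ?N) {w \<in> topspace (simplex_top ?N). (?f \<circ> e \<alpha> \<beta>) w \<in> C}"
        using cfe that C unfolding continuous_map_closedin by blast
      then have "compactin (simplex_top ?N) {w \<in> topspace (simplex_top ?N). (?f \<circ> e \<alpha> \<beta>) w \<in> C}"
        using closedin_compact_space compact_simplex_top by blast
      then have "compactin ?P (?D (\<alpha>, \<beta>))"
        using image_compactin e that by fastforce
      then show ?thesis using HP compactin_imp_closedin by blast
    qed
    then have "closedin ?P (\<Union>(?D ` ?I))"
      using fin by (intro closedin_Union) auto
    moreover have "\<Union>(?D ` ?I) = {z \<in> topspace ?P. ?f z \<in> C}"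
    proof
      show "\<Union>(?D ` ?I) \<subseteq> {z \<in> topspace ?P. ?f z \<in> C}"
        using continuous_map_image_subset_topspace[OF e] by (fastforce simp: image_subset_iff)
      show "{z \<in> topspace ?P. ?f z \<in> C} \<subseteq> \<Union>(?D ` ?I)"
        using surj by fastforce
    qed
    ultimately show "closedin ?P {z \<in> topspace ?P. ?f z \<in> C}" by simp
  qed
qed

text \<open>The cell criterion is applied twice. For a fixed cell of \<open>Z\<close>, its simplex
  is the compact factor, and the criterion reduces to cells of \<open>X\<close>. After
  \<open>f\<close> has been substituted, \<open>K\<close> is the compact factor, and the criterion
  reduces to cells of \<open>Z\<close>.\<close>

lemma continuous_map_mu:
  assumes K: "compact_space K" "Hausdorff_space K" and f: "continuous_map K (realization X) f"
  shows "continuous_map (prod_topology K (realization Z)) (realization Y) (\<lambda>(x, c). mu (f x) c)"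
proof (rule Z.continuous_map_from_prod_realization[OF K])
  fix m s' assume s': "s' \<in> simp Z m"
  have "continuous_map (prod_topology (simplex_top m) (realization X)) (realization Y) (\<lambda>(t', c). mu c (cls Z m s' t'))"
  proof (rule X.continuous_map_from_prod_realization[OF compact_simplex_top Hausdorff_simplex_top])
    fix n s assume "s \<in> simp X n"
    from continuous_map_mu_cells[OF this s']
    have "continuous_map (prod_topology (simplex_top m) (simplex_top n)) (realization Y)
      ((\<lambda>(t, t'). mu (cls X n s t) (cls Z m s' t')) \<circ> (\<lambda>(t', t). (t, t')))"
      by (rule continuous_map_compose[rotated]) (simp add: case_prod_unfold continuous_map_pairwise o_def continuous_map_fst continuous_map_snd)
    then show "continuous_map (prod_topology (simplex_top m) (simplex_top n)) (realization Y)
      (\<lambda>(t', t). mu (cls X n s t) (cls Z m s' t'))"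
      by (simp add: o_def case_prod_unfold)
  qed
  moreover have "continuous_map (prod_topology K (simplex_top m)) (prod_topology (simplex_top m) (realization X)) (\<lambda>(x, t'). (t', f x))"
    using continuous_map_compose[OF continuous_map_fst f]
    by (simp add: case_prod_unfold continuous_map_pairwise o_def continuous_map_snd)
  ultimately have "continuous_map (prod_topology K (simplex_top m)) (realization Y)
      ((\<lambda>(t', c). mu c (cls Z m s' t')) \<circ> (\<lambda>(x, t'). (t', f x)))"
    by (rule continuous_map_compose[rotated])
  then show "continuous_map (prod_topology K (simplex_top m)) (realization Y) (\<lambda>(x, t'). mu (f x) (cls Z m s' t'))"
    by (simp add: o_def case_prod_unfold)
qed

lemma continuous_map_mu_pair:
  assumes K: "compact_space K" "Hausdorff_space K" and f: "continuous_map K (realization X) f"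
    and g: "continuous_map L (realization Z) g"
  shows "continuous_map (prod_topology K L) (realization Y) (\<lambda>(x, y). mu (f x) (g y))"
proof -
  have "continuous_map (prod_topology K L) (prod_topology K (realization Z)) (\<lambda>(x, y). (x, g y))"
    using continuous_map_compose[OF continuous_map_snd g]
    by (simp add: case_prod_unfold continuous_map_pairwise o_def continuous_map_fst)
  from continuous_map_compose[OF this continuous_map_mu[OF K f]]
  show ?thesis by (simp add: o_def case_prod_unfold)
qed

end

section \<open>Homotopy groups\<close>

text \<open>The boundary condition only sees points of the cube, so agreement of \<open>h\<close>
  with \<open>f\<close> and \<open>g\<close> on the cube is enough.\<close>

lemma cube_homotopicI:
  fixes h :: "real \<times> (nat \<Rightarrow> real) \<Rightarrow> 'x"
  assumes "continuous_map (prod_topology (top_of_set {0..1::real}) (cube_top n)) X h"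
    and "\<And>x. x \<in> topspace (cube_top n) \<Longrightarrow> h (0, x) = f x"
    and "\<And>x. x \<in> topspace (cube_top n) \<Longrightarrow> h (1, x) = g x"
    and "\<And>u x. u \<in> {0..1} \<Longrightarrow> x \<in> cube_boundary n \<Longrightarrow> h (u, x) = x0"
  shows "(f, g) \<in> cube_homotopic n X x0"
proof -
  have "\<exists>h. continuous_map (prod_topology (top_of_set {0..1::real}) (cube_top n)) X h
      \<and> (\<forall>x\<in>topspace (cube_top n). h (0, x) = f x) \<and> (\<forall>x\<in>topspace (cube_top n). h (1, x) = g x)
      \<and> (\<forall>t\<in>{0..1}. (\<lambda>x. h (t, x)) ` cube_boundary n \<subseteq> {x0})"
    using assms by (intro exI[of _ h]) auto
  then show ?thesis
    unfolding cube_homotopic_def mem_Collect_eq case_prod_conv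
    by (subst homotopic_with) (auto simp: cube_boundary_def image_subset_iff)
qed

lemma cube_homotopicE:
  assumes "(f, g) \<in> cube_homotopic n X x0"
  obtains h where "continuous_map (prod_topology (top_of_set {0..1::real}) (cube_top n)) X h"
    "\<And>x. h (0, x) = f x" "\<And>x. h (1, x) = g x"
    "\<And>u x. u \<in> {0..1} \<Longrightarrow> x \<in> cube_boundary n \<Longrightarrow> h (u, x) = x0"
proof -
  obtain h where "continuous_map (prod_topology (top_of_set {0..1::real}) (cube_top n)) X h"
    "\<forall>x. h (0, x) = f x" "\<forall>x. h (1, x) = g x" "\<forall>t\<in>{0..1}. (\<lambda>x. h (t, x)) ` cube_boundary n \<subseteq> {x0}"
    using assms unfolding cube_homotopic_def homotopic_with_def by blast
  then show ?thesis by (intro that[of h]) (blast+)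
qed

lemma cube_homotopic_equiv: "equiv (cube_loops n X x0) (cube_homotopic n X x0)"
proof (rule equivI)
  show "cube_homotopic n X x0 \<subseteq> cube_loops n X x0 \<times> cube_loops n X x0"
    unfolding cube_homotopic_def cube_loops_def
    by (auto dest: homotopic_with_imp_continuous_maps homotopic_with_imp_property)
  show "refl_on (cube_loops n X x0) (cube_homotopic n X x0)"
    by (auto simp: refl_on_def cube_homotopic_def cube_loops_def)
  show "sym (cube_homotopic n X x0)"
    by (auto simp: sym_def cube_homotopic_def intro: homotopic_with_symD)
  show "trans (cube_homotopic n X x0)"
    unfolding trans_def cube_homotopic_def using homotopic_with_trans by blast
qed

abbreviation hcl :: "nat \<Rightarrow> 'x topology \<Rightarrow> 'x \<Rightarrow> ((nat \<Rightarrow> real) \<Rightarrow> 'x) \<Rightarrow> ((nat \<Rightarrow> real) \<Rightarrow> 'x) set" where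
  "hcl n X x0 f \<equiv> cube_homotopic n X x0 `` {f}"

lemma hcl_eqI: "(f, g) \<in> cube_homotopic n X x0 \<Longrightarrow> hcl n X x0 f = hcl n X x0 g"
  by (rule equiv_class_eq[OF cube_homotopic_equiv])

lemma cube_homotopic_loops:
  assumes "(f, g) \<in> cube_homotopic n X x0" shows "f \<in> cube_loops n X x0" "g \<in> cube_loops n X x0"
  using assms equivE[OF cube_homotopic_equiv[of n X x0]] by blast+

lemma cube_homotopic_refl: "f \<in> cube_loops n X x0 \<Longrightarrow> (f, f) \<in> cube_homotopic n X x0"
  using equivE[OF cube_homotopic_equiv[of n X x0]] by (blast dest: refl_onD)

lemma cube_homotopic_sym: "(f, g) \<in> cube_homotopic n X x0 \<Longrightarrow> (g, f) \<in> cube_homotopic n X x0"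
  using equivE[OF cube_homotopic_equiv[of n X x0]] by (blast dest: symD)

lemma cube_homotopic_trans:
  "(f, g) \<in> cube_homotopic n X x0 \<Longrightarrow> (g, h) \<in> cube_homotopic n X x0 \<Longrightarrow> (f, h) \<in> cube_homotopic n X x0"
  using equivE[OF cube_homotopic_equiv[of n X x0]] by (blast dest: transD)

lemma cube_homotopic_eq:
  assumes "f \<in> cube_loops n X x0" "\<And>x. x \<in> topspace (cube_top n) \<Longrightarrow> f x = g x"
  shows "(f, g) \<in> cube_homotopic n X x0"
  using assms unfolding cube_homotopic_def cube_loops_def
  by (auto intro!: homotopic_with_equal simp: image_subset_iff cube_boundary_def)

lemma homotopy_group_map_hcl:
  assumes "\<And>f. f \<in> cube_loops n X x0 \<Longrightarrow> \<phi> \<circ> f \<in> cube_loops n Y y0"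
    and "\<And>f g. (f, g) \<in> cube_homotopic n X x0 \<Longrightarrow> (\<phi> \<circ> f, \<phi> \<circ> g) \<in> cube_homotopic n Y y0"
    and f: "f \<in> cube_loops n X x0"
  shows "homotopy_group_map n Y y0 \<phi> (hcl n X x0 f) = hcl n Y y0 (\<phi> \<circ> f)"
  unfolding homotopy_group_map_def
  using assms cube_homotopic_refl cube_homotopic_trans by (fast intro: cube_homotopic_refl)

lemma compact_cube_top: "compact_space (cube_top n)"
  unfolding cube_top_def by (simp add: compact_space_product_topology compact_space_subtopology)

lemma Hausdorff_cube_top: "Hausdorff_space (cube_top n)"
  unfolding cube_top_def by (simp add: Hausdorff_space_product_topology Hausdorff_space_subtopology)

lemma topspace_cube_top: "topspace (cube_top n) = {..<n} \<rightarrow>\<^sub>E {0..1}"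
  by (simp add: cube_top_def)

lemma continuous_map_01:
  "continuous_map Z (top_of_set {0..1}) r \<longleftrightarrow> continuous_map Z euclideanreal r \<and> (\<forall>z\<in>topspace Z. r z \<in> {0..1})"
  by (auto simp: continuous_map_in_subtopology)

section \<open>Concatenation along the zeroth coordinate of a cube\<close>

context
  fixes N :: nat
  assumes N: "0 < N"
begin

lemma continuous_map_cube_upd:
  assumes "continuous_map Z (cube_top N) c" "continuous_map Z (top_of_set {0..1}) r"
  shows "continuous_map Z (cube_top N) (\<lambda>z. (c z)(0 := r z))"
  unfolding cube_top_def continuous_map_componentwise
proof (intro conjI ballI)
  show "(\<lambda>z. (c z)(0 := r z)) ` topspace Z \<subseteq> extensional {..<N}"
    using assms(1) N unfolding cube_top_def continuous_map_componentwise by (auto simp: extensional_def)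
  fix k assume "k \<in> {..<N}"
  then show "continuous_map Z (top_of_set {0..1}) (\<lambda>z. ((c z)(0 := r z)) k)"
    using assms unfolding cube_top_def continuous_map_componentwise by (cases "k = 0") auto
qed

lemma cube_first: "continuous_map (cube_top N) (top_of_set {0..1}) (\<lambda>x. x 0)"
  unfolding cube_top_def using N by (intro continuous_map_product_projection) auto

lemma cube_first_real: "continuous_map (cube_top N) euclideanreal (\<lambda>x. x 0)"
  using cube_first continuous_map_01 by blast

lemma cube_first_in: "x \<in> topspace (cube_top N) \<Longrightarrow> x 0 \<in> {0..1}"
  using N by (auto simp: topspace_cube_top PiE_iff)

lemma cube_upd_in: "x \<in> topspace (cube_top N) \<Longrightarrow> r \<in> {0..1} \<Longrightarrow> x(0 := r) \<in> topspace (cube_top N)"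
  using N by (auto simp: topspace_cube_top PiE_iff extensional_def)

lemma cube_upd_boundary: "x \<in> topspace (cube_top N) \<Longrightarrow> r = 0 \<or> r = 1 \<Longrightarrow> x(0 := r) \<in> cube_boundary N"
  using N cube_upd_in[of x r] by (auto simp: cube_boundary_def intro!: exI[of _ 0])

lemma cube_boundary_upd:
  assumes "x \<in> cube_boundary N" "r \<in> {0..1}" "x 0 = 0 \<or> x 0 = 1 \<Longrightarrow> r = 0 \<or> r = 1"
  shows "x(0 := r) \<in> cube_boundary N"
proof -
  obtain i where i: "i < N" "x i = 0 \<or> x i = 1" and x: "x \<in> topspace (cube_top N)"
    using assms by (auto simp: cube_boundary_def)
  show ?thesis using cube_upd_in[OF x assms(2)] i assms(3)
    by (cases "i = 0") (auto simp: cube_boundary_def intro!: exI[of _ i])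
qed

lemma cube_boundary_sub: "x \<in> cube_boundary N \<Longrightarrow> x \<in> topspace (cube_top N)"
  by (simp add: cube_boundary_def)

lemma cube_loops_boundary: "f \<in> cube_loops N X x0 \<Longrightarrow> x \<in> cube_boundary N \<Longrightarrow> f x = x0"
  by (auto simp: cube_loops_def)

lemma cube_loops_continuous: "f \<in> cube_loops N X x0 \<Longrightarrow> continuous_map (cube_top N) X f"
  by (auto simp: cube_loops_def)

lemma const_loop: "x0 \<in> topspace X \<Longrightarrow> (\<lambda>_. x0) \<in> cube_loops N X x0"
  by (auto simp: cube_loops_def)

text \<open>Associativity and the laws for the unit and inverses are all instances of this.\<close>

lemma cube_reparam_homotopic:
  assumes f: "f \<in> cube_loops N X x0" and p: "continuous_on {0..1} p" "p ` {0..1} \<subseteq> {0..1}"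
    and q: "continuous_on {0..1} q" "q ` {0..1} \<subseteq> {0..1}"
    and e: "p 0 = q 0" "p 1 = q 1" "p 0 \<in> {0, 1}" "p 1 \<in> {0, 1::real}"
  shows "(\<lambda>x. f (x(0 := p (x 0))), \<lambda>x. f (x(0 := q (x 0)))) \<in> cube_homotopic N X x0"
proof -
  let ?I = "top_of_set {0..1::real}"
  \<comment> \<open>The straight line from \<open>p\<close> to \<open>q\<close>, which stays in the
    unit interval by convexity.\<close>
  let ?r = "\<lambda>(u, x). (1 - u) * p (x 0) + u * q (x 0)"
  have r01: "(1 - u) * p s + u * q s \<in> {0..1}" if "u \<in> {0..1}" "s \<in> {0..1}" for u s
  proof -
    have "p s \<in> {0..1}" "q s \<in> {0..1}" using p q that by blast+
    then show ?thesis using that by (auto simp: convex_bound_le)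
  qed
  have cp: "continuous_map (prod_topology ?I (cube_top N)) euclideanreal (\<lambda>z. g (snd z 0))"
    if "continuous_on {0..1} g" for g
  proof -
    have "continuous_map ?I euclideanreal g" using that by simp
    from continuous_map_compose[OF continuous_map_compose[OF continuous_map_snd cube_first] this]
    show ?thesis by (simp add: o_def)
  qed
  have cu: "continuous_map (prod_topology ?I (cube_top N)) euclideanreal fst"
    using continuous_map_fst continuous_map_in_subtopology by blast
  have "continuous_map (prod_topology ?I (cube_top N)) euclideanreal ?r"
    unfolding case_prod_unfold
    by (intro continuous_map_add continuous_map_real_mult continuous_map_diff cp p q cu) auto
  then have "continuous_map (prod_topology ?I (cube_top N)) ?I ?r"
    unfolding continuous_map_01 using r01 cube_first_in by auto
  from continuous_map_cube_upd[OF continuous_map_snd this]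
  have c: "continuous_map (prod_topology ?I (cube_top N)) (cube_top N) (\<lambda>z. (snd z)(0 := ?r z))" .
  show ?thesis
  proof (rule cube_homotopicI)
    show "continuous_map (prod_topology ?I (cube_top N)) X (\<lambda>z. f ((snd z)(0 := ?r z)))"
      using continuous_map_compose[OF c cube_loops_continuous[OF f]] by (simp add: o_def)
    show "f ((snd (u, x))(0 := ?r (u, x))) = x0" if "u \<in> {0..1}" "x \<in> cube_boundary N" for u x
    proof -
      \<comment> \<open>The ends of \<open>p\<close> and \<open>q\<close> agree and lie in
        \<open>{0, 1}\<close>, so a point whose zeroth coordinate is 0 or 1 stays on the boundary
        throughout.\<close>
      have "(1 - u) * p s + u * q s = p s" if "s = 0 \<or> s = 1" for s
        using that e by (auto simp: algebra_simps)
      then have "(1 - u) * p (x 0) + u * q (x 0) \<in> {0, 1}" if "x 0 = 0 \<or> x 0 = 1"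
        using that e(3,4) by metis
      then have "x(0 := (1 - u) * p (x 0) + u * q (x 0)) \<in> cube_boundary N"
        by (intro cube_boundary_upd[OF that(2)] r01[OF that(1) cube_first_in[OF cube_boundary_sub[OF that(2)]]]) blast
      then show ?thesis using cube_loops_boundary[OF f] by simp
    qed
  qed auto
qed

text \<open>The Eckmann--Hilton argument: the two loops are run one after the other instead of
  simultaneously.\<close>

lemma eckmann_hilton_gen:
  assumes f: "f \<in> cube_loops N X x0" and g: "g \<in> cube_loops N Y y0"
    and m: "continuous_map (prod_topology (cube_top N) (cube_top N)) W (\<lambda>(x, y). m (f x) (g y))"
    and base: "m x0 y0 = w0"
    and p: "continuous_on {0..1} p" "p ` {0..1} \<subseteq> {0..1}" "p 0 = 0" "p 1 = (1::real)"
    and q: "continuous_on {0..1} q" "q ` {0..1} \<subseteq> {0..1}" "q 0 = 0" "q 1 = (1::real)"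
  shows "(\<lambda>x. m (f x) (g x), \<lambda>x. m (f (x(0 := p (x 0)))) (g (x(0 := q (x 0))))) \<in> cube_homotopic N W w0"
proof -
  let ?I = "top_of_set {0..1::real}"
  \<comment> \<open>\<open>?r p\<close> moves from the identity to \<open>p\<close> with fixed ends;
    both arguments of \<open>m\<close> are reparametrized at the same time \<open>u\<close>.\<close>
  let ?r = "\<lambda>p (u, x). (1 - u) * x 0 + u * p (x 0)"
  have r01: "(1 - u) * s + u * g s \<in> {0..1}" if "u \<in> {0..1}" "s \<in> {0..1}" "g ` {0..1} \<subseteq> {0..1}" for u s :: real and g
  proof -
    have "g s \<in> {0..1}" using that by blast
    then show ?thesis using that by (simp add: convex_bound_le)
  qed
  have cp: "continuous_map (prod_topology ?I (cube_top N)) euclideanreal (\<lambda>z. g (snd z 0))"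
    if "continuous_on {0..1} g" for g
  proof -
    have "continuous_map ?I euclideanreal g" using that by simp
    from continuous_map_compose[OF continuous_map_compose[OF continuous_map_snd cube_first] this]
    show ?thesis by (simp add: o_def)
  qed
  have cu: "continuous_map (prod_topology ?I (cube_top N)) euclideanreal fst"
    using continuous_map_fst continuous_map_in_subtopology by blast
  have c: "continuous_map (prod_topology ?I (cube_top N)) (cube_top N) (\<lambda>z. (snd z)(0 := ?r g z))"
    if "continuous_on {0..1} g" "g ` {0..1} \<subseteq> {0..1}" for g
  proof (rule continuous_map_cube_upd[OF continuous_map_snd])
    have "continuous_map (prod_topology ?I (cube_top N)) euclideanreal (?r g)"
      unfolding case_prod_unfold
      by (intro continuous_map_add continuous_map_real_mult continuous_map_diff cp that cu
          cp[of "\<lambda>x. x", simplified]) auto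
    then show "continuous_map (prod_topology ?I (cube_top N)) ?I (?r g)"
      unfolding continuous_map_01 using r01 cube_first_in that(2) by auto
  qed
  show ?thesis
  proof (rule cube_homotopicI)
    have "continuous_map (prod_topology ?I (cube_top N)) (prod_topology (cube_top N) (cube_top N))
        (\<lambda>z. ((snd z)(0 := ?r p z), (snd z)(0 := ?r q z)))"
      using c[OF p(1,2)] c[OF q(1,2)] by (simp add: continuous_map_paired)
    from continuous_map_compose[OF this m]
    show "continuous_map (prod_topology ?I (cube_top N)) W (\<lambda>z. m (f ((snd z)(0 := ?r p z))) (g ((snd z)(0 := ?r q z))))"
      by (simp add: o_def case_prod_unfold)
    show "m (f ((snd (u, x))(0 := ?r p (u, x)))) (g ((snd (u, x))(0 := ?r q (u, x)))) = w0"
      if "u \<in> {0..1}" "x \<in> cube_boundary N" for u x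
    proof -
      have "x(0 := (1 - u) * x 0 + u * r (x 0)) \<in> cube_boundary N"
        if "r ` {0..1} \<subseteq> {0..1}" "r 0 = 0" "r 1 = 1" for r
        using that r01[OF \<open>u \<in> {0..1}\<close> cube_first_in[OF cube_boundary_sub[OF \<open>x \<in> cube_boundary N\<close>]] that(1)]
        by (intro cube_boundary_upd \<open>x \<in> cube_boundary N\<close>) auto
      then show ?thesis using p q base cube_loops_boundary[OF f] cube_loops_boundary[OF g] by simp
    qed
  qed auto
qed

text \<open>With \<open>?p\<close> a loop is run in the first half and then rests at its base point;
  with \<open>?q\<close> it rests first. Exchanging the two exchanges the order. Continuity is asked
  only of the composite with \<open>f\<close> and \<open>g\<close>, which is the form in which it is
  known for pairings of realizations.\<close>

lemma eckmann_hilton: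
  assumes f: "f \<in> cube_loops N X x0" and g: "g \<in> cube_loops N Y y0"
    and m: "continuous_map (prod_topology (cube_top N) (cube_top N)) W (\<lambda>(x, y). m (f x) (g y))"
    and base: "m x0 y0 = w0"
  shows "(\<lambda>x. m (f x) (g x), cube_concat (\<lambda>x. m (f x) y0) (\<lambda>x. m x0 (g x))) \<in> cube_homotopic N W w0"
    and "(\<lambda>x. m (f x) (g x), cube_concat (\<lambda>x. m x0 (g x)) (\<lambda>x. m (f x) y0)) \<in> cube_homotopic N W w0"
proof -
  let ?p = "\<lambda>s::real. min 1 (2 * s)" and ?q = "\<lambda>s::real. max 0 (2 * s - 1)"
  have cont: "continuous_on {0..1} ?p" "?p ` {0..1} \<subseteq> {0..1}" "?p 0 = 0" "?p 1 = 1"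
      "continuous_on {0..1} ?q" "?q ` {0..1} \<subseteq> {0..1}" "?q 0 = 0" "?q 1 = 1"
    by (auto intro!: continuous_intros)
  have b: "f (x(0 := 0)) = x0" "f (x(0 := 1)) = x0" "g (x(0 := 0)) = y0" "g (x(0 := 1)) = y0"
    if "x \<in> topspace (cube_top N)" for x
    using that cube_upd_boundary cube_loops_boundary[OF f] cube_loops_boundary[OF g] by auto
  \<comment> \<open>At the midpoint both branches apply; there \<open>2 * x 0\<close> is 1 and both
    loops are at their base points.\<close>
  have b': "f (x(0 := 2 * x 0)) = x0" "g (x(0 := 2 * x 0 - 1)) = y0"
      "f (x(0 := 2 * x 0 - 1)) = x0" "g (x(0 := 2 * x 0)) = y0"
    if "x \<in> topspace (cube_top N)" "1 \<le> 2 * x 0" "x 0 * 2 \<le> 1" for x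
  proof -
    have "2 * x 0 = 1" using that by linarith
    then show "f (x(0 := 2 * x 0)) = x0" "g (x(0 := 2 * x 0 - 1)) = y0"
      "f (x(0 := 2 * x 0 - 1)) = x0" "g (x(0 := 2 * x 0)) = y0" using b that(1) by simp_all
  qed
  note h = eckmann_hilton_gen[OF f g m base cont] eckmann_hilton_gen[OF f g m base cont(5-8) cont(1-4)]
  show "(\<lambda>x. m (f x) (g x), cube_concat (\<lambda>x. m (f x) y0) (\<lambda>x. m x0 (g x))) \<in> cube_homotopic N W w0"
    by (rule cube_homotopic_trans[OF h(1) cube_homotopic_eq[OF cube_homotopic_loops(2)[OF h(1)]]])
      (auto simp: cube_concat_def b b' max_def min_def)
  show "(\<lambda>x. m (f x) (g x), cube_concat (\<lambda>x. m x0 (g x)) (\<lambda>x. m (f x) y0)) \<in> cube_homotopic N W w0"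
    by (rule cube_homotopic_trans[OF h(2) cube_homotopic_eq[OF cube_homotopic_loops(2)[OF h(2)]]])
      (auto simp: cube_concat_def b b' max_def min_def)
qed

text \<open>The two homotopies are concatenated at each time. Truncation by \<open>min\<close> and
  \<open>max\<close> makes both branches continuous on the whole cube, so only agreement on the
  middle hyperplane is left to check, where both take the value \<open>x0\<close>.\<close>

lemma cube_concat_homotopic:
  assumes "(f, f') \<in> cube_homotopic N X x0" "(g, g') \<in> cube_homotopic N X x0"
  shows "(cube_concat f g, cube_concat f' g') \<in> cube_homotopic N X x0"
proof -
  let ?I = "top_of_set {0..1::real}"
  let ?P = "prod_topology ?I (cube_top N)"
  obtain h where h: "continuous_map ?P X h" "\<And>x. h (0, x) = f x" "\<And>x. h (1, x) = f' x"
    "\<And>u x. u \<in> {0..1} \<Longrightarrow> x \<in> cube_boundary N \<Longrightarrow> h (u, x) = x0" by (rule cube_homotopicE[OF assms(1)]) (rule that)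
  obtain k where k: "continuous_map ?P X k" "\<And>x. k (0, x) = g x" "\<And>x. k (1, x) = g' x"
    "\<And>u x. u \<in> {0..1} \<Longrightarrow> x \<in> cube_boundary N \<Longrightarrow> k (u, x) = x0" by (rule cube_homotopicE[OF assms(2)]) (rule that)
  let ?p = "\<lambda>s::real. min 1 (2 * s)" and ?q = "\<lambda>s::real. max 0 (2 * s - 1)"
  have z0: "continuous_map ?P euclideanreal (\<lambda>z. snd z 0)"
    using continuous_map_compose[OF continuous_map_snd cube_first_real] by (simp add: o_def)
  have in01: "snd z 0 \<in> {0..1}" if "z \<in> topspace ?P" for z
    using that cube_first_in by auto
  have c: "continuous_map ?P X (\<lambda>z. k (fst z, (snd z)(0 := r (snd z 0))))"
    if "continuous_map ?P X k" and r: "continuous_on UNIV r" "r ` {0..1} \<subseteq> {0..1}" for k r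
  proof -
    have "continuous_map euclideanreal euclideanreal r" using r by simp
    from continuous_map_compose[OF z0 this]
    have "continuous_map ?P euclideanreal (\<lambda>z. r (snd z 0))" by (simp add: o_def)
    then have "continuous_map ?P ?I (\<lambda>z. r (snd z 0))"
      unfolding continuous_map_01 using in01 r(2) by blast
    from continuous_map_cube_upd[OF continuous_map_snd this]
    have "continuous_map ?P ?P (\<lambda>z. (fst z, (snd z)(0 := r (snd z 0))))"
      by (simp add: continuous_map_paired continuous_map_fst)
    from continuous_map_compose[OF this that(1)] show ?thesis by (simp add: o_def)
  qed
  have ch: "continuous_map ?P X (\<lambda>z. h (fst z, (snd z)(0 := ?p (snd z 0))))"
    by (rule c[OF h(1)]) (auto intro!: continuous_intros)
  have ck: "continuous_map ?P X (\<lambda>z. k (fst z, (snd z)(0 := ?q (snd z 0))))"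
    by (rule c[OF k(1)]) (auto intro!: continuous_intros)
  show ?thesis
  proof (rule cube_homotopicI)
    show "continuous_map ?P X (\<lambda>z. if snd z 0 \<le> 1/2 then h (fst z, (snd z)(0 := ?p (snd z 0)))
        else k (fst z, (snd z)(0 := ?q (snd z 0))))"
    proof (rule continuous_map_cases_le)
      fix z assume z: "z \<in> topspace ?P" "snd z 0 = 1/2"
      have "(snd z)(0 := ?p (snd z 0)) \<in> cube_boundary N" "(snd z)(0 := ?q (snd z 0)) \<in> cube_boundary N"
        using z by (auto intro!: cube_upd_boundary)
      moreover have "fst z \<in> {0..1}" using z by auto
      ultimately show "h (fst z, (snd z)(0 := ?p (snd z 0))) = k (fst z, (snd z)(0 := ?q (snd z 0)))"
        by (simp only: h(4) k(4))
    qed (use ch ck z0 in \<open>auto intro!: continuous_map_from_subtopology\<close>)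
    fix u :: real and x assume ux: "u \<in> {0..1}" "x \<in> cube_boundary N"
    have "x(0 := ?p (x 0)) \<in> cube_boundary N" "x(0 := ?q (x 0)) \<in> cube_boundary N"
      using ux cube_first_in[OF cube_boundary_sub[OF ux(2)]] by (auto intro!: cube_boundary_upd)
    then show "(if snd (u, x) 0 \<le> 1/2 then h (fst (u, x), (snd (u, x))(0 := ?p (snd (u, x) 0)))
        else k (fst (u, x), (snd (u, x))(0 := ?q (snd (u, x) 0)))) = x0"
      by (simp only: fst_conv snd_conv h(4)[OF ux(1)] k(4)[OF ux(1)] if_cancel)
  qed (use h k in \<open>auto simp: cube_concat_def min_absorb2 max_absorb2\<close>)
qed

lemma cube_concat_loops:
  "f \<in> cube_loops N X x0 \<Longrightarrow> g \<in> cube_loops N X x0 \<Longrightarrow> cube_concat f g \<in> cube_loops N X x0"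
  using cube_concat_homotopic cube_homotopic_refl cube_homotopic_loops by metis

lemma homotopy_group_mult:
  assumes "f \<in> cube_loops N X x0" "g \<in> cube_loops N X x0"
  shows "hcl N X x0 f \<otimes>\<^bsub>homotopy_group N X x0\<^esub> hcl N X x0 g = hcl N X x0 (cube_concat f g)"
proof -
  have "cube_homotopic N X x0 `` {cube_concat f' g' | f' g'. f' \<in> hcl N X x0 f \<and> g' \<in> hcl N X x0 g}
      = hcl N X x0 (cube_concat f g)"
  proof
    show "hcl N X x0 (cube_concat f g) \<subseteq> cube_homotopic N X x0 `` {cube_concat f' g' | f' g'. f' \<in> hcl N X x0 f \<and> g' \<in> hcl N X x0 g}"
      using assms cube_homotopic_refl by fast
    show "cube_homotopic N X x0 `` {cube_concat f' g' | f' g'. f' \<in> hcl N X x0 f \<and> g' \<in> hcl N X x0 g} \<subseteq> hcl N X x0 (cube_concat f g)"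
      using cube_concat_homotopic cube_homotopic_trans by fast
  qed
  then show ?thesis by (simp add: homotopy_group_def)
qed

lemma homotopy_group_carrier: "carrier (homotopy_group N X x0) = hcl N X x0 ` cube_loops N X x0"
  by (auto simp: homotopy_group_def quotient_def)

lemma homotopy_group_one: "\<one>\<^bsub>homotopy_group N X x0\<^esub> = hcl N X x0 (\<lambda>_. x0)"
  by (simp add: homotopy_group_def)

lemma homotopy_group_group:
  assumes x0: "x0 \<in> topspace X"
  shows "group (homotopy_group N X x0)"
proof (rule groupI)
  let ?G = "homotopy_group N X x0"
  \<comment> \<open>Both loops are reparametrizations of one loop \<open>k\<close> with the same
    ends; associativity, the unit law and the inverse law are choices of \<open>k\<close>,
    \<open>p\<close> and \<open>q\<close>.\<close>
  have reparam: "hcl N X x0 f = hcl N X x0 g"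
    if k: "k \<in> cube_loops N X x0" and p: "continuous_on {0..1} p" "p ` {0..1} \<subseteq> {0..1}"
      and q: "continuous_on {0..1} q" "q ` {0..1} \<subseteq> {0..1}"
      and e: "p 0 = q 0" "p 1 = q 1" "p 0 \<in> {0, 1}" "p 1 \<in> {0, 1::real}"
      and f: "\<And>x. x \<in> topspace (cube_top N) \<Longrightarrow> f x = k (x(0 := p (x 0)))"
      and g: "\<And>x. x \<in> topspace (cube_top N) \<Longrightarrow> g x = k (x(0 := q (x 0)))"
    for f g k p q
  proof -
    note h = cube_reparam_homotopic[OF k p q e]
    have "(\<lambda>x. k (x(0 := p (x 0))), f) \<in> cube_homotopic N X x0"
      by (rule cube_homotopic_eq[OF cube_homotopic_loops(1)[OF h]]) (simp add: f)
    moreover have "(\<lambda>x. k (x(0 := q (x 0))), g) \<in> cube_homotopic N X x0"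
      by (rule cube_homotopic_eq[OF cube_homotopic_loops(2)[OF h]]) (simp add: g)
    ultimately have "(f, g) \<in> cube_homotopic N X x0"
      using h by (blast intro: cube_homotopic_sym cube_homotopic_trans)
    then show ?thesis by (rule hcl_eqI)
  qed
  show "\<one>\<^bsub>?G\<^esub> \<in> carrier ?G"
    using const_loop[OF x0] by (simp add: homotopy_group_one homotopy_group_carrier)
  fix a b c assume "a \<in> carrier ?G" "b \<in> carrier ?G" "c \<in> carrier ?G"
  then obtain f g h where f: "f \<in> cube_loops N X x0" "a = hcl N X x0 f"
    and g: "g \<in> cube_loops N X x0" "b = hcl N X x0 g" and h: "h \<in> cube_loops N X x0" "c = hcl N X x0 h"
    unfolding homotopy_group_carrier by blast
  show "a \<otimes>\<^bsub>?G\<^esub> b \<in> carrier ?G"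
    using f g by (auto simp: homotopy_group_mult homotopy_group_carrier intro!: imageI cube_concat_loops)
  show "a \<otimes>\<^bsub>?G\<^esub> b \<otimes>\<^bsub>?G\<^esub> c = a \<otimes>\<^bsub>?G\<^esub> (b \<otimes>\<^bsub>?G\<^esub> c)"
  proof -
    \<comment> \<open>The piecewise linear map with slopes 2, 1 and 1/2 that breaks at 1/4 and 1/2.
      It is concave, hence the minimum of its three pieces.\<close>
    let ?p = "\<lambda>s::real. min (2 * s) (min (s + 1/4) (s/2 + 1/2))"
    have "hcl N X x0 (cube_concat (cube_concat f g) h) = hcl N X x0 (cube_concat f (cube_concat g h))"
    proof (rule reparam[of "cube_concat f (cube_concat g h)" ?p "\<lambda>s. s"])
      fix x assume "x \<in> topspace (cube_top N)"
      have "x 0 \<le> 1/4 \<or> 1/4 < x 0 \<and> x 0 \<le> 1/2 \<or> 1/2 < x 0" by linarith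
      then show "cube_concat (cube_concat f g) h x = cube_concat f (cube_concat g h) (x(0 := ?p (x 0)))"
        by (elim disjE) (auto simp: cube_concat_def min_def algebra_simps)
    qed (use f g h in \<open>auto intro!: continuous_intros cube_concat_loops\<close>)
    then show ?thesis using f g h by (simp add: homotopy_group_mult cube_concat_loops)
  qed
  show "\<one>\<^bsub>?G\<^esub> \<otimes>\<^bsub>?G\<^esub> a = a"
  proof -
    have "hcl N X x0 (cube_concat (\<lambda>_. x0) f) = hcl N X x0 f"
    proof (rule reparam[of f "\<lambda>s. max 0 (2 * s - 1)" "\<lambda>s. s"])
      fix x assume "x \<in> topspace (cube_top N)"
      then show "cube_concat (\<lambda>_. x0) f x = f (x(0 := max 0 (2 * x 0 - 1)))"
        using cube_loops_boundary[OF f(1) cube_upd_boundary] by (auto simp: cube_concat_def max_def)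
    qed (use f in \<open>auto intro!: continuous_intros\<close>)
    then show ?thesis using f const_loop[OF x0] by (simp add: homotopy_group_mult homotopy_group_one)
  qed
  show "\<exists>y\<in>carrier ?G. y \<otimes>\<^bsub>?G\<^esub> a = \<one>\<^bsub>?G\<^esub>"
  proof -
    let ?i = "\<lambda>x. f (x(0 := 1 - x 0))"
    have i: "?i \<in> cube_loops N X x0"
      by (rule cube_homotopic_loops(1)[OF cube_reparam_homotopic[OF f(1), of "\<lambda>s. 1 - s" "\<lambda>s. 1 - s"]])
        (auto intro!: continuous_intros)
    have "hcl N X x0 (cube_concat ?i f) = hcl N X x0 (\<lambda>_. x0)"
    \<comment> \<open>The absolute value of \<open>1 - 2 * s\<close> runs \<open>f\<close> backwards
      and then forwards; it is deformed to the constant 1, where \<open>f\<close> is at the base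
      point.\<close>
    proof (rule reparam[of f "\<lambda>s. \<bar>1 - 2 * s\<bar>" "\<lambda>s. 1"])
      fix x assume x: "x \<in> topspace (cube_top N)"
      show "cube_concat ?i f x = f (x(0 := \<bar>1 - 2 * x 0\<bar>))"
        by (auto simp: cube_concat_def abs_if)
      show "x0 = f (x(0 := 1))"
        using cube_loops_boundary[OF f(1) cube_upd_boundary[OF x]] by simp
    qed (use f in \<open>auto intro!: continuous_intros\<close>)
    then show ?thesis using f i
      by (intro bexI[of _ "hcl N X x0 ?i"]) (auto simp: homotopy_group_mult homotopy_group_one homotopy_group_carrier)
  qed
qed

end

section \<open>Maps of realizations induced by simplicial maps\<close>

context simplicial
begin

lemma continuous_map_from_realization:
  assumes "\<And>n s. s \<in> simp X n \<Longrightarrow> continuous_map (simplex_top n) W (\<lambda>t. h (cls X n s t))"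
  shows "continuous_map (realization X) W h"
proof -
  let ?K = "discrete_topology {()}"
  have "continuous_map (prod_topology ?K (realization X)) W (\<lambda>(x, c). h c)"
  proof (rule continuous_map_from_prod_realization)
    fix n s assume "s \<in> simp X n"
    from continuous_map_compose[OF continuous_map_snd assms[OF this]]
    show "continuous_map (prod_topology ?K (simplex_top n)) W (\<lambda>(x, t). h (cls X n s t))"
      by (simp add: o_def case_prod_unfold)
  qed (auto simp: compact_space_discrete_topology)
  moreover have "continuous_map (realization X) (prod_topology ?K (realization X)) (\<lambda>c. ((), c))"
    by (simp add: continuous_map_paired)
  ultimately show ?thesis
    using continuous_map_compose[of "realization X" "prod_topology ?K (realization X)" "\<lambda>c. ((), c)" W "\<lambda>(x, c). h c"]
    by (simp add: o_def)
qed

end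

locale simplicial_map = X: simplicial X + Y: simplicial Y
  for X :: "'s sset" and Y :: "'y sset" +
  fixes \<phi> :: "nat \<Rightarrow> 's \<Rightarrow> 'y"
  assumes phi_in: "s \<in> simp X n \<Longrightarrow> \<phi> n s \<in> simp Y n"
    and phi_sop: "\<theta> \<in> monotone_maps m n \<Longrightarrow> s \<in> simp X n \<Longrightarrow> sop Y m n \<theta> (\<phi> n s) = \<phi> m (sop X m n \<theta> s)"
begin

text \<open>\<open>realization_map\<close> saturates the image of a whole class. All members of the
  class have their images in one class because a simplicial map respects each gluing.\<close>

lemma realization_map_cls:
  assumes "s \<in> simp X n"
  shows "realization_map Y \<phi> (cls X n s t) = cls Y n (\<phi> n s) t"
proof -
  let ?F = "\<lambda>(n, s, t). (n, \<phi> n s, t)"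
  have inv: "cell_equiv Y `` {?F x} = cell_equiv Y `` {?F y}" if "(x, y) \<in> cell_equiv X" for x y
  proof (rule X.cell_equiv_invariant[where F = "\<lambda>x. cell_equiv Y `` {?F x}", OF _ that])
    fix m n \<theta> s t assume a: "\<theta> \<in> monotone_maps m n" "s \<in> simp X n" "t \<in> standard_simplex m"
    show "cell_equiv Y `` {?F (m, sop X m n \<theta> s, t)} = cell_equiv Y `` {?F (n, s, simplex_push m \<theta> t)}"
      using Y.cls_glue[OF a(1) phi_in[OF a(2)] a(3)] phi_sop[OF a(1,2)] by (simp add: cls_def)
  qed
  have "cell_equiv Y `` {?F x} = cell_equiv Y `` {?F (n, s, t)}" if "x \<in> cls X n s t" for x
    by (rule inv[symmetric]) (use that in \<open>simp only: cls_def Image_singleton_iff\<close>)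
  moreover have "(n, s, t) \<in> cls X n s t"
    by (simp add: cls_def cell_equiv_def)
  moreover have "cell_equiv Y `` (?F ` cls X n s t) = (\<Union>x\<in>cls X n s t. cell_equiv Y `` {?F x})"
    by (rule Image_eq_UN[THEN trans]) blast
  ultimately have "cell_equiv Y `` (?F ` cls X n s t) = cell_equiv Y `` {?F (n, s, t)}"
    by (metis (no_types, lifting) SUP_cong SUP_const empty_iff)
  then show ?thesis by (simp add: realization_map_def cls_def)
qed

lemma continuous_map_realization_map:
  "continuous_map (realization X) (realization Y) (realization_map Y \<phi>)"
  by (rule X.continuous_map_from_realization) (simp add: realization_map_cls Y.continuous_map_cls phi_in)

end

lemma cube_compose:
  assumes \<phi>: "continuous_map X Y \<phi>" "\<phi> x0 = y0"
  shows "f \<in> cube_loops n X x0 \<Longrightarrow> \<phi> \<circ> f \<in> cube_loops n Y y0"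
    and "(f, g) \<in> cube_homotopic n X x0 \<Longrightarrow> (\<phi> \<circ> f, \<phi> \<circ> g) \<in> cube_homotopic n Y y0"
proof -
  show "f \<in> cube_loops n X x0 \<Longrightarrow> \<phi> \<circ> f \<in> cube_loops n Y y0"
    using \<phi> continuous_map_compose by (auto simp: cube_loops_def)
  assume "(f, g) \<in> cube_homotopic n X x0"
  then obtain h where h: "continuous_map (prod_topology (top_of_set {0..1::real}) (cube_top n)) X h"
    "\<And>x. h (0, x) = f x" "\<And>x. h (1, x) = g x"
    "\<And>u x. u \<in> {0..1} \<Longrightarrow> x \<in> cube_boundary n \<Longrightarrow> h (u, x) = x0"
    by (rule cube_homotopicE) (rule that)
  show "(\<phi> \<circ> f, \<phi> \<circ> g) \<in> cube_homotopic n Y y0"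
    by (rule cube_homotopicI[OF continuous_map_compose[OF h(1) \<phi>(1)]]) (use h \<phi> in auto)
qed

lemma cube_loops_in: "f \<in> cube_loops n X x0 \<Longrightarrow> x \<in> topspace (cube_top n) \<Longrightarrow> f x \<in> topspace X"
  unfolding cube_loops_def using continuous_map_image_subset_topspace by fastforce

section \<open>The K-theory of exact functors\<close>

lemma sarrows_sindices: "(x, y) \<in> sarrows n \<Longrightarrow> x \<in> sindices n \<and> y \<in> sindices n"
  by (auto simp: sarrows_def)

lemma sarrows_refl: "x \<in> sindices n \<Longrightarrow> (x, x) \<in> sarrows n"
  by (auto simp: sarrows_def)

lemma sarrows_trans: "(x, y) \<in> sarrows n \<Longrightarrow> (y, z) \<in> sarrows n \<Longrightarrow> (x, z) \<in> sarrows n"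
  by (auto simp: sarrows_def)

lemma wS_simpI:
  assumes "\<And>x. x \<in> sindices n \<Longrightarrow> A x \<in> obj C" "A \<in> extensional (sindices n)" "a \<in> extensional (sarrows n)"
    "\<And>x y. (x, y) \<in> sarrows n \<Longrightarrow> a (x, y) \<in> hm C (A x) (A y)"
    "\<And>x. x \<in> sindices n \<Longrightarrow> a (x, x) = idn C (A x)"
    "\<And>x y z. (x, y) \<in> sarrows n \<Longrightarrow> (y, z) \<in> sarrows n \<Longrightarrow> a (x, z) = cmp C (A x) (A y) (A z) (a (y, z)) (a (x, y))"
    "\<And>p q i j. p \<le> q \<Longrightarrow> q \<le> n \<Longrightarrow> i \<le> j \<Longrightarrow> j \<le> n \<Longrightarrow> iso_in C (A (p, i, j)) (A (q, i, j)) (a ((p, i, j), (q, i, j)))"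
    "\<And>p i. p \<le> n \<Longrightarrow> i \<le> n \<Longrightarrow> A (p, i, i) = zob C"
    "\<And>p i j k. p \<le> n \<Longrightarrow> i \<le> j \<Longrightarrow> j \<le> k \<Longrightarrow> k \<le> n \<Longrightarrow>
          ses C (A (p, i, j)) (A (p, i, k)) (A (p, j, k)) (a ((p, i, j), (p, i, k))) (a ((p, i, k), (p, j, k)))"
  shows "(A, a) \<in> wS_simp C n"
  using assms unfolding wS_simp_def by (auto simp: PiE_iff)

lemma wS_simpD:
  assumes "(A, a) \<in> wS_simp C n"
  shows "\<And>x. x \<in> sindices n \<Longrightarrow> A x \<in> obj C" "A \<in> extensional (sindices n)" "a \<in> extensional (sarrows n)"
    "\<And>x y. (x, y) \<in> sarrows n \<Longrightarrow> a (x, y) \<in> hm C (A x) (A y)"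
    "\<And>x. x \<in> sindices n \<Longrightarrow> a (x, x) = idn C (A x)"
    "\<And>x y z. (x, y) \<in> sarrows n \<Longrightarrow> (y, z) \<in> sarrows n \<Longrightarrow> a (x, z) = cmp C (A x) (A y) (A z) (a (y, z)) (a (x, y))"
    "\<And>p q i j. p \<le> q \<Longrightarrow> q \<le> n \<Longrightarrow> i \<le> j \<Longrightarrow> j \<le> n \<Longrightarrow> iso_in C (A (p, i, j)) (A (q, i, j)) (a ((p, i, j), (q, i, j)))"
    "\<And>p i. p \<le> n \<Longrightarrow> i \<le> n \<Longrightarrow> A (p, i, i) = zob C"
    "\<And>p i j k. p \<le> n \<Longrightarrow> i \<le> j \<Longrightarrow> j \<le> k \<Longrightarrow> k \<le> n \<Longrightarrow>
          ses C (A (p, i, j)) (A (p, i, k)) (A (p, j, k)) (a ((p, i, j), (p, i, k))) (a ((p, i, k), (p, j, k)))"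
  using assms unfolding wS_simp_def by (auto simp: PiE_iff)

lemma sindices_simps [simp]: "(p, i, j) \<in> sindices n \<longleftrightarrow> p \<le> n \<and> i \<le> j \<and> j \<le> n"
  by (simp add: sindices_def)

lemma sarrows_simps [simp]:
  "((p, i, j), (p', i', j')) \<in> sarrows n \<longleftrightarrow> p \<le> p' \<and> i \<le> i' \<and> j \<le> j' \<and> p' \<le> n \<and> i \<le> j \<and> i' \<le> j' \<and> j' \<le> n"
  by (auto simp: sarrows_def)

text \<open>Projections replace the pattern matching of the definition, so that the simplifier can
  work with an index that is a variable.\<close>

lemma wS_op_apply:
  "fst (wS_op m \<theta> (A, a)) = (\<lambda>x\<in>sindices m. A (\<theta> (fst x), \<theta> (fst (snd x)), \<theta> (snd (snd x))))"
  "snd (wS_op m \<theta> (A, a)) = (\<lambda>z\<in>sarrows m. a ((\<theta> (fst (fst z)), \<theta> (fst (snd (fst z))), \<theta> (snd (snd (fst z)))),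
      (\<theta> (fst (snd z)), \<theta> (fst (snd (snd z))), \<theta> (snd (snd (snd z))))))"
  by (auto simp: wS_op_def restrict_def fun_eq_iff)

lemma simplicial_wS: "simplicial (wS C)"
proof
  fix \<theta> m n s assume \<theta>: "\<theta> \<in> monotone_maps m n" and "s \<in> simp (wS C) n"
  then obtain A a where s: "s = (A, a)" "(A, a) \<in> wS_simp C n" by (cases s) (auto simp: wS_def)
  note D = wS_simpD[OF s(2)]
  note le = monotone_maps_le[OF \<theta>] monotone_maps_mono[OF \<theta>]
  have "(fst (wS_op m \<theta> (A, a)), snd (wS_op m \<theta> (A, a))) \<in> wS_simp C m"
    unfolding wS_op_apply
  proof (rule wS_simpI, goal_cases)
    case (6 x y z)
    then have "(x, z) \<in> sarrows m" "x \<in> sindices m" "y \<in> sindices m" "z \<in> sindices m"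
      using sarrows_trans sarrows_sindices by blast+
    moreover obtain p i j p' i' j' p'' i'' j'' where "x = (p, i, j)" "y = (p', i', j')" "z = (p'', i'', j'')"
      by (metis surj_pair)
    ultimately show ?case using 6 le by (simp add: D(6))
  qed (use D le in \<open>auto\<close>)
  then show "sop (wS C) m n \<theta> s \<in> simp (wS C) m" by (simp add: wS_def s)
next
  fix \<theta> m n \<theta>' k s assume \<theta>: "\<theta> \<in> monotone_maps m n" "\<theta>' \<in> monotone_maps k m" "s \<in> simp (wS C) n"
  show "sop (wS C) k m \<theta>' (sop (wS C) m n \<theta> s) = sop (wS C) k n (\<theta> \<circ> \<theta>') s"
    by (cases s) (use monotone_maps_le[OF \<theta>(2)] monotone_maps_mono[OF \<theta>(2)] in \<open>auto simp: wS_def wS_op_def restrict_def fun_eq_iff\<close>)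
next
  fix m n :: nat and \<theta> \<theta>' :: "nat \<Rightarrow> nat" and s assume "\<And>i. i \<le> m \<Longrightarrow> \<theta> i = \<theta>' i"
  then show "sop (wS C) m n \<theta> s = sop (wS C) m n \<theta>' s"
    by (cases s) (auto simp: wS_def wS_op_def restrict_def fun_eq_iff)
next
  fix s n assume "s \<in> simp (wS C) n"
  then obtain A a where s: "s = (A, a)" "(A, a) \<in> wS_simp C n" by (cases s) (auto simp: wS_def)
  have "wS_op n id (A, a) = (A, a)"
    by (rule prod_eqI) (simp_all add: wS_op_apply extensional_restrict wS_simpD(2,3)[OF s(2)])
  then show "sop (wS C) n n id s = s" by (simp add: wS_def s)
qed

section \<open>Base points, exact functors and bifunctors\<close>

locale wcategory =
  fixes C :: "('o, 'm) wcat"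
  assumes zob_obj: "zob C \<in> obj C"
    and idn_hm: "M \<in> obj C \<Longrightarrow> idn C M \<in> hm C M M"
    and cmp_hm: "L \<in> obj C \<Longrightarrow> M \<in> obj C \<Longrightarrow> N \<in> obj C \<Longrightarrow> f \<in> hm C L M \<Longrightarrow> g \<in> hm C M N \<Longrightarrow> cmp C L M N g f \<in> hm C L N"
    and cmp_assoc: "K \<in> obj C \<Longrightarrow> L \<in> obj C \<Longrightarrow> M \<in> obj C \<Longrightarrow> N \<in> obj C \<Longrightarrow> f \<in> hm C K L \<Longrightarrow> g \<in> hm C L M \<Longrightarrow> h \<in> hm C M N
      \<Longrightarrow> cmp C K L N (cmp C L M N h g) f = cmp C K M N h (cmp C K L M g f)"
    and cmp_idl: "L \<in> obj C \<Longrightarrow> M \<in> obj C \<Longrightarrow> f \<in> hm C L M \<Longrightarrow> cmp C L M M (idn C M) f = f"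
    and cmp_idr: "L \<in> obj C \<Longrightarrow> M \<in> obj C \<Longrightarrow> f \<in> hm C L M \<Longrightarrow> cmp C L L M f (idn C L) = f"
    and ses_zob: "ses C (zob C) (zob C) (zob C) (idn C (zob C)) (idn C (zob C))"

definition zero_simplex :: "('o, 'm) wcat \<Rightarrow> nat \<Rightarrow> ('o, 'm) sdiagram" where
  "zero_simplex C n = (\<lambda>x\<in>sindices n. zob C, \<lambda>x\<in>sarrows n. idn C (zob C))"

lemma wS_base_cls: "wS_base C = cls (wS C) 0 (zero_simplex C 0) (\<lambda>i. if i = 0 then 1 else 0)"
  by (simp add: wS_base_def cls_def zero_simplex_def)

lemma zero_simplex_op: "\<theta> \<in> monotone_maps m n \<Longrightarrow> wS_op m \<theta> (zero_simplex C n) = zero_simplex C m"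
  using monotone_maps_le[of \<theta> m n] monotone_maps_mono[of \<theta> m n]
  by (auto simp: zero_simplex_def wS_op_def restrict_def fun_eq_iff)

context wcategory
begin

lemma zero_simplex_in: "zero_simplex C n \<in> simp (wS C) n"
proof -
  have "iso_in C (zob C) (zob C) (idn C (zob C))"
    unfolding iso_in_def using idn_hm cmp_idl zob_obj by blast
  then have "(fst (zero_simplex C n), snd (zero_simplex C n)) \<in> wS_simp C n"
    unfolding zero_simplex_def fst_conv snd_conv
  proof (intro wS_simpI, goal_cases)
    case (6 x y z)
    then have "(x, z) \<in> sarrows n" "x \<in> sindices n" "y \<in> sindices n" "z \<in> sindices n"
      using sarrows_trans sarrows_sindices by blast+
    then show ?case using 6 idn_hm cmp_idl zob_obj by simp
  next
    case (4 x y)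
    then show ?case using idn_hm zob_obj sarrows_sindices by auto
  next
    case (5 x)
    then show ?case using sarrows_refl by auto
  qed (use zob_obj ses_zob in auto)
  then show ?thesis by (simp add: wS_def)
qed

text \<open>The zero diagram is a degeneracy of the base vertex, pulled back along the only map to
  dimension 0, and any point pushed along this map is the vertex. So all these cells collapse to the
  base point.\<close>

lemma zero_simplex_cls:
  assumes "t \<in> standard_simplex n"
  shows "cls (wS C) n (zero_simplex C n) t = wS_base C"
proof -
  interpret simplicial "wS C" by (rule simplicial_wS)
  have z: "(\<lambda>_. 0) \<in> monotone_maps n 0" by (simp add: monotone_mapsI)
  have "cls (wS C) n (sop (wS C) n 0 (\<lambda>_. 0) (zero_simplex C 0)) t = cls (wS C) 0 (zero_simplex C 0) (simplex_push n (\<lambda>_. 0) t)"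
    by (rule cls_glue[OF z zero_simplex_in assms])
  then show ?thesis
    by (simp add: wS_def zero_simplex_op[OF z, simplified] wS_base_cls simplex_push_const[OF assms])
qed

lemma wS_base_in: "wS_base C \<in> topspace (realization (wS C))"
  unfolding wS_base_cls using simplicial.cls_in[OF simplicial_wS zero_simplex_in] by simp

end

text \<open>Exactness is joint: a pair of short exact sequences goes to a short exact sequence. This
  is the behaviour of a direct sum, not of a tensor product that is exact in each variable, and it
  makes the functor act on diagrams index by index.\<close>

locale exact_bifunctor =
  fixes C1 :: "('o1, 'm1) wcat" and C2 :: "('o2, 'm2) wcat" and D :: "('o, 'm) wcat"
    and Po :: "'o1 \<Rightarrow> 'o2 \<Rightarrow> 'o" and Pm :: "'o1 \<Rightarrow> 'o1 \<Rightarrow> 'o2 \<Rightarrow> 'o2 \<Rightarrow> 'm1 \<Rightarrow> 'm2 \<Rightarrow> 'm"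
  assumes Po_obj: "M \<in> obj C1 \<Longrightarrow> M' \<in> obj C2 \<Longrightarrow> Po M M' \<in> obj D"
    and Pm_hm: "M \<in> obj C1 \<Longrightarrow> N \<in> obj C1 \<Longrightarrow> M' \<in> obj C2 \<Longrightarrow> N' \<in> obj C2 \<Longrightarrow> f \<in> hm C1 M N \<Longrightarrow> f' \<in> hm C2 M' N'
      \<Longrightarrow> Pm M N M' N' f f' \<in> hm D (Po M M') (Po N N')"
    and Pm_cmp: "L \<in> obj C1 \<Longrightarrow> M \<in> obj C1 \<Longrightarrow> N \<in> obj C1 \<Longrightarrow> L' \<in> obj C2 \<Longrightarrow> M' \<in> obj C2 \<Longrightarrow> N' \<in> obj C2
      \<Longrightarrow> f \<in> hm C1 L M \<Longrightarrow> g \<in> hm C1 M N \<Longrightarrow> f' \<in> hm C2 L' M' \<Longrightarrow> g' \<in> hm C2 M' N'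
      \<Longrightarrow> Pm L N L' N' (cmp C1 L M N g f) (cmp C2 L' M' N' g' f')
        = cmp D (Po L L') (Po M M') (Po N N') (Pm M N M' N' g g') (Pm L M L' M' f f')"
    and Pm_idn: "M \<in> obj C1 \<Longrightarrow> M' \<in> obj C2 \<Longrightarrow> Pm M M M' M' (idn C1 M) (idn C2 M') = idn D (Po M M')"
    and Po_zob: "Po (zob C1) (zob C2) = zob D"
    and Pm_ses: "L \<in> obj C1 \<Longrightarrow> M \<in> obj C1 \<Longrightarrow> N \<in> obj C1 \<Longrightarrow> L' \<in> obj C2 \<Longrightarrow> M' \<in> obj C2 \<Longrightarrow> N' \<in> obj C2
      \<Longrightarrow> f \<in> hm C1 L M \<Longrightarrow> g \<in> hm C1 M N \<Longrightarrow> f' \<in> hm C2 L' M' \<Longrightarrow> g' \<in> hm C2 M' N'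
      \<Longrightarrow> ses C1 L M N f g \<Longrightarrow> ses C2 L' M' N' f' g'
      \<Longrightarrow> ses D (Po L L') (Po M M') (Po N N') (Pm L M L' M' f f') (Pm M N M' N' g g')"
begin

lemma Pm_iso:
  assumes "M \<in> obj C1" "N \<in> obj C1" "M' \<in> obj C2" "N' \<in> obj C2" "iso_in C1 M N f" "iso_in C2 M' N' f'"
  shows "iso_in D (Po M M') (Po N N') (Pm M N M' N' f f')"
proof -
  obtain g where g: "f \<in> hm C1 M N" "g \<in> hm C1 N M" "cmp C1 M N M g f = idn C1 M" "cmp C1 N M N f g = idn C1 N"
    using assms(5) unfolding iso_in_def by blast
  obtain g' where g': "f' \<in> hm C2 M' N'" "g' \<in> hm C2 N' M'" "cmp C2 M' N' M' g' f' = idn C2 M'" "cmp C2 N' M' N' f' g' = idn C2 N'"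
    using assms(6) unfolding iso_in_def by blast
  show ?thesis unfolding iso_in_def
    using Pm_hm[OF assms(1-4) g(1) g'(1)] Pm_hm[OF assms(2,1,4,3) g(2) g'(2)]
      Pm_cmp[OF assms(1,2,1,3,4,3) g(1,2) g'(1,2)] Pm_cmp[OF assms(2,1,2,4,3,4) g(2,1) g'(2,1)]
      Pm_idn[OF assms(1,3)] Pm_idn[OF assms(2,4)] g g'
    by (intro conjI bexI[of _ "Pm N M N' M' g g'"]) simp_all
qed

definition wS_bimap :: "nat \<Rightarrow> ('o1, 'm1) sdiagram \<Rightarrow> ('o2, 'm2) sdiagram \<Rightarrow> ('o, 'm) sdiagram" where
  "wS_bimap n s s' = (\<lambda>x\<in>sindices n. Po (fst s x) (fst s' x),
     \<lambda>z\<in>sarrows n. Pm (fst s (fst z)) (fst s (snd z)) (fst s' (fst z)) (fst s' (snd z)) (snd s z) (snd s' z))"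

lemma pairing_wS: "pairing (wS C1) (wS C2) (wS D) wS_bimap"
proof (intro pairing.intro simplicial_wS pairing_axioms.intro)
  fix s n s' assume "s \<in> simp (wS C1) n" "s' \<in> simp (wS C2) n"
  then obtain A a B b where s: "s = (A, a)" "(A, a) \<in> wS_simp C1 n" and s': "s' = (B, b)" "(B, b) \<in> wS_simp C2 n"
    by (cases s, cases s') (auto simp: wS_def)
  note DA = wS_simpD[OF s(2)] note DB = wS_simpD[OF s'(2)]
  have "(fst (wS_bimap n s s'), snd (wS_bimap n s s')) \<in> wS_simp D n"
    unfolding wS_bimap_def s s' fst_conv snd_conv
  proof (rule wS_simpI, goal_cases)
    case (4 x y)
    then have "x \<in> sindices n" "y \<in> sindices n" using sarrows_sindices by blast+
    then show ?case using 4 DA DB by (simp add: Pm_hm)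
  next
    case (5 x)
    then show ?case using DA DB sarrows_refl[OF 5] by (simp add: Pm_idn)
  next
    case (6 x y z)
    then have "(x, z) \<in> sarrows n" "x \<in> sindices n" "y \<in> sindices n" "z \<in> sindices n"
      using sarrows_trans sarrows_sindices by blast+
    then show ?case using 6 DA(1,4) DB(1,4) by (simp add: DA(6)[OF 6] DB(6)[OF 6] Pm_cmp)
  next
    case (9 p i j k)
    then show ?case using DA DB by (simp add: Pm_ses)
  qed (use DA DB Po_zob in \<open>auto intro!: Po_obj Pm_iso\<close>)
  then show "wS_bimap n s s' \<in> simp (wS D) n" by (simp add: wS_def)
next
  fix \<theta> m n s s' assume \<theta>: "\<theta> \<in> monotone_maps m n"
  show "sop (wS D) m n \<theta> (wS_bimap n s s') = wS_bimap m (sop (wS C1) m n \<theta> s) (sop (wS C2) m n \<theta> s')"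
    by (cases s, cases s') (use monotone_maps_le[OF \<theta>] monotone_maps_mono[OF \<theta>] in
      \<open>auto simp: wS_def wS_op_def wS_bimap_def restrict_def fun_eq_iff sarrows_def\<close>)
qed

end

locale exact_functor = C: wcategory C + D: wcategory D
  for C :: "('o1, 'm1) wcat" and D :: "('o, 'm) wcat" +
  fixes Fo :: "'o1 \<Rightarrow> 'o" and Fm :: "'o1 \<Rightarrow> 'o1 \<Rightarrow> 'm1 \<Rightarrow> 'm"
  assumes Fo_obj: "M \<in> obj C \<Longrightarrow> Fo M \<in> obj D"
    and Fm_hm: "M \<in> obj C \<Longrightarrow> N \<in> obj C \<Longrightarrow> f \<in> hm C M N \<Longrightarrow> Fm M N f \<in> hm D (Fo M) (Fo N)"
    and Fm_cmp: "L \<in> obj C \<Longrightarrow> M \<in> obj C \<Longrightarrow> N \<in> obj C \<Longrightarrow> f \<in> hm C L M \<Longrightarrow> g \<in> hm C M N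
      \<Longrightarrow> Fm L N (cmp C L M N g f) = cmp D (Fo L) (Fo M) (Fo N) (Fm M N g) (Fm L M f)"
    and Fm_idn: "M \<in> obj C \<Longrightarrow> Fm M M (idn C M) = idn D (Fo M)"
    and Fo_zob: "Fo (zob C) = zob D"
    and Fm_ses: "L \<in> obj C \<Longrightarrow> M \<in> obj C \<Longrightarrow> N \<in> obj C \<Longrightarrow> f \<in> hm C L M \<Longrightarrow> g \<in> hm C M N
      \<Longrightarrow> ses C L M N f g \<Longrightarrow> ses D (Fo L) (Fo M) (Fo N) (Fm L M f) (Fm M N g)"
begin

text \<open>A functor is a bifunctor that ignores its second argument. In this way
  \<open>pairing_wS\<close> yields that \<open>wS_map\<close> is simplicial.\<close>

sublocale bi: exact_bifunctor C C D "\<lambda>M _. Fo M" "\<lambda>M N _ _ f _. Fm M N f"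
  by unfold_locales (simp_all add: Fo_obj Fm_hm Fm_cmp Fm_idn Fo_zob Fm_ses)

lemma wS_map_alt:
  "wS_map Fo Fm n s = (\<lambda>x\<in>sindices n. Fo (fst s x), \<lambda>z\<in>sarrows n. Fm (fst s (fst z)) (fst s (snd z)) (snd s z))"
  by (auto simp: wS_map_def restrict_def fun_eq_iff split: prod.splits)

lemma wS_map_bimap: "wS_map Fo Fm n s = bi.wS_bimap n s s"
  by (simp add: wS_map_alt bi.wS_bimap_def)

sublocale wS: simplicial_map "wS C" "wS D" "wS_map Fo Fm"
proof (intro simplicial_map.intro simplicial_wS simplicial_map_axioms.intro)
  interpret pairing "wS C" "wS C" "wS D" bi.wS_bimap by (rule bi.pairing_wS)
  show "s \<in> simp (wS C) n \<Longrightarrow> wS_map Fo Fm n s \<in> simp (wS D) n" for s n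
    unfolding wS_map_bimap by (rule Phi_in)
  show "\<theta> \<in> monotone_maps m n \<Longrightarrow> s \<in> simp (wS C) n
      \<Longrightarrow> sop (wS D) m n \<theta> (wS_map Fo Fm n s) = wS_map Fo Fm m (sop (wS C) m n \<theta> s)" for \<theta> m n s
    unfolding wS_map_bimap by (rule Phi_sop)
qed

abbreviation rmap :: "('o1, 'm1) sdiagram cell_pt set \<Rightarrow> ('o, 'm) sdiagram cell_pt set" where
  "rmap \<equiv> realization_map (wS D) (wS_map Fo Fm)"

lemma wS_map_zero_simplex: "wS_map Fo Fm n (zero_simplex C n) = zero_simplex D n"
proof -
  have "\<And>x y. (x, y) \<in> sarrows n \<Longrightarrow> x \<in> sindices n \<and> y \<in> sindices n" using sarrows_sindices by blast
  then show ?thesis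
    using Fo_zob Fm_idn[OF C.zob_obj] by (auto simp: wS_map_alt zero_simplex_def restrict_def fun_eq_iff)
qed

lemma rmap_base: "rmap (wS_base C) = wS_base D"
  unfolding wS_base_cls by (simp add: wS.realization_map_cls C.zero_simplex_in wS_map_zero_simplex)

lemma rmap_loop: "f \<in> cube_loops n (realization (wS C)) (wS_base C)
    \<Longrightarrow> rmap \<circ> f \<in> cube_loops n (realization (wS D)) (wS_base D)"
  by (rule cube_compose(1)[OF wS.continuous_map_realization_map rmap_base])

lemma K_map_hcl:
  assumes "f \<in> cube_loops (Suc n) (realization (wS C)) (wS_base C)"
  shows "K_map D Fo Fm n (hcl (Suc n) (realization (wS C)) (wS_base C) f)
    = hcl (Suc n) (realization (wS D)) (wS_base D) (rmap \<circ> f)"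
  unfolding K_map_def
  by (rule homotopy_group_map_hcl[OF cube_compose(1,2)[OF wS.continuous_map_realization_map rmap_base] assms])

end

lemma (in wcategory) K_group_carrier:
  "carrier (K_group C n) = hcl (Suc n) (realization (wS C)) (wS_base C) ` cube_loops (Suc n) (realization (wS C)) (wS_base C)"
  unfolding K_group_def by (rule homotopy_group_carrier) simp

lemma (in wcategory) K_group_group: "group (K_group C n)"
  unfolding K_group_def by (rule homotopy_group_group[OF _ wS_base_in]) simp

lemma (in wcategory) exact_functor_id: "exact_functor C C (\<lambda>M. M) (\<lambda>_ _ f. f)"
  by (intro exact_functor.intro exact_functor_axioms.intro wcategory_axioms refl)

lemma (in wcategory) K_map_id:
  assumes "y \<in> carrier (K_group C n)"
  shows "K_map C (\<lambda>M. M) (\<lambda>_ _ f. f) n y = y"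
proof -
  interpret I: exact_functor C C "\<lambda>M. M" "\<lambda>_ _ f. f" by (rule exact_functor_id)
  obtain f where f: "f \<in> cube_loops (Suc n) (realization (wS C)) (wS_base C)"
    "y = hcl (Suc n) (realization (wS C)) (wS_base C) f"
    using assms unfolding K_group_carrier by blast
  have id: "I.rmap c = c" if c_in: "c \<in> topspace (realization (wS C))" for c
  proof -
    obtain m s t where c: "s \<in> simp (wS C) m" "c = cls (wS C) m s t"
      using c_in unfolding simplicial.topspace_realization[OF simplicial_wS] by blast
    have "wS_map (\<lambda>M. M) (\<lambda>_ _ f. f) m s = s"
      using c(1) by (cases s) (auto simp: I.wS_map_alt wS_def wS_simp_def PiE_iff extensional_restrict)
    then show ?thesis using c by (simp add: I.wS.realization_map_cls)
  qed
  have "(f, I.rmap \<circ> f) \<in> cube_homotopic (Suc n) (realization (wS C)) (wS_base C)"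
    by (rule cube_homotopic_eq[OF f(1)]) (simp add: id cube_loops_in[OF f(1)])
  from hcl_eqI[OF this] show ?thesis using I.K_map_hcl[OF f(1)] f(2) by simp
qed

text \<open>The nerve of the contractible groupoid on the two objects \<open>False\<close> and \<open>True\<close>: a natural
  isomorphism of two functors is a functor on the product with this groupoid.\<close>

definition bool_sset :: "(nat \<Rightarrow> bool) sset" where
  "bool_sset = \<lparr>simp = (\<lambda>n. extensional {..n}), sop = (\<lambda>m n \<theta> e. \<lambda>i\<in>{..m}. e (\<theta> i))\<rparr>"

lemma simplicial_bool_sset: "simplicial bool_sset"
  by unfold_locales (auto simp: bool_sset_def fun_eq_iff monotone_maps_le extensional_def)

section \<open>Naturally isomorphic functors induce homotopic maps\<close>

locale natural_iso = F: exact_functor C D Fo Fm + G: exact_functor C D Go Gm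
  for C :: "('o1, 'm1) wcat" and D :: "('o, 'm) wcat" and Fo Fm Go Gm +
  fixes \<phi> :: "'o1 \<Rightarrow> 'm"
  assumes phi_iso: "M \<in> obj C \<Longrightarrow> iso_in D (Fo M) (Go M) (\<phi> M)"
    and phi_nat: "M \<in> obj C \<Longrightarrow> N \<in> obj C \<Longrightarrow> f \<in> hm C M N
      \<Longrightarrow> cmp D (Fo M) (Fo N) (Go N) (\<phi> N) (Fm M N f) = cmp D (Fo M) (Go M) (Go N) (Gm M N f) (\<phi> M)"
    and phi_zob: "\<phi> (zob C) = idn D (zob D)"
begin

definition inv_phi :: "'o1 \<Rightarrow> 'm" where
  "inv_phi M = (SOME \<psi>. \<psi> \<in> hm D (Go M) (Fo M) \<and> cmp D (Fo M) (Go M) (Fo M) \<psi> (\<phi> M) = idn D (Fo M)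
     \<and> cmp D (Go M) (Fo M) (Go M) (\<phi> M) \<psi> = idn D (Go M))"

lemma phi_hm: "M \<in> obj C \<Longrightarrow> \<phi> M \<in> hm D (Fo M) (Go M)"
  using phi_iso unfolding iso_in_def by blast

lemma inv_phi:
  assumes "M \<in> obj C"
  shows "inv_phi M \<in> hm D (Go M) (Fo M)" "cmp D (Fo M) (Go M) (Fo M) (inv_phi M) (\<phi> M) = idn D (Fo M)"
    "cmp D (Go M) (Fo M) (Go M) (\<phi> M) (inv_phi M) = idn D (Go M)"
proof -
  have "\<exists>\<psi>. \<psi> \<in> hm D (Go M) (Fo M) \<and> cmp D (Fo M) (Go M) (Fo M) \<psi> (\<phi> M) = idn D (Fo M)
     \<and> cmp D (Go M) (Fo M) (Go M) (\<phi> M) \<psi> = idn D (Go M)"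
    using phi_iso[OF assms] unfolding iso_in_def by blast
  from someI_ex[OF this, folded inv_phi_def]
  show "inv_phi M \<in> hm D (Go M) (Fo M)" "cmp D (Fo M) (Go M) (Fo M) (inv_phi M) (\<phi> M) = idn D (Fo M)"
    "cmp D (Go M) (Fo M) (Go M) (\<phi> M) (inv_phi M) = idn D (Go M)" by blast+
qed

lemma inv_phi_nat:
  assumes M: "M \<in> obj C" and N: "N \<in> obj C" and f: "f \<in> hm C M N"
  shows "cmp D (Go M) (Go N) (Fo N) (inv_phi N) (Gm M N f) = cmp D (Go M) (Fo M) (Fo N) (Fm M N f) (inv_phi M)"
proof -
  note obs = F.Fo_obj[OF M] F.Fo_obj[OF N] G.Fo_obj[OF M] G.Fo_obj[OF N]
  note hms = phi_hm[OF M] phi_hm[OF N] inv_phi(1)[OF M] inv_phi(1)[OF N] F.Fm_hm[OF M N f] G.Fm_hm[OF M N f]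
  have "cmp D (Go M) (Go N) (Fo N) (inv_phi N) (Gm M N f)
      = cmp D (Go M) (Go N) (Fo N) (inv_phi N) (cmp D (Go M) (Go M) (Go N) (Gm M N f) (cmp D (Go M) (Fo M) (Go M) (\<phi> M) (inv_phi M)))"
    using obs hms by (simp add: inv_phi(3)[OF M] F.D.cmp_idr)
  also have "\<dots> = cmp D (Go M) (Go N) (Fo N) (inv_phi N) (cmp D (Go M) (Fo M) (Go N) (cmp D (Fo M) (Go M) (Go N) (Gm M N f) (\<phi> M)) (inv_phi M))"
    using obs hms by (simp add: F.D.cmp_assoc)
  also have "\<dots> = cmp D (Go M) (Go N) (Fo N) (inv_phi N) (cmp D (Go M) (Fo M) (Go N) (cmp D (Fo M) (Fo N) (Go N) (\<phi> N) (Fm M N f)) (inv_phi M))"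
    by (simp add: phi_nat[OF M N f])
  also have "\<dots> = cmp D (Go M) (Go N) (Fo N) (inv_phi N) (cmp D (Go M) (Fo N) (Go N) (\<phi> N) (cmp D (Go M) (Fo M) (Fo N) (Fm M N f) (inv_phi M)))"
    using obs hms by (simp add: F.D.cmp_assoc)
  also have "\<dots> = cmp D (Go M) (Fo N) (Fo N) (cmp D (Fo N) (Go N) (Fo N) (inv_phi N) (\<phi> N)) (cmp D (Go M) (Fo M) (Fo N) (Fm M N f) (inv_phi M))"
    using obs hms by (simp add: F.D.cmp_assoc F.D.cmp_hm)
  also have "\<dots> = cmp D (Go M) (Fo M) (Fo N) (Fm M N f) (inv_phi M)"
    using obs hms by (simp add: inv_phi(2)[OF N] F.D.cmp_idl F.D.cmp_hm)
  finally show ?thesis .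
qed

definition Ho :: "bool \<Rightarrow> 'o1 \<Rightarrow> 'o" where "Ho e = (if e then Go else Fo)"
definition Hm :: "bool \<Rightarrow> 'o1 \<Rightarrow> 'o1 \<Rightarrow> 'm1 \<Rightarrow> 'm" where "Hm e = (if e then Gm else Fm)"
text \<open>The image of the unique arrow from \<open>e\<close> to \<open>e'\<close> in the
  contractible groupoid.\<close>

definition \<kappa> :: "bool \<Rightarrow> bool \<Rightarrow> 'o1 \<Rightarrow> 'm" where
  "\<kappa> e e' M = (if e = e' then idn D (Ho e M) else if e then inv_phi M else \<phi> M)"

lemma H_functor: "exact_functor C D (Ho e) (Hm e)"
  using F.exact_functor_axioms G.exact_functor_axioms by (cases e) (simp_all add: Ho_def Hm_def)

lemma kappa_hm: "M \<in> obj C \<Longrightarrow> \<kappa> e e' M \<in> hm D (Ho e M) (Ho e' M)"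
  using phi_hm inv_phi(1) F.D.idn_hm F.Fo_obj G.Fo_obj by (auto simp: \<kappa>_def Ho_def)

lemma kappa_cmp:
  "M \<in> obj C \<Longrightarrow> cmp D (Ho e M) (Ho e' M) (Ho e'' M) (\<kappa> e' e'' M) (\<kappa> e e' M) = \<kappa> e e'' M"
  using phi_hm inv_phi F.D.cmp_idl F.D.cmp_idr F.D.idn_hm F.Fo_obj G.Fo_obj by (auto simp: \<kappa>_def Ho_def)

lemma kappa_nat:
  assumes "M \<in> obj C" "N \<in> obj C" "f \<in> hm C M N"
  shows "cmp D (Ho e M) (Ho e N) (Ho e' N) (\<kappa> e e' N) (Hm e M N f) = cmp D (Ho e M) (Ho e' M) (Ho e' N) (Hm e' M N f) (\<kappa> e e' M)"
  using assms phi_nat inv_phi_nat F.D.cmp_idl F.D.cmp_idr F.Fo_obj G.Fo_obj F.Fm_hm G.Fm_hm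
  by (auto simp: \<kappa>_def Ho_def Hm_def)

text \<open>The value of the functor on the product of \<open>C\<close> with the groupoid, at the
  arrow \<open>f\<close> paired with the arrow from \<open>e\<close> to \<open>e'\<close>.\<close>

definition tw :: "bool \<Rightarrow> bool \<Rightarrow> 'o1 \<Rightarrow> 'o1 \<Rightarrow> 'm1 \<Rightarrow> 'm" where
  "tw e e' M N f = cmp D (Ho e M) (Ho e N) (Ho e' N) (\<kappa> e e' N) (Hm e M N f)"

lemma tw_hm: "M \<in> obj C \<Longrightarrow> N \<in> obj C \<Longrightarrow> f \<in> hm C M N \<Longrightarrow> tw e e' M N f \<in> hm D (Ho e M) (Ho e' N)"
  unfolding tw_def
  using exact_functor.Fo_obj[OF H_functor] exact_functor.Fm_hm[OF H_functor] kappa_hm F.D.cmp_hm by meson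

lemma tw_same: "M \<in> obj C \<Longrightarrow> N \<in> obj C \<Longrightarrow> f \<in> hm C M N \<Longrightarrow> tw e e M N f = Hm e M N f"
  unfolding tw_def \<kappa>_def
  using exact_functor.Fo_obj[OF H_functor] exact_functor.Fm_hm[OF H_functor] F.D.cmp_idl by simp

lemma tw_idn: "M \<in> obj C \<Longrightarrow> tw e e' M M (idn C M) = \<kappa> e e' M"
  unfolding tw_def
  using exact_functor.Fo_obj[OF H_functor] exact_functor.Fm_idn[OF H_functor] kappa_hm F.D.cmp_idr by simp

lemma tw_cmp:
  assumes L: "L \<in> obj C" and M: "M \<in> obj C" and N: "N \<in> obj C" and f: "f \<in> hm C L M" and g: "g \<in> hm C M N"
  shows "tw e e'' L N (cmp C L M N g f) = cmp D (Ho e L) (Ho e' M) (Ho e'' N) (tw e' e'' M N g) (tw e e' L M f)"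
proof -
  note obs = exact_functor.Fo_obj[OF H_functor L] exact_functor.Fo_obj[OF H_functor M] exact_functor.Fo_obj[OF H_functor N]
  note hms = exact_functor.Fm_hm[OF H_functor L M f] exact_functor.Fm_hm[OF H_functor M N g] kappa_hm[OF M] kappa_hm[OF N]
  have "cmp D (Ho e L) (Ho e' M) (Ho e'' N) (tw e' e'' M N g) (tw e e' L M f)
    = cmp D (Ho e L) (Ho e' M) (Ho e'' N) (cmp D (Ho e' M) (Ho e' N) (Ho e'' N) (\<kappa> e' e'' N) (Hm e' M N g))
        (cmp D (Ho e L) (Ho e M) (Ho e' M) (\<kappa> e e' M) (Hm e L M f))"
    by (simp add: tw_def)
  also have "\<dots> = cmp D (Ho e L) (Ho e' N) (Ho e'' N) (\<kappa> e' e'' N)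
      (cmp D (Ho e L) (Ho e' M) (Ho e' N) (Hm e' M N g) (cmp D (Ho e L) (Ho e M) (Ho e' M) (\<kappa> e e' M) (Hm e L M f)))"
    using obs hms by (intro F.D.cmp_assoc F.D.cmp_hm)
  also have "cmp D (Ho e L) (Ho e' M) (Ho e' N) (Hm e' M N g) (cmp D (Ho e L) (Ho e M) (Ho e' M) (\<kappa> e e' M) (Hm e L M f))
      = cmp D (Ho e L) (Ho e M) (Ho e' N) (cmp D (Ho e M) (Ho e' M) (Ho e' N) (Hm e' M N g) (\<kappa> e e' M)) (Hm e L M f)"
    using obs hms by (intro F.D.cmp_assoc[symmetric])
  also have "\<dots> = cmp D (Ho e L) (Ho e M) (Ho e' N) (cmp D (Ho e M) (Ho e N) (Ho e' N) (\<kappa> e e' N) (Hm e M N g)) (Hm e L M f)"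
    by (simp add: kappa_nat[OF M N g])
  also have "\<dots> = cmp D (Ho e L) (Ho e N) (Ho e' N) (\<kappa> e e' N) (cmp D (Ho e L) (Ho e M) (Ho e N) (Hm e M N g) (Hm e L M f))"
    using obs hms by (intro F.D.cmp_assoc)
  also have "cmp D (Ho e L) (Ho e M) (Ho e N) (Hm e M N g) (Hm e L M f) = Hm e L N (cmp C L M N g f)"
    using exact_functor.Fm_cmp[OF H_functor L M N f g] by simp
  also have "cmp D (Ho e L) (Ho e' N) (Ho e'' N) (\<kappa> e' e'' N) (cmp D (Ho e L) (Ho e N) (Ho e' N) (\<kappa> e e' N) (Hm e L N (cmp C L M N g f)))
     = cmp D (Ho e L) (Ho e N) (Ho e'' N) (cmp D (Ho e N) (Ho e' N) (Ho e'' N) (\<kappa> e' e'' N) (\<kappa> e e' N)) (Hm e L N (cmp C L M N g f))"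
    using obs hms exact_functor.Fm_hm[OF H_functor L N F.C.cmp_hm[OF L M N f g]] by (intro F.D.cmp_assoc[symmetric])
  also have "\<dots> = tw e e'' L N (cmp C L M N g f)"
    by (simp add: kappa_cmp[OF N] tw_def)
  finally show ?thesis by simp
qed

text \<open>The colour \<epsilon> is evaluated at the chain position only. So only arrows that move
  along the chain are twisted, whereas the diagram at a fixed position is transported by a single
  functor and stays exact.\<close>

definition \<Phi> :: "nat \<Rightarrow> ('o1, 'm1) sdiagram \<Rightarrow> (nat \<Rightarrow> bool) \<Rightarrow> ('o, 'm) sdiagram" where
  "\<Phi> n s \<epsilon> = (\<lambda>x\<in>sindices n. Ho (\<epsilon> (fst x)) (fst s x),
     \<lambda>z\<in>sarrows n. tw (\<epsilon> (fst (fst z))) (\<epsilon> (fst (snd z))) (fst s (fst z)) (fst s (snd z)) (snd s z))"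

lemma pairing_natural_iso: "pairing (wS C) bool_sset (wS D) \<Phi>"
proof (intro pairing.intro simplicial_wS simplicial_bool_sset pairing_axioms.intro)
  fix s n \<epsilon> assume "s \<in> simp (wS C) n"
  then obtain A a where s: "s = (A, a)" "(A, a) \<in> wS_simp C n" by (cases s) (auto simp: wS_def)
  note DA = wS_simpD[OF s(2)]
  have "(fst (\<Phi> n s \<epsilon>), snd (\<Phi> n s \<epsilon>)) \<in> wS_simp D n"
    unfolding \<Phi>_def s fst_conv snd_conv
  proof (rule wS_simpI, goal_cases)
    case (1 x)
    then show ?case using DA exact_functor.Fo_obj[OF H_functor] by simp
  next
    case (4 x y)
    then have "x \<in> sindices n" "y \<in> sindices n" using sarrows_sindices by blast+
    then show ?case using 4 DA by (simp add: tw_hm)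
  next
    case (5 x)
    then show ?case using DA sarrows_refl[OF 5] by (simp add: tw_idn \<kappa>_def)
  next
    case (6 x y z)
    then have "(x, z) \<in> sarrows n" "x \<in> sindices n" "y \<in> sindices n" "z \<in> sindices n"
      using sarrows_trans sarrows_sindices by blast+
    then show ?case using 6 DA(1,4) by (simp add: DA(6)[OF 6] tw_cmp[of _ "A y"])
  next
    case (7 p q i j)
    let ?x = "(p, i, j)" and ?y = "(q, i, j)"
    have xy: "?x \<in> sindices n" "?y \<in> sindices n" "(?x, ?y) \<in> sarrows n" using 7 by auto
    obtain g where g: "a (?x, ?y) \<in> hm C (A ?x) (A ?y)" "g \<in> hm C (A ?y) (A ?x)"
      "cmp C (A ?x) (A ?y) (A ?x) g (a (?x, ?y)) = idn C (A ?x)" "cmp C (A ?y) (A ?x) (A ?y) (a (?x, ?y)) g = idn C (A ?y)"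
      using DA(7)[OF 7] unfolding iso_in_def by blast
    let ?e = "\<epsilon> p" and ?e' = "\<epsilon> q"
    \<comment> \<open>The inverse is the oppositely twisted inverse; both composites are twists of
      identities with equal colours at the two ends.\<close>
    have "iso_in D (Ho ?e (A ?x)) (Ho ?e' (A ?y)) (tw ?e ?e' (A ?x) (A ?y) (a (?x, ?y)))"
      unfolding iso_in_def
      using tw_cmp[OF DA(1)[OF xy(1)] DA(1)[OF xy(2)] DA(1)[OF xy(1)] g(1,2), of ?e ?e ?e']
        tw_cmp[OF DA(1)[OF xy(2)] DA(1)[OF xy(1)] DA(1)[OF xy(2)] g(2,1), of ?e' ?e' ?e] g
        tw_hm[OF DA(1)[OF xy(1)] DA(1)[OF xy(2)] g(1)] tw_hm[OF DA(1)[OF xy(2)] DA(1)[OF xy(1)] g(2)]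
        tw_idn DA(1)[OF xy(1)] DA(1)[OF xy(2)]
      by (intro conjI bexI[of _ "tw ?e' ?e (A ?y) (A ?x) g"]) (simp_all add: \<kappa>_def)
    then show ?case using 7 by simp
  next
    case (8 p i)
    then show ?case using DA F.Fo_zob G.Fo_zob by (simp add: Ho_def)
  next
    case (9 p i j k)
    have "(p, i, j) \<in> sindices n" "(p, i, k) \<in> sindices n" "(p, j, k) \<in> sindices n"
      "((p, i, j), (p, i, k)) \<in> sarrows n" "((p, i, k), (p, j, k)) \<in> sarrows n" using 9 by auto
    then show ?case using DA(1,4) DA(9)[OF 9]
      by (simp add: tw_same exact_functor.Fm_ses[OF H_functor])
  qed auto
  then show "\<Phi> n s \<epsilon> \<in> simp (wS D) n" by (simp add: wS_def)
next
  fix \<theta> m n s \<epsilon> assume \<theta>: "\<theta> \<in> monotone_maps m n"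
  show "sop (wS D) m n \<theta> (\<Phi> n s \<epsilon>) = \<Phi> m (sop (wS C) m n \<theta> s) (sop bool_sset m n \<theta> \<epsilon>)"
    by (cases s) (use monotone_maps_le[OF \<theta>] monotone_maps_mono[OF \<theta>] in
      \<open>auto simp: wS_def wS_op_def bool_sset_def \<Phi>_def restrict_def fun_eq_iff sarrows_def\<close>)
qed

lemma Phi_const:
  assumes "s \<in> simp (wS C) n"
  shows "\<Phi> n s (\<lambda>i\<in>{..n}. e) = wS_map (Ho e) (Hm e) n s"
proof -
  obtain A a where s: "s = (A, a)" "(A, a) \<in> wS_simp C n" using assms by (cases s) (auto simp: wS_def)
  interpret H: exact_functor C D "Ho e" "Hm e" by (rule H_functor)
  have "tw e e (A x) (A y) (a (x, y)) = Hm e (A x) (A y) (a (x, y))" if "(x, y) \<in> sarrows n" for x y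
    using wS_simpD[OF s(2)] sarrows_sindices[OF that] that by (simp add: tw_same)
  then show ?thesis
    by (auto simp: s \<Phi>_def H.wS_map_alt restrict_def fun_eq_iff sarrows_def sindices_def)
qed

text \<open>The edge \<epsilon> from \<open>False\<close> to \<open>True\<close> gives a path
  \<open>d\<close> in the realization of the groupoid. Pairing a loop with this path is a homotopy
  between its images under the two functors.\<close>

theorem K_map_natural_iso:
  assumes "y \<in> carrier (K_group C n)"
  shows "K_map D Fo Fm n y = K_map D Go Gm n y"
proof -
  interpret pairing "wS C" bool_sset "wS D" \<Phi> by (rule pairing_natural_iso)
  let ?X = "realization (wS C)" and ?Y = "realization (wS D)"
  obtain f where f: "f \<in> cube_loops (Suc n) ?X (wS_base C)" "y = hcl (Suc n) ?X (wS_base C) f"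
    using assms unfolding F.C.K_group_carrier by blast
  define \<epsilon> where "\<epsilon> = (\<lambda>i\<in>{..1::nat}. i = 1)"
  define \<gamma> :: "real \<Rightarrow> nat \<Rightarrow> real" where "\<gamma> u = (\<lambda>i. if i = 0 then 1 - u else if i = 1 then u else 0)" for u
  have eps: "\<epsilon> \<in> simp bool_sset 1" by (simp add: bool_sset_def \<epsilon>_def)
  have gam: "continuous_map (top_of_set {0..1}) (simplex_top 1) \<gamma>"
  proof -
    have "continuous_on {0..1} (\<lambda>u. \<gamma> u i)" for i
      by (cases "i = 0"; cases "i = 1") (auto simp: \<gamma>_def intro!: continuous_intros)
    then show ?thesis
      unfolding continuous_map_in_subtopology continuous_map_componentwise_UNIV
      by (intro conjI allI) (simp, auto simp: \<gamma>_def standard_simplex_def)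
  qed
  define d where "d u = cls bool_sset 1 \<epsilon> (\<gamma> u)" for u
  have d: "continuous_map (top_of_set {0..1}) (realization bool_sset) d"
  proof -
    have "d = cls bool_sset 1 \<epsilon> \<circ> \<gamma>" by (simp add: fun_eq_iff d_def)
    then show ?thesis using continuous_map_compose[OF gam Z.continuous_map_cls[OF eps]] by simp
  qed
  have end_pt: "mu c (d (if e then 1 else 0)) = realization_map (wS D) (wS_map (Ho e) (Hm e)) c"
    if c_in: "c \<in> topspace ?X" for c e
  proof -
    interpret H: exact_functor C D "Ho e" "Hm e" by (rule H_functor)
    obtain m s t where c: "s \<in> simp (wS C) m" "t \<in> standard_simplex m" "c = cls (wS C) m s t"
      using F.wS.X.cls_cases[OF c_in] .
    let ?v = "if e then 1 else 0 :: nat"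
    \<comment> \<open>The end of the path is a vertex of the edge, so \<open>t\<close> itself is a
      coupling: the identity on one side, the constant map to this vertex on the other.\<close>
    have "coupling m 1 t (\<gamma> (if e then 1 else 0)) m id (\<lambda>_. ?v) t"
      using c by (auto simp: coupling_def id_monotone_maps simplex_push_id simplex_push_const \<gamma>_def fun_eq_iff intro!: monotone_mapsI)
    from mu_eq[OF c(1) eps this]
    have "mu c (d (if e then 1 else 0)) = cls (wS D) m (\<Phi> m s (\<lambda>i\<in>{..m}. e)) t"
      using c by (cases e) (simp_all add: d_def bool_sset_def F.wS.X.sop_id \<epsilon>_def)
    then show ?thesis using c by (simp add: Phi_const H.wS.realization_map_cls)
  qed
  \<comment> \<open>This is the role of \<open>phi_zob\<close>: at the zero object all twists are
    identities, so the homotopy keeps the base point fixed.\<close>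
  have base: "mu (wS_base C) (d u) = wS_base D" if "u \<in> {0..1}" for u
  proof -
    have gu: "\<gamma> u \<in> standard_simplex 1"
      using gam that by (auto simp: continuous_map_in_subtopology)
    have "coupling 0 1 (\<lambda>i. if i = 0 then 1 else 0) (\<gamma> u) 1 (\<lambda>_. 0) id (\<gamma> u)"
      using gu by (auto simp: coupling_def id_monotone_maps simplex_push_id simplex_push_const intro!: monotone_mapsI)
    from mu_eq[OF F.C.zero_simplex_in eps this]
    have "mu (wS_base C) (d u) = cls (wS D) 1 (\<Phi> 1 (zero_simplex C 1) \<epsilon>) (\<gamma> u)"
      using zero_simplex_op[of "\<lambda>_. 0" 1 0 C] eps by (simp add: d_def wS_base_cls wS_def Z.sop_id monotone_mapsI)
    moreover have "tw e e' (zob C) (zob C) (idn C (zob C)) = idn D (zob D)" for e e'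
    proof -
      have "cmp D (zob D) (zob D) (zob D) (inv_phi (zob C)) (idn D (zob D)) = idn D (zob D)"
        using inv_phi(2)[OF F.C.zob_obj] by (simp add: F.Fo_zob G.Fo_zob phi_zob)
      moreover have "inv_phi (zob C) \<in> hm D (zob D) (zob D)"
        using inv_phi(1)[OF F.C.zob_obj] by (simp add: F.Fo_zob G.Fo_zob)
      ultimately have "inv_phi (zob C) = idn D (zob D)"
        using F.D.cmp_idr F.D.zob_obj by simp
      then show ?thesis by (simp add: tw_idn F.C.zob_obj \<kappa>_def Ho_def F.Fo_zob G.Fo_zob phi_zob)
    qed
    then have "\<Phi> 1 (zero_simplex C 1) \<epsilon> = zero_simplex D 1"
      by (auto simp: \<Phi>_def zero_simplex_def restrict_def fun_eq_iff Ho_def F.Fo_zob G.Fo_zob sarrows_def sindices_def)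
    ultimately show ?thesis by (simp only: F.D.zero_simplex_cls[OF gu])
  qed
  have "(F.rmap \<circ> f, G.rmap \<circ> f) \<in> cube_homotopic (Suc n) ?Y (wS_base D)"
  proof (rule cube_homotopicI)
    have 1: "continuous_map (prod_topology (cube_top (Suc n)) (top_of_set {0..1})) ?Y (\<lambda>(x, u). mu (f x) (d u))"
      by (rule continuous_map_mu_pair[OF compact_cube_top Hausdorff_cube_top cube_loops_continuous[OF _ f(1)] d]) simp
    have 2: "continuous_map (prod_topology (top_of_set {0..1::real}) (cube_top (Suc n)))
        (prod_topology (cube_top (Suc n)) (top_of_set {0..1})) (\<lambda>(u, x). (x, u))"
      by (simp add: case_prod_unfold continuous_map_paired continuous_map_fst continuous_map_snd)
    show "continuous_map (prod_topology (top_of_set {0..1::real}) (cube_top (Suc n))) ?Y (\<lambda>(u, x). mu (f x) (d u))"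
      using continuous_map_compose[OF 2 1] by (simp add: o_def case_prod_unfold)
    show "(case (0, x) of (u, x) \<Rightarrow> mu (f x) (d u)) = (F.rmap \<circ> f) x" if "x \<in> topspace (cube_top (Suc n))" for x
      using end_pt[OF cube_loops_in[OF f(1) that], of False] by (simp add: Ho_def Hm_def)
    show "(case (1, x) of (u, x) \<Rightarrow> mu (f x) (d u)) = (G.rmap \<circ> f) x" if "x \<in> topspace (cube_top (Suc n))" for x
      using end_pt[OF cube_loops_in[OF f(1) that], of True] by (simp add: Ho_def Hm_def)
    show "(case (u, x) of (u, x) \<Rightarrow> mu (f x) (d u)) = wS_base D" if "u \<in> {0..1}" "x \<in> cube_boundary (Suc n)" for u x
      using base that cube_loops_boundary[OF _ f(1)] by simp
  qed
  from hcl_eqI[OF this] show ?thesis using F.K_map_hcl[OF f(1)] G.K_map_hcl[OF f(1)] f(2) by simp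
qed

end

section \<open>Direct sums compute the group law\<close>

locale direct_sum_category = wcategory C + exact_bifunctor C C C Do Dm
  for C :: "('o, 'm) wcat" and Do Dm +
  fixes lunit runit :: "'o \<Rightarrow> 'm"
  assumes right_unit: "natural_iso C C (\<lambda>M. Do M (zob C)) (\<lambda>M N f. Dm M N (zob C) (zob C) f (idn C (zob C)))
      (\<lambda>M. M) (\<lambda>_ _ f. f) runit"
    and left_unit: "natural_iso C C (\<lambda>M. Do (zob C) M) (\<lambda>M N f. Dm (zob C) (zob C) M N (idn C (zob C)) f)
      (\<lambda>M. M) (\<lambda>_ _ f. f) lunit"
begin

sublocale sum: pairing "wS C" "wS C" "wS C" wS_bimap
  by (rule pairing_wS)

text \<open>Pairing with the base point amounts to adding the zero object to every entry of a
  diagram. This functor is isomorphic to the identity without being equal to it.\<close>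

lemma mu_base_right:
  assumes "c \<in> topspace (realization (wS C))"
  shows "sum.mu c (wS_base C)
    = realization_map (wS C) (wS_map (\<lambda>M. Do M (zob C)) (\<lambda>M N f. Dm M N (zob C) (zob C) f (idn C (zob C)))) c"
proof -
  interpret natural_iso C C "\<lambda>M. Do M (zob C)" "\<lambda>M N f. Dm M N (zob C) (zob C) f (idn C (zob C))" "\<lambda>M. M" "\<lambda>_ _ f. f" runit
    by (rule right_unit)
  obtain m s t where c: "s \<in> simp (wS C) m" "t \<in> standard_simplex m" "c = cls (wS C) m s t"
    using sum.X.cls_cases[OF assms] .
  have "sum.mu c (wS_base C) = cls (wS C) m (wS_bimap m s (zero_simplex C m)) t"
    using sum.mu_same[OF c(1) zero_simplex_in c(2)] c zero_simplex_cls by simp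
  also have "wS_bimap m s (zero_simplex C m) = wS_map (\<lambda>M. Do M (zob C)) (\<lambda>M N f. Dm M N (zob C) (zob C) f (idn C (zob C))) m s"
    by (auto simp: wS_bimap_def F.wS_map_alt zero_simplex_def restrict_def fun_eq_iff sarrows_def)
  finally show ?thesis using c by (simp add: F.wS.realization_map_cls)
qed

lemma mu_base_left:
  assumes "c \<in> topspace (realization (wS C))"
  shows "sum.mu (wS_base C) c
    = realization_map (wS C) (wS_map (\<lambda>M. Do (zob C) M) (\<lambda>M N f. Dm (zob C) (zob C) M N (idn C (zob C)) f)) c"
proof -
  interpret natural_iso C C "\<lambda>M. Do (zob C) M" "\<lambda>M N f. Dm (zob C) (zob C) M N (idn C (zob C)) f" "\<lambda>M. M" "\<lambda>_ _ f. f" lunit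
    by (rule left_unit)
  obtain m s t where c: "s \<in> simp (wS C) m" "t \<in> standard_simplex m" "c = cls (wS C) m s t"
    using sum.X.cls_cases[OF assms] .
  have "sum.mu (wS_base C) c = cls (wS C) m (wS_bimap m (zero_simplex C m) s) t"
    using sum.mu_same[OF zero_simplex_in c(1,2)] c zero_simplex_cls by simp
  also have "wS_bimap m (zero_simplex C m) s = wS_map (\<lambda>M. Do (zob C) M) (\<lambda>M N f. Dm (zob C) (zob C) M N (idn C (zob C)) f) m s"
    by (auto simp: wS_bimap_def F.wS_map_alt zero_simplex_def restrict_def fun_eq_iff sarrows_def)
  finally show ?thesis using c by (simp add: F.wS.realization_map_cls)
qed

text \<open>Eckmann-Hilton replaces the pointwise sum by the concatenations, in either order, of the
  sums with the base point; the unit isomorphisms turn these two factors into \<open>f\<close> and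
  \<open>g\<close>. Having both orders gives commutativity in every degree.\<close>

lemma K_sum:
  fixes n
  defines "h \<equiv> hcl (Suc n) (realization (wS C)) (wS_base C)"
  assumes f: "f \<in> cube_loops (Suc n) (realization (wS C)) (wS_base C)"
    and g: "g \<in> cube_loops (Suc n) (realization (wS C)) (wS_base C)"
  shows "h (\<lambda>x. sum.mu (f x) (g x)) = h f \<otimes>\<^bsub>K_group C n\<^esub> h g"
    and "h (\<lambda>x. sum.mu (f x) (g x)) = h g \<otimes>\<^bsub>K_group C n\<^esub> h f"
proof -
  let ?X = "realization (wS C)" and ?b = "wS_base C"
  interpret R: natural_iso C C "\<lambda>M. Do M (zob C)" "\<lambda>M N f. Dm M N (zob C) (zob C) f (idn C (zob C))" "\<lambda>M. M" "\<lambda>_ _ f. f" runit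
    by (rule right_unit)
  interpret L: natural_iso C C "\<lambda>M. Do (zob C) M" "\<lambda>M N f. Dm (zob C) (zob C) M N (idn C (zob C)) f" "\<lambda>M. M" "\<lambda>_ _ f. f" lunit
    by (rule left_unit)
  have hf: "h f \<in> carrier (K_group C n)" "h g \<in> carrier (K_group C n)"
    using f g by (auto simp: h_def K_group_carrier)
  have m: "continuous_map (prod_topology (cube_top (Suc n)) (cube_top (Suc n))) ?X (\<lambda>(x, y). sum.mu (f x) (g y))"
    by (rule sum.continuous_map_mu_pair[OF compact_cube_top Hausdorff_cube_top])
      (use f g in \<open>auto simp: cube_loops_def\<close>)
  have base: "sum.mu ?b ?b = ?b"
    using mu_base_right[OF wS_base_in] R.F.rmap_base by simp
  have r: "(R.F.rmap \<circ> f, \<lambda>x. sum.mu (f x) ?b) \<in> cube_homotopic (Suc n) ?X ?b"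
    by (rule cube_homotopic_eq[OF R.F.rmap_loop[OF f]]) (simp add: mu_base_right cube_loops_in[OF f])
  have l: "(L.F.rmap \<circ> g, \<lambda>x. sum.mu ?b (g x)) \<in> cube_homotopic (Suc n) ?X ?b"
    by (rule cube_homotopic_eq[OF L.F.rmap_loop[OF g]]) (simp add: mu_base_left cube_loops_in[OF g])
  have hr: "h (\<lambda>x. sum.mu (f x) ?b) = h f"
    using hcl_eqI[OF r] R.F.K_map_hcl[OF f] R.K_map_natural_iso[OF hf(1)] K_map_id[OF hf(1)] by (simp add: h_def)
  have hl: "h (\<lambda>x. sum.mu ?b (g x)) = h g"
    using hcl_eqI[OF l] L.F.K_map_hcl[OF g] L.K_map_natural_iso[OF hf(2)] K_map_id[OF hf(2)] by (simp add: h_def)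
  note EH = eckmann_hilton[OF _ f g m base]
  show "h (\<lambda>x. sum.mu (f x) (g x)) = h f \<otimes>\<^bsub>K_group C n\<^esub> h g"
    using hcl_eqI[OF EH(1)] homotopy_group_mult[OF _ cube_homotopic_loops(2)[OF r] cube_homotopic_loops(2)[OF l]] hr hl
    by (simp add: h_def K_group_def)
  show "h (\<lambda>x. sum.mu (f x) (g x)) = h g \<otimes>\<^bsub>K_group C n\<^esub> h f"
    using hcl_eqI[OF EH(2)] homotopy_group_mult[OF _ cube_homotopic_loops(2)[OF l] cube_homotopic_loops(2)[OF r]] hr hl
    by (simp add: h_def K_group_def)
qed

lemma K_group_comm_group: "comm_group (K_group C n)"
proof (rule group.group_comm_groupI[OF K_group_group])
  fix x y assume "x \<in> carrier (K_group C n)" "y \<in> carrier (K_group C n)"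
  then obtain f g where f: "f \<in> cube_loops (Suc n) (realization (wS C)) (wS_base C)" "x = hcl (Suc n) (realization (wS C)) (wS_base C) f"
    and g: "g \<in> cube_loops (Suc n) (realization (wS C)) (wS_base C)" "y = hcl (Suc n) (realization (wS C)) (wS_base C) g"
    unfolding K_group_carrier by blast
  show "x \<otimes>\<^bsub>K_group C n\<^esub> y = y \<otimes>\<^bsub>K_group C n\<^esub> x"
    unfolding f(2) g(2) K_sum(1)[OF f(1) g(1), symmetric] by (rule K_sum(2)[OF f(1) g(1)])
qed

text \<open>On a cell, the sum of two functors is the pairing of the two images at the same point of
  the simplex, where \<open>mu_same\<close> applies. The induced loop is thus a pointwise
  sum.\<close>

lemma K_map_sum:
  assumes F: "exact_functor C C Fo Fm" and G: "exact_functor C C Go Gm"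
    and S: "exact_functor C C (\<lambda>M. Do (Fo M) (Go M)) (\<lambda>M N f. Dm (Fo M) (Fo N) (Go M) (Go N) (Fm M N f) (Gm M N f))"
    and y: "y \<in> carrier (K_group C n)"
  shows "K_map C (\<lambda>M. Do (Fo M) (Go M)) (\<lambda>M N f. Dm (Fo M) (Fo N) (Go M) (Go N) (Fm M N f) (Gm M N f)) n y
    = K_map C Fo Fm n y \<otimes>\<^bsub>K_group C n\<^esub> K_map C Go Gm n y"
proof -
  interpret F: exact_functor C C Fo Fm by (rule F)
  interpret G: exact_functor C C Go Gm by (rule G)
  interpret S: exact_functor C C "\<lambda>M. Do (Fo M) (Go M)" "\<lambda>M N f. Dm (Fo M) (Fo N) (Go M) (Go N) (Fm M N f) (Gm M N f)"
    by (rule S)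
  let ?X = "realization (wS C)" and ?b = "wS_base C"
  obtain f where f: "f \<in> cube_loops (Suc n) ?X ?b" "y = hcl (Suc n) ?X ?b f"
    using y unfolding K_group_carrier by blast
  have mu: "S.rmap c = sum.mu (F.rmap c) (G.rmap c)" if c_in: "c \<in> topspace ?X" for c
  proof -
    obtain m s t where c: "s \<in> simp (wS C) m" "t \<in> standard_simplex m" "c = cls (wS C) m s t"
      using sum.X.cls_cases[OF c_in] .
    have "wS_bimap m (wS_map Fo Fm m s) (wS_map Go Gm m s)
        = wS_map (\<lambda>M. Do (Fo M) (Go M)) (\<lambda>M N f. Dm (Fo M) (Fo N) (Go M) (Go N) (Fm M N f) (Gm M N f)) m s"
      by (auto simp: wS_bimap_def F.wS_map_alt G.wS_map_alt S.wS_map_alt restrict_def fun_eq_iff sarrows_def)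
    then show ?thesis
      using sum.mu_same[OF F.wS.phi_in[OF c(1)] G.wS.phi_in[OF c(1)] c(2)] c
      by (simp add: F.wS.realization_map_cls G.wS.realization_map_cls S.wS.realization_map_cls)
  qed
  have "(S.rmap \<circ> f, \<lambda>x. sum.mu ((F.rmap \<circ> f) x) ((G.rmap \<circ> f) x)) \<in> cube_homotopic (Suc n) ?X ?b"
    by (rule cube_homotopic_eq[OF S.rmap_loop[OF f(1)]]) (simp add: mu cube_loops_in[OF f(1)])
  from hcl_eqI[OF this] show ?thesis
    using f F.K_map_hcl G.K_map_hcl S.K_map_hcl K_sum(1)[OF F.rmap_loop[OF f(1)] G.rmap_loop[OF f(1)]] by simp
qed

end

section \<open>Equivariant modules\<close>

definition linear_on :: "'a ring \<Rightarrow> ('a, 'b, 'z) module_scheme \<Rightarrow> ('a, 'c, 'y) module_scheme \<Rightarrow> ('b \<Rightarrow> 'c) \<Rightarrow> bool" where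
  "linear_on R M N f \<longleftrightarrow> (\<forall>x\<in>carrier M. f x \<in> carrier N)
     \<and> (\<forall>x\<in>carrier M. \<forall>y\<in>carrier M. f (x \<oplus>\<^bsub>M\<^esub> y) = f x \<oplus>\<^bsub>N\<^esub> f y)
     \<and> (\<forall>a\<in>carrier R. \<forall>x\<in>carrier M. f (a \<odot>\<^bsub>M\<^esub> x) = a \<odot>\<^bsub>N\<^esub> f x)"

lemma additive_zero:
  assumes "abelian_group M" "abelian_group N" "\<And>x. x \<in> carrier M \<Longrightarrow> f x \<in> carrier N"
    "\<And>x y. x \<in> carrier M \<Longrightarrow> y \<in> carrier M \<Longrightarrow> f (x \<oplus>\<^bsub>M\<^esub> y) = f x \<oplus>\<^bsub>N\<^esub> f y"
  shows "f \<zero>\<^bsub>M\<^esub> = \<zero>\<^bsub>N\<^esub>"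
proof -
  interpret M: abelian_group M by fact
  interpret N: abelian_group N by fact
  have "f \<zero>\<^bsub>M\<^esub> \<oplus>\<^bsub>N\<^esub> f \<zero>\<^bsub>M\<^esub> = f \<zero>\<^bsub>M\<^esub>" using assms(4)[of "\<zero>\<^bsub>M\<^esub>" "\<zero>\<^bsub>M\<^esub>"] by simp
  then show ?thesis using assms(3)[OF M.zero_closed] N.add.l_cancel_one by blast
qed

lemma additive_finsum:
  assumes M: "abelian_group M" and N: "abelian_group N" and f: "\<And>x. x \<in> carrier M \<Longrightarrow> f x \<in> carrier N"
    "\<And>x y. x \<in> carrier M \<Longrightarrow> y \<in> carrier M \<Longrightarrow> f (x \<oplus>\<^bsub>M\<^esub> y) = f x \<oplus>\<^bsub>N\<^esub> f y"
    and g: "\<And>i. i \<in> I \<Longrightarrow> g i \<in> carrier M" and "finite I"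
  shows "f (\<Oplus>\<^bsub>M\<^esub>i\<in>I. g i) = (\<Oplus>\<^bsub>N\<^esub>i\<in>I. f (g i))"
  using \<open>finite I\<close> g
proof (induction I rule: finite_induct)
  case empty
  then show ?case using additive_zero[OF M N f] M N
    by (simp add: abelian_monoid.finsum_empty abelian_group.axioms(1))
next
  case (insert i I)
  interpret M: abelian_group M by fact
  interpret N: abelian_group N by fact
  have "(\<lambda>i. g i) \<in> I \<rightarrow> carrier M" "(\<lambda>i. f (g i)) \<in> I \<rightarrow> carrier N" using insert f by auto
  then show ?case using insert f by (simp add: M.finsum_insert N.finsum_insert)
qed

lemma finsum_exchange:
  assumes "abelian_monoid M" "finite A" "finite B" "\<And>i j. i \<in> A \<Longrightarrow> j \<in> B \<Longrightarrow> f i j \<in> carrier M"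
  shows "(\<Oplus>\<^bsub>M\<^esub>i\<in>A. \<Oplus>\<^bsub>M\<^esub>j\<in>B. f i j) = (\<Oplus>\<^bsub>M\<^esub>j\<in>B. \<Oplus>\<^bsub>M\<^esub>i\<in>A. f i j)"
proof -
  interpret abelian_monoid M by fact
  show ?thesis using assms(2,4)
  proof (induction A rule: finite_induct)
    case empty
    then show ?case by (simp add: finsum_zero)
  next
    case (insert i A)
    have 1: "(\<lambda>j. f i j) \<in> B \<rightarrow> carrier M" "(\<lambda>j. \<Oplus>\<^bsub>M\<^esub>i\<in>A. f i j) \<in> B \<rightarrow> carrier M"
      using insert by (auto intro!: finsum_closed)
    have "(\<Oplus>\<^bsub>M\<^esub>i\<in>insert i A. \<Oplus>\<^bsub>M\<^esub>j\<in>B. f i j) = (\<Oplus>\<^bsub>M\<^esub>j\<in>B. f i j) \<oplus>\<^bsub>M\<^esub> (\<Oplus>\<^bsub>M\<^esub>i\<in>A. \<Oplus>\<^bsub>M\<^esub>j\<in>B. f i j)"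
      using insert by (intro finsum_insert) (auto intro!: finsum_closed)
    also have "\<dots> = (\<Oplus>\<^bsub>M\<^esub>j\<in>B. f i j \<oplus>\<^bsub>M\<^esub> (\<Oplus>\<^bsub>M\<^esub>i\<in>A. f i j))"
      using insert 1 by (simp add: finsum_addf)
    also have "\<dots> = (\<Oplus>\<^bsub>M\<^esub>j\<in>B. \<Oplus>\<^bsub>M\<^esub>i\<in>insert i A. f i j)"
      using insert by (intro finsum_cong') (auto intro!: finsum_closed finsum_insert[symmetric])
    finally show ?case .
  qed
qed

lemma finsum_delta:
  assumes "abelian_monoid M" "i \<in> A" "finite A" "x \<in> carrier M"
    "\<And>j. j \<in> A \<Longrightarrow> f j = (if j = i then x else \<zero>\<^bsub>M\<^esub>)"
  shows "(\<Oplus>\<^bsub>M\<^esub>j\<in>A. f j) = x"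
proof -
  interpret abelian_monoid M by fact
  have "(\<Oplus>\<^bsub>M\<^esub>j\<in>A. f j) = (\<Oplus>\<^bsub>M\<^esub>j\<in>A. if i = j then x else \<zero>\<^bsub>M\<^esub>)"
    using assms by (intro finsum_cong') auto
  also have "\<dots> = x" using finsum_singleton[of i A "\<lambda>_. x"] assms by simp
  finally show ?thesis .
qed

lemma (in module) smult_finsum:
  assumes "finite I" "a \<in> carrier R" "\<And>i. i \<in> I \<Longrightarrow> g i \<in> carrier M"
  shows "a \<odot>\<^bsub>M\<^esub> (\<Oplus>\<^bsub>M\<^esub>i\<in>I. g i) = (\<Oplus>\<^bsub>M\<^esub>i\<in>I. a \<odot>\<^bsub>M\<^esub> g i)"
  by (rule additive_finsum[of M M]) (use assms smult_r_distr in \<open>auto intro: M.abelian_group_axioms\<close>)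

lemma (in module) finsum_smult:
  assumes "finite I" "x \<in> carrier M" "\<And>i. i \<in> I \<Longrightarrow> a i \<in> carrier R"
  shows "(\<Oplus>\<^bsub>R\<^esub>i\<in>I. a i) \<odot>\<^bsub>M\<^esub> x = (\<Oplus>\<^bsub>M\<^esub>i\<in>I. a i \<odot>\<^bsub>M\<^esub> x)"
  by (rule additive_finsum[of R M "\<lambda>r. r \<odot>\<^bsub>M\<^esub> x"])
    (use assms smult_l_distr in \<open>auto intro: M.abelian_group_axioms R.abelian_group_axioms\<close>)

section \<open>Matrices over a ring acting on tuples of module elements\<close>

definition mat_app ::
    "('a, 'b, 'z) module_scheme \<Rightarrow> nat \<Rightarrow> (nat \<Rightarrow> nat \<Rightarrow> 'a) \<Rightarrow> (nat \<Rightarrow> 'b) \<Rightarrow> nat \<Rightarrow> 'b" where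
  "mat_app M d U x i = (\<Oplus>\<^bsub>M\<^esub>j\<in>{..<d}. U i j \<odot>\<^bsub>M\<^esub> x j)"

context module
begin

lemma mat_app_closed:
  assumes "\<And>j. j < d \<Longrightarrow> U i j \<in> carrier R" "\<And>j. j < d \<Longrightarrow> x j \<in> carrier M"
  shows "mat_app M d U x i \<in> carrier M"
  unfolding mat_app_def using assms by (intro M.finsum_closed) auto

lemma mat_app_add:
  assumes "\<And>j. j < d \<Longrightarrow> U i j \<in> carrier R" "\<And>j. j < d \<Longrightarrow> x j \<in> carrier M" "\<And>j. j < d \<Longrightarrow> y j \<in> carrier M"
  shows "mat_app M d U (\<lambda>j. x j \<oplus>\<^bsub>M\<^esub> y j) i = mat_app M d U x i \<oplus>\<^bsub>M\<^esub> mat_app M d U y i"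
proof -
  have "(\<Oplus>\<^bsub>M\<^esub>j\<in>{..<d}. U i j \<odot>\<^bsub>M\<^esub> (x j \<oplus>\<^bsub>M\<^esub> y j)) = (\<Oplus>\<^bsub>M\<^esub>j\<in>{..<d}. U i j \<odot>\<^bsub>M\<^esub> x j \<oplus>\<^bsub>M\<^esub> U i j \<odot>\<^bsub>M\<^esub> y j)"
    using assms by (intro M.finsum_cong') (auto simp: smult_r_distr)
  also have "\<dots> = mat_app M d U x i \<oplus>\<^bsub>M\<^esub> mat_app M d U y i"
    unfolding mat_app_def using assms by (intro M.finsum_addf) auto
  finally show ?thesis by (simp add: mat_app_def)
qed

lemma mat_app_smult:
  assumes "\<And>j. j < d \<Longrightarrow> U i j \<in> carrier R" "\<And>j. j < d \<Longrightarrow> x j \<in> carrier M" "a \<in> carrier R"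
  shows "mat_app M d U (\<lambda>j. a \<odot>\<^bsub>M\<^esub> x j) i = a \<odot>\<^bsub>M\<^esub> mat_app M d U x i"
proof -
  have "U i j \<odot>\<^bsub>M\<^esub> (a \<odot>\<^bsub>M\<^esub> x j) = a \<odot>\<^bsub>M\<^esub> (U i j \<odot>\<^bsub>M\<^esub> x j)" if "j < d" for j
    using assms that by (metis R.m_comm smult_assoc1)
  then have "(\<Oplus>\<^bsub>M\<^esub>j\<in>{..<d}. U i j \<odot>\<^bsub>M\<^esub> (a \<odot>\<^bsub>M\<^esub> x j)) = (\<Oplus>\<^bsub>M\<^esub>j\<in>{..<d}. a \<odot>\<^bsub>M\<^esub> (U i j \<odot>\<^bsub>M\<^esub> x j))"
    using assms by (intro M.finsum_cong') auto
  then show ?thesis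
    unfolding mat_app_def using assms by (subst smult_finsum) auto
qed

lemma mat_app_cong:
  assumes "\<And>j. j < d \<Longrightarrow> U i j = V i j" "\<And>j. j < d \<Longrightarrow> x j = y j"
    "\<And>j. j < d \<Longrightarrow> V i j \<in> carrier R" "\<And>j. j < d \<Longrightarrow> y j \<in> carrier M"
  shows "mat_app M d U x i = mat_app M d V y i"
  unfolding mat_app_def using assms by (intro M.finsum_cong') auto

lemma mat_app_mat_app:
  assumes "\<And>j. j < d \<Longrightarrow> U i j \<in> carrier R" "\<And>j k. j < d \<Longrightarrow> k < c \<Longrightarrow> V j k \<in> carrier R"
    "\<And>k. k < c \<Longrightarrow> x k \<in> carrier M"
  shows "mat_app M d U (mat_app M c V x) i = mat_app M c (\<lambda>i k. \<Oplus>\<^bsub>R\<^esub>j\<in>{..<d}. U i j \<otimes>\<^bsub>R\<^esub> V j k) x i"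
proof -
  have "mat_app M d U (mat_app M c V x) i = (\<Oplus>\<^bsub>M\<^esub>j\<in>{..<d}. \<Oplus>\<^bsub>M\<^esub>k\<in>{..<c}. (U i j \<otimes>\<^bsub>R\<^esub> V j k) \<odot>\<^bsub>M\<^esub> x k)"
    unfolding mat_app_def
  proof (rule M.finsum_cong')
    fix j assume j: "j \<in> {..<d}"
    have "U i j \<odot>\<^bsub>M\<^esub> (\<Oplus>\<^bsub>M\<^esub>k\<in>{..<c}. V j k \<odot>\<^bsub>M\<^esub> x k) = (\<Oplus>\<^bsub>M\<^esub>k\<in>{..<c}. U i j \<odot>\<^bsub>M\<^esub> (V j k \<odot>\<^bsub>M\<^esub> x k))"
      using assms j by (intro smult_finsum) auto
    also have "\<dots> = (\<Oplus>\<^bsub>M\<^esub>k\<in>{..<c}. (U i j \<otimes>\<^bsub>R\<^esub> V j k) \<odot>\<^bsub>M\<^esub> x k)"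
      using assms j by (intro M.finsum_cong') (auto simp: smult_assoc1)
    finally show "U i j \<odot>\<^bsub>M\<^esub> (\<Oplus>\<^bsub>M\<^esub>k\<in>{..<c}. V j k \<odot>\<^bsub>M\<^esub> x k) = (\<Oplus>\<^bsub>M\<^esub>k\<in>{..<c}. (U i j \<otimes>\<^bsub>R\<^esub> V j k) \<odot>\<^bsub>M\<^esub> x k)" .
  qed (use assms in \<open>auto intro!: M.finsum_closed\<close>)
  also have "\<dots> = (\<Oplus>\<^bsub>M\<^esub>k\<in>{..<c}. \<Oplus>\<^bsub>M\<^esub>j\<in>{..<d}. (U i j \<otimes>\<^bsub>R\<^esub> V j k) \<odot>\<^bsub>M\<^esub> x k)"
    using assms by (intro finsum_exchange M.abelian_monoid_axioms) auto
  also have "\<dots> = mat_app M c (\<lambda>i k. \<Oplus>\<^bsub>R\<^esub>j\<in>{..<d}. U i j \<otimes>\<^bsub>R\<^esub> V j k) x i"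
    unfolding mat_app_def
  proof (rule M.finsum_cong')
    fix k assume k: "k \<in> {..<c}"
    show "(\<Oplus>\<^bsub>M\<^esub>j\<in>{..<d}. (U i j \<otimes>\<^bsub>R\<^esub> V j k) \<odot>\<^bsub>M\<^esub> x k) = (\<Oplus>\<^bsub>R\<^esub>j\<in>{..<d}. U i j \<otimes>\<^bsub>R\<^esub> V j k) \<odot>\<^bsub>M\<^esub> x k"
      using assms k by (intro finsum_smult[symmetric]) auto
  qed (use assms in \<open>auto intro!: R.finsum_closed\<close>)
  finally show ?thesis .
qed

lemma mat_app_id:
  assumes "i < d" "\<And>j. j < d \<Longrightarrow> x j \<in> carrier M" "\<And>j. j < d \<Longrightarrow> U i j = (if j = i then \<one>\<^bsub>R\<^esub> else \<zero>\<^bsub>R\<^esub>)"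
  shows "mat_app M d U x i = x i"
  unfolding mat_app_def using assms by (intro finsum_delta[of M i] M.abelian_monoid_axioms) auto

end

text \<open>\<open>S\<close> is a product of the \<open>Ms i\<close> with projections
  \<open>c i\<close>. The description by coordinates treats genuine tuples and the collapsed zero
  module alike, and later properties are checked one coordinate at a time.\<close>

definition module_prod ::
    "'a ring \<Rightarrow> nat \<Rightarrow> (nat \<Rightarrow> ('a, 'c, 'y) module_scheme) \<Rightarrow> ('a, 'b, 'z) module_scheme \<Rightarrow> (nat \<Rightarrow> 'b \<Rightarrow> 'c) \<Rightarrow> bool" where
  "module_prod R d Ms S c \<longleftrightarrow> \<zero>\<^bsub>S\<^esub> \<in> carrier S \<and> (\<forall>i<d. c i \<zero>\<^bsub>S\<^esub> = \<zero>\<^bsub>Ms i\<^esub>)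
     \<and> (\<forall>u\<in>carrier S. \<forall>i<d. c i u \<in> carrier (Ms i))
     \<and> (\<forall>f. (\<forall>i<d. f i \<in> carrier (Ms i)) \<longrightarrow> (\<exists>u\<in>carrier S. \<forall>i<d. c i u = f i))
     \<and> (\<forall>u\<in>carrier S. \<forall>v\<in>carrier S. (\<forall>i<d. c i u = c i v) \<longrightarrow> u = v)
     \<and> (\<forall>u\<in>carrier S. \<forall>v\<in>carrier S. u \<oplus>\<^bsub>S\<^esub> v \<in> carrier S \<and> (\<forall>i<d. c i (u \<oplus>\<^bsub>S\<^esub> v) = c i u \<oplus>\<^bsub>Ms i\<^esub> c i v))
     \<and> (\<forall>a\<in>carrier R. \<forall>u\<in>carrier S. a \<odot>\<^bsub>S\<^esub> u \<in> carrier S \<and> (\<forall>i<d. c i (a \<odot>\<^bsub>S\<^esub> u) = a \<odot>\<^bsub>Ms i\<^esub> c i u))"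

lemma module_prodD:
  assumes "module_prod R d Ms S c"
  shows "\<zero>\<^bsub>S\<^esub> \<in> carrier S" "\<And>i. i < d \<Longrightarrow> c i \<zero>\<^bsub>S\<^esub> = \<zero>\<^bsub>Ms i\<^esub>"
    "\<And>u i. u \<in> carrier S \<Longrightarrow> i < d \<Longrightarrow> c i u \<in> carrier (Ms i)"
    "\<And>f. (\<And>i. i < d \<Longrightarrow> f i \<in> carrier (Ms i)) \<Longrightarrow> \<exists>u\<in>carrier S. \<forall>i<d. c i u = f i"
    "\<And>u v. u \<in> carrier S \<Longrightarrow> v \<in> carrier S \<Longrightarrow> (\<And>i. i < d \<Longrightarrow> c i u = c i v) \<Longrightarrow> u = v"
    "\<And>u v. u \<in> carrier S \<Longrightarrow> v \<in> carrier S \<Longrightarrow> u \<oplus>\<^bsub>S\<^esub> v \<in> carrier S"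
    "\<And>u v i. u \<in> carrier S \<Longrightarrow> v \<in> carrier S \<Longrightarrow> i < d \<Longrightarrow> c i (u \<oplus>\<^bsub>S\<^esub> v) = c i u \<oplus>\<^bsub>Ms i\<^esub> c i v"
    "\<And>a u. a \<in> carrier R \<Longrightarrow> u \<in> carrier S \<Longrightarrow> a \<odot>\<^bsub>S\<^esub> u \<in> carrier S"
    "\<And>a u i. a \<in> carrier R \<Longrightarrow> u \<in> carrier S \<Longrightarrow> i < d \<Longrightarrow> c i (a \<odot>\<^bsub>S\<^esub> u) = a \<odot>\<^bsub>Ms i\<^esub> c i u"
  using assms unfolding module_prod_def by blast+

lemma module_prod_module:
  assumes P: "module_prod R d Ms S c" and R: "cring R" and M: "\<And>i. i < d \<Longrightarrow> module R (Ms i)"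
  shows "module R S"
proof -
  note D = module_prodD[OF P]
  have ab: "abelian_group (Ms i)" if "i < d" for i using M[OF that] by (rule module.axioms)
  note abm = abelian_group.axioms(1)[OF ab]
  interpret R: cring R by fact
  show ?thesis
  proof (rule moduleI[OF R])
    show "abelian_group S"
    proof (rule abelian_groupI)
      fix u v w assume u: "u \<in> carrier S" and v: "v \<in> carrier S" and w: "w \<in> carrier S"
      show "u \<oplus>\<^bsub>S\<^esub> v \<oplus>\<^bsub>S\<^esub> w = u \<oplus>\<^bsub>S\<^esub> (v \<oplus>\<^bsub>S\<^esub> w)"
        by (rule D(5)) (use u v w D(3) abm in \<open>simp_all add: D(6,7) abelian_monoid.a_assoc\<close>)
    next
      fix u v assume u: "u \<in> carrier S" and v: "v \<in> carrier S"
      show "u \<oplus>\<^bsub>S\<^esub> v = v \<oplus>\<^bsub>S\<^esub> u"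
        by (rule D(5)) (use u v D(3) abm in \<open>simp_all add: D(6,7) abelian_monoid.a_comm\<close>)
    next
      fix u assume u: "u \<in> carrier S"
      show "\<zero>\<^bsub>S\<^esub> \<oplus>\<^bsub>S\<^esub> u = u"
        by (rule D(5)) (use u D(1-3) abm in \<open>simp_all add: D(6,7) abelian_monoid.l_zero\<close>)
      have "\<exists>v\<in>carrier S. \<forall>i<d. c i v = \<ominus>\<^bsub>Ms i\<^esub> c i u"
        by (rule D(4)) (use u D(3) ab in \<open>simp add: abelian_group.a_inv_closed\<close>)
      then obtain v where v: "v \<in> carrier S" "\<And>i. i < d \<Longrightarrow> c i v = \<ominus>\<^bsub>Ms i\<^esub> c i u" by blast
      have "v \<oplus>\<^bsub>S\<^esub> u = \<zero>\<^bsub>S\<^esub>"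
        by (rule D(5)) (use u v D(1-3) ab in \<open>simp_all add: D(6,7) abelian_group.l_neg\<close>)
      then show "\<exists>v\<in>carrier S. v \<oplus>\<^bsub>S\<^esub> u = \<zero>\<^bsub>S\<^esub>" using v by blast
    qed (use D in auto)
  next
    fix a x assume a: "a \<in> carrier R" and x: "x \<in> carrier S"
    show "a \<odot>\<^bsub>S\<^esub> x \<in> carrier S" by (rule D(8)[OF a x])
  next
    fix a b x assume a: "a \<in> carrier R" and b: "b \<in> carrier R" and x: "x \<in> carrier S"
    show "(a \<oplus>\<^bsub>R\<^esub> b) \<odot>\<^bsub>S\<^esub> x = a \<odot>\<^bsub>S\<^esub> x \<oplus>\<^bsub>S\<^esub> b \<odot>\<^bsub>S\<^esub> x"
      by (rule D(5)) (use a b x D(3) M in \<open>simp_all add: D(6-9) module.smult_l_distr\<close>)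
    show "(a \<otimes>\<^bsub>R\<^esub> b) \<odot>\<^bsub>S\<^esub> x = a \<odot>\<^bsub>S\<^esub> (b \<odot>\<^bsub>S\<^esub> x)"
      by (rule D(5)) (use a b x D(3) M in \<open>simp_all add: D(6-9) module.smult_assoc1\<close>)
  next
    fix a x y assume a: "a \<in> carrier R" and x: "x \<in> carrier S" and y: "y \<in> carrier S"
    show "a \<odot>\<^bsub>S\<^esub> (x \<oplus>\<^bsub>S\<^esub> y) = a \<odot>\<^bsub>S\<^esub> x \<oplus>\<^bsub>S\<^esub> a \<odot>\<^bsub>S\<^esub> y"
      by (rule D(5)) (use a x y D(3) M in \<open>simp_all add: D(6-9) module.smult_r_distr[OF M]\<close>)
  next
    fix x assume x: "x \<in> carrier S"
    show "\<one>\<^bsub>R\<^esub> \<odot>\<^bsub>S\<^esub> x = x"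
      by (rule D(5)) (use x D(3) M in \<open>simp_all add: D(6-9) module.smult_one\<close>)
  qed
qed

lemma lessThan_add_split: "{..<n + k :: nat} = {..<n} \<union> (\<lambda>i. n + i) ` {..<k}"
proof (intro equalityI subsetI)
  fix i assume "i \<in> {..<n + k}"
  then show "i \<in> {..<n} \<union> (\<lambda>i. n + i) ` {..<k}"
    by (cases "i < n") (auto intro!: image_eqI[of _ _ "i - n"])
qed auto

lemma lin_comb_split:
  assumes M: "module R M" and z: "\<And>i. i < n + n' \<Longrightarrow> z i \<in> carrier M" and a: "\<And>i. i < n + n' \<Longrightarrow> a i \<in> carrier R"
  shows "lin_comb M (n + n') z a = lin_comb M n z a \<oplus>\<^bsub>M\<^esub> lin_comb M n' (\<lambda>i. z (n + i)) (\<lambda>i. a (n + i))"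
proof -
  interpret module R M by fact
  note lessThan_add_split[of n n']
  moreover have "(\<Oplus>\<^bsub>M\<^esub>i\<in>(\<lambda>i. n + i) ` {..<n'}. a i \<odot>\<^bsub>M\<^esub> z i) = (\<Oplus>\<^bsub>M\<^esub>i\<in>{..<n'}. a (n + i) \<odot>\<^bsub>M\<^esub> z (n + i))"
    by (rule M.finsum_reindex) (use z a in auto)
  moreover have "(\<Oplus>\<^bsub>M\<^esub>i\<in>{..<n} \<union> (\<lambda>i. n + i) ` {..<n'}. a i \<odot>\<^bsub>M\<^esub> z i)
      = (\<Oplus>\<^bsub>M\<^esub>i\<in>{..<n}. a i \<odot>\<^bsub>M\<^esub> z i) \<oplus>\<^bsub>M\<^esub> (\<Oplus>\<^bsub>M\<^esub>i\<in>(\<lambda>i. n + i) ` {..<n'}. a i \<odot>\<^bsub>M\<^esub> z i)"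
    by (rule M.finsum_Un_disjoint) (use z a in auto)
  ultimately show ?thesis
    unfolding lin_comb_def by simp
qed

text \<open>The generators of either factor are lifted to \<open>S\<close> with the other component
  zero, and the relations of the two factors are placed side by side: a block diagonal
  presentation.\<close>

lemma finitely_presented_sum:
  assumes S: "module R S" and M: "module R M" and N: "module R N"
    and fM: "finitely_presented R M" and fN: "finitely_presented R N"
    and p: "linear_on R S M p" and q: "linear_on R S N q"
    and ex: "\<And>x y. x \<in> carrier M \<Longrightarrow> y \<in> carrier N \<Longrightarrow> \<exists>u\<in>carrier S. p u = x \<and> q u = y"
    and inj: "\<And>u v. u \<in> carrier S \<Longrightarrow> v \<in> carrier S \<Longrightarrow> p u = p v \<Longrightarrow> q u = q v \<Longrightarrow> u = v"
  shows "finitely_presented R S"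
proof -
  interpret S: module R S by fact
  interpret M: module R M by fact
  interpret N: module R N by fact
  obtain n x m y where x: "x \<in> {..<n} \<rightarrow> carrier M" "lin_comb M n x ` coeff_vectors R n = carrier M"
     "y \<in> {..<m} \<rightarrow> coeff_vectors R n"
     and xk: "{a \<in> coeff_vectors R n. lin_comb M n x a = \<zero>\<^bsub>M\<^esub>}
         = {\<lambda>i\<in>{..<n}. \<Oplus>\<^bsub>R\<^esub>j\<in>{..<m}. c j \<otimes>\<^bsub>R\<^esub> y j i | c. c \<in> coeff_vectors R m}"
    using fM unfolding finitely_presented_def by blast
  obtain n' x' m' y' where x': "x' \<in> {..<n'} \<rightarrow> carrier N" "lin_comb N n' x' ` coeff_vectors R n' = carrier N"
     "y' \<in> {..<m'} \<rightarrow> coeff_vectors R n'"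
     and xk': "{a \<in> coeff_vectors R n'. lin_comb N n' x' a = \<zero>\<^bsub>N\<^esub>}
         = {\<lambda>i\<in>{..<n'}. \<Oplus>\<^bsub>R\<^esub>j\<in>{..<m'}. c j \<otimes>\<^bsub>R\<^esub> y' j i | c. c \<in> coeff_vectors R m'}"
    using fN unfolding finitely_presented_def by blast
  have xc: "x i \<in> carrier M" if "i < n" for i using x(1) that by auto
  have xc': "x' i \<in> carrier N" if "i < n'" for i using x'(1) that by auto
  have yc: "y j i \<in> carrier R" if "j < m" "i < n" for i j using x(3) that by (auto simp: coeff_vectors_def Pi_iff PiE_iff)
  have yc': "y' j i \<in> carrier R" if "j < m'" "i < n'" for i j using x'(3) that by (auto simp: coeff_vectors_def Pi_iff PiE_iff)
  define sec where "sec a b = (SOME u. u \<in> carrier S \<and> p u = a \<and> q u = b)" for a b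
  have sec: "sec a b \<in> carrier S" "p (sec a b) = a" "q (sec a b) = b" if "a \<in> carrier M" "b \<in> carrier N" for a b
    using someI_ex[of "\<lambda>u. u \<in> carrier S \<and> p u = a \<and> q u = b"] ex[OF that] unfolding sec_def by blast+
  define z where "z i = (if i < n then sec (x i) \<zero>\<^bsub>N\<^esub> else sec \<zero>\<^bsub>M\<^esub> (x' (i - n)))" for i
  \<comment> \<open>The block diagonal matrix of relations; \<open>j - m\<close> and
    \<open>i - n\<close> are positions within the second block.\<close>
  define w where "w j = (\<lambda>i\<in>{..<n + n'}. if j < m then (if i < n then y j i else \<zero>\<^bsub>R\<^esub>)
      else (if i < n then \<zero>\<^bsub>R\<^esub> else y' (j - m) (i - n)))" for j
  have zc: "z i \<in> carrier S" if "i < n + n'" for i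
    unfolding z_def using that sec(1)[OF xc] sec(1)[OF _ xc'] by auto
  have pz: "p (z i) = (if i < n then x i else \<zero>\<^bsub>M\<^esub>)" "q (z i) = (if i < n then \<zero>\<^bsub>N\<^esub> else x' (i - n))"
    if "i < n + n'" for i
    using that sec xc xc' unfolding z_def by auto
  have p1: "\<And>u. u \<in> carrier S \<Longrightarrow> p u \<in> carrier M" "\<And>u v. u \<in> carrier S \<Longrightarrow> v \<in> carrier S \<Longrightarrow> p (u \<oplus>\<^bsub>S\<^esub> v) = p u \<oplus>\<^bsub>M\<^esub> p v"
     "\<And>a u. a \<in> carrier R \<Longrightarrow> u \<in> carrier S \<Longrightarrow> p (a \<odot>\<^bsub>S\<^esub> u) = a \<odot>\<^bsub>M\<^esub> p u" using p by (auto simp: linear_on_def)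
  have q1: "\<And>u. u \<in> carrier S \<Longrightarrow> q u \<in> carrier N" "\<And>u v. u \<in> carrier S \<Longrightarrow> v \<in> carrier S \<Longrightarrow> q (u \<oplus>\<^bsub>S\<^esub> v) = q u \<oplus>\<^bsub>N\<^esub> q v"
     "\<And>a u. a \<in> carrier R \<Longrightarrow> u \<in> carrier S \<Longrightarrow> q (a \<odot>\<^bsub>S\<^esub> u) = a \<odot>\<^bsub>N\<^esub> q u" using q by (auto simp: linear_on_def)
  let ?l = "\<lambda>a. \<lambda>i\<in>{..<n}. a i" and ?r = "\<lambda>a. \<lambda>i\<in>{..<n'}. a (n + i)"
  have lr: "?l a \<in> coeff_vectors R n" "?r a \<in> coeff_vectors R n'" if "a \<in> coeff_vectors R (n + n')" for a
    using that unfolding coeff_vectors_def by (auto simp: PiE_iff)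
  have ac: "a i \<in> carrier R" if "a \<in> coeff_vectors R k" "i < k" for a i k
    using that unfolding coeff_vectors_def by (auto simp: PiE_iff)
  have zero_sum: "lin_comb K k (\<lambda>_. \<zero>\<^bsub>K\<^esub>) a = \<zero>\<^bsub>K\<^esub>" if "module R K" "\<And>i. i < k \<Longrightarrow> a i \<in> carrier R" for K :: "('a, 'w, 'v) module_scheme" and k a
  proof -
    interpret K: module R K by fact
    have "(\<Oplus>\<^bsub>K\<^esub>i\<in>{..<k}. a i \<odot>\<^bsub>K\<^esub> \<zero>\<^bsub>K\<^esub>) = (\<Oplus>\<^bsub>K\<^esub>i\<in>{..<k}. \<zero>\<^bsub>K\<^esub>)"
      using that by (intro K.finsum_cong') auto
    then show ?thesis by (simp add: lin_comb_def K.finsum_zero)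
  qed
  have pl: "p (lin_comb S (n + n') z a) = lin_comb M n x (?l a)" and ql: "q (lin_comb S (n + n') z a) = lin_comb N n' x' (?r a)"
    if a: "a \<in> coeff_vectors R (n + n')" for a
  proof -
    have "p (lin_comb S (n + n') z a) = lin_comb M (n + n') (\<lambda>i. p (z i)) a"
      unfolding lin_comb_def using zc ac[OF a] p1
      by (subst additive_finsum[OF S.M.abelian_group_axioms M.M.abelian_group_axioms]) (auto intro!: M.M.finsum_cong')
    also have "\<dots> = lin_comb M n (\<lambda>i. p (z i)) a \<oplus>\<^bsub>M\<^esub> lin_comb M n' (\<lambda>i. p (z (n + i))) (\<lambda>i. a (n + i))"
      by (rule lin_comb_split[OF M]) (use zc p1 ac[OF a] in auto)
    also have "lin_comb M n (\<lambda>i. p (z i)) a = lin_comb M n x (?l a)"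
      unfolding lin_comb_def by (rule M.M.finsum_cong') (use pz xc ac[OF a] in auto)
    also have "lin_comb M n' (\<lambda>i. p (z (n + i))) (\<lambda>i. a (n + i)) = lin_comb M n' (\<lambda>_. \<zero>\<^bsub>M\<^esub>) (\<lambda>i. a (n + i))"
      unfolding lin_comb_def by (rule M.M.finsum_cong') (use pz ac[OF a] in auto)
    also have "\<dots> = \<zero>\<^bsub>M\<^esub>" by (rule zero_sum[OF M]) (use ac[OF a] in auto)
    also have "lin_comb M n x (?l a) \<oplus>\<^bsub>M\<^esub> \<zero>\<^bsub>M\<^esub> = lin_comb M n x (?l a)"
      using xc ac[OF a] by (intro M.M.r_zero) (auto simp: lin_comb_def intro!: M.M.finsum_closed)
    finally show "p (lin_comb S (n + n') z a) = lin_comb M n x (?l a)" .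
    have "q (lin_comb S (n + n') z a) = lin_comb N (n + n') (\<lambda>i. q (z i)) a"
      unfolding lin_comb_def using zc ac[OF a] q1
      by (subst additive_finsum[OF S.M.abelian_group_axioms N.M.abelian_group_axioms]) (auto intro!: N.M.finsum_cong')
    also have "\<dots> = lin_comb N n (\<lambda>i. q (z i)) a \<oplus>\<^bsub>N\<^esub> lin_comb N n' (\<lambda>i. q (z (n + i))) (\<lambda>i. a (n + i))"
      by (rule lin_comb_split[OF N]) (use zc q1 ac[OF a] in auto)
    also have "lin_comb N n (\<lambda>i. q (z i)) a = lin_comb N n (\<lambda>_. \<zero>\<^bsub>N\<^esub>) a"
      unfolding lin_comb_def by (rule N.M.finsum_cong') (use pz ac[OF a] in auto)
    also have "\<dots> = \<zero>\<^bsub>N\<^esub>" by (rule zero_sum[OF N]) (use ac[OF a] in auto)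
    also have "lin_comb N n' (\<lambda>i. q (z (n + i))) (\<lambda>i. a (n + i)) = lin_comb N n' x' (?r a)"
      unfolding lin_comb_def by (rule N.M.finsum_cong') (use pz xc' ac[OF a] in auto)
    also have "\<zero>\<^bsub>N\<^esub> \<oplus>\<^bsub>N\<^esub> lin_comb N n' x' (?r a) = lin_comb N n' x' (?r a)"
      using xc' ac[OF a] by (intro N.M.l_zero) (auto simp: lin_comb_def intro!: N.M.finsum_closed)
    finally show "q (lin_comb S (n + n') z a) = lin_comb N n' x' (?r a)" .
  qed
  have Lc: "lin_comb S (n + n') z a \<in> carrier S" if "a \<in> coeff_vectors R (n + n')" for a
    unfolding lin_comb_def using zc ac[OF that] by (intro S.M.finsum_closed) auto
  have join: "(\<lambda>i\<in>{..<n + n'}. if i < n then a i else b (i - n)) \<in> coeff_vectors R (n + n')"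
    if "a \<in> coeff_vectors R n" "b \<in> coeff_vectors R n'" for a b
    using that by (auto simp: coeff_vectors_def PiE_iff)
  have join_lr: "?l (\<lambda>i\<in>{..<n + n'}. if i < n then a i else b (i - n)) = a"
    "?r (\<lambda>i\<in>{..<n + n'}. if i < n then a i else b (i - n)) = b"
    if "a \<in> coeff_vectors R n" "b \<in> coeff_vectors R n'" for a b
    using that by (auto simp: coeff_vectors_def fun_eq_iff PiE_iff extensional_def)
  \<comment> \<open>A coefficient vector is determined by its two blocks, because beyond
    \<open>n + n'\<close> it is \<open>undefined\<close> by extensionality.\<close>
  have lr_inj: "a = b" if "a \<in> coeff_vectors R (n + n')" "b \<in> coeff_vectors R (n + n')" "?l a = ?l b" "?r a = ?r b" for a b
  proof
    fix i
    consider "i < n" | "n \<le> i" "i < n + n'" | "n + n' \<le> i" by linarith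
    then show "a i = b i"
    proof cases
      case 1 then show ?thesis using fun_cong[OF that(3), of i] by simp
    next
      case 2
      then have "i - n < n'" by linarith
      then show ?thesis using fun_cong[OF that(4), of "i - n"] 2 by simp
    next
      case 3 then show ?thesis using that(1,2) by (simp add: coeff_vectors_def PiE_iff extensional_def)
    qed
  qed
  have relw: "?l (\<lambda>i\<in>{..<n + n'}. \<Oplus>\<^bsub>R\<^esub>j\<in>{..<m + m'}. c j \<otimes>\<^bsub>R\<^esub> w j i) = (\<lambda>i\<in>{..<n}. \<Oplus>\<^bsub>R\<^esub>j\<in>{..<m}. c j \<otimes>\<^bsub>R\<^esub> y j i)"
    "?r (\<lambda>i\<in>{..<n + n'}. \<Oplus>\<^bsub>R\<^esub>j\<in>{..<m + m'}. c j \<otimes>\<^bsub>R\<^esub> w j i) = (\<lambda>i\<in>{..<n'}. \<Oplus>\<^bsub>R\<^esub>j\<in>{..<m'}. c (m + j) \<otimes>\<^bsub>R\<^esub> y' j i)"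
    if c: "\<And>j. j < m + m' \<Longrightarrow> c j \<in> carrier R" for c
  proof -
    have split: "(\<Oplus>\<^bsub>R\<^esub>j\<in>{..<m + m'}. f j) = (\<Oplus>\<^bsub>R\<^esub>j\<in>{..<m}. f j) \<oplus>\<^bsub>R\<^esub> (\<Oplus>\<^bsub>R\<^esub>j\<in>{..<m'}. f (m + j))"
      if "\<And>j. j < m + m' \<Longrightarrow> f j \<in> carrier R" for f
    proof -
      note lessThan_add_split[of m m']
      moreover have "(\<Oplus>\<^bsub>R\<^esub>j\<in>(\<lambda>i. m + i) ` {..<m'}. f j) = (\<Oplus>\<^bsub>R\<^esub>j\<in>{..<m'}. f (m + j))"
        by (rule S.R.finsum_reindex) (use that in auto)
      moreover have "(\<Oplus>\<^bsub>R\<^esub>j\<in>{..<m} \<union> (\<lambda>i. m + i) ` {..<m'}. f j)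
          = (\<Oplus>\<^bsub>R\<^esub>j\<in>{..<m}. f j) \<oplus>\<^bsub>R\<^esub> (\<Oplus>\<^bsub>R\<^esub>j\<in>(\<lambda>i. m + i) ` {..<m'}. f j)"
        by (rule S.R.finsum_Un_disjoint) (use that in auto)
      ultimately show ?thesis by simp
    qed
    have wc: "w j i \<in> carrier R" if "j < m + m'" "i < n + n'" for i j
      using that yc yc' by (auto simp: w_def)
    have 1: "(\<Oplus>\<^bsub>R\<^esub>j\<in>{..<m + m'}. c j \<otimes>\<^bsub>R\<^esub> w j i) = (\<Oplus>\<^bsub>R\<^esub>j\<in>{..<m}. c j \<otimes>\<^bsub>R\<^esub> y j i)" if i: "i < n" for i
    proof -
      have "(\<Oplus>\<^bsub>R\<^esub>j\<in>{..<m + m'}. c j \<otimes>\<^bsub>R\<^esub> w j i) = (\<Oplus>\<^bsub>R\<^esub>j\<in>{..<m}. c j \<otimes>\<^bsub>R\<^esub> w j i) \<oplus>\<^bsub>R\<^esub> (\<Oplus>\<^bsub>R\<^esub>j\<in>{..<m'}. c (m + j) \<otimes>\<^bsub>R\<^esub> w (m + j) i)"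
        by (rule split) (use c wc i in auto)
      also have "(\<Oplus>\<^bsub>R\<^esub>j\<in>{..<m'}. c (m + j) \<otimes>\<^bsub>R\<^esub> w (m + j) i) = (\<Oplus>\<^bsub>R\<^esub>j\<in>{..<m'}. \<zero>\<^bsub>R\<^esub>)"
        by (rule S.R.finsum_cong') (use c i in \<open>auto simp: w_def\<close>)
      also have "\<dots> = \<zero>\<^bsub>R\<^esub>" by (rule S.R.finsum_zero)
      also have "(\<Oplus>\<^bsub>R\<^esub>j\<in>{..<m}. c j \<otimes>\<^bsub>R\<^esub> w j i) = (\<Oplus>\<^bsub>R\<^esub>j\<in>{..<m}. c j \<otimes>\<^bsub>R\<^esub> y j i)"
        by (rule S.R.finsum_cong') (use c i yc in \<open>auto simp: w_def\<close>)
      finally show ?thesis using c i yc by (simp add: S.R.finsum_closed)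
    qed
    have 2: "(\<Oplus>\<^bsub>R\<^esub>j\<in>{..<m + m'}. c j \<otimes>\<^bsub>R\<^esub> w j (n + i)) = (\<Oplus>\<^bsub>R\<^esub>j\<in>{..<m'}. c (m + j) \<otimes>\<^bsub>R\<^esub> y' j i)" if i: "i < n'" for i
    proof -
      have "(\<Oplus>\<^bsub>R\<^esub>j\<in>{..<m + m'}. c j \<otimes>\<^bsub>R\<^esub> w j (n + i)) = (\<Oplus>\<^bsub>R\<^esub>j\<in>{..<m}. c j \<otimes>\<^bsub>R\<^esub> w j (n + i)) \<oplus>\<^bsub>R\<^esub> (\<Oplus>\<^bsub>R\<^esub>j\<in>{..<m'}. c (m + j) \<otimes>\<^bsub>R\<^esub> w (m + j) (n + i))"
        by (rule split) (use c wc i in auto)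
      also have "(\<Oplus>\<^bsub>R\<^esub>j\<in>{..<m}. c j \<otimes>\<^bsub>R\<^esub> w j (n + i)) = (\<Oplus>\<^bsub>R\<^esub>j\<in>{..<m}. \<zero>\<^bsub>R\<^esub>)"
        by (rule S.R.finsum_cong') (use c i in \<open>auto simp: w_def\<close>)
      also have "\<dots> = \<zero>\<^bsub>R\<^esub>" by (rule S.R.finsum_zero)
      also have "(\<Oplus>\<^bsub>R\<^esub>j\<in>{..<m'}. c (m + j) \<otimes>\<^bsub>R\<^esub> w (m + j) (n + i)) = (\<Oplus>\<^bsub>R\<^esub>j\<in>{..<m'}. c (m + j) \<otimes>\<^bsub>R\<^esub> y' j i)"
        by (rule S.R.finsum_cong') (use c i yc' in \<open>auto simp: w_def\<close>)
      finally show ?thesis using c i yc' by (simp add: S.R.finsum_closed)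
    qed
    show "?l (\<lambda>i\<in>{..<n + n'}. \<Oplus>\<^bsub>R\<^esub>j\<in>{..<m + m'}. c j \<otimes>\<^bsub>R\<^esub> w j i) = (\<lambda>i\<in>{..<n}. \<Oplus>\<^bsub>R\<^esub>j\<in>{..<m}. c j \<otimes>\<^bsub>R\<^esub> y j i)"
      using 1 by (auto simp: fun_eq_iff)
    show "?r (\<lambda>i\<in>{..<n + n'}. \<Oplus>\<^bsub>R\<^esub>j\<in>{..<m + m'}. c j \<otimes>\<^bsub>R\<^esub> w j i) = (\<lambda>i\<in>{..<n'}. \<Oplus>\<^bsub>R\<^esub>j\<in>{..<m'}. c (m + j) \<otimes>\<^bsub>R\<^esub> y' j i)"
      using 2 by (auto simp: fun_eq_iff)
  qed
  have relc: "(\<lambda>i\<in>{..<n + n'}. \<Oplus>\<^bsub>R\<^esub>j\<in>{..<m + m'}. c j \<otimes>\<^bsub>R\<^esub> w j i) \<in> coeff_vectors R (n + n')"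
    if "c \<in> coeff_vectors R (m + m')" for c
    using ac[OF that] yc yc' by (auto simp: coeff_vectors_def w_def intro!: S.R.finsum_closed)
  show ?thesis
    unfolding finitely_presented_def
  proof (intro exI conjI)
    show "z \<in> {..<n + n'} \<rightarrow> carrier S" using zc by auto
    show "lin_comb S (n + n') z ` coeff_vectors R (n + n') = carrier S"
    proof
      show "lin_comb S (n + n') z ` coeff_vectors R (n + n') \<subseteq> carrier S" using Lc by blast
      show "carrier S \<subseteq> lin_comb S (n + n') z ` coeff_vectors R (n + n')"
      proof
        fix u assume u: "u \<in> carrier S"
        obtain a where a: "a \<in> coeff_vectors R n" "p u = lin_comb M n x a" using p1(1)[OF u] x(2) by blast
        obtain b where b: "b \<in> coeff_vectors R n'" "q u = lin_comb N n' x' b" using q1(1)[OF u] x'(2) by blast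
        note ab = join[OF a(1) b(1)]
        have "u = lin_comb S (n + n') z (\<lambda>i\<in>{..<n + n'}. if i < n then a i else b (i - n))"
          by (rule inj[OF u Lc[OF ab]]) (use pl[OF ab] ql[OF ab] join_lr[OF a(1) b(1)] a b in simp_all)
        then show "u \<in> lin_comb S (n + n') z ` coeff_vectors R (n + n')" using ab by blast
      qed
    qed
    show "w \<in> {..<m + m'} \<rightarrow> coeff_vectors R (n + n')"
      using yc yc' by (auto simp: coeff_vectors_def w_def)
    show "{a \<in> coeff_vectors R (n + n'). lin_comb S (n + n') z a = \<zero>\<^bsub>S\<^esub>}
       = {\<lambda>i\<in>{..<n + n'}. \<Oplus>\<^bsub>R\<^esub>j\<in>{..<m + m'}. c j \<otimes>\<^bsub>R\<^esub> w j i | c. c \<in> coeff_vectors R (m + m')}" (is "?K = ?I")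
    proof
      have p0: "p \<zero>\<^bsub>S\<^esub> = \<zero>\<^bsub>M\<^esub>" and q0: "q \<zero>\<^bsub>S\<^esub> = \<zero>\<^bsub>N\<^esub>"
        using additive_zero[OF S.M.abelian_group_axioms M.M.abelian_group_axioms p1(1,2)]
          additive_zero[OF S.M.abelian_group_axioms N.M.abelian_group_axioms q1(1,2)] by auto
      show "?K \<subseteq> ?I"
      proof
        fix a assume a: "a \<in> ?K"
        then have ac1: "a \<in> coeff_vectors R (n + n')" by simp
        have "?l a \<in> {a \<in> coeff_vectors R n. lin_comb M n x a = \<zero>\<^bsub>M\<^esub>}"
          using lr(1)[OF ac1] pl[OF ac1] a p0 by simp
        then obtain c where c: "c \<in> coeff_vectors R m" "?l a = (\<lambda>i\<in>{..<n}. \<Oplus>\<^bsub>R\<^esub>j\<in>{..<m}. c j \<otimes>\<^bsub>R\<^esub> y j i)"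
          unfolding xk by blast
        have "?r a \<in> {a \<in> coeff_vectors R n'. lin_comb N n' x' a = \<zero>\<^bsub>N\<^esub>}"
          using lr(2)[OF ac1] ql[OF ac1] a q0 by simp
        then obtain c' where c': "c' \<in> coeff_vectors R m'" "?r a = (\<lambda>i\<in>{..<n'}. \<Oplus>\<^bsub>R\<^esub>j\<in>{..<m'}. c' j \<otimes>\<^bsub>R\<^esub> y' j i)"
          unfolding xk' by blast
        let ?c = "\<lambda>i\<in>{..<m + m'}. if i < m then c i else c' (i - m)"
        have cc: "?c \<in> coeff_vectors R (m + m')"
          using c(1) c'(1) by (auto simp: coeff_vectors_def PiE_iff)
        have l: "(\<Oplus>\<^bsub>R\<^esub>j\<in>{..<m}. ?c j \<otimes>\<^bsub>R\<^esub> y j i) = (\<Oplus>\<^bsub>R\<^esub>j\<in>{..<m}. c j \<otimes>\<^bsub>R\<^esub> y j i)" if "i < n" for i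
          by (rule S.R.finsum_cong') (use ac[OF c(1)] yc that in auto)
        have r: "(\<Oplus>\<^bsub>R\<^esub>j\<in>{..<m'}. ?c (m + j) \<otimes>\<^bsub>R\<^esub> y' j i) = (\<Oplus>\<^bsub>R\<^esub>j\<in>{..<m'}. c' j \<otimes>\<^bsub>R\<^esub> y' j i)" if "i < n'" for i
          by (rule S.R.finsum_cong') (use ac[OF c'(1)] yc' that in auto)
        have "a = (\<lambda>i\<in>{..<n + n'}. \<Oplus>\<^bsub>R\<^esub>j\<in>{..<m + m'}. ?c j \<otimes>\<^bsub>R\<^esub> w j i)"
        proof (rule lr_inj[OF ac1 relc[OF cc]])
          show "?l a = ?l (\<lambda>i\<in>{..<n + n'}. \<Oplus>\<^bsub>R\<^esub>j\<in>{..<m + m'}. ?c j \<otimes>\<^bsub>R\<^esub> w j i)"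
          proof -
            have "(\<lambda>i\<in>{..<n}. \<Oplus>\<^bsub>R\<^esub>j\<in>{..<m}. c j \<otimes>\<^bsub>R\<^esub> y j i) = (\<lambda>i\<in>{..<n}. \<Oplus>\<^bsub>R\<^esub>j\<in>{..<m}. ?c j \<otimes>\<^bsub>R\<^esub> y j i)"
              by (rule restrict_ext) (simp only: l lessThan_iff)
            from trans[OF trans[OF c(2) this] relw(1)[of ?c, OF ac[OF cc], symmetric]] show ?thesis .
          qed
          show "?r a = ?r (\<lambda>i\<in>{..<n + n'}. \<Oplus>\<^bsub>R\<^esub>j\<in>{..<m + m'}. ?c j \<otimes>\<^bsub>R\<^esub> w j i)"
          proof -
            have "(\<lambda>i\<in>{..<n'}. \<Oplus>\<^bsub>R\<^esub>j\<in>{..<m'}. c' j \<otimes>\<^bsub>R\<^esub> y' j i) = (\<lambda>i\<in>{..<n'}. \<Oplus>\<^bsub>R\<^esub>j\<in>{..<m'}. ?c (m + j) \<otimes>\<^bsub>R\<^esub> y' j i)"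
              by (rule restrict_ext) (simp only: r lessThan_iff)
            from trans[OF trans[OF c'(2) this] relw(2)[of ?c, OF ac[OF cc], symmetric]] show ?thesis .
          qed
        qed
        then show "a \<in> ?I" using cc by blast
      qed
      show "?I \<subseteq> ?K"
      proof
        fix a assume "a \<in> ?I"
        then obtain c where c: "c \<in> coeff_vectors R (m + m')" "a = (\<lambda>i\<in>{..<n + n'}. \<Oplus>\<^bsub>R\<^esub>j\<in>{..<m + m'}. c j \<otimes>\<^bsub>R\<^esub> w j i)" by blast
        have a: "a \<in> coeff_vectors R (n + n')" using relc c by simp
        have "?l a \<in> {a \<in> coeff_vectors R n. lin_comb M n x a = \<zero>\<^bsub>M\<^esub>}"
          unfolding xk mem_Collect_eq
        proof (intro exI conjI, rule trans)
          show "?l a = (\<lambda>i\<in>{..<n}. \<Oplus>\<^bsub>R\<^esub>j\<in>{..<m}. c j \<otimes>\<^bsub>R\<^esub> y j i)"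
            unfolding c(2) by (rule relw(1)[of c, OF ac[OF c(1)]])
          show "(\<lambda>j\<in>{..<m}. c j) \<in> coeff_vectors R m" using ac[OF c(1)] by (auto simp: coeff_vectors_def)
          show "(\<lambda>i\<in>{..<n}. \<Oplus>\<^bsub>R\<^esub>j\<in>{..<m}. c j \<otimes>\<^bsub>R\<^esub> y j i) = (\<lambda>i\<in>{..<n}. \<Oplus>\<^bsub>R\<^esub>j\<in>{..<m}. (\<lambda>j\<in>{..<m}. c j) j \<otimes>\<^bsub>R\<^esub> y j i)"
            by (rule restrict_ext, rule S.R.finsum_cong') (use ac[OF c(1)] yc in auto)
        qed
        moreover have "?r a \<in> {a \<in> coeff_vectors R n'. lin_comb N n' x' a = \<zero>\<^bsub>N\<^esub>}"
          unfolding xk' mem_Collect_eq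
        proof (intro exI conjI, rule trans)
          show "?r a = (\<lambda>i\<in>{..<n'}. \<Oplus>\<^bsub>R\<^esub>j\<in>{..<m'}. c (m + j) \<otimes>\<^bsub>R\<^esub> y' j i)"
            unfolding c(2) by (rule relw(2)[of c, OF ac[OF c(1)]])
          show "(\<lambda>j\<in>{..<m'}. c (m + j)) \<in> coeff_vectors R m'" using ac[OF c(1)] by (auto simp: coeff_vectors_def)
          show "(\<lambda>i\<in>{..<n'}. \<Oplus>\<^bsub>R\<^esub>j\<in>{..<m'}. c (m + j) \<otimes>\<^bsub>R\<^esub> y' j i) = (\<lambda>i\<in>{..<n'}. \<Oplus>\<^bsub>R\<^esub>j\<in>{..<m'}. (\<lambda>j\<in>{..<m'}. c (m + j)) j \<otimes>\<^bsub>R\<^esub> y' j i)"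
            by (rule restrict_ext, rule S.R.finsum_cong') (use ac[OF c(1)] yc' in auto)
        qed
        ultimately have "lin_comb S (n + n') z a = \<zero>\<^bsub>S\<^esub>"
          using inj[OF Lc[OF a] S.M.zero_closed] pl[OF a] ql[OF a] p0 q0 by simp
        then show "a \<in> ?K" using a by simp
      qed
    qed
  qed
qed

section \<open>Locally constant functions and continuous actions\<close>

definition locally_constant :: "'g topology \<Rightarrow> ('g \<Rightarrow> 'b) \<Rightarrow> bool" where
  "locally_constant T f \<longleftrightarrow> (\<forall>x\<in>topspace T. \<exists>U. openin T U \<and> x \<in> U \<and> (\<forall>y\<in>U. f y = f x))"

lemma continuous_map_discrete_iff:
  "continuous_map T (discrete_topology S) f \<longleftrightarrow> f ` topspace T \<subseteq> S \<and> locally_constant T f"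
proof
  assume c: "continuous_map T (discrete_topology S) f"
  have "\<exists>U. openin T U \<and> x \<in> U \<and> (\<forall>y\<in>U. f y = f x)" if x: "x \<in> topspace T" for x
  proof (intro exI conjI)
    have "f x \<in> S" using continuous_map_image_subset_topspace[OF c] x by auto
    then show "openin T {y \<in> topspace T. f y \<in> {f x}}"
      using c unfolding continuous_map by (metis openin_discrete_topology empty_subsetI insert_subset)
  qed (use x in auto)
  then show "f ` topspace T \<subseteq> S \<and> locally_constant T f"
    using continuous_map_image_subset_topspace[OF c] unfolding locally_constant_def by auto
next
  assume f: "f ` topspace T \<subseteq> S \<and> locally_constant T f"
  have "openin T {x \<in> topspace T. f x \<in> U}" for U
  proof (subst openin_subopen, intro ballI)
    fix x assume x: "x \<in> {x \<in> topspace T. f x \<in> U}"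
    then obtain V where V: "openin T V" "x \<in> V" "\<forall>y\<in>V. f y = f x"
      using f unfolding locally_constant_def by blast
    have "y \<in> {x \<in> topspace T. f x \<in> U}" if y: "y \<in> V" for y
      using bspec[OF V(3) y] x openin_subset[OF V(1)] y by auto
    then have "V \<subseteq> {x \<in> topspace T. f x \<in> U}" by blast
    then show "\<exists>V. openin T V \<and> x \<in> V \<and> V \<subseteq> {x \<in> topspace T. f x \<in> U}" using V by blast
  qed
  then show "continuous_map T (discrete_topology S) f"
    using f unfolding continuous_map by auto
qed

text \<open>On a discrete set joint continuity can be tested on one element at a time, because
  singletons are open. For a group action this says that stabilizers are open.\<close>

lemma continuous_map_prod_discrete_iff:
  "continuous_map (prod_topology T (discrete_topology S)) (discrete_topology S) (\<lambda>(g, x). a g x)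
    \<longleftrightarrow> (\<forall>x\<in>S. (\<forall>g\<in>topspace T. a g x \<in> S) \<and> locally_constant T (\<lambda>g. a g x))"
proof
  assume c: "continuous_map (prod_topology T (discrete_topology S)) (discrete_topology S) (\<lambda>(g, x). a g x)"
  show "\<forall>x\<in>S. (\<forall>g\<in>topspace T. a g x \<in> S) \<and> locally_constant T (\<lambda>g. a g x)"
  proof
    fix x assume "x \<in> S"
    then have "continuous_map T (prod_topology T (discrete_topology S)) (\<lambda>g. (g, x))"
      by (simp add: continuous_map_paired)
    from continuous_map_compose[OF this c] have "continuous_map T (discrete_topology S) (\<lambda>g. a g x)"
      by (simp add: o_def)
    then show "(\<forall>g\<in>topspace T. a g x \<in> S) \<and> locally_constant T (\<lambda>g. a g x)"
      unfolding continuous_map_discrete_iff by auto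
  qed
next
  assume a: "\<forall>x\<in>S. (\<forall>g\<in>topspace T. a g x \<in> S) \<and> locally_constant T (\<lambda>g. a g x)"
  show "continuous_map (prod_topology T (discrete_topology S)) (discrete_topology S) (\<lambda>(g, x). a g x)"
    unfolding continuous_map_discrete_iff locally_constant_def
  proof (intro conjI ballI)
    have "a g x \<in> S" if "g \<in> topspace T" "x \<in> S" for g x using a that by blast
    then show "(\<lambda>(g, x). a g x) ` topspace (prod_topology T (discrete_topology S)) \<subseteq> S" by auto
    fix z assume z: "z \<in> topspace (prod_topology T (discrete_topology S))"
    obtain g x where gx: "z = (g, x)" "g \<in> topspace T" "x \<in> S" using z by auto
    have "locally_constant T (\<lambda>g. a g x)" using bspec[OF a gx(3)] by (rule conjunct2)
    then obtain U where U: "openin T U" "g \<in> U" "\<forall>h\<in>U. a h x = a g x"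
      using gx(2) unfolding locally_constant_def by blast
    have "openin (prod_topology T (discrete_topology S)) (U \<times> {x})"
      using U gx by (simp add: openin_prod_Times_iff)
    moreover have "z \<in> U \<times> {x}" using U gx by simp
    moreover have "(case y of (g, x) \<Rightarrow> a g x) = (case z of (g, x) \<Rightarrow> a g x)" if yU: "y \<in> U \<times> {x}" for y
    proof -
      obtain h where h: "y = (h, x)" "h \<in> U" using yU by blast
      show ?thesis unfolding h(1) gx(1) case_prod_conv by (rule bspec[OF U(3) h(2)])
    qed
    ultimately show "\<exists>U. openin (prod_topology T (discrete_topology S)) U \<and> z \<in> U
        \<and> (\<forall>y\<in>U. (case y of (g, x) \<Rightarrow> a g x) = (case z of (g, x) \<Rightarrow> a g x))"
      by blast
  qed
qed

text \<open>Used to derive the continuity of an action from finitely many locally constant data that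
  determine it, such as a matrix and the coordinates of a vector.\<close>

lemma locally_constant_factor:
  assumes "locally_constant T f" "\<And>x y. x \<in> topspace T \<Longrightarrow> y \<in> topspace T \<Longrightarrow> f x = f y \<Longrightarrow> h x = h y"
  shows "locally_constant T h"
  unfolding locally_constant_def
proof
  fix x assume x: "x \<in> topspace T"
  then obtain U where U: "openin T U" "x \<in> U" "\<forall>y\<in>U. f y = f x"
    using assms(1) unfolding locally_constant_def by blast
  have "h y = h x" if y: "y \<in> U" for y
    by (rule assms(2)[OF subsetD[OF openin_subset[OF U(1)] y] x bspec[OF U(3) y]])
  then show "\<exists>U. openin T U \<and> x \<in> U \<and> (\<forall>y\<in>U. h y = h x)" using U by blast
qed

lemma locally_constant_pair:
  assumes "locally_constant T f" "locally_constant T g"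
  shows "locally_constant T (\<lambda>x. (f x, g x))"
  unfolding locally_constant_def
proof
  fix x assume x: "x \<in> topspace T"
  obtain U where U: "openin T U" "x \<in> U" "\<forall>y\<in>U. f y = f x" using assms(1) x unfolding locally_constant_def by blast
  obtain V where V: "openin T V" "x \<in> V" "\<forall>y\<in>V. g y = g x" using assms(2) x unfolding locally_constant_def by blast
  have "(f y, g y) = (f x, g x)" if y: "y \<in> U \<inter> V" for y
    using bspec[OF U(3) IntD1[OF y]] bspec[OF V(3) IntD2[OF y]] by (rule arg_cong2)
  then show "\<exists>U. openin T U \<and> x \<in> U \<and> (\<forall>y\<in>U. (f y, g y) = (f x, g x))"
    using openin_Int[OF U(1) V(1)] U(2) V(2) by blast
qed

lemma locally_constant_map:
  "(\<And>j. j < (d::nat) \<Longrightarrow> locally_constant T (f j)) \<Longrightarrow> locally_constant T (\<lambda>x. map (\<lambda>j. f j x) [0..<d])"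
proof (induction d)
  case 0
  then show ?case by (auto simp: locally_constant_def)
next
  case (Suc d)
  have "locally_constant T (\<lambda>x. (map (\<lambda>j. f j x) [0..<d], f d x))"
    using Suc by (intro locally_constant_pair) auto
  then show ?case by (rule locally_constant_factor) simp
qed

section \<open>Tuples in the module universe\<close>

definition mk :: "nat \<Rightarrow> (nat \<Rightarrow> 'a muniv) \<Rightarrow> 'a muniv" where
  "mk d f = tup (map f [0..<d])"

definition co :: "nat \<Rightarrow> nat \<Rightarrow> 'a muniv \<Rightarrow> 'a muniv" where
  "co d i u = untup d u ! i"

lemma untup_mk: "untup d (mk d f) = map f [0..<d]"
  unfolding mk_def by (rule untup_tup) simp

lemma co_mk [simp]: "i < d \<Longrightarrow> co d i (mk d f) = f i"
  by (simp add: co_def untup_mk)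

lemma mk_cong: "(\<And>i. i < d \<Longrightarrow> f i = g i) \<Longrightarrow> mk d f = mk d g"
  unfolding mk_def by (auto intro!: arg_cong[where f = tup])

lemma tup_image:
  "tup ` {xs. length xs = d \<and> set xs \<subseteq> A} = mk d ` {f. \<forall>i<d. f i \<in> A}"
proof (intro equalityI subsetI)
  fix u assume "u \<in> tup ` {xs. length xs = d \<and> set xs \<subseteq> A}"
  then obtain xs where xs: "u = tup xs" "length xs = d" "set xs \<subseteq> A" by blast
  have "u = mk d (\<lambda>i. xs ! i)" unfolding mk_def xs(1) using xs(2) map_nth[of xs] by simp
  then show "u \<in> mk d ` {f. \<forall>i<d. f i \<in> A}" using xs by (auto simp: subset_iff)
next
  fix u assume "u \<in> mk d ` {f. \<forall>i<d. f i \<in> A}"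
  then obtain f where f: "u = mk d f" "\<forall>i<d. f i \<in> A" by blast
  then show "u \<in> tup ` {xs. length xs = d \<and> set xs \<subseteq> A}"
    unfolding mk_def by (intro image_eqI[of _ _ "map f [0..<d]"]) auto
qed

text \<open>The action is a parameter: direct sums act coordinatewise, and where only the module
  structure matters it is left \<open>undefined\<close>.\<close>

definition tuple_module ::
    "nat \<Rightarrow> (nat \<Rightarrow> ('a, 'a muniv, 'g) gmodule) \<Rightarrow> ('g \<Rightarrow> 'a muniv \<Rightarrow> 'a muniv) \<Rightarrow> ('a, 'a muniv, 'g) gmodule" where
  "tuple_module d Ms \<gamma> = \<lparr>carrier = mk d ` {f. \<forall>i<d. f i \<in> carrier (Ms i)},
     monoid.mult = undefined, one = undefined, zero = mk d (\<lambda>i. \<zero>\<^bsub>Ms i\<^esub>),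
     add = (\<lambda>u v. mk d (\<lambda>i. co d i u \<oplus>\<^bsub>Ms i\<^esub> co d i v)),
     smult = (\<lambda>a u. mk d (\<lambda>i. a \<odot>\<^bsub>Ms i\<^esub> co d i u)), gact = \<gamma>\<rparr>"

lemma tuple_module_prod:
  assumes M: "\<And>i. i < d \<Longrightarrow> module R (Ms i)"
  shows "module_prod R d Ms (tuple_module d Ms \<gamma>) (co d)"
proof -
  have z: "\<zero>\<^bsub>Ms i\<^esub> \<in> carrier (Ms i)" and a: "x \<in> carrier (Ms i) \<Longrightarrow> y \<in> carrier (Ms i) \<Longrightarrow> x \<oplus>\<^bsub>Ms i\<^esub> y \<in> carrier (Ms i)"
    and s: "r \<in> carrier R \<Longrightarrow> x \<in> carrier (Ms i) \<Longrightarrow> r \<odot>\<^bsub>Ms i\<^esub> x \<in> carrier (Ms i)" if "i < d" for i x y r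
    using M[OF that] by (auto simp: module_def abelian_group_def abelian_monoid.zero_closed abelian_monoid.a_closed
        module_axioms_def)
  show ?thesis
    unfolding module_prod_def tuple_module_def
    by (auto simp: z a s intro!: mk_cong imageI)
qed

text \<open>By the convention of \<open>tup\<close> and \<open>untup\<close>, \<open>Tup []\<close>
  stands for the tuple of any length with all entries \<open>Tup []\<close>, so the zero module is
  its own power for every \<open>d\<close>.\<close>

lemma zero_gmodule_prod: "module_prod R d (\<lambda>_. zero_gmodule) zero_gmodule (co d)"
  by (auto simp: module_prod_def zero_gmodule_def co_def untup_def)

lemma zero_module: "cring R \<Longrightarrow> module R zero_gmodule"
proof (rule moduleI)
  show "abelian_group zero_gmodule"
    by (rule abelian_groupI) (auto simp: zero_gmodule_def)
qed (auto simp: zero_gmodule_def)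

lemma finitely_presented_trivial:
  assumes R: "cring R" and S: "module R S" "carrier S = {\<zero>\<^bsub>S\<^esub>}"
  shows "finitely_presented R S"
proof -
  interpret S: module R S by fact
  have c0: "coeff_vectors R 0 = {\<lambda>_. undefined}" by (simp add: coeff_vectors_def)
  have l0: "lin_comb S 0 x a = \<zero>\<^bsub>S\<^esub>" for x a by (simp add: lin_comb_def)
  show ?thesis
    unfolding finitely_presented_def
  proof (intro exI conjI)
    show "undefined \<in> {..<0::nat} \<rightarrow> carrier S" "undefined \<in> {..<0::nat} \<rightarrow> coeff_vectors R 0" by auto
    show "lin_comb S 0 undefined ` coeff_vectors R 0 = carrier S" by (simp add: c0 l0 S(2))
    show "{a \<in> coeff_vectors R 0. lin_comb S 0 undefined a = \<zero>\<^bsub>S\<^esub>}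
         = {\<lambda>i\<in>{..<0}. \<Oplus>\<^bsub>R\<^esub>j\<in>{..<0}. c j \<otimes>\<^bsub>R\<^esub> undefined j i | c. c \<in> coeff_vectors R 0}"
      by (auto simp: c0 l0 restrict_def)
  qed
qed

text \<open>Induction that splits off the last factor. The intermediate product of the first
  \<open>d\<close> factors is a \<open>tuple_module\<close>, whatever form \<open>S\<close>
  has.\<close>

lemma finitely_presented_prod:
  fixes Ms :: "nat \<Rightarrow> ('a, 'a muniv, 'g) gmodule" and S :: "('a, 'a muniv, 'g) gmodule"
  assumes R: "cring R" and P: "module_prod R d Ms S c" and M: "\<And>i. i < d \<Longrightarrow> module R (Ms i)"
    "\<And>i. i < d \<Longrightarrow> finitely_presented R (Ms i)"
  shows "finitely_presented R S"
  using P M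
proof (induction d arbitrary: S c)
  case 0
  have "carrier S = {\<zero>\<^bsub>S\<^esub>}" using module_prodD(1,5)[OF 0(1)] by blast
  then show ?case using finitely_presented_trivial[OF R] module_prod_module[OF 0(1) R] by simp
next
  case (Suc d)
  let ?T = "tuple_module d Ms undefined"
  have T: "module_prod R d Ms ?T (co d)" by (rule tuple_module_prod) (use Suc in auto)
  note D = module_prodD[OF Suc.prems(1)] and TD = module_prodD[OF T]
  have fT: "finitely_presented R ?T" by (rule Suc.IH[OF T]) (use Suc.prems in auto)
  have mT: "module R ?T" by (rule module_prod_module[OF T R]) (use Suc.prems in auto)
  have Tin: "mk d f \<in> carrier ?T" if "\<And>i. i < d \<Longrightarrow> f i \<in> carrier (Ms i)" for f
    using that by (auto simp: tuple_module_def)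
  show ?case
  proof (rule finitely_presented_sum[OF module_prod_module[OF Suc.prems(1) R] mT])
    show "module R (Ms d)" "finitely_presented R ?T" "finitely_presented R (Ms d)"
      using Suc.prems fT by auto
    show "linear_on R S ?T (\<lambda>u. mk d (\<lambda>i. c i u))"
      unfolding linear_on_def
    proof (intro conjI ballI)
      show "mk d (\<lambda>i. c i u) \<in> carrier ?T" if "u \<in> carrier S" for u
        using D(3)[OF that] by (intro Tin) auto
      show "mk d (\<lambda>i. c i (u \<oplus>\<^bsub>S\<^esub> v)) = mk d (\<lambda>i. c i u) \<oplus>\<^bsub>?T\<^esub> mk d (\<lambda>i. c i v)"
        if "u \<in> carrier S" "v \<in> carrier S" for u v
        using D(7)[OF that] by (auto simp: tuple_module_def intro!: mk_cong)
      show "mk d (\<lambda>i. c i (a \<odot>\<^bsub>S\<^esub> u)) = a \<odot>\<^bsub>?T\<^esub> mk d (\<lambda>i. c i u)"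
        if "a \<in> carrier R" "u \<in> carrier S" for a u
        using D(9)[OF that] by (auto simp: tuple_module_def intro!: mk_cong)
    qed
    show "linear_on R S (Ms d) (c d)"
      unfolding linear_on_def using D(3,7,9) by auto
    show "\<exists>u\<in>carrier S. mk d (\<lambda>i. c i u) = x \<and> c d u = y" if x: "x \<in> carrier ?T" and y: "y \<in> carrier (Ms d)" for x y
    proof -
      obtain f where f: "x = mk d f" "\<forall>i<d. f i \<in> carrier (Ms i)" using x by (auto simp: tuple_module_def)
      have "\<exists>u\<in>carrier S. \<forall>i<Suc d. c i u = (if i < d then f i else y)"
        by (rule D(4)) (use f y in \<open>auto simp: less_Suc_eq\<close>)
      then obtain u where u: "u \<in> carrier S" "\<forall>i<Suc d. c i u = (if i < d then f i else y)" by blast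
      then have "mk d (\<lambda>i. c i u) = x" "c d u = y" unfolding f(1) by (auto intro!: mk_cong)
      then show ?thesis using u(1) by blast
    qed
    show "u = v" if "u \<in> carrier S" "v \<in> carrier S" "mk d (\<lambda>i. c i u) = mk d (\<lambda>i. c i v)" "c d u = c d v" for u v
    proof (rule D(5)[OF that(1,2)])
      fix i assume "i < Suc d"
      then show "c i u = c i v"
        using that(4) arg_cong[OF that(3), of "co d i"] by (cases "i = d") auto
    qed
  qed (use Suc.prems(2) in blast)
qed

lemma gmodulesI:
  assumes "module R M" "finitely_presented R M"
    "\<And>g x. g \<in> carrier G \<Longrightarrow> x \<in> carrier M \<Longrightarrow> gact M g x \<in> carrier M"
    "\<And>x. x \<in> carrier M \<Longrightarrow> gact M \<one>\<^bsub>G\<^esub> x = x"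
    "\<And>g h x. g \<in> carrier G \<Longrightarrow> h \<in> carrier G \<Longrightarrow> x \<in> carrier M \<Longrightarrow> gact M (g \<otimes>\<^bsub>G\<^esub> h) x = gact M g (gact M h x)"
    "\<And>g x y. g \<in> carrier G \<Longrightarrow> x \<in> carrier M \<Longrightarrow> y \<in> carrier M \<Longrightarrow> gact M g (x \<oplus>\<^bsub>M\<^esub> y) = gact M g x \<oplus>\<^bsub>M\<^esub> gact M g y"
    "\<And>g a x. g \<in> carrier G \<Longrightarrow> a \<in> carrier R \<Longrightarrow> x \<in> carrier M \<Longrightarrow> gact M g (a \<odot>\<^bsub>M\<^esub> x) = ract g a \<odot>\<^bsub>M\<^esub> gact M g x"
    "topspace T = carrier G" "\<And>x. x \<in> carrier M \<Longrightarrow> locally_constant T (\<lambda>g. gact M g x)"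
  shows "M \<in> gmodules G T R ract"
  unfolding gmodules_def mem_Collect_eq continuous_map_prod_discrete_iff using assms by simp

lemma gmodulesD:
  assumes "M \<in> gmodules G T R ract"
  shows "module R M" "finitely_presented R M"
    "\<And>g x. g \<in> carrier G \<Longrightarrow> x \<in> carrier M \<Longrightarrow> gact M g x \<in> carrier M"
    "\<And>x. x \<in> carrier M \<Longrightarrow> gact M \<one>\<^bsub>G\<^esub> x = x"
    "\<And>g h x. g \<in> carrier G \<Longrightarrow> h \<in> carrier G \<Longrightarrow> x \<in> carrier M \<Longrightarrow> gact M (g \<otimes>\<^bsub>G\<^esub> h) x = gact M g (gact M h x)"
    "\<And>g x y. g \<in> carrier G \<Longrightarrow> x \<in> carrier M \<Longrightarrow> y \<in> carrier M \<Longrightarrow> gact M g (x \<oplus>\<^bsub>M\<^esub> y) = gact M g x \<oplus>\<^bsub>M\<^esub> gact M g y"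
    "\<And>g a x. g \<in> carrier G \<Longrightarrow> a \<in> carrier R \<Longrightarrow> x \<in> carrier M \<Longrightarrow> gact M g (a \<odot>\<^bsub>M\<^esub> x) = ract g a \<odot>\<^bsub>M\<^esub> gact M g x"
    "\<And>x. x \<in> carrier M \<Longrightarrow> locally_constant T (\<lambda>g. gact M g x)"
  using assms unfolding gmodules_def mem_Collect_eq continuous_map_prod_discrete_iff by blast+

lemma gmodule_homI:
  assumes "f \<in> extensional (carrier M)" "\<And>x. x \<in> carrier M \<Longrightarrow> f x \<in> carrier N"
    "\<And>x y. x \<in> carrier M \<Longrightarrow> y \<in> carrier M \<Longrightarrow> f (x \<oplus>\<^bsub>M\<^esub> y) = f x \<oplus>\<^bsub>N\<^esub> f y"
    "\<And>a x. a \<in> carrier R \<Longrightarrow> x \<in> carrier M \<Longrightarrow> f (a \<odot>\<^bsub>M\<^esub> x) = a \<odot>\<^bsub>N\<^esub> f x"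
    "\<And>g x. g \<in> carrier G \<Longrightarrow> x \<in> carrier M \<Longrightarrow> f (gact M g x) = gact N g (f x)"
  shows "f \<in> gmodule_hom G R M N"
  unfolding gmodule_hom_def using assms by (auto simp: PiE_iff)

lemma gmodule_homD:
  assumes "f \<in> gmodule_hom G R M N"
  shows "f \<in> extensional (carrier M)" "\<And>x. x \<in> carrier M \<Longrightarrow> f x \<in> carrier N"
    "\<And>x y. x \<in> carrier M \<Longrightarrow> y \<in> carrier M \<Longrightarrow> f (x \<oplus>\<^bsub>M\<^esub> y) = f x \<oplus>\<^bsub>N\<^esub> f y"
    "\<And>a x. a \<in> carrier R \<Longrightarrow> x \<in> carrier M \<Longrightarrow> f (a \<odot>\<^bsub>M\<^esub> x) = a \<odot>\<^bsub>N\<^esub> f x"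
    "\<And>g x. g \<in> carrier G \<Longrightarrow> x \<in> carrier M \<Longrightarrow> f (gact M g x) = gact N g (f x)"
  using assms unfolding gmodule_hom_def by (auto simp: PiE_iff)

section \<open>The category of equivariant modules\<close>

locale equivariant_ring =
  fixes G :: "'g monoid" and T :: "'g topology" and R :: "'a ring" and ract :: "'g \<Rightarrow> 'a \<Rightarrow> 'a"
  assumes G: "group G" and T: "topspace T = carrier G" and R: "cring R"
    and ract_closed: "g \<in> carrier G \<Longrightarrow> a \<in> carrier R \<Longrightarrow> ract g a \<in> carrier R"
begin

abbreviation C where "C \<equiv> Mod_cat G T R ract"

lemma obj_module: "M \<in> obj C \<Longrightarrow> module R M"
  by (simp add: Mod_cat_def gmodules_def)

lemma C_simps: "obj C = gmodules G T R ract" "hm C = gmodule_hom G R" "zob C = zero_gmodule"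
  "cmp C L M N g f = compose (carrier L) g f" "idn C M = (\<lambda>x\<in>carrier M. x)"
  "ses C L M N f g \<longleftrightarrow> f \<in> gmodule_hom G R L M \<and> g \<in> gmodule_hom G R M N
       \<and> inj_on f (carrier L) \<and> g ` carrier M = carrier N \<and> f ` carrier L = {x \<in> carrier M. g x = \<zero>\<^bsub>N\<^esub>}"
  by (simp_all add: Mod_cat_def)

lemma zero_obj: "zero_gmodule \<in> gmodules G T R ract"
proof (rule gmodulesI[OF _ _ _ _ _ _ _ T])
  show "module R zero_gmodule" by (rule zero_module[OF R])
  then show "finitely_presented R zero_gmodule"
    by (rule finitely_presented_trivial[OF R]) (simp add: zero_gmodule_def)
qed (auto simp: zero_gmodule_def locally_constant_def)

lemma hom_idn:
  assumes M: "M \<in> gmodules G T R ract"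
  shows "(\<lambda>x\<in>carrier M. x) \<in> gmodule_hom G R M M"
proof (rule gmodule_homI)
  interpret module R M by (rule gmodulesD(1)[OF M])
  show "(\<lambda>x\<in>carrier M. x) (x \<oplus>\<^bsub>M\<^esub> y) = (\<lambda>x\<in>carrier M. x) x \<oplus>\<^bsub>M\<^esub> (\<lambda>x\<in>carrier M. x) y"
    if "x \<in> carrier M" "y \<in> carrier M" for x y using that by simp
qed (use gmodulesD(3)[OF M] module.smult_closed[OF gmodulesD(1)[OF M]] in auto)

lemma hom_compose:
  assumes f: "f \<in> gmodule_hom G R L M" and g: "g \<in> gmodule_hom G R M N" and L: "L \<in> gmodules G T R ract"
  shows "compose (carrier L) g f \<in> gmodule_hom G R L N"
proof -
  interpret module R L by (rule gmodulesD(1)[OF L])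
  note F = gmodule_homD[OF f] and H = gmodule_homD[OF g]
  show ?thesis
    by (rule gmodule_homI) (use F H gmodulesD(3)[OF L] in \<open>simp_all add: compose_def\<close>)
qed

sublocale wcategory C
proof
  fix L M N K f g h
  assume o: "K \<in> obj C" "L \<in> obj C" "M \<in> obj C" "N \<in> obj C" and h: "f \<in> hm C K L" "g \<in> hm C L M" "h \<in> hm C M N"
  show "cmp C K L N (cmp C L M N h g) f = cmp C K M N h (cmp C K L M g f)"
    using gmodule_homD(2)[of f G R K L] h by (auto simp: C_simps compose_def fun_eq_iff restrict_def)
next
  fix L M f assume "L \<in> obj C" "M \<in> obj C" and f: "f \<in> hm C L M"
  then show "cmp C L M M (idn C M) f = f" "cmp C L L M f (idn C L) = f"
    using gmodule_homD(1,2)[of f G R L M] by (auto simp: C_simps compose_def fun_eq_iff restrict_def extensional_def)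
next
  show "ses C (zob C) (zob C) (zob C) (idn C (zob C)) (idn C (zob C))"
    using hom_idn[OF zero_obj] by (auto simp: C_simps zero_gmodule_def)
qed (auto simp: C_simps zero_obj hom_idn hom_compose)

text \<open>The inverse function respects all the structure automatically; it is restricted to the
  carrier because morphisms are extensional.\<close>

lemma iso_inI:
  assumes M: "M \<in> gmodules G T R ract" and f: "f \<in> gmodule_hom G R M N" and b: "bij_betw f (carrier M) (carrier N)"
  shows "iso_in C M N f"
proof -
  interpret M: module R M by (rule gmodulesD(1)[OF M])
  note F = gmodule_homD[OF f] and MD = gmodulesD[OF M]
  let ?g = "\<lambda>y\<in>carrier N. the_inv_into (carrier M) f y"
  have inj: "inj_on f (carrier M)" and im: "f ` carrier M = carrier N" using b by (auto simp: bij_betw_def)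
  have g: "?g (f x) = x" if "x \<in> carrier M" for x
    using the_inv_into_f_f[OF inj that] F(2)[OF that] by simp
  have fg: "\<exists>x\<in>carrier M. y = f x" if "y \<in> carrier N" for y using im that by blast
  have "?g \<in> gmodule_hom G R N M"
  proof (rule gmodule_homI)
    fix y assume "y \<in> carrier N"
    then obtain x where x: "x \<in> carrier M" "y = f x" using fg by blast
    show "?g y \<in> carrier M" using g x by simp
    show "?g (a \<odot>\<^bsub>N\<^esub> y) = a \<odot>\<^bsub>M\<^esub> ?g y" if "a \<in> carrier R" for a
      using g[of "a \<odot>\<^bsub>M\<^esub> x"] F(4)[OF that x(1)] g[OF x(1)] that x by (simp del: restrict_apply)
    show "?g (gact N h y) = gact M h (?g y)" if "h \<in> carrier G" for h
      using g[of "gact M h x"] F(5)[OF that x(1)] g[OF x(1)] MD(3)[OF that x(1)] x by (simp del: restrict_apply)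
  next
    fix y z assume "y \<in> carrier N" "z \<in> carrier N"
    then obtain x w where x: "x \<in> carrier M" "y = f x" "w \<in> carrier M" "z = f w" using fg by blast
    then show "?g (y \<oplus>\<^bsub>N\<^esub> z) = ?g y \<oplus>\<^bsub>M\<^esub> ?g z"
      using g[of "x \<oplus>\<^bsub>M\<^esub> w"] F(3)[OF x(1,3)] g[OF x(1)] g[OF x(3)] by (simp del: restrict_apply)
  qed auto
  moreover have "compose (carrier M) ?g f = (\<lambda>x\<in>carrier M. x)"
    using g by (auto simp: compose_def fun_eq_iff restrict_def F(2))
  moreover have "compose (carrier N) f ?g = (\<lambda>x\<in>carrier N. x)"
    unfolding compose_def
  proof (rule restrict_ext)
    fix y assume "y \<in> carrier N"
    then obtain x where "x \<in> carrier M" "y = f x" using fg by blast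
    then show "f (?g y) = y" using g by (simp only:)
  qed
  ultimately show ?thesis unfolding iso_in_def using f by (auto simp: C_simps)
qed

end

text \<open>Preimages are chosen in each coordinate and assembled to an element of the
  product.\<close>

lemma prod_hom_ses:
  assumes P: "module_prod R d Ls SL cl" "module_prod R d Ms SM cm" "module_prod R d Ns SN cn"
    and f: "\<And>u. u \<in> carrier SL \<Longrightarrow> f u \<in> carrier SM" "\<And>u i. u \<in> carrier SL \<Longrightarrow> i < d \<Longrightarrow> cm i (f u) = fs i (cl i u)"
    and g: "\<And>u. u \<in> carrier SM \<Longrightarrow> g u \<in> carrier SN" "\<And>u i. u \<in> carrier SM \<Longrightarrow> i < d \<Longrightarrow> cn i (g u) = gs i (cm i u)"
    and inj: "\<And>i. i < d \<Longrightarrow> inj_on (fs i) (carrier (Ls i))"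
    and surj: "\<And>i. i < d \<Longrightarrow> gs i ` carrier (Ms i) = carrier (Ns i)"
    and ker: "\<And>i. i < d \<Longrightarrow> fs i ` carrier (Ls i) = {x \<in> carrier (Ms i). gs i x = \<zero>\<^bsub>Ns i\<^esub>}"
  shows "inj_on f (carrier SL)" "g ` carrier SM = carrier SN"
    "f ` carrier SL = {x \<in> carrier SM. g x = \<zero>\<^bsub>SN\<^esub>}"
proof -
  note L = module_prodD[OF P(1)] and M = module_prodD[OF P(2)] and N = module_prodD[OF P(3)]
  show "inj_on f (carrier SL)"
  proof (rule inj_onI)
    fix u v assume uv: "u \<in> carrier SL" "v \<in> carrier SL" "f u = f v"
    show "u = v"
    proof (rule L(5)[OF uv(1,2)])
      fix i assume i: "i < d"
      have "fs i (cl i u) = fs i (cl i v)" using f(2)[OF uv(1) i] f(2)[OF uv(2) i] uv(3) by simp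
      then show "cl i u = cl i v" using inj[OF i] L(3) uv i by (meson inj_onD)
    qed
  qed
  show "g ` carrier SM = carrier SN"
  proof
    show "g ` carrier SM \<subseteq> carrier SN" using g(1) by blast
    show "carrier SN \<subseteq> g ` carrier SM"
    proof
      fix v assume v: "v \<in> carrier SN"
      have "\<exists>x. \<forall>i<d. x i \<in> carrier (Ms i) \<and> gs i (x i) = cn i v"
        using surj N(3)[OF v] by (intro choice) (metis imageE)
      then obtain x where x: "\<forall>i<d. x i \<in> carrier (Ms i) \<and> gs i (x i) = cn i v" by blast
      obtain u where u: "u \<in> carrier SM" "\<forall>i<d. cm i u = x i" using M(4)[of x] x by blast
      have "v = g u" by (rule N(5)[OF v g(1)[OF u(1)]]) (use u x g(2) in simp)
      then show "v \<in> g ` carrier SM" using u by blast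
    qed
  qed
  show "f ` carrier SL = {x \<in> carrier SM. g x = \<zero>\<^bsub>SN\<^esub>}"
  proof
    show "f ` carrier SL \<subseteq> {x \<in> carrier SM. g x = \<zero>\<^bsub>SN\<^esub>}"
    proof
      fix v assume "v \<in> f ` carrier SL"
      then obtain u where u: "u \<in> carrier SL" "v = f u" by blast
      have "g v = \<zero>\<^bsub>SN\<^esub>"
      proof (rule N(5))
        fix i assume i: "i < d"
        have "fs i (cl i u) \<in> {x \<in> carrier (Ms i). gs i x = \<zero>\<^bsub>Ns i\<^esub>}"
          using ker[OF i] L(3)[OF u(1) i] by blast
        then show "cn i (g v) = cn i \<zero>\<^bsub>SN\<^esub>"
          using g(2)[OF f(1)[OF u(1)] i] f(2)[OF u(1) i] N(2)[OF i] u(2) by simp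
      qed (use u f g N(1) in auto)
      then show "v \<in> {x \<in> carrier SM. g x = \<zero>\<^bsub>SN\<^esub>}" using u f by auto
    qed
    show "{x \<in> carrier SM. g x = \<zero>\<^bsub>SN\<^esub>} \<subseteq> f ` carrier SL"
    proof
      fix v assume v: "v \<in> {x \<in> carrier SM. g x = \<zero>\<^bsub>SN\<^esub>}"
      have "\<exists>y\<in>carrier (Ls i). fs i y = cm i v" if i: "i < d" for i
      proof -
        have "gs i (cm i v) = \<zero>\<^bsub>Ns i\<^esub>" using g(2)[of v i] v i N(2)[OF i] by simp
        then have "cm i v \<in> fs i ` carrier (Ls i)" using ker[OF i] M(3)[of v i] v i by simp
        then show ?thesis by (metis imageE)
      qed
      then have "\<exists>x. \<forall>i<d. x i \<in> carrier (Ls i) \<and> fs i (x i) = cm i v"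
        by (intro choice) blast
      then obtain x where x: "\<forall>i<d. x i \<in> carrier (Ls i) \<and> fs i (x i) = cm i v" by blast
      obtain u where u: "u \<in> carrier SL" "\<forall>i<d. cl i u = x i" using L(4)[of x] x by blast
      have "v = f u" by (rule M(5)) (use u x f v in auto)
      then show "v \<in> f ` carrier SL" using u by blast
    qed
  qed
qed

section \<open>Coordinate criteria and direct sums of equivariant modules\<close>

context equivariant_ring
begin

lemma gmodule_homI_coords:
  assumes P: "module_prod R d Ns S c" and M: "M \<in> gmodules G T R ract" and S: "S \<in> gmodules G T R ract"
    and f: "f \<in> extensional (carrier M)" "\<And>x. x \<in> carrier M \<Longrightarrow> f x \<in> carrier S"
    "\<And>i x y. i < d \<Longrightarrow> x \<in> carrier M \<Longrightarrow> y \<in> carrier M \<Longrightarrow> c i (f (x \<oplus>\<^bsub>M\<^esub> y)) = c i (f x) \<oplus>\<^bsub>Ns i\<^esub> c i (f y)"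
    "\<And>i a x. i < d \<Longrightarrow> a \<in> carrier R \<Longrightarrow> x \<in> carrier M \<Longrightarrow> c i (f (a \<odot>\<^bsub>M\<^esub> x)) = a \<odot>\<^bsub>Ns i\<^esub> c i (f x)"
    "\<And>i g x. i < d \<Longrightarrow> g \<in> carrier G \<Longrightarrow> x \<in> carrier M \<Longrightarrow> c i (f (gact M g x)) = c i (gact S g (f x))"
  shows "f \<in> gmodule_hom G R M S"
proof -
  note D = module_prodD[OF P]
  interpret module R M by (rule gmodulesD(1)[OF M])
  show ?thesis
  proof (rule gmodule_homI[OF f(1,2)])
    show "f (x \<oplus>\<^bsub>M\<^esub> y) = f x \<oplus>\<^bsub>S\<^esub> f y" if "x \<in> carrier M" "y \<in> carrier M" for x y
      by (rule D(5)) (use that f(2,3) D(6,7) in auto)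
    show "f (a \<odot>\<^bsub>M\<^esub> x) = a \<odot>\<^bsub>S\<^esub> f x" if "a \<in> carrier R" "x \<in> carrier M" for a x
      by (rule D(5)) (use that f(2,4) D(8,9) in auto)
    show "f (gact M g x) = gact S g (f x)" if "g \<in> carrier G" "x \<in> carrier M" for g x
      by (rule D(5)) (use that f(2,5) gmodulesD(3)[OF M] gmodulesD(3)[OF S] in auto)
  qed
qed

text \<open>The remaining axioms are equations or local constancy, which can be read off the
  finitely many coordinates; finite presentation comes from
  \<open>finitely_presented_prod\<close>.\<close>

lemma gmodulesI_coords:
  fixes Ms :: "nat \<Rightarrow> ('a, 'a muniv, 'g) gmodule" and S :: "('a, 'a muniv, 'g) gmodule"
  assumes P: "module_prod R d Ms S c" and M: "\<And>i. i < d \<Longrightarrow> Ms i \<in> gmodules G T R ract"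
    and act: "\<And>g u. g \<in> carrier G \<Longrightarrow> u \<in> carrier S \<Longrightarrow> gact S g u \<in> carrier S"
    "\<And>i u. i < d \<Longrightarrow> u \<in> carrier S \<Longrightarrow> c i (gact S \<one>\<^bsub>G\<^esub> u) = c i u"
    "\<And>i g h u. i < d \<Longrightarrow> g \<in> carrier G \<Longrightarrow> h \<in> carrier G \<Longrightarrow> u \<in> carrier S \<Longrightarrow> c i (gact S (g \<otimes>\<^bsub>G\<^esub> h) u) = c i (gact S g (gact S h u))"
    "\<And>i g u v. i < d \<Longrightarrow> g \<in> carrier G \<Longrightarrow> u \<in> carrier S \<Longrightarrow> v \<in> carrier S
        \<Longrightarrow> c i (gact S g (u \<oplus>\<^bsub>S\<^esub> v)) = c i (gact S g u) \<oplus>\<^bsub>Ms i\<^esub> c i (gact S g v)"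
    "\<And>i g a u. i < d \<Longrightarrow> g \<in> carrier G \<Longrightarrow> a \<in> carrier R \<Longrightarrow> u \<in> carrier S
        \<Longrightarrow> c i (gact S g (a \<odot>\<^bsub>S\<^esub> u)) = ract g a \<odot>\<^bsub>Ms i\<^esub> c i (gact S g u)"
    and lc: "\<And>i u. i < d \<Longrightarrow> u \<in> carrier S \<Longrightarrow> locally_constant T (\<lambda>g. c i (gact S g u))"
  shows "S \<in> gmodules G T R ract"
proof -
  note D = module_prodD[OF P]
  interpret G: group G by (rule G)
  have m: "module R S" by (rule module_prod_module[OF P R]) (use M gmodulesD(1) in blast)
  show ?thesis
  proof (rule gmodulesI[OF m _ act(1) _ _ _ _ T])
    show "finitely_presented R S"
      by (rule finitely_presented_prod[OF R P]) (use M gmodulesD(1,2) in blast)+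
    show "gact S \<one>\<^bsub>G\<^esub> u = u" if "u \<in> carrier S" for u
      by (rule D(5)) (use that act(1,2) in auto)
    show "gact S (g \<otimes>\<^bsub>G\<^esub> h) u = gact S g (gact S h u)" if "g \<in> carrier G" "h \<in> carrier G" "u \<in> carrier S" for g h u
      by (rule D(5)) (use that act(1,3) in auto)
    show "gact S g (u \<oplus>\<^bsub>S\<^esub> v) = gact S g u \<oplus>\<^bsub>S\<^esub> gact S g v" if "g \<in> carrier G" "u \<in> carrier S" "v \<in> carrier S" for g u v
      by (rule D(5)) (use that act(1,4) D(6,7) in auto)
    show "gact S g (a \<odot>\<^bsub>S\<^esub> u) = ract g a \<odot>\<^bsub>S\<^esub> gact S g u" if "g \<in> carrier G" "a \<in> carrier R" "u \<in> carrier S" for g a u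
      by (rule D(5)) (use that act(1,5) D(8,9) ract_closed in auto)
    show "locally_constant T (\<lambda>g. gact S g u)" if u: "u \<in> carrier S" for u
    proof (rule locally_constant_factor)
      show "locally_constant T (\<lambda>g. map (\<lambda>i. c i (gact S g u)) [0..<d])"
        by (rule locally_constant_map) (use lc u in auto)
      fix g h assume gh: "g \<in> topspace T" "h \<in> topspace T"
        "map (\<lambda>i. c i (gact S g u)) [0..<d] = map (\<lambda>i. c i (gact S h u)) [0..<d]"
      show "gact S g u = gact S h u"
        by (rule D(5)) (use gh u act(1) T in auto)
    qed
  qed
qed

text \<open>The zero object is a special case because exact functors have to preserve it on the nose.\<close>

definition dsum :: "('a, 'a muniv, 'g) gmodule \<Rightarrow> ('a, 'a muniv, 'g) gmodule \<Rightarrow> ('a, 'a muniv, 'g) gmodule" where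
  "dsum M N = (if M = zero_gmodule \<and> N = zero_gmodule then zero_gmodule
     else tuple_module 2 (\<lambda>i. if i = 0 then M else N) (\<lambda>g u. mk 2 (\<lambda>i. gact (if i = 0 then M else N) g (co 2 i u))))"

definition dsum_mor :: "('a, 'a muniv, 'g) gmodule \<Rightarrow> ('a, 'a muniv, 'g) gmodule \<Rightarrow> ('a, 'a muniv, 'g) gmodule \<Rightarrow> ('a, 'a muniv, 'g) gmodule
    \<Rightarrow> ('a muniv \<Rightarrow> 'a muniv) \<Rightarrow> ('a muniv \<Rightarrow> 'a muniv) \<Rightarrow> 'a muniv \<Rightarrow> 'a muniv" where
  "dsum_mor M N M' N' f f' = (\<lambda>u\<in>carrier (dsum M M'). mk 2 (\<lambda>i. (if i = 0 then f else f') (co 2 i u)))"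

lemma mk_zero: "mk d (\<lambda>_. Tup []) = Tup []"
  by (auto simp: mk_def tup_def)

text \<open>The special case fits the same formula because \<open>mk 2\<close> sends the pair with
  both entries \<open>Tup []\<close> to \<open>Tup []\<close>.\<close>

lemma dsum_carrier: "carrier (dsum M N) = mk 2 ` {f. f 0 \<in> carrier M \<and> f 1 \<in> carrier N}"
proof -
  have "(\<forall>i<2. f i \<in> carrier (if i = 0 then M else N)) \<longleftrightarrow> f 0 \<in> carrier M \<and> f 1 \<in> carrier N" for f :: "nat \<Rightarrow> 'a muniv"
    by (auto simp: less_2_cases_iff)
  moreover have "carrier (zero_gmodule :: ('a, 'a muniv, 'g) gmodule)
      = mk 2 ` {f. f 0 \<in> carrier (zero_gmodule :: ('a, 'a muniv, 'g) gmodule) \<and> f 1 \<in> carrier (zero_gmodule :: ('a, 'a muniv, 'g) gmodule)}"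
  proof -
    have "mk 2 f = Tup []" if "f 0 = Tup []" "f 1 = Tup []" for f :: "nat \<Rightarrow> 'a muniv"
    proof -
      have "mk 2 f = mk 2 (\<lambda>_. Tup [])" by (rule mk_cong) (use that in \<open>auto simp: less_2_cases_iff\<close>)
      then show ?thesis by (simp add: mk_zero)
    qed
    then show ?thesis by (auto simp: zero_gmodule_def intro!: image_eqI[of _ _ "\<lambda>_. Tup []"])
  qed
  ultimately show ?thesis by (simp add: dsum_def tuple_module_def)
qed

lemma dsum_in: "x \<in> carrier M \<Longrightarrow> y \<in> carrier N \<Longrightarrow> mk 2 (\<lambda>i. if i = 0 then x else y) \<in> carrier (dsum M N)"
  unfolding dsum_carrier by (rule imageI) simp

lemma dsum_prod:
  assumes "module R M" "module R N"
  shows "module_prod R 2 (\<lambda>i. if i = 0 then M else N) (dsum M N) (co 2)"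
proof (cases "M = zero_gmodule \<and> N = zero_gmodule")
  case True
  then have "(\<lambda>i::nat. if i = 0 then M else N) = (\<lambda>_. zero_gmodule)" by auto
  then show ?thesis using zero_gmodule_prod[of R 2] True by (simp add: dsum_def)
next
  case False
  then show ?thesis using tuple_module_prod[of 2 R "\<lambda>i. if i = 0 then M else N"] assms by (auto simp: dsum_def)
qed

text \<open>In the special case both sides are \<open>Tup []\<close>, so one formula serves all
  later computations.\<close>

lemma dsum_gact:
  assumes "u \<in> carrier (dsum M N)"
  shows "gact (dsum M N) g u = mk 2 (\<lambda>i. gact (if i = 0 then M else N) g (co 2 i u))"
proof (cases "M = zero_gmodule \<and> N = zero_gmodule")
  case True
  have "gact (if i = 0 then M else N) g x = Tup []" for i :: nat and x
    using True by (simp add: zero_gmodule_def)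
  moreover have "dsum M N = zero_gmodule" using True by (simp add: dsum_def)
  ultimately show ?thesis by (simp add: mk_zero) (simp add: zero_gmodule_def)
next
  case False
  then show ?thesis by (auto simp: dsum_def tuple_module_def)
qed

lemma dsum_obj:
  assumes M: "M \<in> gmodules G T R ract" and N: "N \<in> gmodules G T R ract"
  shows "dsum M N \<in> gmodules G T R ract"
proof (rule gmodulesI_coords[OF dsum_prod[OF gmodulesD(1)[OF M] gmodulesD(1)[OF N]]])
  let ?K = "\<lambda>i::nat. if i = 0 then M else N"
  note P = dsum_prod[OF gmodulesD(1)[OF M] gmodulesD(1)[OF N]]
  note D = module_prodD[OF P]
  have K: "?K i \<in> gmodules G T R ract" for i using M N by simp
  note KD = gmodulesD[OF K]
  interpret G: group G by (rule G)
  show "?K i \<in> gmodules G T R ract" for i by (rule K)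
  have cc: "co 2 i u \<in> carrier (?K i)" if "i < 2" "u \<in> carrier (dsum M N)" for i u using D(3) that by blast
  show act: "gact (dsum M N) g u \<in> carrier (dsum M N)" if "g \<in> carrier G" "u \<in> carrier (dsum M N)" for g u
    unfolding dsum_gact[OF that(2)] dsum_carrier
    using KD(3)[of g _ 0] KD(3)[of g _ 1] cc[of 0 u] cc[of 1 u] that by (intro imageI) simp
  have cg: "co 2 i (gact (dsum M N) g u) = gact (?K i) g (co 2 i u)" if "i < 2" "u \<in> carrier (dsum M N)" for i g u
    using that by (simp add: dsum_gact)
  fix i :: nat assume i: "i < 2"
  show "co 2 i (gact (dsum M N) \<one>\<^bsub>G\<^esub> u) = co 2 i u" if "u \<in> carrier (dsum M N)" for u
    using cg[OF i that] KD(4)[OF cc[OF i that]] by simp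
  show "co 2 i (gact (dsum M N) (g \<otimes>\<^bsub>G\<^esub> h) u) = co 2 i (gact (dsum M N) g (gact (dsum M N) h u))"
    if "g \<in> carrier G" "h \<in> carrier G" "u \<in> carrier (dsum M N)" for g h u
    unfolding cg[OF i that(3)] cg[OF i act[OF that(2,3)]] by (rule KD(5)[OF that(1,2) cc[OF i that(3)]])
  show "co 2 i (gact (dsum M N) g (u \<oplus>\<^bsub>dsum M N\<^esub> v)) = co 2 i (gact (dsum M N) g u) \<oplus>\<^bsub>?K i\<^esub> co 2 i (gact (dsum M N) g v)"
    if "g \<in> carrier G" "u \<in> carrier (dsum M N)" "v \<in> carrier (dsum M N)" for g u v
    unfolding cg[OF i D(6)[OF that(2,3)]] cg[OF i that(2)] cg[OF i that(3)] D(7)[OF that(2,3) i]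
    by (rule KD(6)[OF that(1) cc[OF i that(2)] cc[OF i that(3)]])
  show "co 2 i (gact (dsum M N) g (a \<odot>\<^bsub>dsum M N\<^esub> u)) = ract g a \<odot>\<^bsub>?K i\<^esub> co 2 i (gact (dsum M N) g u)"
    if "g \<in> carrier G" "a \<in> carrier R" "u \<in> carrier (dsum M N)" for g a u
    unfolding cg[OF i D(8)[OF that(2,3)]] cg[OF i that(3)] D(9)[OF that(2,3) i]
    by (rule KD(7)[OF that(1,2) cc[OF i that(3)]])
  show "locally_constant T (\<lambda>g. co 2 i (gact (dsum M N) g u))" if "u \<in> carrier (dsum M N)" for u
    unfolding cg[OF i that] by (rule KD(8)[OF cc[OF i that]])
qed

lemma dsum_mor_coords:
  assumes "u \<in> carrier (dsum M M')" "i < 2"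
  shows "co 2 i (dsum_mor M N M' N' f f' u) = (if i = 0 then f else f') (co 2 i u)"
  using assms by (simp add: dsum_mor_def)

lemma dsum_mor_hom:
  assumes M: "M \<in> gmodules G T R ract" "M' \<in> gmodules G T R ract" and N: "N \<in> gmodules G T R ract" "N' \<in> gmodules G T R ract"
    and f: "f \<in> gmodule_hom G R M N" "f' \<in> gmodule_hom G R M' N'"
  shows "dsum_mor M N M' N' f f' \<in> gmodule_hom G R (dsum M M') (dsum N N')"
proof -
  let ?K = "\<lambda>i::nat. if i = 0 then M else M'" and ?L = "\<lambda>i::nat. if i = 0 then N else N'" and ?f = "\<lambda>i::nat. if i = 0 then f else f'"
  note PM = dsum_prod[OF gmodulesD(1)[OF M(1)] gmodulesD(1)[OF M(2)]]
  note PN = dsum_prod[OF gmodulesD(1)[OF N(1)] gmodulesD(1)[OF N(2)]]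
  note D = module_prodD[OF PM]
  have h: "?f i \<in> gmodule_hom G R (?K i) (?L i)" for i using f by simp
  note HD = gmodule_homD[OF h]
  have cc: "co 2 i u \<in> carrier (?K i)" if "i < 2" "u \<in> carrier (dsum M M')" for i u using D(3) that by blast
  note oM = dsum_obj[OF M] and oN = dsum_obj[OF N]
  show ?thesis
  proof (rule gmodule_homI_coords[OF PN oM oN])
    show closed: "dsum_mor M N M' N' f f' u \<in> carrier (dsum N N')" if "u \<in> carrier (dsum M M')" for u
      using HD(2)[OF cc[of 0 u]] HD(2)[OF cc[of 1 u]] that unfolding dsum_mor_def dsum_carrier by simp
    fix i :: nat assume i: "i < 2"
    show "co 2 i (dsum_mor M N M' N' f f' (u \<oplus>\<^bsub>dsum M M'\<^esub> v))
        = co 2 i (dsum_mor M N M' N' f f' u) \<oplus>\<^bsub>?L i\<^esub> co 2 i (dsum_mor M N M' N' f f' v)"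
      if "u \<in> carrier (dsum M M')" "v \<in> carrier (dsum M M')" for u v
      unfolding dsum_mor_coords[OF that(1) i] dsum_mor_coords[OF that(2) i] dsum_mor_coords[OF D(6)[OF that] i] D(7)[OF that i]
      by (rule HD(3)[OF cc[OF i that(1)] cc[OF i that(2)]])
    show "co 2 i (dsum_mor M N M' N' f f' (a \<odot>\<^bsub>dsum M M'\<^esub> u)) = a \<odot>\<^bsub>?L i\<^esub> co 2 i (dsum_mor M N M' N' f f' u)"
      if "a \<in> carrier R" "u \<in> carrier (dsum M M')" for a u
      unfolding dsum_mor_coords[OF that(2) i] dsum_mor_coords[OF D(8)[OF that] i] D(9)[OF that i]
      by (rule HD(4)[OF that(1) cc[OF i that(2)]])
    show "co 2 i (dsum_mor M N M' N' f f' (gact (dsum M M') g u)) = co 2 i (gact (dsum N N') g (dsum_mor M N M' N' f f' u))"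
      if g: "g \<in> carrier G" and u: "u \<in> carrier (dsum M M')" for g u
      unfolding dsum_mor_coords[OF gmodulesD(3)[OF oM g u] i]
      using HD(5)[OF g cc[OF i u]] i by (simp add: dsum_gact[OF u] dsum_gact[OF closed[OF u]] dsum_mor_coords[OF u i])
  qed (simp add: dsum_mor_def)
qed

lemma dsum_ext:
  assumes "module R M" "module R N" "u \<in> carrier (dsum M N)" "v \<in> carrier (dsum M N)" "co 2 0 u = co 2 0 v" "co 2 1 u = co 2 1 v"
  shows "u = v"
  by (rule module_prodD(5)[OF dsum_prod[OF assms(1,2)] assms(3,4)]) (use assms(5,6) in \<open>auto simp: less_2_cases_iff\<close>)

lemma dsum_co:
  assumes "u \<in> carrier (dsum M N)" shows "co 2 0 u \<in> carrier M" "co 2 1 u \<in> carrier N" "co 2 (Suc 0) u \<in> carrier N"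
  using assms unfolding dsum_carrier by auto

lemma dsum_bifunctor: "exact_bifunctor C C C dsum dsum_mor"
proof
  fix M N M' N' L L' f g f' g'
  show "M \<in> obj C \<Longrightarrow> M' \<in> obj C \<Longrightarrow> dsum M M' \<in> obj C"
    by (simp add: C_simps dsum_obj)
  show "M \<in> obj C \<Longrightarrow> N \<in> obj C \<Longrightarrow> M' \<in> obj C \<Longrightarrow> N' \<in> obj C \<Longrightarrow> f \<in> hm C M N \<Longrightarrow> f' \<in> hm C M' N'
      \<Longrightarrow> dsum_mor M N M' N' f f' \<in> hm C (dsum M M') (dsum N N')"
    by (simp add: C_simps dsum_mor_hom)
  show "M \<in> obj C \<Longrightarrow> M' \<in> obj C \<Longrightarrow> dsum_mor M M M' M' (idn C M) (idn C M') = idn C (dsum M M')"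
  proof -
    assume M: "M \<in> obj C" "M' \<in> obj C"
    show "dsum_mor M M M' M' (idn C M) (idn C M') = idn C (dsum M M')"
      unfolding C_simps dsum_mor_def
    proof (rule restrict_ext)
      fix u assume u: "u \<in> carrier (dsum M M')"
      show "mk 2 (\<lambda>i. (if i = 0 then \<lambda>x\<in>carrier M. x else (\<lambda>x\<in>carrier M'. x)) (co 2 i u)) = u"
        by (rule dsum_ext[OF obj_module[OF M(1)] obj_module[OF M(2)] _ u]) (use dsum_co[OF u] in \<open>auto simp: dsum_carrier\<close>)
    qed
  qed
  show "dsum (zob C) (zob C) = zob C" by (simp add: C_simps dsum_def)
  assume o: "L \<in> obj C" "M \<in> obj C" "N \<in> obj C" "L' \<in> obj C" "M' \<in> obj C" "N' \<in> obj C"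
    and h: "f \<in> hm C L M" "g \<in> hm C M N" "f' \<in> hm C L' M'" "g' \<in> hm C M' N'"
  have h': "f \<in> gmodule_hom G R L M" "g \<in> gmodule_hom G R M N" "f' \<in> gmodule_hom G R L' M'" "g' \<in> gmodule_hom G R M' N'"
    using h by (simp_all add: C_simps)
  have o': "L \<in> gmodules G T R ract" "M \<in> gmodules G T R ract" "N \<in> gmodules G T R ract"
     "L' \<in> gmodules G T R ract" "M' \<in> gmodules G T R ract" "N' \<in> gmodules G T R ract" using o by (simp_all add: C_simps)
  note f = dsum_mor_hom[OF o'(1,4,2,5) h'(1,3)] and g = dsum_mor_hom[OF o'(2,5,3,6) h'(2,4)]
  show "dsum_mor L N L' N' (cmp C L M N g f) (cmp C L' M' N' g' f')
      = cmp C (dsum L L') (dsum M M') (dsum N N') (dsum_mor M N M' N' g g') (dsum_mor L M L' M' f f')"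
    unfolding C_simps compose_def
  proof
    fix u
    show "dsum_mor L N L' N' (\<lambda>x\<in>carrier L. g (f x)) (\<lambda>x\<in>carrier L'. g' (f' x)) u
        = (\<lambda>x\<in>carrier (dsum L L'). dsum_mor M N M' N' g g' (dsum_mor L M L' M' f f' x)) u"
    proof (cases "u \<in> carrier (dsum L L')")
      case True
      have "dsum_mor L M L' M' f f' u \<in> carrier (dsum M M')" using gmodule_homD(2)[OF f] True by simp
      then have "dsum_mor M N M' N' g g' (dsum_mor L M L' M' f f' u)
          = mk 2 (\<lambda>i. (if i = 0 then g else g') (co 2 i (dsum_mor L M L' M' f f' u)))"
        by (simp add: dsum_mor_def[of M N])
      also have "\<dots> = dsum_mor L N L' N' (\<lambda>x\<in>carrier L. g (f x)) (\<lambda>x\<in>carrier L'. g' (f' x)) u"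
        using True dsum_co[OF True] by (auto simp: dsum_mor_coords dsum_mor_def[of L N] less_2_cases_iff intro!: mk_cong)
      finally show ?thesis using True by simp
    qed (simp add: dsum_mor_def)
  qed
  assume s: "ses C L M N f g" "ses C L' M' N' f' g'"
  note P = dsum_prod[OF obj_module[OF o(1)] obj_module[OF o(4)]] dsum_prod[OF obj_module[OF o(2)] obj_module[OF o(5)]]
    dsum_prod[OF obj_module[OF o(3)] obj_module[OF o(6)]]
  note * = prod_hom_ses[OF P, where f = "dsum_mor L M L' M' f f'" and g = "dsum_mor M N M' N' g g'"
      and fs = "\<lambda>i. if i = 0 then f else f'" and gs = "\<lambda>i. if i = 0 then g else g'",
      OF gmodule_homD(2)[OF f] dsum_mor_coords gmodule_homD(2)[OF g] dsum_mor_coords]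
  show "ses C (dsum L L') (dsum M M') (dsum N N') (dsum_mor L M L' M' f f') (dsum_mor M N M' N' g g')"
    unfolding C_simps using s by (intro conjI f g *) (auto simp: C_simps)
qed

end

section \<open>Tensor products with representations\<close>

lemma mat_mult_entry:
  assumes "A \<in> carrier_mat n m" "B \<in> carrier_mat m l" "i < n" "j < l"
  shows "(A * B) $$ (i, j) = (\<Sum>k<m. A $$ (i, k) * B $$ (k, j))"
  using assms by (simp add: scalar_prod_def atLeast0LessThan)

lemma module_prod_cong:
  assumes "module_prod R d Ms S c" "carrier S' = carrier S" "\<zero>\<^bsub>S'\<^esub> = \<zero>\<^bsub>S\<^esub>"
    "\<And>u v. u \<in> carrier S \<Longrightarrow> v \<in> carrier S \<Longrightarrow> u \<oplus>\<^bsub>S'\<^esub> v = u \<oplus>\<^bsub>S\<^esub> v"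
    "\<And>a u. u \<in> carrier S \<Longrightarrow> a \<odot>\<^bsub>S'\<^esub> u = a \<odot>\<^bsub>S\<^esub> u"
  shows "module_prod R d Ms S' c"
  using assms unfolding module_prod_def by simp

lemma hom_mat_app:
  assumes M: "module R M" and N: "module R N" and f: "f \<in> gmodule_hom G R M N"
    and U: "\<And>j. j < d \<Longrightarrow> U i j \<in> carrier R" and x: "\<And>j. j < d \<Longrightarrow> x j \<in> carrier M"
  shows "f (mat_app M d U x i) = mat_app N d U (\<lambda>j. f (x j)) i"
proof -
  interpret M: module R M by fact
  interpret N: module R N by fact
  note F = gmodule_homD[OF f]
  have "f (mat_app M d U x i) = (\<Oplus>\<^bsub>N\<^esub>j\<in>{..<d}. f (U i j \<odot>\<^bsub>M\<^esub> x j))"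
    unfolding mat_app_def
    by (rule additive_finsum[OF M.M.abelian_group_axioms N.M.abelian_group_axioms F(2,3)]) (use U x in auto)
  also have "\<dots> = mat_app N d U (\<lambda>j. f (x j)) i"
    unfolding mat_app_def by (rule N.M.finsum_cong') (use U x F(2,4) in auto)
  finally show ?thesis .
qed

text \<open>The action is semilinear, so a group element moves the matrix entries as well as the
  vector.\<close>

lemma gact_mat_app:
  assumes M: "M \<in> gmodules G T R ract" and g: "g \<in> carrier G" and "cring R"
    and U: "\<And>j. j < d \<Longrightarrow> U i j \<in> carrier R" "\<And>j. j < d \<Longrightarrow> ract g (U i j) \<in> carrier R"
    and x: "\<And>j. j < d \<Longrightarrow> x j \<in> carrier M"
  shows "gact M g (mat_app M d U x i) = mat_app M d (\<lambda>i j. ract g (U i j)) (\<lambda>j. gact M g (x j)) i"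
proof -
  interpret M: module R M by (rule gmodulesD(1)[OF M])
  note D = gmodulesD[OF M]
  have "gact M g (mat_app M d U x i) = (\<Oplus>\<^bsub>M\<^esub>j\<in>{..<d}. gact M g (U i j \<odot>\<^bsub>M\<^esub> x j))"
    unfolding mat_app_def
    by (rule additive_finsum[OF M.M.abelian_group_axioms M.M.abelian_group_axioms D(3)[OF g] D(6)[OF g]]) (use U x in auto)
  also have "\<dots> = mat_app M d (\<lambda>i j. ract g (U i j)) (\<lambda>j. gact M g (x j)) i"
    unfolding mat_app_def by (rule M.M.finsum_cong') (use U x D(3)[OF g] D(7)[OF g] in auto)
  finally show ?thesis .
qed

text \<open>By \<open>ract_iota\<close> the group fixes the scalars. Matrices with entries in
  \<open>k\<close> therefore commute with the action on tuples, which makes the diagonal action on a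
  tensor product multiplicative.\<close>

locale equivariant_algebra = equivariant_ring G T R ract
  for G :: "'g monoid" and T :: "'g topology" and R :: "'a ring" and ract :: "'g \<Rightarrow> 'a \<Rightarrow> 'a" +
  fixes \<iota> :: "'k::field \<Rightarrow> 'a"
  assumes iota_closed: "\<iota> c \<in> carrier R" and iota_add: "\<iota> (c + d) = \<iota> c \<oplus>\<^bsub>R\<^esub> \<iota> d"
    and iota_mult: "\<iota> (c * d) = \<iota> c \<otimes>\<^bsub>R\<^esub> \<iota> d" and iota_one: "\<iota> 1 = \<one>\<^bsub>R\<^esub>" and iota_zero: "\<iota> 0 = \<zero>\<^bsub>R\<^esub>"
    and ract_iota: "g \<in> carrier G \<Longrightarrow> ract g (\<iota> c) = \<iota> c"
begin

lemma iota_sum: "finite A \<Longrightarrow> \<iota> (\<Sum>k\<in>A. f k) = (\<Oplus>\<^bsub>R\<^esub>k\<in>A. \<iota> (f k))"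
proof (induction A rule: finite_induct)
  case empty
  interpret R: cring R by (rule R)
  show ?case by (simp add: iota_zero)
next
  case (insert x A)
  interpret R: cring R by (rule R)
  show ?case using insert by (simp add: iota_add R.finsum_insert iota_closed Pi_def)
qed

definition imat :: "'k mat \<Rightarrow> nat \<Rightarrow> nat \<Rightarrow> 'a" where
  "imat A i j = \<iota> (A $$ (i, j))"

lemma imat_closed: "imat A i j \<in> carrier R"
  by (simp add: imat_def iota_closed)

lemma imat_mult:
  assumes "A \<in> carrier_mat n m" "B \<in> carrier_mat m l" "i < n" "j < l"
  shows "(\<Oplus>\<^bsub>R\<^esub>k\<in>{..<m}. imat A i k \<otimes>\<^bsub>R\<^esub> imat B k j) = imat (A * B) i j"
  unfolding imat_def mat_mult_entry[OF assms] by (simp add: iota_sum iota_mult)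

lemma imat_one: "i < n \<Longrightarrow> j < n \<Longrightarrow> imat (1\<^sub>m n) i j = (if j = i then \<one>\<^bsub>R\<^esub> else \<zero>\<^bsub>R\<^esub>)"
  by (auto simp: imat_def iota_one iota_zero)

lemma ract_imat: "g \<in> carrier G \<Longrightarrow> ract g (imat A i j) = imat A i j"
  by (simp add: imat_def ract_iota)

abbreviation "tobj \<equiv> tensor_obj G \<iota>"
abbreviation "tmor \<equiv> tensor_mor G \<iota>"
abbreviation "dm \<equiv> rep_dim G"

text \<open>Together with the two facts that follow, this hides the case distinction in
  \<open>tensor_obj\<close>. The zero module fits because \<open>mk\<close> collapses tuples of
  \<open>Tup []\<close>.\<close>

lemma tensor_carrier: "carrier (tobj \<rho> M) = mk (dm \<rho>) ` {f. \<forall>i<dm \<rho>. f i \<in> carrier M}"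
proof (cases "M = zero_gmodule")
  case True
  have "mk d f = Tup []" if "\<forall>i<d. f i = Tup []" for d and f :: "nat \<Rightarrow> 'a muniv"
  proof -
    have "mk d f = mk d (\<lambda>_. Tup [])" by (rule mk_cong) (use that in auto)
    then show ?thesis by (simp add: mk_zero)
  qed
  then show ?thesis using True
    by (auto simp: tensor_obj_def zero_gmodule_def Let_def intro!: image_eqI[of _ _ "\<lambda>_. Tup []"])
next
  case False
  then show ?thesis by (simp add: tensor_obj_def Let_def tup_image)
qed

lemma tensor_prod:
  assumes "module R M"
  shows "module_prod R (dm \<rho>) (\<lambda>_. M) (tobj \<rho> M) (co (dm \<rho>))"
proof (cases "M = zero_gmodule")
  case True
  then show ?thesis using zero_gmodule_prod by (simp add: tensor_obj_def Let_def)
next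
  case False
  let ?d = "dm \<rho>" and ?S = "tuple_module (dm \<rho>) (\<lambda>_. M) undefined"
  show ?thesis
  proof (rule module_prod_cong[OF tuple_module_prod[where \<gamma> = undefined]])
    show "module R M" by fact
    show c: "carrier (tobj \<rho> M) = carrier ?S" by (simp add: tensor_carrier tuple_module_def)
    have "map (\<lambda>_. \<zero>\<^bsub>M\<^esub>) [0..<?d] = replicate ?d \<zero>\<^bsub>M\<^esub>" by (simp add: map_replicate_const)
    then show "\<zero>\<^bsub>tobj \<rho> M\<^esub> = \<zero>\<^bsub>?S\<^esub>" using False by (simp add: tensor_obj_def Let_def tuple_module_def mk_def)
    fix u assume "u \<in> carrier ?S"
    then obtain f where f: "u = mk ?d f" by (auto simp: tuple_module_def)
    show "a \<odot>\<^bsub>tobj \<rho> M\<^esub> u = a \<odot>\<^bsub>?S\<^esub> u" for a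
    proof -
      have "mk ?d (\<lambda>i. a \<odot>\<^bsub>M\<^esub> co ?d i (mk ?d f)) = mk ?d (\<lambda>i. a \<odot>\<^bsub>M\<^esub> f i)" by (rule mk_cong) simp
      then show ?thesis
        using False by (simp add: tensor_obj_def Let_def tuple_module_def f untup_mk o_def) (simp add: mk_def)
    qed
    fix v assume "v \<in> carrier ?S"
    then obtain h where h: "v = mk ?d h" by (auto simp: tuple_module_def)
    have "map2 (\<lambda>x y. x \<oplus>\<^bsub>M\<^esub> y) (map f [0..<?d]) (map h [0..<?d]) = map (\<lambda>i. f i \<oplus>\<^bsub>M\<^esub> h i) [0..<?d]"
      by (rule nth_equalityI) auto
    moreover have "mk ?d (\<lambda>i. co ?d i (mk ?d f) \<oplus>\<^bsub>M\<^esub> co ?d i (mk ?d h)) = mk ?d (\<lambda>i. f i \<oplus>\<^bsub>M\<^esub> h i)"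
      by (rule mk_cong) simp
    ultimately show "u \<oplus>\<^bsub>tobj \<rho> M\<^esub> v = u \<oplus>\<^bsub>?S\<^esub> v"
      using False by (simp add: tensor_obj_def Let_def tuple_module_def f h untup_mk) (simp add: mk_def)
  qed
qed

lemma tensor_gact:
  assumes M: "M \<in> gmodules G T R ract" and u: "u \<in> carrier (tobj \<rho> M)" and g: "g \<in> carrier G"
  shows "gact (tobj \<rho> M) g u
    = mk (dm \<rho>) (mat_app M (dm \<rho>) (imat (\<rho> g)) (\<lambda>j. gact M g (co (dm \<rho>) j u)))"
proof (cases "M = zero_gmodule")
  case True
  interpret M: module R M by (rule gmodulesD(1)[OF M])
  have "mat_app M (dm \<rho>) (imat (\<rho> g)) (\<lambda>j. gact M g (co (dm \<rho>) j u)) i \<in> carrier M" for i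
    by (rule M.mat_app_closed) (use True imat_closed in \<open>auto simp: zero_gmodule_def\<close>)
  then have "mk (dm \<rho>) (mat_app M (dm \<rho>) (imat (\<rho> g)) (\<lambda>j. gact M g (co (dm \<rho>) j u))) = mk (dm \<rho>) (\<lambda>_. Tup [])"
    using True by (intro mk_cong) (simp add: zero_gmodule_def)
  moreover have "gact (tobj \<rho> M) g u = Tup []" using True by (simp add: tensor_obj_def Let_def) (simp add: zero_gmodule_def)
  ultimately show ?thesis by (simp add: mk_zero)
next
  case False
  then show ?thesis by (simp add: tensor_obj_def Let_def mk_def mat_app_def[abs_def] imat_def co_def)
qed

lemma tensor_mor_apply:
  assumes "u \<in> carrier (tobj \<rho> M)"
  shows "tmor \<rho> M N f u = mk (dm \<rho>) (\<lambda>i. f (co (dm \<rho>) i u))"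
proof -
  obtain x where x: "u = mk (dm \<rho>) x" using assms by (auto simp: tensor_carrier)
  have "mk (dm \<rho>) (\<lambda>i. f (co (dm \<rho>) i (mk (dm \<rho>) x))) = mk (dm \<rho>) (\<lambda>i. f (x i))" by (rule mk_cong) simp
  then show ?thesis using assms
    by (simp add: tensor_mor_def x untup_mk o_def) (simp add: mk_def)
qed

lemma tensor_co: "u \<in> carrier (tobj \<rho> M) \<Longrightarrow> i < dm \<rho> \<Longrightarrow> co (dm \<rho>) i u \<in> carrier M"
  by (auto simp: tensor_carrier)

lemma tensor_in: "(\<And>i. i < dm \<rho> \<Longrightarrow> f i \<in> carrier M) \<Longrightarrow> mk (dm \<rho>) f \<in> carrier (tobj \<rho> M)"
  by (auto simp: tensor_carrier)

lemma tensor_ext: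
  assumes "u \<in> carrier (tobj \<rho> M)" "v \<in> carrier (tobj \<rho> M)" "\<And>i. i < dm \<rho> \<Longrightarrow> co (dm \<rho>) i u = co (dm \<rho>) i v"
  shows "u = v"
  using assms by (auto simp: tensor_carrier intro!: mk_cong)

lemma tensor_mor_coords:
  "u \<in> carrier (tobj \<rho> M) \<Longrightarrow> i < dm \<rho> \<Longrightarrow> co (dm \<rho>) i (tmor \<rho> M N f u) = f (co (dm \<rho>) i u)"
  by (simp add: tensor_mor_apply)

lemma rep_mult: "\<rho> \<in> reps G T \<Longrightarrow> g \<in> carrier G \<Longrightarrow> h \<in> carrier G \<Longrightarrow> \<rho> (g \<otimes>\<^bsub>G\<^esub> h) = \<rho> g * \<rho> h"
  by (simp add: reps_def)

lemma rep_mat: "\<rho> \<in> reps G T \<Longrightarrow> g \<in> carrier G \<Longrightarrow> \<rho> g \<in> carrier_mat (dm \<rho>) (dm \<rho>)"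
  by (simp add: reps_def)

lemma rep_one: "\<rho> \<in> reps G T \<Longrightarrow> \<rho> \<one>\<^bsub>G\<^esub> = 1\<^sub>m (dm \<rho>)"
  by (simp add: reps_def)

lemma tensor_gmodules:
  assumes \<rho>: "\<rho> \<in> reps G T" and M: "M \<in> gmodules G T R ract"
  shows "tobj \<rho> M \<in> gmodules G T R ract"
proof -
  let ?d = "dm \<rho>" and ?S = "tobj \<rho> M"
  note P = tensor_prod[OF gmodulesD(1)[OF M], of \<rho>]
  note D = module_prodD[OF P] and MD = gmodulesD[OF M]
  interpret G: group G by (rule G)
  interpret M: module R M by (rule MD(1))
  have closed: "gact ?S g u \<in> carrier ?S" if g: "g \<in> carrier G" and u: "u \<in> carrier ?S" for g u
    unfolding tensor_gact[OF M u g]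
    by (intro tensor_in M.mat_app_closed imat_closed MD(3)[OF g] tensor_co[OF u])
  have cg: "co ?d i (gact ?S g u) = mat_app M ?d (imat (\<rho> g)) (\<lambda>j. gact M g (co ?d j u)) i"
    if "i < ?d" "g \<in> carrier G" "u \<in> carrier ?S" for i g u
    using that by (simp add: tensor_gact[OF M])
  show ?thesis
  proof (rule gmodulesI_coords[OF P M closed])
    fix i assume i: "i < ?d"
    show "co ?d i (gact ?S \<one>\<^bsub>G\<^esub> u) = co ?d i u" if u: "u \<in> carrier ?S" for u
    proof -
      have "mat_app M ?d (imat (\<rho> \<one>\<^bsub>G\<^esub>)) (\<lambda>j. gact M \<one>\<^bsub>G\<^esub> (co ?d j u)) i = gact M \<one>\<^bsub>G\<^esub> (co ?d i u)"
        by (rule M.mat_app_id[OF i]) (use tensor_co[OF u] MD(3) i in \<open>simp_all add: rep_one[OF \<rho>] imat_one\<close>)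
      then show ?thesis using cg[OF i G.one_closed u] MD(4)[OF tensor_co[OF u i]] by simp
    qed
    show "co ?d i (gact ?S (g \<otimes>\<^bsub>G\<^esub> h) u) = co ?d i (gact ?S g (gact ?S h u))"
      if g: "g \<in> carrier G" and h: "h \<in> carrier G" and u: "u \<in> carrier ?S" for g h u
    proof -
      let ?y = "\<lambda>j. gact M g (gact M h (co ?d j u))"
      have y: "?y j \<in> carrier M" if "j < ?d" for j by (rule MD(3)[OF g MD(3)[OF h tensor_co[OF u that]]])
      have "co ?d i (gact ?S g (gact ?S h u)) = mat_app M ?d (imat (\<rho> g)) (\<lambda>j. gact M g (co ?d j (gact ?S h u))) i"
        by (rule cg[OF i g closed[OF h u]])
      \<comment> \<open>The matrix of \<open>h\<close> has entries in \<open>k\<close>, which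
        \<open>g\<close> fixes, so \<open>g\<close> passes through it to the vector; then the two
        matrices are multiplied.\<close>
      also have "\<dots> = mat_app M ?d (imat (\<rho> g)) (mat_app M ?d (imat (\<rho> h)) ?y) i"
      proof (rule M.mat_app_cong)
        fix j assume j: "j < ?d"
        have "gact M g (co ?d j (gact ?S h u)) = mat_app M ?d (\<lambda>i j. ract g (imat (\<rho> h) i j)) ?y j"
          unfolding cg[OF j h u]
          by (rule gact_mat_app[OF M g R]) (use imat_closed ract_imat[OF g] MD(3)[OF h] tensor_co[OF u] in auto)
        then show "gact M g (co ?d j (gact ?S h u)) = mat_app M ?d (imat (\<rho> h)) ?y j"
          by (simp add: ract_imat[OF g])
        show "mat_app M ?d (imat (\<rho> h)) ?y j \<in> carrier M"
          by (rule M.mat_app_closed) (use imat_closed y in auto)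
      qed (use imat_closed in auto)
      also have "\<dots> = mat_app M ?d (\<lambda>i k. \<Oplus>\<^bsub>R\<^esub>j\<in>{..<?d}. imat (\<rho> g) i j \<otimes>\<^bsub>R\<^esub> imat (\<rho> h) j k) ?y i"
        by (rule M.mat_app_mat_app) (use imat_closed y in auto)
      also have "\<dots> = mat_app M ?d (imat (\<rho> (g \<otimes>\<^bsub>G\<^esub> h))) (\<lambda>j. gact M (g \<otimes>\<^bsub>G\<^esub> h) (co ?d j u)) i"
        by (rule M.mat_app_cong) (use i imat_mult[OF rep_mat[OF \<rho> g] rep_mat[OF \<rho> h] i] rep_mult[OF \<rho> g h] MD(3,5) g h tensor_co[OF u] imat_closed in auto)
      finally show ?thesis using cg[OF i G.m_closed[OF g h] u] by simp
    qed
    show "co ?d i (gact ?S g (u \<oplus>\<^bsub>?S\<^esub> v)) = co ?d i (gact ?S g u) \<oplus>\<^bsub>M\<^esub> co ?d i (gact ?S g v)"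
      if g: "g \<in> carrier G" and u: "u \<in> carrier ?S" and v: "v \<in> carrier ?S" for g u v
      unfolding cg[OF i g D(6)[OF u v]] cg[OF i g u] cg[OF i g v]
      by (rule trans[OF M.mat_app_cong M.mat_app_add])
        (use D(7)[OF u v] MD(6)[OF g] MD(3)[OF g] tensor_co[OF u] tensor_co[OF v] imat_closed in auto)
    show "co ?d i (gact ?S g (a \<odot>\<^bsub>?S\<^esub> u)) = ract g a \<odot>\<^bsub>M\<^esub> co ?d i (gact ?S g u)"
      if g: "g \<in> carrier G" and a: "a \<in> carrier R" and u: "u \<in> carrier ?S" for g a u
      unfolding cg[OF i g D(8)[OF a u]] cg[OF i g u]
      by (rule trans[OF M.mat_app_cong M.mat_app_smult])
        (use D(9)[OF a u] MD(7)[OF g a] MD(3)[OF g] tensor_co[OF u] imat_closed ract_closed[OF g a] in auto)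
    show "locally_constant T (\<lambda>g. co ?d i (gact ?S g u))" if u: "u \<in> carrier ?S" for u
    proof (rule locally_constant_factor)
      \<comment> \<open>The matrix and the finitely many translated coordinates determine the action
        on \<open>u\<close>.\<close>
      show "locally_constant T (\<lambda>g. (\<rho> g, map (\<lambda>j. gact M g (co ?d j u)) [0..<?d]))"
      proof (rule locally_constant_pair)
        show "locally_constant T \<rho>" using \<rho> by (simp add: reps_def continuous_map_discrete_iff)
        show "locally_constant T (\<lambda>g. map (\<lambda>j. gact M g (co ?d j u)) [0..<?d])"
          by (rule locally_constant_map) (rule MD(8)[OF tensor_co[OF u]])
      qed
      fix g h assume gh: "g \<in> topspace T" "h \<in> topspace T"
        "(\<rho> g, map (\<lambda>j. gact M g (co ?d j u)) [0..<?d]) = (\<rho> h, map (\<lambda>j. gact M h (co ?d j u)) [0..<?d])"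
      then have gh': "g \<in> carrier G" "h \<in> carrier G" using T by auto
      show "co ?d i (gact ?S g u) = co ?d i (gact ?S h u)"
        unfolding cg[OF i gh'(1) u] cg[OF i gh'(2) u]
        by (rule M.mat_app_cong) (use gh(3) MD(3)[OF gh'(2)] tensor_co[OF u] imat_closed in auto)
    qed
  qed
qed

lemma tensor_hom:
  assumes \<rho>: "\<rho> \<in> reps G T" and M: "M \<in> gmodules G T R ract" and N: "N \<in> gmodules G T R ract"
    and f: "f \<in> gmodule_hom G R M N"
  shows "tmor \<rho> M N f \<in> gmodule_hom G R (tobj \<rho> M) (tobj \<rho> N)"
proof -
  let ?d = "dm \<rho>" and ?S = "tobj \<rho> M" and ?S' = "tobj \<rho> N"
  note P = tensor_prod[OF gmodulesD(1)[OF M], of \<rho>] and P' = tensor_prod[OF gmodulesD(1)[OF N], of \<rho>]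
  note D = module_prodD[OF P] and F = gmodule_homD[OF f]
  note oM = tensor_gmodules[OF \<rho> M] and oN = tensor_gmodules[OF \<rho> N]
  interpret N: module R N by (rule gmodulesD(1)[OF N])
  have closed: "tmor \<rho> M N f u \<in> carrier ?S'" if u: "u \<in> carrier ?S" for u
    unfolding tensor_mor_apply[OF u] by (intro tensor_in F(2) tensor_co[OF u])
  show ?thesis
  proof (rule gmodule_homI_coords[OF P' oM oN])
    show "tmor \<rho> M N f \<in> extensional (carrier ?S)" by (simp add: tensor_mor_def)
    show "tmor \<rho> M N f u \<in> carrier ?S'" if u: "u \<in> carrier ?S" for u by (rule closed[OF u])
    fix i assume i: "i < ?d"
    show "co ?d i (tmor \<rho> M N f (u \<oplus>\<^bsub>?S\<^esub> v)) = co ?d i (tmor \<rho> M N f u) \<oplus>\<^bsub>N\<^esub> co ?d i (tmor \<rho> M N f v)"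
      if u: "u \<in> carrier ?S" and v: "v \<in> carrier ?S" for u v
      unfolding tensor_mor_coords[OF u i] tensor_mor_coords[OF v i] tensor_mor_coords[OF D(6)[OF u v] i] D(7)[OF u v i]
      by (rule F(3)[OF tensor_co[OF u i] tensor_co[OF v i]])
    show "co ?d i (tmor \<rho> M N f (a \<odot>\<^bsub>?S\<^esub> u)) = a \<odot>\<^bsub>N\<^esub> co ?d i (tmor \<rho> M N f u)"
      if a: "a \<in> carrier R" and u: "u \<in> carrier ?S" for a u
      unfolding tensor_mor_coords[OF u i] tensor_mor_coords[OF D(8)[OF a u] i] D(9)[OF a u i]
      by (rule F(4)[OF a tensor_co[OF u i]])
    show "co ?d i (tmor \<rho> M N f (gact ?S g u)) = co ?d i (gact ?S' g (tmor \<rho> M N f u))"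
      if g: "g \<in> carrier G" and u: "u \<in> carrier ?S" for g u
    proof -
      have "co ?d i (tmor \<rho> M N f (gact ?S g u)) = f (mat_app M ?d (imat (\<rho> g)) (\<lambda>j. gact M g (co ?d j u)) i)"
        using tensor_mor_coords[OF gmodulesD(3)[OF oM g u] i] i by (simp add: tensor_gact[OF M u g])
      also have "\<dots> = mat_app N ?d (imat (\<rho> g)) (\<lambda>j. f (gact M g (co ?d j u))) i"
        by (rule hom_mat_app[OF gmodulesD(1)[OF M] gmodulesD(1)[OF N] f])
          (use imat_closed gmodulesD(3)[OF M g] tensor_co[OF u] in auto)
      also have "\<dots> = mat_app N ?d (imat (\<rho> g)) (\<lambda>j. gact N g (co ?d j (tmor \<rho> M N f u))) i"
        by (rule N.mat_app_cong) (use F(2,5) g tensor_co[OF u] imat_closed gmodulesD(3)[OF N g] tensor_mor_coords[OF u] in auto)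
      also have "\<dots> = co ?d i (gact ?S' g (tmor \<rho> M N f u))"
        using i by (simp add: tensor_gact[OF N closed[OF u] g])
      finally show ?thesis .
    qed
  qed
qed

lemma tensor_functor:
  assumes \<rho>: "\<rho> \<in> reps G T"
  shows "exact_functor C C (tobj \<rho>) (tmor \<rho>)"
proof (intro exact_functor.intro wcategory_axioms exact_functor_axioms.intro)
  let ?d = "dm \<rho>"
  fix L M N f g
  show "M \<in> obj C \<Longrightarrow> tobj \<rho> M \<in> obj C" by (simp add: C_simps tensor_gmodules[OF \<rho>])
  show "M \<in> obj C \<Longrightarrow> N \<in> obj C \<Longrightarrow> f \<in> hm C M N \<Longrightarrow> tmor \<rho> M N f \<in> hm C (tobj \<rho> M) (tobj \<rho> N)"
    by (simp add: C_simps tensor_hom[OF \<rho>])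
  show "M \<in> obj C \<Longrightarrow> tmor \<rho> M M (idn C M) = idn C (tobj \<rho> M)"
  proof
    fix u show "tmor \<rho> M M (idn C M) u = idn C (tobj \<rho> M) u"
    proof (cases "u \<in> carrier (tobj \<rho> M)")
      case True
      then obtain f where f: "u = mk ?d f" "\<forall>i<?d. f i \<in> carrier M" by (auto simp: tensor_carrier)
      have "mk ?d (\<lambda>i. (\<lambda>x\<in>carrier M. x) (co ?d i u)) = u" unfolding f(1) by (rule mk_cong) (use f(2) in simp)
      then show ?thesis using True by (simp add: tensor_mor_apply[OF True] C_simps)
    qed (simp add: tensor_mor_def C_simps)
  qed
  show "tobj \<rho> (zob C) = zob C" by (simp add: C_simps tensor_obj_def Let_def)
  assume o: "L \<in> obj C" "M \<in> obj C" "N \<in> obj C" and h: "f \<in> hm C L M" "g \<in> hm C M N"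
  have h': "f \<in> gmodule_hom G R L M" "g \<in> gmodule_hom G R M N" using h by (simp_all add: C_simps)
  have o': "L \<in> gmodules G T R ract" "M \<in> gmodules G T R ract" "N \<in> gmodules G T R ract" using o by (simp_all add: C_simps)
  note f = tensor_hom[OF \<rho> o'(1,2) h'(1)] and g = tensor_hom[OF \<rho> o'(2,3) h'(2)]
  show "tmor \<rho> L N (cmp C L M N g f) = cmp C (tobj \<rho> L) (tobj \<rho> M) (tobj \<rho> N) (tmor \<rho> M N g) (tmor \<rho> L M f)"
    unfolding C_simps compose_def
  proof
    fix u
    show "tmor \<rho> L N (\<lambda>x\<in>carrier L. g (f x)) u = (\<lambda>x\<in>carrier (tobj \<rho> L). tmor \<rho> M N g (tmor \<rho> L M f x)) u"
    proof (cases "u \<in> carrier (tobj \<rho> L)")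
      case True
      then show ?thesis using gmodule_homD(2)[OF f True] tensor_co[OF True]
        by (simp add: tensor_mor_apply tensor_mor_coords cong: mk_cong)
    qed (simp add: tensor_mor_def)
  qed
  assume s: "ses C L M N f g"
  note P = tensor_prod[OF obj_module[OF o(1)], of \<rho>] tensor_prod[OF obj_module[OF o(2)], of \<rho>] tensor_prod[OF obj_module[OF o(3)], of \<rho>]
  note * = prod_hom_ses[OF P, where f = "tmor \<rho> L M f" and g = "tmor \<rho> M N g" and fs = "\<lambda>_. f" and gs = "\<lambda>_. g",
      OF gmodule_homD(2)[OF f] tensor_mor_coords gmodule_homD(2)[OF g] tensor_mor_coords]
  show "ses C (tobj \<rho> L) (tobj \<rho> M) (tobj \<rho> N) (tmor \<rho> L M f) (tmor \<rho> M N g)"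
    unfolding C_simps using s by (intro conjI f g *) (auto simp: C_simps)
qed

end

section \<open>The zero functor and the unit laws of the direct sum\<close>

context equivariant_ring
begin

abbreviation zm :: "('a, 'a muniv, 'g) gmodule" where
  "zm \<equiv> zero_gmodule"

lemma zero_functor: "exact_functor C C (\<lambda>_. zm) (\<lambda>_ _ _. \<lambda>x\<in>carrier zm. x)"
proof (intro exact_functor.intro wcategory_axioms exact_functor_axioms.intro)
  fix L M N f g
  show "(\<lambda>x\<in>carrier zm. x) \<in> hm C zm zm"
    using hom_idn[OF zero_obj] by (simp add: C_simps)
  show "(\<lambda>x\<in>carrier zm. x) = cmp C zm zm zm (\<lambda>x\<in>carrier zm. x) (\<lambda>x\<in>carrier zm. x)"
    by (auto simp: C_simps compose_def fun_eq_iff restrict_def)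
  show "ses C zm zm zm (\<lambda>x\<in>carrier zm. x) (\<lambda>x\<in>carrier zm. x)"
    using ses_zob by (simp add: C_simps)
qed (simp_all add: C_simps zero_obj)

text \<open>Every simplex goes to a zero simplex, whose cell collapses to the base point, so the
  image loop is constant.\<close>

lemma K_map_zero:
  assumes "y \<in> carrier (K_group C n)"
  shows "K_map C (\<lambda>_. zm) (\<lambda>_ _ _. \<lambda>x\<in>carrier zm. x) n y = \<one>\<^bsub>K_group C n\<^esub>"
proof -
  interpret Z: exact_functor C C "\<lambda>_. zm" "\<lambda>_ _ _. \<lambda>x\<in>carrier zm. x" by (rule zero_functor)
  obtain f where f: "f \<in> cube_loops (Suc n) (realization (wS C)) (wS_base C)"
    "y = hcl (Suc n) (realization (wS C)) (wS_base C) f"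
    using assms unfolding K_group_carrier by blast
  have id: "Z.rmap c = wS_base C" if c_in: "c \<in> topspace (realization (wS C))" for c
  proof -
    obtain m s t where c: "s \<in> simp (wS C) m" "t \<in> standard_simplex m" "c = cls (wS C) m s t"
      using c_in unfolding simplicial.topspace_realization[OF simplicial_wS] by blast
    have "wS_map (\<lambda>_. zm) (\<lambda>_ _ _. \<lambda>x\<in>carrier zm. x) m s = zero_simplex C m"
      by (simp add: Z.wS_map_alt zero_simplex_def C_simps)
    then show ?thesis using c by (simp add: Z.wS.realization_map_cls zero_simplex_cls)
  qed
  have "(Z.rmap \<circ> f, \<lambda>_. wS_base C) \<in> cube_homotopic (Suc n) (realization (wS C)) (wS_base C)"
    by (rule cube_homotopic_eq[OF Z.rmap_loop[OF f(1)]]) (simp add: id cube_loops_in[OF f(1)])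
  from hcl_eqI[OF this] show ?thesis using Z.K_map_hcl[OF f(1)] f(2)
    by (simp add: K_group_def homotopy_group_def)
qed

text \<open>The inverse \<psi> is a mere function on carriers; \<open>iso_inI\<close> supplies its
  linearity and equivariance.\<close>

lemma natural_isoI:
  assumes F: "exact_functor C C Fo Fm" and H: "exact_functor C C Go Gm"
    and hom: "\<And>M. M \<in> gmodules G T R ract \<Longrightarrow> \<phi> M \<in> gmodule_hom G R (Fo M) (Go M)"
    and inv: "\<And>M v. M \<in> gmodules G T R ract \<Longrightarrow> v \<in> carrier (Go M) \<Longrightarrow> \<psi> M v \<in> carrier (Fo M) \<and> \<phi> M (\<psi> M v) = v"
      "\<And>M u. M \<in> gmodules G T R ract \<Longrightarrow> u \<in> carrier (Fo M) \<Longrightarrow> \<psi> M (\<phi> M u) = u"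
    and nat: "\<And>M N f u. M \<in> gmodules G T R ract \<Longrightarrow> N \<in> gmodules G T R ract \<Longrightarrow> f \<in> gmodule_hom G R M N
        \<Longrightarrow> u \<in> carrier (Fo M) \<Longrightarrow> \<phi> N (Fm M N f u) = Gm M N f (\<phi> M u)"
  shows "natural_iso C C Fo Fm Go Gm \<phi>"
proof (intro natural_iso.intro F H natural_iso_axioms.intro)
  interpret F: exact_functor C C Fo Fm by (rule F)
  interpret H: exact_functor C C Go Gm by (rule H)
  fix M N f
  show "iso_in C (Fo M) (Go M) (\<phi> M)" if "M \<in> obj C"
  proof (rule iso_inI)
    have M: "M \<in> gmodules G T R ract" using that by (simp add: C_simps)
    show "Fo M \<in> gmodules G T R ract" using F.Fo_obj[OF that] by (simp add: C_simps)
    show "\<phi> M \<in> gmodule_hom G R (Fo M) (Go M)" by (rule hom[OF M])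
    show "bij_betw (\<phi> M) (carrier (Fo M)) (carrier (Go M))"
      by (rule bij_betw_byWitness[where f' = "\<psi> M"]) (use inv[OF M] gmodule_homD(2)[OF hom[OF M]] in auto)
  qed
  show "cmp C (Fo M) (Fo N) (Go N) (\<phi> N) (Fm M N f) = cmp C (Fo M) (Go M) (Go N) (Gm M N f) (\<phi> M)"
    if "M \<in> obj C" "N \<in> obj C" "f \<in> hm C M N"
    unfolding C_simps compose_def by (rule restrict_ext) (use nat that in \<open>simp add: C_simps\<close>)
  \<comment> \<open>Automatic here, since both functors send the zero module to itself and it has a
    single element.\<close>
  show "\<phi> (zob C) = idn C (zob C)"
  proof
    have z: "Fo zm = zm" "Go zm = zm"
      using F.Fo_zob H.Fo_zob by (simp_all add: C_simps)
    note h = gmodule_homD(1,2)[OF hom[OF zero_obj], unfolded z]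
    fix x show "\<phi> (zob C) x = idn C (zob C) x"
      using h(1) h(2)[of x] by (cases "x \<in> carrier zm") (auto simp: C_simps zero_gmodule_def extensional_def)
  qed
qed

lemma dsum_zero_right: "exact_functor C C (\<lambda>M. dsum M (zob C)) (\<lambda>M N f. dsum_mor M N (zob C) (zob C) f (idn C (zob C)))"
proof -
  interpret exact_bifunctor C C C dsum dsum_mor by (rule dsum_bifunctor)
  show ?thesis
  proof (intro exact_functor.intro wcategory_axioms exact_functor_axioms.intro)
    show "dsum_mor L N (zob C) (zob C) (cmp C L M N g f) (idn C (zob C))
        = cmp C (dsum L (zob C)) (dsum M (zob C)) (dsum N (zob C)) (dsum_mor M N (zob C) (zob C) g (idn C (zob C))) (dsum_mor L M (zob C) (zob C) f (idn C (zob C)))"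
      if "L \<in> obj C" "M \<in> obj C" "N \<in> obj C" "f \<in> hm C L M" "g \<in> hm C M N" for L M N f g
      using Pm_cmp[OF that(1-3) zob_obj zob_obj zob_obj that(4,5) idn_hm[OF zob_obj] idn_hm[OF zob_obj]]
      by (simp add: cmp_idl[OF zob_obj zob_obj idn_hm[OF zob_obj]])
  qed (use Po_obj Pm_hm Pm_idn Po_zob Pm_ses zob_obj idn_hm ses_zob in auto)
qed

lemma dsum_zero_left: "exact_functor C C (\<lambda>M. dsum (zob C) M) (\<lambda>M N f. dsum_mor (zob C) (zob C) M N (idn C (zob C)) f)"
proof -
  interpret exact_bifunctor C C C dsum dsum_mor by (rule dsum_bifunctor)
  show ?thesis
  proof (intro exact_functor.intro wcategory_axioms exact_functor_axioms.intro)
    show "dsum_mor (zob C) (zob C) L N (idn C (zob C)) (cmp C L M N g f)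
        = cmp C (dsum (zob C) L) (dsum (zob C) M) (dsum (zob C) N) (dsum_mor (zob C) (zob C) M N (idn C (zob C)) g) (dsum_mor (zob C) (zob C) L M (idn C (zob C)) f)"
      if "L \<in> obj C" "M \<in> obj C" "N \<in> obj C" "f \<in> hm C L M" "g \<in> hm C M N" for L M N f g
      using Pm_cmp[OF zob_obj zob_obj zob_obj that(1-3) idn_hm[OF zob_obj] idn_hm[OF zob_obj] that(4,5)]
      by (simp add: cmp_idl[OF zob_obj zob_obj idn_hm[OF zob_obj]])
  qed (use Po_obj Pm_hm Pm_idn Po_zob Pm_ses zob_obj idn_hm ses_zob in auto)
qed

text \<open>The unit isomorphisms are the projections; their inverses insert \<open>Tup []\<close>,
  the only element of the zero module.\<close>

sublocale direct_sum_category C dsum dsum_mor "\<lambda>M. \<lambda>u\<in>carrier (dsum zm M). co 2 1 u" "\<lambda>M. \<lambda>u\<in>carrier (dsum M zm). co 2 0 u"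
proof (intro direct_sum_category.intro wcategory_axioms dsum_bifunctor direct_sum_category_axioms.intro)
  let ?Z = zm
  have zc: "Tup [] \<in> carrier ?Z" by (simp add: zero_gmodule_def)
  show "natural_iso C C (\<lambda>M. dsum M (zob C)) (\<lambda>M N f. dsum_mor M N (zob C) (zob C) f (idn C (zob C)))
      (\<lambda>M. M) (\<lambda>_ _ f. f) (\<lambda>M. \<lambda>u\<in>carrier (dsum M ?Z). co 2 0 u)"
  proof (rule natural_isoI[OF dsum_zero_right exact_functor_id, where \<psi> = "\<lambda>M x. mk 2 (\<lambda>i. if i = 0 then x else Tup [])"], unfold C_simps)
    fix M N :: "('a, 'a muniv, 'g) gmodule" and f u assume M: "M \<in> gmodules G T R ract"
    note D = module_prodD[OF dsum_prod[OF gmodulesD(1)[OF M] gmodulesD(1)[OF zero_obj]]]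
    have 0: "(0::nat) < 2" by simp
    show "(\<lambda>u\<in>carrier (dsum M ?Z). co 2 0 u) \<in> gmodule_hom G R (dsum M ?Z) M"
      by (rule gmodule_homI) (use D(6-9) dsum_co gmodulesD(3)[OF dsum_obj[OF M zero_obj]] in \<open>auto simp: dsum_gact\<close>)
    show "mk 2 (\<lambda>i. if i = 0 then v else Tup []) \<in> carrier (dsum M ?Z) \<and>
        (\<lambda>u\<in>carrier (dsum M ?Z). co 2 0 u) (mk 2 (\<lambda>i. if i = 0 then v else Tup [])) = v" if "v \<in> carrier M" for v
      using dsum_in[OF that zc] by simp
    show "mk 2 (\<lambda>i. if i = 0 then (\<lambda>u\<in>carrier (dsum M ?Z). co 2 0 u) u else Tup []) = u" if u: "u \<in> carrier (dsum M ?Z)"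
      by (rule dsum_ext[OF gmodulesD(1)[OF M] gmodulesD(1)[OF zero_obj] _ u])
        (use u dsum_co[OF u] zc in \<open>auto intro!: dsum_in simp: zero_gmodule_def\<close>)
    assume N: "N \<in> gmodules G T R ract" and f: "f \<in> gmodule_hom G R M N" and u: "u \<in> carrier (dsum M ?Z)"
    have "dsum_mor M N ?Z ?Z f (\<lambda>x\<in>carrier ?Z. x) u \<in> carrier (dsum N ?Z)"
      by (rule gmodule_homD(2)[OF dsum_mor_hom[OF M zero_obj N zero_obj f hom_idn[OF zero_obj]] u])
    then show "(\<lambda>u\<in>carrier (dsum N ?Z). co 2 0 u) (dsum_mor M N ?Z ?Z f (\<lambda>x\<in>carrier ?Z. x) u) = f ((\<lambda>u\<in>carrier (dsum M ?Z). co 2 0 u) u)"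
      using u by (simp add: dsum_mor_coords)
  qed
  show "natural_iso C C (\<lambda>M. dsum (zob C) M) (\<lambda>M N f. dsum_mor (zob C) (zob C) M N (idn C (zob C)) f)
      (\<lambda>M. M) (\<lambda>_ _ f. f) (\<lambda>M. \<lambda>u\<in>carrier (dsum ?Z M). co 2 1 u)"
  proof (rule natural_isoI[OF dsum_zero_left exact_functor_id, where \<psi> = "\<lambda>M x. mk 2 (\<lambda>i. if i = 0 then Tup [] else x)"], unfold C_simps)
    fix M N :: "('a, 'a muniv, 'g) gmodule" and f u assume M: "M \<in> gmodules G T R ract"
    note D = module_prodD[OF dsum_prod[OF gmodulesD(1)[OF zero_obj] gmodulesD(1)[OF M]]]
    show "(\<lambda>u\<in>carrier (dsum ?Z M). co 2 1 u) \<in> gmodule_hom G R (dsum ?Z M) M"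
      by (rule gmodule_homI) (use D(6-9) dsum_co gmodulesD(3)[OF dsum_obj[OF zero_obj M]] in \<open>auto simp: dsum_gact\<close>)
    show "mk 2 (\<lambda>i. if i = 0 then Tup [] else v) \<in> carrier (dsum ?Z M) \<and>
        (\<lambda>u\<in>carrier (dsum ?Z M). co 2 1 u) (mk 2 (\<lambda>i. if i = 0 then Tup [] else v)) = v" if "v \<in> carrier M" for v
      using dsum_in[OF zc that] by simp
    show "mk 2 (\<lambda>i. if i = 0 then Tup [] else (\<lambda>u\<in>carrier (dsum ?Z M). co 2 1 u) u) = u" if u: "u \<in> carrier (dsum ?Z M)"
      by (rule dsum_ext[OF gmodulesD(1)[OF zero_obj] gmodulesD(1)[OF M] _ u])
        (use u dsum_co[OF u] zc in \<open>auto intro!: dsum_in simp: zero_gmodule_def\<close>)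
    assume N: "N \<in> gmodules G T R ract" and f: "f \<in> gmodule_hom G R M N" and u: "u \<in> carrier (dsum ?Z M)"
    have "dsum_mor ?Z ?Z M N (\<lambda>x\<in>carrier ?Z. x) f u \<in> carrier (dsum ?Z N)"
      by (rule gmodule_homD(2)[OF dsum_mor_hom[OF zero_obj M zero_obj N hom_idn[OF zero_obj] f] u])
    then show "(\<lambda>u\<in>carrier (dsum ?Z N). co 2 1 u) (dsum_mor ?Z ?Z M N (\<lambda>x\<in>carrier ?Z. x) f u) = f ((\<lambda>u\<in>carrier (dsum ?Z M). co 2 1 u) u)"
      using u by (simp add: dsum_mor_coords)
  qed
qed

end

lemma (in module) mat_app_Suc:
  assumes "\<And>j. j < Suc d \<Longrightarrow> U i j \<in> carrier R" "\<And>j. j < Suc d \<Longrightarrow> x j \<in> carrier M"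
  shows "mat_app M (Suc d) U x i = U i 0 \<odot>\<^bsub>M\<^esub> x 0 \<oplus>\<^bsub>M\<^esub> mat_app M d (\<lambda>_ j. U i (Suc j)) (\<lambda>j. x (Suc j)) i"
proof -
  have "lin_comb M (1 + d) x (U i) = lin_comb M 1 x (U i) \<oplus>\<^bsub>M\<^esub> lin_comb M d (\<lambda>j. x (1 + j)) (\<lambda>j. U i (1 + j))"
    by (rule lin_comb_split[OF module_axioms]) (use assms in auto)
  moreover have "lin_comb M 1 x (U i) = U i 0 \<odot>\<^bsub>M\<^esub> x 0"
    unfolding lin_comb_def by (rule finsum_delta[OF M.abelian_monoid_axioms, of 0]) (use assms in auto)
  ultimately show ?thesis by (simp add: lin_comb_def mat_app_def)
qed

section \<open>Comparison of tensor functors\<close>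

context equivariant_algebra
begin

text \<open>\<open>tensor_obj\<close> yields a module with the single element \<open>Tup []\<close>
  that need not equal the zero module as a record, hence the passage through a natural
  isomorphism.\<close>

lemma K_map_tensor_zero_dim:
  assumes \<rho>: "\<rho> \<in> reps G T" and d: "dm \<rho> = 0" and y: "y \<in> carrier (K_group C n)"
  shows "K_map C (tobj \<rho>) (tmor \<rho>) n y = \<one>\<^bsub>K_group C n\<^esub>"
proof -
  have c: "carrier (tobj \<rho> M) = {Tup []}" for M by (simp add: tensor_carrier d mk_def tup_def)
  have zc: "carrier zm = {Tup []}" by (simp add: zero_gmodule_def)
  interpret natural_iso C C "tobj \<rho>" "tmor \<rho>" "\<lambda>_. zm" "\<lambda>_ _ _. \<lambda>x\<in>carrier zm. x" "\<lambda>_. \<lambda>x\<in>carrier zm. x"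
  proof (rule natural_isoI[OF tensor_functor[OF \<rho>] zero_functor, where \<psi> = "\<lambda>_ x. x"])
    fix M N :: "('a, 'a muniv, 'g) gmodule" and f u assume M: "M \<in> gmodules G T R ract"
    interpret Z: module R zm by (rule gmodulesD(1)[OF zero_obj])
    interpret S: module R "tobj \<rho> M" by (rule gmodulesD(1)[OF tensor_gmodules[OF \<rho> M]])
    show "(\<lambda>x\<in>carrier zm. x) \<in> gmodule_hom G R (tobj \<rho> M) zm"
    proof (rule gmodule_homI)
      show "(\<lambda>x\<in>carrier zm. x) (u \<oplus>\<^bsub>tobj \<rho> M\<^esub> v) = (\<lambda>x\<in>carrier zm. x) u \<oplus>\<^bsub>zm\<^esub> (\<lambda>x\<in>carrier zm. x) v"
        if "u \<in> carrier (tobj \<rho> M)" "v \<in> carrier (tobj \<rho> M)" for u v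
        using S.M.a_closed[OF that] by (simp add: zero_gmodule_def c)
      show "(\<lambda>x\<in>carrier zm. x) (a \<odot>\<^bsub>tobj \<rho> M\<^esub> u) = a \<odot>\<^bsub>zm\<^esub> (\<lambda>x\<in>carrier zm. x) u"
        if "a \<in> carrier R" "u \<in> carrier (tobj \<rho> M)" for a u
        using S.smult_closed[OF that] by (simp add: zero_gmodule_def c)
      show "(\<lambda>x\<in>carrier zm. x) (gact (tobj \<rho> M) g u) = gact zm g ((\<lambda>x\<in>carrier zm. x) u)"
        if "g \<in> carrier G" "u \<in> carrier (tobj \<rho> M)" for g u
        using gmodulesD(3)[OF tensor_gmodules[OF \<rho> M] that] by (simp add: zero_gmodule_def c)
    qed (auto simp: c zc)
    assume N: "N \<in> gmodules G T R ract" "f \<in> gmodule_hom G R M N" "u \<in> carrier (tobj \<rho> M)"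
    show "(\<lambda>x\<in>carrier zm. x) (tmor \<rho> M N f u) = (\<lambda>x\<in>carrier zm. x) ((\<lambda>x\<in>carrier zm. x) u)"
      using gmodule_homD(2)[OF tensor_hom[OF \<rho> M N(1,2)] N(3)] N(3) by (simp add: c zc)
  qed (auto simp: c zc)
  show ?thesis using K_map_natural_iso[OF y] K_map_zero[OF y] by simp
qed

text \<open>\<open>U\<close> and \<open>V\<close> are the matrices of an equivariant isomorphism \<open>\<rho> \<otimes> R \<cong> \<sigma> \<otimes> R\<close> and its inverse.\<close>

lemma K_map_tensor_twisted:
  assumes \<rho>: "\<rho> \<in> reps G T" and \<sigma>: "\<sigma> \<in> reps G T"
    and U: "\<And>i j. i < dm \<sigma> \<Longrightarrow> j < dm \<rho> \<Longrightarrow> U i j \<in> carrier R" and V: "\<And>i j. i < dm \<rho> \<Longrightarrow> j < dm \<sigma> \<Longrightarrow> V i j \<in> carrier R"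
    and VU: "\<And>i k. i < dm \<rho> \<Longrightarrow> k < dm \<rho> \<Longrightarrow> (\<Oplus>\<^bsub>R\<^esub>j\<in>{..<dm \<sigma>}. V i j \<otimes>\<^bsub>R\<^esub> U j k) = (if k = i then \<one>\<^bsub>R\<^esub> else \<zero>\<^bsub>R\<^esub>)"
    and UV: "\<And>i k. i < dm \<sigma> \<Longrightarrow> k < dm \<sigma> \<Longrightarrow> (\<Oplus>\<^bsub>R\<^esub>j\<in>{..<dm \<rho>}. U i j \<otimes>\<^bsub>R\<^esub> V j k) = (if k = i then \<one>\<^bsub>R\<^esub> else \<zero>\<^bsub>R\<^esub>)"
    and eq: "\<And>g i k. g \<in> carrier G \<Longrightarrow> i < dm \<sigma> \<Longrightarrow> k < dm \<rho> \<Longrightarrow>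
        (\<Oplus>\<^bsub>R\<^esub>j\<in>{..<dm \<sigma>}. imat (\<sigma> g) i j \<otimes>\<^bsub>R\<^esub> ract g (U j k)) = (\<Oplus>\<^bsub>R\<^esub>j\<in>{..<dm \<rho>}. U i j \<otimes>\<^bsub>R\<^esub> imat (\<rho> g) j k)"
    and y: "y \<in> carrier (K_group C n)"
  shows "K_map C (tobj \<rho>) (tmor \<rho>) n y = K_map C (tobj \<sigma>) (tmor \<sigma>) n y"
proof -
  let ?d = "dm \<rho>" and ?e = "dm \<sigma>"
  define \<phi> where "\<phi> M = (\<lambda>u\<in>carrier (tobj \<rho> M). mk ?e (mat_app M ?d U (\<lambda>j. co ?d j u)))" for M :: "('a, 'a muniv, 'g) gmodule"
  define \<psi> where "\<psi> M v = mk ?d (mat_app M ?e V (\<lambda>j. co ?e j v))" for M :: "('a, 'a muniv, 'g) gmodule" and v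
  have pc: "co ?e i (\<phi> M u) = mat_app M ?d U (\<lambda>j. co ?d j u) i" if "u \<in> carrier (tobj \<rho> M)" "i < ?e" for M u i
    using that by (simp add: \<phi>_def)
  have closed: "\<phi> M u \<in> carrier (tobj \<sigma> M)" if M: "M \<in> gmodules G T R ract" and u: "u \<in> carrier (tobj \<rho> M)" for M u
    using module.mat_app_closed[OF gmodulesD(1)[OF M]] U tensor_co[OF u] u unfolding \<phi>_def by (simp add: tensor_in)
  have "natural_iso C C (tobj \<rho>) (tmor \<rho>) (tobj \<sigma>) (tmor \<sigma>) \<phi>"
  proof (rule natural_isoI[OF tensor_functor[OF \<rho>] tensor_functor[OF \<sigma>], where \<psi> = \<psi>])
    fix M N :: "('a, 'a muniv, 'g) gmodule" and f u assume M: "M \<in> gmodules G T R ract"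
    interpret M: module R M by (rule gmodulesD(1)[OF M])
    note D = module_prodD[OF tensor_prod[OF gmodulesD(1)[OF M], of \<rho>]]
    show "\<phi> M \<in> gmodule_hom G R (tobj \<rho> M) (tobj \<sigma> M)"
    proof (rule gmodule_homI_coords[OF tensor_prod[OF gmodulesD(1)[OF M], of \<sigma>] tensor_gmodules[OF \<rho> M] tensor_gmodules[OF \<sigma> M]])
      show "\<phi> M \<in> extensional (carrier (tobj \<rho> M))" by (simp add: \<phi>_def)
      show "\<phi> M u \<in> carrier (tobj \<sigma> M)" if "u \<in> carrier (tobj \<rho> M)" for u by (rule closed[OF M that])
      fix i assume i: "i < ?e"
      show "co ?e i (\<phi> M (u \<oplus>\<^bsub>tobj \<rho> M\<^esub> v)) = co ?e i (\<phi> M u) \<oplus>\<^bsub>M\<^esub> co ?e i (\<phi> M v)"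
        if u: "u \<in> carrier (tobj \<rho> M)" and v: "v \<in> carrier (tobj \<rho> M)" for u v
        unfolding pc[OF u i] pc[OF v i] pc[OF D(6)[OF u v] i]
        by (rule trans[OF M.mat_app_cong M.mat_app_add]) (use D(7)[OF u v] tensor_co[OF u] tensor_co[OF v] U i in auto)
      show "co ?e i (\<phi> M (a \<odot>\<^bsub>tobj \<rho> M\<^esub> u)) = a \<odot>\<^bsub>M\<^esub> co ?e i (\<phi> M u)"
        if a: "a \<in> carrier R" and u: "u \<in> carrier (tobj \<rho> M)" for a u
        unfolding pc[OF u i] pc[OF D(8)[OF a u] i]
        by (rule trans[OF M.mat_app_cong M.mat_app_smult]) (use D(9)[OF a u] tensor_co[OF u] U i a in auto)
      show "co ?e i (\<phi> M (gact (tobj \<rho> M) g u)) = co ?e i (gact (tobj \<sigma> M) g (\<phi> M u))"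
        if g: "g \<in> carrier G" and u: "u \<in> carrier (tobj \<rho> M)" for g u
      proof -
        let ?y = "\<lambda>k. gact M g (co ?d k u)"
        have yc: "?y k \<in> carrier M" if "k < ?d" for k by (rule gmodulesD(3)[OF M g tensor_co[OF u that]])
        have "co ?e i (\<phi> M (gact (tobj \<rho> M) g u)) = mat_app M ?d U (\<lambda>j. co ?d j (gact (tobj \<rho> M) g u)) i"
          by (rule pc[OF gmodulesD(3)[OF tensor_gmodules[OF \<rho> M] g u] i])
        also have "\<dots> = mat_app M ?d U (mat_app M ?d (imat (\<rho> g)) ?y) i"
          by (rule M.mat_app_cong) (use i U yc imat_closed in \<open>auto simp: tensor_gact[OF M u g] intro!: M.mat_app_closed\<close>)
        also have "\<dots> = mat_app M ?d (\<lambda>i k. \<Oplus>\<^bsub>R\<^esub>j\<in>{..<?d}. U i j \<otimes>\<^bsub>R\<^esub> imat (\<rho> g) j k) ?y i"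
          by (rule M.mat_app_mat_app) (use i U yc imat_closed in auto)
        \<comment> \<open>Here \<open>eq\<close> enters. Unlike for an intertwiner over
          \<open>k\<close>, the entries of \<open>U\<close> are moved by \<open>g\<close>, to match
          the semilinear action on the module.\<close>
        also have "\<dots> = mat_app M ?d (\<lambda>i k. \<Oplus>\<^bsub>R\<^esub>j\<in>{..<?e}. imat (\<sigma> g) i j \<otimes>\<^bsub>R\<^esub> ract g (U j k)) ?y i"
          by (rule M.mat_app_cong) (use i U yc imat_closed eq[OF g i] ract_closed[OF g] in \<open>auto intro!: M.R.finsum_closed\<close>)
        also have "\<dots> = mat_app M ?e (imat (\<sigma> g)) (mat_app M ?d (\<lambda>j k. ract g (U j k)) ?y) i"
          by (rule M.mat_app_mat_app[symmetric]) (use i U yc imat_closed ract_closed[OF g] in auto)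
        also have "\<dots> = mat_app M ?e (imat (\<sigma> g)) (\<lambda>j. gact M g (co ?e j (\<phi> M u))) i"
        proof (rule M.mat_app_cong)
          fix j assume j: "j < ?e"
          show "mat_app M ?d (\<lambda>j k. ract g (U j k)) ?y j = gact M g (co ?e j (\<phi> M u))"
            unfolding pc[OF u j] by (rule gact_mat_app[OF M g R, symmetric]) (use j U tensor_co[OF u] ract_closed[OF g] in auto)
          show "gact M g (co ?e j (\<phi> M u)) \<in> carrier M"
            by (rule gmodulesD(3)[OF M g tensor_co[OF closed[OF M u] j]])
        qed (use imat_closed in auto)
        also have "\<dots> = co ?e i (gact (tobj \<sigma> M) g (\<phi> M u))"
          using i by (simp add: tensor_gact[OF M closed[OF M u] g])
        finally show ?thesis .
      qed
    qed
    have psi_closed: "\<psi> M v \<in> carrier (tobj \<rho> M)" if v: "v \<in> carrier (tobj \<sigma> M)" for v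
      unfolding \<psi>_def by (intro tensor_in M.mat_app_closed V tensor_co[OF v])
    show "\<psi> M v \<in> carrier (tobj \<rho> M) \<and> \<phi> M (\<psi> M v) = v" if v: "v \<in> carrier (tobj \<sigma> M)" for v
    proof
      show pv: "\<psi> M v \<in> carrier (tobj \<rho> M)" by (rule psi_closed[OF v])
      show "\<phi> M (\<psi> M v) = v"
      proof (rule tensor_ext[OF closed[OF M pv] v])
        fix i assume i: "i < ?e"
        have "co ?e i (\<phi> M (\<psi> M v)) = mat_app M ?d U (mat_app M ?e V (\<lambda>j. co ?e j v)) i"
          unfolding pc[OF pv i]
          by (rule M.mat_app_cong) (use i U V tensor_co[OF v] in \<open>auto simp: \<psi>_def intro!: M.mat_app_closed\<close>)
        also have "\<dots> = mat_app M ?e (\<lambda>i k. \<Oplus>\<^bsub>R\<^esub>j\<in>{..<?d}. U i j \<otimes>\<^bsub>R\<^esub> V j k) (\<lambda>j. co ?e j v) i"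
          by (rule M.mat_app_mat_app) (use i U V tensor_co[OF v] in auto)
        also have "\<dots> = co ?e i v"
          by (rule M.mat_app_id[OF i]) (use UV[OF i] tensor_co[OF v] in auto)
        finally show "co ?e i (\<phi> M (\<psi> M v)) = co ?e i v" .
      qed
    qed
    show "\<psi> M (\<phi> M u) = u" if u: "u \<in> carrier (tobj \<rho> M)"
    proof (rule tensor_ext[OF psi_closed[OF closed[OF M u]] u])
      fix i assume i: "i < ?d"
      have "co ?d i (\<psi> M (\<phi> M u)) = mat_app M ?e V (\<lambda>j. co ?e j (\<phi> M u)) i"
        using i by (simp add: \<psi>_def)
      also have "\<dots> = mat_app M ?e V (mat_app M ?d U (\<lambda>j. co ?d j u)) i"
        by (rule M.mat_app_cong) (use i U V tensor_co[OF u] in \<open>auto simp: pc[OF u] intro!: M.mat_app_closed\<close>)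
      also have "\<dots> = mat_app M ?d (\<lambda>i k. \<Oplus>\<^bsub>R\<^esub>j\<in>{..<?e}. V i j \<otimes>\<^bsub>R\<^esub> U j k) (\<lambda>j. co ?d j u) i"
        by (rule M.mat_app_mat_app) (use i U V tensor_co[OF u] in auto)
      also have "\<dots> = co ?d i u"
        by (rule M.mat_app_id[OF i]) (use VU[OF i] tensor_co[OF u] in auto)
      finally show "co ?d i (\<psi> M (\<phi> M u)) = co ?d i u" .
    qed
    assume N: "N \<in> gmodules G T R ract" and f: "f \<in> gmodule_hom G R M N" and u: "u \<in> carrier (tobj \<rho> M)"
    note fu = gmodule_homD(2)[OF tensor_hom[OF \<rho> M N f] u]
    note fpu = gmodule_homD(2)[OF tensor_hom[OF \<sigma> M N f] closed[OF M u]]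
    show "\<phi> N (tmor \<rho> M N f u) = tmor \<sigma> M N f (\<phi> M u)"
    proof (rule tensor_ext[OF closed[OF N fu] fpu])
      fix i assume i: "i < ?e"
      have "co ?e i (\<phi> N (tmor \<rho> M N f u)) = mat_app N ?d U (\<lambda>j. f (co ?d j u)) i"
        unfolding pc[OF fu i]
        by (rule module.mat_app_cong[OF gmodulesD(1)[OF N]]) (use i U tensor_co[OF u] gmodule_homD(2)[OF f] in \<open>auto simp: tensor_mor_coords[OF u]\<close>)
      also have "\<dots> = f (mat_app M ?d U (\<lambda>j. co ?d j u) i)"
        by (rule hom_mat_app[OF gmodulesD(1)[OF M] gmodulesD(1)[OF N] f, symmetric]) (use i U tensor_co[OF u] in auto)
      also have "\<dots> = co ?e i (tmor \<sigma> M N f (\<phi> M u))"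
        by (simp add: tensor_mor_coords[OF closed[OF M u] i] pc[OF u i])
      finally show "co ?e i (\<phi> N (tmor \<rho> M N f u)) = co ?e i (tmor \<sigma> M N f (\<phi> M u))" .
    qed
  qed
  then show ?thesis by (rule natural_iso.K_map_natural_iso[OF _ y])
qed

lemma sum_functor:
  assumes F: "exact_functor C C Fo Fm" and H: "exact_functor C C Go Gm"
  shows "exact_functor C C (\<lambda>M. dsum (Fo M) (Go M)) (\<lambda>M N f. dsum_mor (Fo M) (Fo N) (Go M) (Go N) (Fm M N f) (Gm M N f))"
proof -
  interpret exact_bifunctor C C C dsum dsum_mor by (rule dsum_bifunctor)
  interpret F: exact_functor C C Fo Fm by (rule F)
  interpret H: exact_functor C C Go Gm by (rule H)
  show ?thesis
    by (intro exact_functor.intro wcategory_axioms exact_functor_axioms.intro)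
      (simp_all add: Po_obj Pm_hm Pm_cmp Pm_idn Po_zob Pm_ses F.Fo_obj H.Fo_obj F.Fm_hm H.Fm_hm F.Fm_cmp H.Fm_cmp
        F.Fm_idn H.Fm_idn F.Fo_zob H.Fo_zob F.Fm_ses H.Fm_ses)
qed

text \<open>Splitting off coordinate 0 identifies the tensor functor of \<tau> with the direct sum
  of the identity and the tensor functor of \<sigma>; then \<open>K_map_sum\<close> applies.\<close>

lemma K_map_tensor_trivial_sum:
  assumes \<tau>: "\<tau> \<in> reps G T" and \<sigma>: "\<sigma> \<in> reps G T" and d: "dm \<tau> = Suc (dm \<sigma>)"
    and ent: "\<And>g. g \<in> carrier G \<Longrightarrow> \<tau> g $$ (0, 0) = 1"
      "\<And>g j. g \<in> carrier G \<Longrightarrow> j < dm \<sigma> \<Longrightarrow> \<tau> g $$ (0, Suc j) = 0"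
      "\<And>g i. g \<in> carrier G \<Longrightarrow> i < dm \<sigma> \<Longrightarrow> \<tau> g $$ (Suc i, 0) = 0"
      "\<And>g i j. g \<in> carrier G \<Longrightarrow> i < dm \<sigma> \<Longrightarrow> j < dm \<sigma> \<Longrightarrow> \<tau> g $$ (Suc i, Suc j) = \<sigma> g $$ (i, j)"
    and y: "y \<in> carrier (K_group C n)"
  shows "K_map C (tobj \<tau>) (tmor \<tau>) n y = y \<otimes>\<^bsub>K_group C n\<^esub> K_map C (tobj \<sigma>) (tmor \<sigma>) n y"
proof -
  let ?d = "dm \<sigma>" and ?e = "dm \<tau>"
  let ?D = "\<lambda>M. dsum M (tobj \<sigma> M)" and ?m = "\<lambda>M N f. dsum_mor M N (tobj \<sigma> M) (tobj \<sigma> N) f (tmor \<sigma> M N f)"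
  note FD = sum_functor[OF exact_functor_id tensor_functor[OF \<sigma>]]
  have dS: "0 < ?e" "i < ?d \<Longrightarrow> Suc i < ?e" for i using d by simp_all
  define \<phi> where "\<phi> M = (\<lambda>u\<in>carrier (tobj \<tau> M). mk 2 (\<lambda>i. if i = 0 then co ?e 0 u else mk ?d (\<lambda>i. co ?e (Suc i) u)))"
    for M :: "('a, 'a muniv, 'g) gmodule"
  define \<psi> where "\<psi> M v = mk ?e (\<lambda>i. case i of 0 \<Rightarrow> co 2 0 v | Suc i \<Rightarrow> co ?d i (co 2 1 v))" for M :: "('a, 'a muniv, 'g) gmodule" and v :: "'a muniv"
  have p0: "co 2 0 (\<phi> M u) = co ?e 0 u" and p1: "co 2 1 (\<phi> M u) = mk ?d (\<lambda>i. co ?e (Suc i) u)"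
    if "u \<in> carrier (tobj \<tau> M)" for M u using that by (simp_all add: \<phi>_def)
  have closed: "\<phi> M u \<in> carrier (?D M)" if u: "u \<in> carrier (tobj \<tau> M)" for M u
    using dsum_in[OF tensor_co[OF u, of 0], of "mk ?d (\<lambda>i. co ?e (Suc i) u)" "tobj \<sigma> M"] u d tensor_co[OF u]
    unfolding \<phi>_def by (simp add: tensor_in)
  \<comment> \<open>The second summand is itself a module of tuples, so equality is tested on its
    coordinates as well.\<close>
  have D_ext: "u = v" if M: "M \<in> gmodules G T R ract" and u: "u \<in> carrier (?D M)" and v: "v \<in> carrier (?D M)"
     and e: "co 2 0 u = co 2 0 v" "\<And>i. i < ?d \<Longrightarrow> co ?d i (co 2 1 u) = co ?d i (co 2 1 v)" for M u v
    by (rule dsum_ext[OF gmodulesD(1)[OF M] gmodulesD(1)[OF tensor_gmodules[OF \<sigma> M]] u v e(1)])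
      (rule tensor_ext[OF dsum_co(2)[OF u] dsum_co(2)[OF v] e(2)])
  have "natural_iso C C (tobj \<tau>) (tmor \<tau>) ?D ?m \<phi>"
  proof (rule natural_isoI[OF tensor_functor[OF \<tau>] FD, where \<psi> = \<psi>])
    fix M N :: "('a, 'a muniv, 'g) gmodule" and f u assume M: "M \<in> gmodules G T R ract"
    interpret M: module R M by (rule gmodulesD(1)[OF M])
    note oT = tensor_gmodules[OF \<tau> M] and oS = tensor_gmodules[OF \<sigma> M]
    note oD = dsum_obj[OF M oS]
    note D = module_prodD[OF tensor_prod[OF gmodulesD(1)[OF M], of \<tau>]]
    note S = module_prodD[OF tensor_prod[OF gmodulesD(1)[OF M], of \<sigma>]]
    note DD = module_prodD[OF dsum_prod[OF gmodulesD(1)[OF M] gmodulesD(1)[OF oS]]]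
    have c01: "co 2 0 (u \<oplus>\<^bsub>?D M\<^esub> v) = co 2 0 u \<oplus>\<^bsub>M\<^esub> co 2 0 v" "co 2 1 (u \<oplus>\<^bsub>?D M\<^esub> v) = co 2 1 u \<oplus>\<^bsub>tobj \<sigma> M\<^esub> co 2 1 v"
      if "u \<in> carrier (?D M)" "v \<in> carrier (?D M)" for u v
      using DD(7)[OF that, of 0] DD(7)[OF that, of 1] by simp_all
    have s01: "co 2 0 (a \<odot>\<^bsub>?D M\<^esub> u) = a \<odot>\<^bsub>M\<^esub> co 2 0 u" "co 2 1 (a \<odot>\<^bsub>?D M\<^esub> u) = a \<odot>\<^bsub>tobj \<sigma> M\<^esub> co 2 1 u"
      if "a \<in> carrier R" "u \<in> carrier (?D M)" for a u
      using DD(9)[OF that, of 0] DD(9)[OF that, of 1] by simp_all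
    have cs: "co ?d i (co 2 1 (\<phi> M u)) = co ?e (Suc i) u" if "i < ?d" "u \<in> carrier (tobj \<tau> M)" for i u
      using that by (simp only: p1 co_mk)
    show "\<phi> M \<in> gmodule_hom G R (tobj \<tau> M) (?D M)"
    proof (rule gmodule_homI)
      show "\<phi> M \<in> extensional (carrier (tobj \<tau> M))" by (simp add: \<phi>_def)
      show "\<phi> M u \<in> carrier (?D M)" if "u \<in> carrier (tobj \<tau> M)" for u by (rule closed[OF that])
      show "\<phi> M (u \<oplus>\<^bsub>tobj \<tau> M\<^esub> v) = \<phi> M u \<oplus>\<^bsub>?D M\<^esub> \<phi> M v"
        if u: "u \<in> carrier (tobj \<tau> M)" and v: "v \<in> carrier (tobj \<tau> M)" for u v
        by (rule D_ext[OF M closed[OF D(6)[OF u v]] DD(6)[OF closed[OF u] closed[OF v]]])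
          (simp_all only: c01[OF closed[OF u] closed[OF v]] p0[OF u] p0[OF v] p0[OF D(6)[OF u v]] D(7)[OF u v] dS
            cs[OF _ u] cs[OF _ v] cs[OF _ D(6)[OF u v]] S(7)[OF dsum_co(2)[OF closed[OF u]] dsum_co(2)[OF closed[OF v]]])
      show "\<phi> M (a \<odot>\<^bsub>tobj \<tau> M\<^esub> u) = a \<odot>\<^bsub>?D M\<^esub> \<phi> M u" if a: "a \<in> carrier R" and u: "u \<in> carrier (tobj \<tau> M)" for a u
        by (rule D_ext[OF M closed[OF D(8)[OF a u]] DD(8)[OF a closed[OF u]]])
          (simp_all only: s01[OF a closed[OF u]] p0[OF u] p0[OF D(8)[OF a u]] D(9)[OF a u] dS
            cs[OF _ u] cs[OF _ D(8)[OF a u]] S(9)[OF a dsum_co(2)[OF closed[OF u]]])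
      show "\<phi> M (gact (tobj \<tau> M) g u) = gact (?D M) g (\<phi> M u)" if g: "g \<in> carrier G" and u: "u \<in> carrier (tobj \<tau> M)" for g u
      proof -
        let ?y = "\<lambda>j. gact M g (co ?e j u)"
        have yc: "?y j \<in> carrier M" if "j < Suc ?d" for j using gmodulesD(3)[OF M g tensor_co[OF u]] that d by simp
        note gu = gmodulesD(3)[OF oT g u]
        have gc: "co ?e i (gact (tobj \<tau> M) g u) = imat (\<tau> g) i 0 \<odot>\<^bsub>M\<^esub> ?y 0 \<oplus>\<^bsub>M\<^esub> mat_app M ?d (\<lambda>_ j. imat (\<tau> g) i (Suc j)) (\<lambda>j. ?y (Suc j)) i"
          if "i < ?e" for i
        proof -
          have "co ?e i (gact (tobj \<tau> M) g u) = mat_app M (Suc ?d) (imat (\<tau> g)) ?y i"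
            using that by (simp add: tensor_gact[OF M u g] d)
          also have "\<dots> = imat (\<tau> g) i 0 \<odot>\<^bsub>M\<^esub> ?y 0 \<oplus>\<^bsub>M\<^esub> mat_app M ?d (\<lambda>_ j. imat (\<tau> g) i (Suc j)) (\<lambda>j. ?y (Suc j)) i"
            by (rule M.mat_app_Suc) (use imat_closed yc in auto)
          finally show ?thesis .
        qed
        show ?thesis
        proof (rule D_ext[OF M closed[OF gu] gmodulesD(3)[OF oD g closed[OF u]]])
          have "mat_app M ?d (\<lambda>_ j. imat (\<tau> g) 0 (Suc j)) (\<lambda>j. ?y (Suc j)) 0 = (\<Oplus>\<^bsub>M\<^esub>j\<in>{..<?d}. \<zero>\<^bsub>M\<^esub>)"
            unfolding mat_app_def by (rule M.M.finsum_cong') (use ent(2)[OF g] yc in \<open>auto simp: imat_def iota_zero\<close>)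
          then have "co ?e 0 (gact (tobj \<tau> M) g u) = ?y 0"
            using gc[of 0] d yc[of 0] ent(1)[OF g] by (simp add: imat_def iota_one M.M.finsum_zero)
          then show "co 2 0 (\<phi> M (gact (tobj \<tau> M) g u)) = co 2 0 (gact (?D M) g (\<phi> M u))"
            using p0[OF gu] p0[OF u] by (simp add: dsum_gact[OF closed[OF u]])
          fix i assume i: "i < ?d"
          have "co ?e (Suc i) (gact (tobj \<tau> M) g u) = mat_app M ?d (\<lambda>_ j. imat (\<tau> g) (Suc i) (Suc j)) (\<lambda>j. ?y (Suc j)) (Suc i)"
            using gc[of "Suc i"] d i yc[of 0] ent(3)[OF g i] yc imat_closed
            by (simp add: imat_def[of _ _ 0] iota_zero M.mat_app_closed)
          also have "\<dots> = (\<Oplus>\<^bsub>M\<^esub>j\<in>{..<?d}. imat (\<sigma> g) i j \<odot>\<^bsub>M\<^esub> gact M g (co ?d j (co 2 1 (\<phi> M u))))"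
            unfolding mat_app_def
            by (rule M.M.finsum_cong') (use ent(4)[OF g i] yc cs[OF _ u] imat_closed in \<open>auto simp del: One_nat_def simp: imat_def iota_closed\<close>)
          also have "\<dots> = co ?d i (gact (tobj \<sigma> M) g (co 2 1 (\<phi> M u)))"
            by (simp only: tensor_gact[OF M dsum_co(2)[OF closed[OF u]] g] co_mk[OF i] mat_app_def)
          also have "\<dots> = co ?d i (co 2 1 (gact (?D M) g (\<phi> M u)))"
            by (simp add: dsum_gact[OF closed[OF u]])
          finally show "co ?d i (co 2 1 (\<phi> M (gact (tobj \<tau> M) g u))) = co ?d i (co 2 1 (gact (?D M) g (\<phi> M u)))"
            using cs[OF i gu] by simp
        qed
      qed
    qed
    have psi_closed: "\<psi> M v \<in> carrier (tobj \<tau> M)" if v: "v \<in> carrier (?D M)" for v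
      unfolding \<psi>_def using dsum_co(1)[OF v] tensor_co[OF dsum_co(2)[OF v]] d
      by (intro tensor_in) (auto split: nat.split)
    have psi_co: "co ?e 0 (\<psi> M v) = co 2 0 v" "i < ?d \<Longrightarrow> co ?e (Suc i) (\<psi> M v) = co ?d i (co 2 1 v)" for v i
      using d by (simp_all add: \<psi>_def)
    show "\<psi> M v \<in> carrier (tobj \<tau> M) \<and> \<phi> M (\<psi> M v) = v" if v: "v \<in> carrier (?D M)" for v
      by (intro conjI psi_closed[OF v] D_ext[OF M closed[OF psi_closed[OF v]] v])
        (simp_all only: p0[OF psi_closed[OF v]] cs[OF _ psi_closed[OF v]] psi_co)
    show "\<psi> M (\<phi> M u) = u" if u: "u \<in> carrier (tobj \<tau> M)"
    proof (rule tensor_ext[OF psi_closed[OF closed[OF u]] u])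
      fix i assume i: "i < ?e"
      show "co ?e i (\<psi> M (\<phi> M u)) = co ?e i u"
      proof (cases i)
        case 0
        then show ?thesis by (simp only: psi_co p0[OF u])
      next
        case (Suc k)
        then have "k < ?d" using i d by simp
        then show ?thesis by (simp only: Suc psi_co cs[OF _ u])
      qed
    qed
    assume N: "N \<in> gmodules G T R ract" and f: "f \<in> gmodule_hom G R M N" and u: "u \<in> carrier (tobj \<tau> M)"
    note fu = gmodule_homD(2)[OF tensor_hom[OF \<tau> M N f] u]
    have Su: "co 2 1 (\<phi> M u) \<in> carrier (tobj \<sigma> M)" by (rule dsum_co(2)[OF closed[OF u]])
    note fpu = gmodule_homD(2)[OF dsum_mor_hom[OF M oS N tensor_gmodules[OF \<sigma> N] f tensor_hom[OF \<sigma> M N f]] closed[OF u]]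
    show "\<phi> N (tmor \<tau> M N f u) = ?m M N f (\<phi> M u)"
    proof (rule D_ext[OF N closed[OF fu] fpu])
      show "co 2 0 (\<phi> N (tmor \<tau> M N f u)) = co 2 0 (?m M N f (\<phi> M u))"
        by (simp add: p0[OF fu] dsum_mor_coords[OF closed[OF u]] p0[OF u] tensor_mor_coords[OF u dS(1)])
      fix i assume i: "i < ?d"
      have "co ?d i (co 2 1 (?m M N f (\<phi> M u))) = co ?d i (tmor \<sigma> M N f (co 2 1 (\<phi> M u)))"
        by (simp add: dsum_mor_coords[OF closed[OF u]])
      also have "\<dots> = f (co ?e (Suc i) u)" by (simp only: tensor_mor_coords[OF Su i] cs[OF i u])
      also have "\<dots> = co ?e (Suc i) (tmor \<tau> M N f u)" by (simp add: tensor_mor_coords[OF u dS(2)[OF i]])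
      also have "\<dots> = co ?d i (co 2 1 (\<phi> N (tmor \<tau> M N f u)))"
        using i by (simp only: p1[OF fu] co_mk)
      finally show "co ?d i (co 2 1 (\<phi> N (tmor \<tau> M N f u))) = co ?d i (co 2 1 (?m M N f (\<phi> M u)))" by simp
    qed
  qed
  then have "K_map C (tobj \<tau>) (tmor \<tau>) n y = K_map C ?D ?m n y"
    by (rule natural_iso.K_map_natural_iso[OF _ y])
  also have "\<dots> = K_map C (\<lambda>M. M) (\<lambda>_ _ f. f) n y \<otimes>\<^bsub>K_group C n\<^esub> K_map C (tobj \<sigma>) (tmor \<sigma>) n y"
    by (rule K_map_sum[OF exact_functor_id tensor_functor[OF \<sigma>] FD y])
  finally show ?thesis by (simp add: K_map_id[OF y])
qed

end

section \<open>Representations with finite image and their trivial summands\<close>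

lemma repsI:
  assumes "\<And>g. g \<in> carrier G \<Longrightarrow> \<rho> g \<in> carrier_mat n n" "\<rho> \<one>\<^bsub>G\<^esub> = 1\<^sub>m n"
    "\<And>g h. g \<in> carrier G \<Longrightarrow> h \<in> carrier G \<Longrightarrow> \<rho> (g \<otimes>\<^bsub>G\<^esub> h) = \<rho> g * \<rho> h" "locally_constant T \<rho>"
  shows "\<rho> \<in> reps G T" "rep_dim G \<rho> = n"
proof -
  show d: "rep_dim G \<rho> = n" using assms(2) by (simp add: rep_dim_def)
  show "\<rho> \<in> reps G T"
    unfolding reps_def mem_Collect_eq d using assms by (simp add: continuous_map_discrete_iff)
qed

context equivariant_algebra
begin

lemma rep_lc: "\<rho> \<in> reps G T \<Longrightarrow> locally_constant T \<rho>"
  by (simp add: reps_def continuous_map_discrete_iff)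

text \<open>Matrices over \<open>k\<close> are fixed by the action on the ring, so an ordinary
  intertwiner satisfies the twisted condition.\<close>

lemma K_map_tensor_iso:
  assumes \<rho>: "\<rho> \<in> reps G T" and \<sigma>: "\<sigma> \<in> reps G T" and d: "dm \<rho> = m" "dm \<sigma> = m"
    and U: "U \<in> carrier_mat m m" and V: "V \<in> carrier_mat m m" and inv: "U * V = 1\<^sub>m m" "V * U = 1\<^sub>m m"
    and eq: "\<And>g. g \<in> carrier G \<Longrightarrow> U * \<rho> g = \<sigma> g * U"
    and y: "y \<in> carrier (K_group C n)"
  shows "K_map C (tobj \<rho>) (tmor \<rho>) n y = K_map C (tobj \<sigma>) (tmor \<sigma>) n y"
proof (rule K_map_tensor_twisted[OF \<rho> \<sigma>, where U = "imat U" and V = "imat V"], unfold d)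
  fix i k :: nat assume i: "i < m" and k: "k < m"
  show "(\<Oplus>\<^bsub>R\<^esub>j\<in>{..<m}. imat V i j \<otimes>\<^bsub>R\<^esub> imat U j k) = (if k = i then \<one>\<^bsub>R\<^esub> else \<zero>\<^bsub>R\<^esub>)"
    using imat_mult[OF V U i k] inv(2) imat_one[OF i k] by simp
  show "(\<Oplus>\<^bsub>R\<^esub>j\<in>{..<m}. imat U i j \<otimes>\<^bsub>R\<^esub> imat V j k) = (if k = i then \<one>\<^bsub>R\<^esub> else \<zero>\<^bsub>R\<^esub>)"
    using imat_mult[OF U V i k] inv(1) imat_one[OF i k] by simp
  fix g assume g: "g \<in> carrier G"
  have "(\<Oplus>\<^bsub>R\<^esub>j\<in>{..<m}. imat (\<sigma> g) i j \<otimes>\<^bsub>R\<^esub> ract g (imat U j k)) = imat (\<sigma> g * U) i k"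
    using imat_mult[OF _ U i k, of "\<sigma> g"] rep_mat[OF \<sigma> g] by (simp add: d ract_imat[OF g])
  also have "\<dots> = imat (U * \<rho> g) i k" by (simp add: eq[OF g])
  also have "\<dots> = (\<Oplus>\<^bsub>R\<^esub>j\<in>{..<m}. imat U i j \<otimes>\<^bsub>R\<^esub> imat (\<rho> g) j k)"
    using imat_mult[OF U _ i k, of "\<rho> g"] rep_mat[OF \<rho> g] by (simp add: d)
  finally show "(\<Oplus>\<^bsub>R\<^esub>j\<in>{..<m}. imat (\<sigma> g) i j \<otimes>\<^bsub>R\<^esub> ract g (imat U j k)) = (\<Oplus>\<^bsub>R\<^esub>j\<in>{..<m}. imat U i j \<otimes>\<^bsub>R\<^esub> imat (\<rho> g) j k)" .
qed (simp_all add: imat_closed y)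

text \<open>The kernel is open because the representation is locally constant, and the image is in
  bijection with the cosets of the kernel.\<close>

lemma rep_image_card:
  assumes \<pi>: "\<pi> \<in> reps G T"
    and fin: "\<And>N. N \<lhd> G \<Longrightarrow> openin T N \<Longrightarrow> \<exists>r. card (rcosets\<^bsub>G\<^esub> N) = l ^ r" and l: "l > 0"
  shows "finite (\<pi> ` carrier G)" "\<exists>r. card (\<pi> ` carrier G) = l ^ r"
proof -
  interpret G: group G by (rule G)
  let ?d = "dm \<pi>"
  define N where "N = {g \<in> carrier G. \<pi> g = 1\<^sub>m ?d}"
  note m = rep_mult[OF \<pi>] and M = rep_mat[OF \<pi>] and o = rep_one[OF \<pi>]
  have inv: "\<pi> (inv\<^bsub>G\<^esub> g) * \<pi> g = 1\<^sub>m ?d" "\<pi> g * \<pi> (inv\<^bsub>G\<^esub> g) = 1\<^sub>m ?d" if "g \<in> carrier G" for g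
    using m[of "inv\<^bsub>G\<^esub> g" g] m[of g "inv\<^bsub>G\<^esub> g"] that o by simp_all
  have sub: "subgroup N G"
  proof (rule G.subgroupI)
    show "inv\<^bsub>G\<^esub> g \<in> N" if "g \<in> N" for g
      using inv(1)[of g] M[of "inv\<^bsub>G\<^esub> g"] that by (simp add: N_def)
    show "g \<otimes>\<^bsub>G\<^esub> h \<in> N" if "g \<in> N" "h \<in> N" for g h
      using that by (simp add: N_def m)
  qed (auto simp: N_def o intro!: exI[of _ "\<one>\<^bsub>G\<^esub>"])
  have norm: "N \<lhd> G"
    unfolding G.normal_inv_iff
  proof (intro conjI sub ballI)
    fix x h assume x: "x \<in> carrier G" and h: "h \<in> N"
    then have "\<pi> (x \<otimes>\<^bsub>G\<^esub> h \<otimes>\<^bsub>G\<^esub> inv\<^bsub>G\<^esub> x) = \<pi> x * 1\<^sub>m ?d * \<pi> (inv\<^bsub>G\<^esub> x)" by (simp add: N_def m)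
    also have "\<dots> = 1\<^sub>m ?d" using inv(2)[OF x] M[OF x] by simp
    finally show "x \<otimes>\<^bsub>G\<^esub> h \<otimes>\<^bsub>G\<^esub> inv\<^bsub>G\<^esub> x \<in> N" using x h by (simp add: N_def)
  qed
  have NT: "N = {g \<in> topspace T. \<pi> g \<in> {1\<^sub>m ?d}}" by (auto simp: N_def T)
  have "continuous_map T (discrete_topology UNIV) \<pi>" using \<pi> by (simp add: reps_def)
  then have "openin T N" unfolding NT by (rule openin_continuous_map_preimage) simp
  then obtain r where r: "card (rcosets\<^bsub>G\<^esub> N) = l ^ r" using fin[OF norm] by blast
  \<comment> \<open>By convention an infinite set has cardinality 0, which is no power of a positive
    \<open>l\<close>.\<close>
  then have finR: "finite (rcosets\<^bsub>G\<^esub> N)" using l by (metis card.infinite power_not_zero not_gr_zero)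
  have cos: "N #>\<^bsub>G\<^esub> g = N #>\<^bsub>G\<^esub> h \<longleftrightarrow> \<pi> g = \<pi> h" if g: "g \<in> carrier G" and h: "h \<in> carrier G" for g h
  proof -
    have "N #>\<^bsub>G\<^esub> g = N #>\<^bsub>G\<^esub> h \<longleftrightarrow> g \<otimes>\<^bsub>G\<^esub> inv\<^bsub>G\<^esub> h \<in> N"
    proof
      assume "N #>\<^bsub>G\<^esub> g = N #>\<^bsub>G\<^esub> h"
      then have "g \<in> N #>\<^bsub>G\<^esub> h" using G.rcos_self[OF g sub] by simp
      then obtain k where k: "k \<in> N" "g = k \<otimes>\<^bsub>G\<^esub> h" by (auto simp: r_coset_def)
      then show "g \<otimes>\<^bsub>G\<^esub> inv\<^bsub>G\<^esub> h \<in> N" using h by (simp add: N_def G.m_assoc)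
    next
      assume a: "g \<otimes>\<^bsub>G\<^esub> inv\<^bsub>G\<^esub> h \<in> N"
      have "g = g \<otimes>\<^bsub>G\<^esub> inv\<^bsub>G\<^esub> h \<otimes>\<^bsub>G\<^esub> h" using g h by (simp add: G.m_assoc)
      then have "g \<in> N #>\<^bsub>G\<^esub> h" using a unfolding r_coset_def by blast
      then show "N #>\<^bsub>G\<^esub> g = N #>\<^bsub>G\<^esub> h" using G.repr_independence[OF _ h sub] by simp
    qed
    also have "\<dots> \<longleftrightarrow> \<pi> g * \<pi> (inv\<^bsub>G\<^esub> h) = 1\<^sub>m ?d" using g h by (simp add: N_def m)
    also have "\<dots> \<longleftrightarrow> \<pi> g = \<pi> h"
    proof
      assume "\<pi> g * \<pi> (inv\<^bsub>G\<^esub> h) = 1\<^sub>m ?d"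
      then have "\<pi> g * \<pi> (inv\<^bsub>G\<^esub> h) * \<pi> h = \<pi> h" using M[OF h] by simp
      then show "\<pi> g = \<pi> h" using inv(1)[OF h] M[OF h] M[OF g] M[of "inv\<^bsub>G\<^esub> h"] h
        by (simp add: assoc_mult_mat[of _ ?d ?d _ ?d _ ?d])
    next
      assume "\<pi> g = \<pi> h"
      then show "\<pi> g * \<pi> (inv\<^bsub>G\<^esub> h) = 1\<^sub>m ?d" using inv(2)[OF h] by simp
    qed
    finally show ?thesis .
  qed
  have R: "rcosets\<^bsub>G\<^esub> N = (\<lambda>g. N #>\<^bsub>G\<^esub> g) ` carrier G" by (auto simp: RCOSETS_def)
  define f where "f c = (SOME q. \<exists>g\<in>carrier G. c = N #>\<^bsub>G\<^esub> g \<and> q = \<pi> g)" for c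
  have f: "f (N #>\<^bsub>G\<^esub> g) = \<pi> g" if "g \<in> carrier G" for g
    unfolding f_def by (rule some_equality) (use that cos in auto)
  have "bij_betw f (rcosets\<^bsub>G\<^esub> N) (\<pi> ` carrier G)"
    unfolding bij_betw_def R
  proof
    show "inj_on f ((\<lambda>g. N #>\<^bsub>G\<^esub> g) ` carrier G)"
      by (rule inj_onI) (clarsimp simp: f cos)
    show "f ` (\<lambda>g. N #>\<^bsub>G\<^esub> g) ` carrier G = \<pi> ` carrier G"
      unfolding image_image by (rule image_cong) (use f in auto)
  qed
  then show "finite (\<pi> ` carrier G)" "\<exists>r. card (\<pi> ` carrier G) = l ^ r"
    using finR r bij_betw_finite bij_betw_same_card by metis+
qed

text \<open>The vector \<open>(1, \<dots>, 1)\<close> spans a direct summand, since averaging the first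
  coordinate over the finite image yields an invariant functional that does not vanish on this vector.\<close>

lemma K_map_tensor_fixed_vector:
  assumes \<pi>: "\<pi> \<in> reps G T" and d: "dm \<pi> = Suc e"
    and row: "\<And>g i. g \<in> carrier G \<Longrightarrow> i < Suc e \<Longrightarrow> (\<Sum>j<Suc e. \<pi> g $$ (i, j)) = 1"
    and fin: "finite (\<pi> ` carrier G)" "of_nat (card (\<pi> ` carrier G)) \<noteq> (0 :: 'k)"
  obtains \<sigma> where "\<sigma> \<in> reps G T" "dm \<sigma> = e"
    "\<And>n y. y \<in> carrier (K_group C n) \<Longrightarrow>
      K_map C (tobj \<pi>) (tmor \<pi>) n y = y \<otimes>\<^bsub>K_group C n\<^esub> K_map C (tobj \<sigma>) (tmor \<sigma>) n y"
proof -
  interpret G: group G by (rule G)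
  let ?m = "Suc e" and ?Q = "\<pi> ` carrier G"
  note m = rep_mult[OF \<pi>] and M = rep_mat[OF \<pi>, unfolded d] and o = rep_one[OF \<pi>, unfolded d]
  \<comment> \<open>The first coordinate summed over the finite image; division by the order is
    postponed to \<open>U\<close> and \<open>V\<close>.\<close>
  define lam where "lam j = (\<Sum>q\<in>?Q. q $$ (0, j))" for j
  define c where "c = (of_nat (card ?Q) :: 'k)"
  have c: "c \<noteq> 0" using fin(2) by (simp add: c_def)
  \<comment> \<open>The row sums are 1, so on the vector with all entries 1 the functional takes the
    order of the image as its value.\<close>
  have sum_lam: "(\<Sum>j<?m. lam j) = c"
  proof -
    have "(\<Sum>j<?m. lam j) = (\<Sum>q\<in>?Q. \<Sum>j<?m. q $$ (0, j))" unfolding lam_def by (rule sum.swap)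
    also have "\<dots> = (\<Sum>q\<in>?Q. 1)" by (rule sum.cong) (use row in auto)
    finally show ?thesis by (simp add: c_def)
  qed
  \<comment> \<open>Right multiplication by \<open>\<pi> g\<close> permutes the image.\<close>
  have lam_inv: "(\<Sum>j<?m. lam j * \<pi> g $$ (j, k)) = lam k" if g: "g \<in> carrier G" and k: "k < ?m" for g k
  proof -
    have "(\<Sum>j<?m. lam j * \<pi> g $$ (j, k)) = (\<Sum>q\<in>?Q. \<Sum>j<?m. q $$ (0, j) * \<pi> g $$ (j, k))"
      unfolding lam_def sum_distrib_right by (rule sum.swap)
    also have "\<dots> = (\<Sum>q\<in>?Q. (q * \<pi> g) $$ (0, k))"
      by (rule sum.cong[OF refl]) (use mat_mult_entry[OF _ M[OF g] _ k, of _ ?m 0] M in auto)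
    also have "\<dots> = (\<Sum>q\<in>?Q. q $$ (0, k))"
    proof (rule sum.reindex_bij_betw[where h = "\<lambda>q. q * \<pi> g" and g = "\<lambda>q. q $$ (0, k)"])
      show "bij_betw (\<lambda>q. q * \<pi> g) ?Q ?Q"
      proof (rule bij_betw_byWitness[where f' = "\<lambda>q. q * \<pi> (inv\<^bsub>G\<^esub> g)"])
        show "\<forall>q\<in>?Q. q * \<pi> g * \<pi> (inv\<^bsub>G\<^esub> g) = q" "\<forall>q\<in>?Q. q * \<pi> (inv\<^bsub>G\<^esub> g) * \<pi> g = q"
          using g by (auto simp: m[symmetric] G.m_assoc)
        show "(\<lambda>q. q * \<pi> g) ` ?Q \<subseteq> ?Q" "(\<lambda>q. q * \<pi> (inv\<^bsub>G\<^esub> g)) ` ?Q \<subseteq> ?Q"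
          using g by (auto simp: m[symmetric])
      qed
    qed
    finally show ?thesis by (simp add: lam_def)
  qed
  \<comment> \<open>The first row of \<open>U\<close> is the normalized functional; the others are
    differences of a coordinate and the last one, which vanish on the vector with all entries 1. The
    first column of \<open>V\<close> is this vector; the others are unit vectors corrected by
    multiples of it so as to lie in the kernel of the functional.\<close>
  define U where "U = mat ?m ?m (\<lambda>(i, j). case i of 0 \<Rightarrow> lam j / c
      | Suc i \<Rightarrow> (if j = i then 1 else 0) - (if j = e then 1 else 0))"
  define V where "V = mat ?m ?m (\<lambda>(i, j). case j of 0 \<Rightarrow> 1 | Suc j \<Rightarrow> (if i = j then 1 else 0) - lam j / c)"
  have U: "U \<in> carrier_mat ?m ?m" and V: "V \<in> carrier_mat ?m ?m" by (simp_all add: U_def V_def)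
  have U0: "U $$ (0, j) = lam j / c" and US: "i < e \<Longrightarrow> U $$ (Suc i, j) = (if j = i then 1 else 0) - (if j = e then 1 else 0)"
    if "j < ?m" for i j using that by (simp_all add: U_def)
  have V0: "V $$ (i, 0) = 1" and VS: "j < e \<Longrightarrow> V $$ (i, Suc j) = (if i = j then 1 else 0) - lam j / c"
    if "i < ?m" for i j using that by (simp_all add: V_def)
  have sum_c: "(\<Sum>k<?m. lam k / c) = 1" using sum_lam c by (simp add: sum_divide_distrib[symmetric] del: sum.lessThan_Suc)
  have US_sum: "(\<Sum>k<?m. U $$ (Suc i, k) * f k) = f i - f e" if "i < e" for i and f :: "nat \<Rightarrow> 'k"
  proof -
    have "(\<Sum>k<?m. U $$ (Suc i, k) * f k) = (\<Sum>k<?m. (if k = i then f k else 0) - (if k = e then f k else 0))"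
      by (rule sum.cong) (use that in \<open>auto simp: US\<close>)
    also have "\<dots> = f i - f e" unfolding sum_subtractf using that by (simp add: sum.delta del: sum.lessThan_Suc)
    finally show ?thesis .
  qed
  have UV: "U * V = 1\<^sub>m ?m"
  proof (rule eq_matI)
    fix i j assume "i < dim_row (1\<^sub>m ?m)" "j < dim_col (1\<^sub>m ?m)"
    then have ij: "i < ?m" "j < ?m" by auto
    have "(\<Sum>k<?m. U $$ (i, k) * V $$ (k, j)) = (if i = j then 1 else 0)"
    proof (cases i)
      case 0
      show ?thesis
      proof (cases j)
        case j: 0
        have "(\<Sum>k<?m. U $$ (i, k) * V $$ (k, j)) = (\<Sum>k<?m. lam k / c)"
          by (rule sum.cong) (auto simp: 0 j U0 V0)
        then show ?thesis using sum_c 0 j by simp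
      next
        case j: (Suc j')
        have "(\<Sum>k<?m. U $$ (i, k) * V $$ (k, j)) = (\<Sum>k<?m. (if k = j' then lam k / c else 0) - lam k / c * (lam j' / c))"
          by (rule sum.cong) (use ij j in \<open>auto simp: 0 U0 VS algebra_simps\<close>)
        also have "\<dots> = lam j' / c - (\<Sum>k<?m. lam k / c) * (lam j' / c)"
          unfolding sum_subtractf sum_distrib_right using ij j by (simp add: sum.delta del: sum.lessThan_Suc)
        finally show ?thesis using sum_c 0 j by simp
      qed
    next
      case i: (Suc i')
      then have "(\<Sum>k<?m. U $$ (i, k) * V $$ (k, j)) = V $$ (i', j) - V $$ (e, j)"
        using US_sum[of i' "\<lambda>k. V $$ (k, j)"] ij by simp
      also have "\<dots> = (if i = j then 1 else 0)"
        using ij i by (cases j) (auto simp: V0 VS)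
      finally show ?thesis .
    qed
    then show "(U * V) $$ (i, j) = 1\<^sub>m ?m $$ (i, j)"
      using mat_mult_entry[OF U V ij] ij by simp
  qed (simp_all add: U_def V_def)
  have VU: "V * U = 1\<^sub>m ?m" by (rule mat_mult_left_right_inverse[OF U V UV])
  define \<tau> where "\<tau> g = U * \<pi> g * V" for g
  have \<tau>M: "\<tau> g \<in> carrier_mat ?m ?m" if "g \<in> carrier G" for g using U V M[OF that] by (simp add: \<tau>_def)
  have \<tau>_mult: "\<tau> (g \<otimes>\<^bsub>G\<^esub> h) = \<tau> g * \<tau> h" if "g \<in> carrier G" "h \<in> carrier G" for g h
  proof -
    note Mg = M[OF that(1)] and Mh = M[OF that(2)]
    have "\<tau> g * \<tau> h = U * \<pi> g * (V * U) * (\<pi> h * V)"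
      unfolding \<tau>_def using U V Mg Mh by (simp add: assoc_mult_mat[of _ ?m ?m _ ?m _ ?m])
    also have "\<dots> = U * (\<pi> g * \<pi> h) * V"
      unfolding VU using U V Mg Mh by (simp add: assoc_mult_mat[of _ ?m ?m _ ?m _ ?m])
    finally show ?thesis by (simp add: \<tau>_def m[OF that])
  qed
  have \<tau>_one: "\<tau> \<one>\<^bsub>G\<^esub> = 1\<^sub>m ?m" using U V UV by (simp add: \<tau>_def o)
  have \<tau>_lc: "locally_constant T \<tau>"
    by (rule locally_constant_factor[OF rep_lc[OF \<pi>]]) (simp add: \<tau>_def)
  note \<tau> = repsI[OF \<tau>M \<tau>_one \<tau>_mult \<tau>_lc]
  have eq: "U * \<pi> g = \<tau> g * U" if g: "g \<in> carrier G" for g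
    unfolding \<tau>_def using U V M[OF g] VU by (simp add: assoc_mult_mat[of _ ?m ?m _ ?m _ ?m])
  have \<tau>_ent: "\<tau> g $$ (i, j) = (\<Sum>a<?m. (\<Sum>b<?m. U $$ (i, b) * \<pi> g $$ (b, a)) * V $$ (a, j))"
    if "g \<in> carrier G" "i < ?m" "j < ?m" for g i j
  proof -
    have "\<tau> g $$ (i, j) = (\<Sum>a<?m. (U * \<pi> g) $$ (i, a) * V $$ (a, j))"
      unfolding \<tau>_def by (rule mat_mult_entry[OF _ V that(2,3)]) (use U M[OF that(1)] in simp)
    also have "\<dots> = (\<Sum>a<?m. (\<Sum>b<?m. U $$ (i, b) * \<pi> g $$ (b, a)) * V $$ (a, j))"
      by (rule sum.cong[OF refl]) (simp only: lessThan_iff mat_mult_entry[OF U M[OF that(1)] that(2)])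
    finally show ?thesis .
  qed
  \<comment> \<open>Invariance of the functional makes the first row of the conjugated matrix a unit
    vector.\<close>
  have top: "\<tau> g $$ (0, j) = (if 0 = j then 1 else 0)" if g: "g \<in> carrier G" and j: "j < ?m" for g j
  proof -
    have "(\<Sum>b<?m. U $$ (0, b) * \<pi> g $$ (b, a)) = U $$ (0, a)" if a: "a < ?m" for a
    proof -
      have "(\<Sum>b<?m. U $$ (0, b) * \<pi> g $$ (b, a)) = (\<Sum>b<?m. lam b * \<pi> g $$ (b, a)) / c"
        unfolding sum_divide_distrib by (rule sum.cong) (auto simp: U0)
      then show ?thesis using lam_inv[OF g a] a by (simp add: U0)
    qed
    then have "\<tau> g $$ (0, j) = (\<Sum>a<?m. U $$ (0, a) * V $$ (a, j))"
      unfolding \<tau>_ent[OF g zero_less_Suc j] by (intro sum.cong) auto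
    also have "\<dots> = (U * V) $$ (0, j)" by (rule mat_mult_entry[OF U V zero_less_Suc j, symmetric])
    finally show ?thesis using UV j by simp
  qed
  \<comment> \<open>Invariance of the vector with all entries 1, in the form of the row sums, clears
    the first column below the corner.\<close>
  have left: "\<tau> g $$ (Suc i, 0) = 0" if g: "g \<in> carrier G" and i: "i < e" for g i
  proof -
    have "\<tau> g $$ (Suc i, 0) = (\<Sum>a<?m. \<Sum>b<?m. U $$ (Suc i, b) * \<pi> g $$ (b, a))"
      unfolding \<tau>_ent[OF g Suc_mono[OF i] zero_less_Suc] by (rule sum.cong) (auto simp: V0)
    also have "\<dots> = (\<Sum>b<?m. U $$ (Suc i, b) * (\<Sum>a<?m. \<pi> g $$ (b, a)))"
      unfolding sum_distrib_left by (rule sum.swap)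
    also have "\<dots> = (\<Sum>b<?m. U $$ (Suc i, b) * 1)"
      by (rule sum.cong) (use row[OF g] in auto)
    also have "\<dots> = 0" using US_sum[OF i, of "\<lambda>_. 1"] by simp
    finally show ?thesis .
  qed
  \<comment> \<open>The remaining block; it is multiplicative because the mixed entries
    vanish.\<close>
  define \<sigma> where "\<sigma> g = mat e e (\<lambda>(i, j). \<tau> g $$ (Suc i, Suc j))" for g
  have \<sigma>_mult: "\<sigma> (g \<otimes>\<^bsub>G\<^esub> h) = \<sigma> g * \<sigma> h" if g: "g \<in> carrier G" and h: "h \<in> carrier G" for g h
  proof (rule eq_matI)
    fix i j assume "i < dim_row (\<sigma> g * \<sigma> h)" "j < dim_col (\<sigma> g * \<sigma> h)"
    then have ij: "i < e" "j < e" by (auto simp: \<sigma>_def)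
    have "\<tau> (g \<otimes>\<^bsub>G\<^esub> h) $$ (Suc i, Suc j) = (\<Sum>k<?m. \<tau> g $$ (Suc i, k) * \<tau> h $$ (k, Suc j))"
      unfolding \<tau>_mult[OF g h] using ij by (intro mat_mult_entry[OF \<tau>M[OF g] \<tau>M[OF h]]) auto
    also have "\<dots> = \<tau> g $$ (Suc i, 0) * \<tau> h $$ (0, Suc j) + (\<Sum>k<e. \<tau> g $$ (Suc i, Suc k) * \<tau> h $$ (Suc k, Suc j))"
      by (rule sum.lessThan_Suc_shift)
    also have "\<dots> = (\<Sum>k<e. \<sigma> g $$ (i, k) * \<sigma> h $$ (k, j))"
      using ij by (simp add: left[OF g] \<sigma>_def)
    also have "\<dots> = (\<sigma> g * \<sigma> h) $$ (i, j)"
      by (rule mat_mult_entry[symmetric]) (use ij in \<open>auto simp: \<sigma>_def\<close>)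
    finally show "\<sigma> (g \<otimes>\<^bsub>G\<^esub> h) $$ (i, j) = (\<sigma> g * \<sigma> h) $$ (i, j)" using ij by (simp add: \<sigma>_def)
  qed (simp_all add: \<sigma>_def)
  have \<sigma>M: "\<sigma> g \<in> carrier_mat e e" for g by (simp add: \<sigma>_def)
  have \<sigma>_one: "\<sigma> \<one>\<^bsub>G\<^esub> = 1\<^sub>m e" by (rule eq_matI) (auto simp: \<sigma>_def \<tau>_one)
  have \<sigma>_lc: "locally_constant T \<sigma>" by (rule locally_constant_factor[OF \<tau>_lc]) (simp add: \<sigma>_def)
  note \<sigma> = repsI[OF \<sigma>M \<sigma>_one \<sigma>_mult \<sigma>_lc]
  show ?thesis
  proof (rule that[OF \<sigma>])
    fix n y assume y: "y \<in> carrier (K_group C n)"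
    have "K_map C (tobj \<pi>) (tmor \<pi>) n y = K_map C (tobj \<tau>) (tmor \<tau>) n y"
      by (rule K_map_tensor_iso[OF \<pi> \<tau>(1) d \<tau>(2) U V UV VU eq y])
    also have "\<dots> = y \<otimes>\<^bsub>K_group C n\<^esub> K_map C (tobj \<sigma>) (tmor \<sigma>) n y"
    proof (rule K_map_tensor_trivial_sum[OF \<tau>(1) \<sigma>(1) _ _ _ _ _ y])
      show "dm \<tau> = Suc (dm \<sigma>)" by (simp add: \<tau>(2) \<sigma>(2))
      fix g assume g: "g \<in> carrier G"
      show "\<tau> g $$ (0, 0) = 1" using top[OF g, of 0] by simp
      fix j assume j: "j < dm \<sigma>"
      show "\<tau> g $$ (0, Suc j) = 0" using top[OF g, of "Suc j"] j \<sigma>(2) by simp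
      show "\<tau> g $$ (Suc j, 0) = 0" using left[OF g, of j] j \<sigma>(2) by simp
      fix i assume "i < dm \<sigma>"
      then show "\<tau> g $$ (Suc i, Suc j) = \<sigma> g $$ (i, j)" using j \<sigma>(2) by (simp add: \<sigma>_def)
    qed
    finally show "K_map C (tobj \<pi>) (tmor \<pi>) n y = y \<otimes>\<^bsub>K_group C n\<^esub> K_map C (tobj \<sigma>) (tmor \<sigma>) n y" .
  qed
qed

text \<open>Rescaling the basis by the units \<open>t\<close> turns the monomial matrices into permutation matrices.\<close>

lemma K_map_tensor_monomial:
  fixes bs :: "'b list" and p :: "'g \<Rightarrow> 'b \<Rightarrow> 'b" and \<omega> :: "'g \<Rightarrow> 'b \<Rightarrow> 'k" and t t' :: "'b \<Rightarrow> 'a"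
  assumes bs: "distinct bs" and p: "\<And>g. g \<in> carrier G \<Longrightarrow> bij_betw (p g) (set bs) (set bs)"
    "\<And>g h b. g \<in> carrier G \<Longrightarrow> h \<in> carrier G \<Longrightarrow> b \<in> set bs \<Longrightarrow> p (g \<otimes>\<^bsub>G\<^esub> h) b = p g (p h b)"
    and \<omega>: "\<And>g b. \<omega> g b \<noteq> 0"
    and \<rho>: "\<rho> \<in> reps G T" "\<And>g. \<rho> g = mat (length bs) (length bs) (\<lambda>(i, j). if bs ! i = p g (bs ! j) then \<omega> g (bs ! i) else 0)"
    and t: "\<And>b. b \<in> set bs \<Longrightarrow> t b \<in> carrier R" "\<And>b. b \<in> set bs \<Longrightarrow> t' b \<in> carrier R" "\<And>b. b \<in> set bs \<Longrightarrow> t b \<otimes>\<^bsub>R\<^esub> t' b = \<one>\<^bsub>R\<^esub>"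
    "\<And>g b. g \<in> carrier G \<Longrightarrow> b \<in> set bs \<Longrightarrow> ract g (t b) = \<iota> (\<omega> g (p g b)) \<otimes>\<^bsub>R\<^esub> t (p g b)"
  obtains \<pi> where "\<pi> \<in> reps G T" "dm \<pi> = dm \<rho>"
    "\<And>g i. g \<in> carrier G \<Longrightarrow> i < dm \<rho> \<Longrightarrow> (\<Sum>j<dm \<rho>. \<pi> g $$ (i, j)) = 1"
    "\<And>n y. y \<in> carrier (K_group C n) \<Longrightarrow> K_map C (tobj \<rho>) (tmor \<rho>) n y = K_map C (tobj \<pi>) (tmor \<pi>) n y"
proof -
  interpret G: group G by (rule G)
  interpret R: cring R by (rule R)
  let ?m = "length bs"
  have d: "dm \<rho> = ?m" by (simp add: rep_dim_def \<rho>(2))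
  define \<pi> where "\<pi> g = mat ?m ?m (\<lambda>(i, j). if bs ! i = p g (bs ! j) then 1 else (0::'k))" for g
  have ent: "\<pi> g $$ (i, j) = (if bs ! i = p g (bs ! j) then 1 else 0)"
     "\<rho> g $$ (i, j) = (if bs ! i = p g (bs ! j) then \<omega> g (bs ! i) else 0)" if "i < ?m" "j < ?m" for g i j
    using that by (simp_all add: \<pi>_def \<rho>(2))
  have pin: "p g b \<in> set bs" if "g \<in> carrier G" "b \<in> set bs" for g b using p(1)[OF that(1)] that(2) by (auto simp: bij_betw_def)
  have delta: "(\<Sum>k<?m. if bs ! k = b then f k else 0) = f k0" if "k0 < ?m" "bs ! k0 = b" for b k0 and f :: "nat \<Rightarrow> 'k"
  proof -
    have "(\<Sum>k<?m. if bs ! k = b then f k else 0) = (\<Sum>k<?m. if k = k0 then f k else 0)"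
      by (rule sum.cong) (use that nth_eq_iff_index_eq[OF bs] in auto)
    then show ?thesis using that by (simp add: sum.delta)
  qed
  \<comment> \<open>Multiplicativity makes the map of the unit idempotent, and an idempotent
    injection is the identity.\<close>
  have one: "p \<one>\<^bsub>G\<^esub> b = b" if b: "b \<in> set bs" for b
  proof -
    have "p \<one>\<^bsub>G\<^esub> (p \<one>\<^bsub>G\<^esub> b) = p \<one>\<^bsub>G\<^esub> b" using p(2)[of "\<one>\<^bsub>G\<^esub>" "\<one>\<^bsub>G\<^esub>" b] b by simp
    with bij_betw_imp_inj_on[OF p(1)[OF G.one_closed]] show ?thesis
      by (rule inj_onD) (use pin b in auto)
  qed
  have \<pi>_mult: "\<pi> (g \<otimes>\<^bsub>G\<^esub> h) = \<pi> g * \<pi> h" if g: "g \<in> carrier G" and h: "h \<in> carrier G" for g h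
  proof (rule eq_matI)
    fix i j assume "i < dim_row (\<pi> g * \<pi> h)" "j < dim_col (\<pi> g * \<pi> h)"
    then have ij: "i < ?m" "j < ?m" by (auto simp: \<pi>_def)
    obtain k0 where k0: "k0 < ?m" "bs ! k0 = p h (bs ! j)" using pin[OF h, of "bs ! j"] ij by (auto simp: in_set_conv_nth)
    have "(\<pi> g * \<pi> h) $$ (i, j) = (\<Sum>k<?m. \<pi> g $$ (i, k) * \<pi> h $$ (k, j))"
      by (rule mat_mult_entry) (use ij in \<open>auto simp: \<pi>_def\<close>)
    also have "\<dots> = (\<Sum>k<?m. if bs ! k = p h (bs ! j) then \<pi> g $$ (i, k) else 0)"
      by (rule sum.cong) (use ij in \<open>auto simp: ent\<close>)
    also have "\<dots> = \<pi> g $$ (i, k0)" by (rule delta[OF k0])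
    also have "\<dots> = \<pi> (g \<otimes>\<^bsub>G\<^esub> h) $$ (i, j)" using ij k0 p(2)[OF g h, of "bs ! j"] by (simp add: ent)
    finally show "\<pi> (g \<otimes>\<^bsub>G\<^esub> h) $$ (i, j) = (\<pi> g * \<pi> h) $$ (i, j)" by simp
  qed (simp_all add: \<pi>_def)
  have \<pi>_one: "\<pi> \<one>\<^bsub>G\<^esub> = 1\<^sub>m ?m"
    by (rule eq_matI) (auto simp: \<pi>_def one nth_eq_iff_index_eq[OF bs])
  \<comment> \<open>The factors \<omega> do not vanish, so the positions of the nonzero entries of
    \<open>\<rho> g\<close> already determine the permutation.\<close>
  have \<pi>_lc: "locally_constant T \<pi>"
  proof (rule locally_constant_factor[OF rep_lc[OF \<rho>(1)]])
    fix g h assume gh: "\<rho> g = \<rho> h"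
    have "bs ! i = p g (bs ! j) \<longleftrightarrow> bs ! i = p h (bs ! j)" if "i < ?m" "j < ?m" for i j
      using ent(2)[OF that, of g] ent(2)[OF that, of h] gh \<omega> by (auto split: if_splits)
    then show "\<pi> g = \<pi> h" by (intro eq_matI) (auto simp: \<pi>_def)
  qed
  have \<pi>M: "\<pi> g \<in> carrier_mat ?m ?m" for g by (simp add: \<pi>_def)
  note \<pi> = repsI[OF \<pi>M \<pi>_one \<pi>_mult \<pi>_lc]
  \<comment> \<open>Row sums 1 say that the vector with all entries 1 is fixed, as
    \<open>K_map_tensor_fixed_vector\<close> demands.\<close>
  have row: "(\<Sum>j<?m. \<pi> g $$ (i, j)) = 1" if g: "g \<in> carrier G" and i: "i < ?m" for g i
  proof -
    have "bs ! i \<in> p g ` set bs" using p(1)[OF g] i by (simp add: bij_betw_def)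
    then obtain j0 where j0: "j0 < ?m" "bs ! i = p g (bs ! j0)" by (auto simp: in_set_conv_nth)
    have "(\<Sum>j<?m. \<pi> g $$ (i, j)) = (\<Sum>j<?m. if bs ! j = bs ! j0 then 1 else 0)"
    proof (rule sum.cong)
      fix j assume "j \<in> {..<?m}"
      then have "p g (bs ! j0) = p g (bs ! j) \<longleftrightarrow> bs ! j0 = bs ! j"
        using inj_on_eq_iff[OF bij_betw_imp_inj_on[OF p(1)[OF g]], of "bs ! j0" "bs ! j"] j0 by simp
      then show "\<pi> g $$ (i, j) = (if bs ! j = bs ! j0 then 1 else 0)"
        using ent(1)[OF i, of j g] \<open>j \<in> {..<?m}\<close> j0 by auto
    qed simp
    then show ?thesis using delta[OF j0(1) refl, of "\<lambda>_. 1"] by simp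
  qed
  \<comment> \<open>Diagonal matrices of the units and of their inverses: each basis vector is
    rescaled by its own unit.\<close>
  define U where "U i j = (if i = j then t (bs ! i) else \<zero>\<^bsub>R\<^esub>)" for i j
  define V where "V i j = (if i = j then t' (bs ! i) else \<zero>\<^bsub>R\<^esub>)" for i j
  have r0: "ract g \<zero>\<^bsub>R\<^esub> = \<zero>\<^bsub>R\<^esub>" if "g \<in> carrier G" for g using ract_iota[OF that, of 0] by (simp add: iota_zero)
  have Rab: "abelian_monoid R" by (rule R.abelian_monoid_axioms)
  show ?thesis
  proof (rule that[OF \<pi>(1)])
    show "dm \<pi> = dm \<rho>" by (simp add: \<pi>(2) d)
    show "(\<Sum>j<dm \<rho>. \<pi> g $$ (i, j)) = 1" if "g \<in> carrier G" "i < dm \<rho>" for g i using row that d by simp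
    fix n y assume y: "y \<in> carrier (K_group C n)"
    have 1: "U i k \<in> carrier R" "V i k \<in> carrier R" if "i < ?m" "k < ?m" for i k
      using that t by (auto simp: U_def V_def)
    have 2: "(\<Oplus>\<^bsub>R\<^esub>j\<in>{..<?m}. V i j \<otimes>\<^bsub>R\<^esub> U j k) = (if k = i then \<one>\<^bsub>R\<^esub> else \<zero>\<^bsub>R\<^esub>)"
        "(\<Oplus>\<^bsub>R\<^esub>j\<in>{..<?m}. U i j \<otimes>\<^bsub>R\<^esub> V j k) = (if k = i then \<one>\<^bsub>R\<^esub> else \<zero>\<^bsub>R\<^esub>)"
      if i: "i < ?m" and k: "k < ?m" for i k
    proof -
      show "(\<Oplus>\<^bsub>R\<^esub>j\<in>{..<?m}. V i j \<otimes>\<^bsub>R\<^esub> U j k) = (if k = i then \<one>\<^bsub>R\<^esub> else \<zero>\<^bsub>R\<^esub>)"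
        by (rule finsum_delta[OF Rab, of i]) (use i k t in \<open>auto simp: U_def V_def R.m_comm\<close>)
      show "(\<Oplus>\<^bsub>R\<^esub>j\<in>{..<?m}. U i j \<otimes>\<^bsub>R\<^esub> V j k) = (if k = i then \<one>\<^bsub>R\<^esub> else \<zero>\<^bsub>R\<^esub>)"
        by (rule finsum_delta[OF Rab, of i]) (use i k t in \<open>auto simp: U_def V_def\<close>)
    qed
    \<comment> \<open>Each product has at most one nonzero summand, and both give the monomial entry
      times the unit of the target vector, since the units are permuted and scaled exactly as the
      basis vectors are.\<close>
    have 3: "(\<Oplus>\<^bsub>R\<^esub>j\<in>{..<?m}. imat (\<pi> g) i j \<otimes>\<^bsub>R\<^esub> ract g (U j k)) = (\<Oplus>\<^bsub>R\<^esub>j\<in>{..<?m}. U i j \<otimes>\<^bsub>R\<^esub> imat (\<rho> g) j k)"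
      if g: "g \<in> carrier G" and i: "i < ?m" and k: "k < ?m" for g i k
    proof -
      let ?x = "if bs ! i = p g (bs ! k) then \<iota> (\<omega> g (bs ! i)) \<otimes>\<^bsub>R\<^esub> t (bs ! i) else \<zero>\<^bsub>R\<^esub>"
      have x: "?x \<in> carrier R" by (rule if_split[THEN iffD2]) (use R.m_closed[OF iota_closed t(1)[OF nth_mem[OF i]]] in blast)
      have "(\<Oplus>\<^bsub>R\<^esub>j\<in>{..<?m}. imat (\<pi> g) i j \<otimes>\<^bsub>R\<^esub> ract g (U j k)) = ?x"
      proof (rule finsum_delta[OF Rab, of k])
        fix j assume j: "j \<in> {..<?m}"
        show "imat (\<pi> g) i j \<otimes>\<^bsub>R\<^esub> ract g (U j k) = (if j = k then ?x else \<zero>\<^bsub>R\<^esub>)"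
        proof (cases "j = k")
          case True
          then show ?thesis using i k t(4)[OF g, of "bs ! k"] t(1) pin[OF g, of "bs ! k"] iota_closed
            by (auto simp: U_def imat_def ent iota_one iota_zero)
        next
          case False
          then show ?thesis using r0[OF g] imat_closed by (simp add: U_def)
        qed
      qed (use x k in auto)
      moreover have "(\<Oplus>\<^bsub>R\<^esub>j\<in>{..<?m}. U i j \<otimes>\<^bsub>R\<^esub> imat (\<rho> g) j k) = ?x"
      proof (rule finsum_delta[OF Rab, of i])
        fix j assume j: "j \<in> {..<?m}"
        show "U i j \<otimes>\<^bsub>R\<^esub> imat (\<rho> g) j k = (if j = i then ?x else \<zero>\<^bsub>R\<^esub>)"
          using i k t(1) iota_closed imat_closed j R.m_comm[OF iota_closed[of "\<omega> g (bs ! i)"] t(1)[OF nth_mem[OF i]]]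
          by (auto simp: U_def imat_def ent iota_zero)
      qed (use x i in auto)
      ultimately show ?thesis by simp
    qed
    show "K_map C (tobj \<rho>) (tmor \<rho>) n y = K_map C (tobj \<pi>) (tmor \<pi>) n y"
      using 1 2 3 by (intro K_map_tensor_twisted[OF \<rho>(1) \<pi>(1) _ _ _ _ _ y, where U = U and V = V]) (simp_all add: d \<pi>(2))
  qed
qed

end

section \<open>The action of virtual representations on the K-theory of \<open>\<E>G\<close>\<close>

text \<open>With more columns than rows the matrix could be padded by zero rows to a singular square
  matrix, whose kernel contains a nonzero vector that \<open>A\<close> kills too.\<close>

lemma inj_mat_dim_le:
  fixes A :: "'k::field mat"
  assumes A: "A \<in> carrier_mat n m" and inj: "\<And>v. v \<in> carrier_vec m \<Longrightarrow> A *\<^sub>v v = 0\<^sub>v n \<Longrightarrow> v = 0\<^sub>v m"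
  shows "m \<le> n"
proof (rule ccontr)
  assume "\<not> m \<le> n"
  then have nm: "n < m" by simp
  define B where "B = mat m m (\<lambda>(i, j). if i < n then A $$ (i, j) else 0)"
  have B: "B \<in> carrier_mat m m" by (simp add: B_def)
  \<comment> \<open>Row \<open>n\<close> of \<open>B\<close> is zero, so the transpose kills a unit
    vector and the determinant vanishes.\<close>
  have "transpose_mat B *\<^sub>v unit_vec m n = 0\<^sub>v m"
  proof (rule eq_vecI)
    fix i assume "i < dim_vec (0\<^sub>v m)"
    then have i: "i < m" by simp
    have "(transpose_mat B *\<^sub>v unit_vec m n) $ i = row (transpose_mat B) i $ n"
      using i nm B by (simp add: scalar_prod_right_unit)
    also have "\<dots> = 0" using i nm by (simp add: B_def)
    finally show "(transpose_mat B *\<^sub>v unit_vec m n) $ i = 0\<^sub>v m $ i" using i by simp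
  qed (use B in simp)
  moreover have "unit_vec m n \<noteq> (0\<^sub>v m :: 'k vec)" using nm by (metis index_unit_vec(1) index_zero_vec(1) zero_neq_one)
  ultimately have "det (transpose_mat B) = 0"
    using det_0_iff_vec_prod_zero_field[of "transpose_mat B" m] B unit_vec_carrier[of m n] by (metis transpose_carrier_mat)
  then have "det B = 0" using det_transpose[OF B] by simp
  then obtain v where v: "v \<in> carrier_vec m" "v \<noteq> 0\<^sub>v m" "B *\<^sub>v v = 0\<^sub>v m"
    using det_0_iff_vec_prod_zero_field[OF B] by blast
  have "A *\<^sub>v v = 0\<^sub>v n"
  proof (rule eq_vecI)
    fix i assume "i < dim_vec (0\<^sub>v n)"
    then have i: "i < n" by simp
    have "row A i = row B i" by (rule eq_vecI) (use i nm A in \<open>auto simp: B_def\<close>)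
    then have "(A *\<^sub>v v) $ i = (B *\<^sub>v v) $ i" using i nm A B by simp
    then show "(A *\<^sub>v v) $ i = 0\<^sub>v n $ i" using v(3) i nm by simp
  qed (use A in simp)
  then show False using inj v by blast
qed

lemma mat_vec_entry:
  "A \<in> carrier_mat n m \<Longrightarrow> v \<in> carrier_vec m \<Longrightarrow> i < n \<Longrightarrow> (A *\<^sub>v v) $ i = (\<Sum>j<m. A $$ (i, j) * v $ j)"
  by (simp add: scalar_prod_def atLeast0LessThan)

lemma mat_mult_zero_vec: "A \<in> carrier_mat n m \<Longrightarrow> A *\<^sub>v 0\<^sub>v m = 0\<^sub>v n"
  by (intro eq_vecI) auto

text \<open>Two injective block matrices give the two inequalities. With a section \<open>S\<close>
  of \<open>Q\<close> these are \<open>P\<close> next to \<open>S\<close>, and \<open>X\<close>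
  above \<open>Q\<close>, where \<open>X\<close> satisfies \<open>P * X = 1 - S * Q\<close>.\<close>

lemma rep_ses_dim:
  assumes "rep_ses G \<rho>' \<rho> (\<rho>'' :: 'g \<Rightarrow> 'k::field mat)"
  shows "rep_dim G \<rho> = rep_dim G \<rho>' + rep_dim G \<rho>''"
proof -
  let ?a = "rep_dim G \<rho>'" and ?b = "rep_dim G \<rho>" and ?c = "rep_dim G \<rho>''"
  obtain P Q where PQ: "intertwiner G \<rho>' \<rho> P \<and> intertwiner G \<rho> \<rho>'' Q
    \<and> inj_on (\<lambda>v. P *\<^sub>v v) (carrier_vec ?a)
    \<and> (\<lambda>v. Q *\<^sub>v v) ` carrier_vec ?b = carrier_vec ?c
    \<and> (\<lambda>v. P *\<^sub>v v) ` carrier_vec ?a = {v \<in> carrier_vec ?b. Q *\<^sub>v v = 0\<^sub>v ?c}"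
    using assms unfolding rep_ses_def by blast
  then have P: "P \<in> carrier_mat ?b ?a" and Q: "Q \<in> carrier_mat ?c ?b"
    by (simp_all add: intertwiner_def)
  note inj = PQ[THEN conjunct2, THEN conjunct2, THEN conjunct1]
    and surj = PQ[THEN conjunct2, THEN conjunct2, THEN conjunct2, THEN conjunct1]
    and ex = PQ[THEN conjunct2, THEN conjunct2, THEN conjunct2, THEN conjunct2]
  have P0: "v = 0\<^sub>v ?a" if "v \<in> carrier_vec ?a" "P *\<^sub>v v = 0\<^sub>v ?b" for v
    using inj_onD[OF inj, of v "0\<^sub>v ?a"] that mat_mult_zero_vec[OF P] by simp
  have "\<forall>j. \<exists>s. j < ?c \<longrightarrow> s \<in> carrier_vec ?b \<and> Q *\<^sub>v s = unit_vec ?c j"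
    using surj by (metis (no_types, lifting) imageE unit_vec_carrier)
  then obtain s where s: "\<And>j. j < ?c \<Longrightarrow> s j \<in> carrier_vec ?b" "\<And>j. j < ?c \<Longrightarrow> Q *\<^sub>v s j = unit_vec ?c j" by metis
  define S where "S = mat ?b ?c (\<lambda>(i, j). s j $ i)"
  have S: "S \<in> carrier_mat ?b ?c" by (simp add: S_def)
  have colS: "col S j = s j" if "j < ?c" for j by (rule eq_vecI) (use that s(1)[OF that] in \<open>auto simp: S_def\<close>)
  have QS: "Q * S = 1\<^sub>m ?c"
  proof (rule eq_matI)
    fix i j assume "i < dim_row (1\<^sub>m ?c)" "j < dim_col (1\<^sub>m ?c)"
    then have ij: "i < ?c" "j < ?c" by auto
    have "(Q * S) $$ (i, j) = (Q *\<^sub>v s j) $ i" using ij Q S colS[OF ij(2)] by simp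
    then show "(Q * S) $$ (i, j) = 1\<^sub>m ?c $$ (i, j)" using s(2)[OF ij(2)] ij by simp
  qed (use Q S in auto)
  have le1: "?a + ?c \<le> ?b"
  proof (rule inj_mat_dim_le)
    let ?A = "mat ?b (?a + ?c) (\<lambda>(i, j). if j < ?a then P $$ (i, j) else S $$ (i, j - ?a))"
    show A: "?A \<in> carrier_mat ?b (?a + ?c)" by simp
    fix v assume v: "v \<in> carrier_vec (?a + ?c)" and Av: "?A *\<^sub>v v = 0\<^sub>v ?b"
    let ?x = "vec ?a (\<lambda>j. v $ j)" and ?y = "vec ?c (\<lambda>j. v $ (?a + j))"
    have xy: "?x \<in> carrier_vec ?a" "?y \<in> carrier_vec ?c" by auto
    have sum: "P *\<^sub>v ?x + S *\<^sub>v ?y = 0\<^sub>v ?b"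
    proof (rule eq_vecI)
      fix i assume "i < dim_vec (0\<^sub>v ?b)"
      then have i: "i < ?b" by simp
      have "0 = (?A *\<^sub>v v) $ i" using Av i by simp
      also have "\<dots> = (\<Sum>j<?a + ?c. ?A $$ (i, j) * v $ j)" by (rule mat_vec_entry[OF A v i])
      also have "\<dots> = (\<Sum>j\<in>{..<?a}. ?A $$ (i, j) * v $ j) + (\<Sum>j\<in>(\<lambda>j. ?a + j) ` {..<?c}. ?A $$ (i, j) * v $ j)"
        unfolding lessThan_add_split[of ?a ?c] by (rule sum.union_disjoint) auto
      also have "(\<Sum>j\<in>{..<?a}. ?A $$ (i, j) * v $ j) = (P *\<^sub>v ?x) $ i"
        unfolding mat_vec_entry[OF P xy(1) i] by (rule sum.cong) (use i in auto)
      also have "(\<Sum>j\<in>(\<lambda>j. ?a + j) ` {..<?c}. ?A $$ (i, j) * v $ j) = (\<Sum>j<?c. ?A $$ (i, ?a + j) * v $ (?a + j))"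
        by (subst sum.reindex) (auto simp: inj_on_def)
      also have "\<dots> = (S *\<^sub>v ?y) $ i"
        unfolding mat_vec_entry[OF S xy(2) i] by (rule sum.cong) (use i in auto)
      finally show "(P *\<^sub>v ?x + S *\<^sub>v ?y) $ i = 0\<^sub>v ?b $ i" using i P S by simp
    qed (use P S in auto)
    have "P *\<^sub>v ?x \<in> {v \<in> carrier_vec ?b. Q *\<^sub>v v = 0\<^sub>v ?c}" using xy(1) unfolding ex[symmetric] by blast
    then have QP: "Q *\<^sub>v (P *\<^sub>v ?x) = 0\<^sub>v ?c" by simp
    have "Q *\<^sub>v (P *\<^sub>v ?x + S *\<^sub>v ?y) = Q *\<^sub>v (P *\<^sub>v ?x) + Q *\<^sub>v (S *\<^sub>v ?y)"
      by (rule mult_add_distrib_mat_vec[OF Q]) (use P S xy in auto)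
    also have "Q *\<^sub>v (S *\<^sub>v ?y) = Q * S *\<^sub>v ?y" by (rule assoc_mult_mat_vec[OF Q S xy(2), symmetric])
    \<comment> \<open>Applying \<open>Q\<close> to the vanishing sum kills the part from
      \<open>P\<close> and returns \<open>?y\<close>.\<close>
    finally have y0: "?y = 0\<^sub>v ?c" using sum QP QS xy mat_mult_zero_vec[OF Q] by simp
    have "P *\<^sub>v ?x = 0\<^sub>v ?b" using sum P mat_mult_zero_vec[OF S] unfolding y0 by simp
    then have x0: "?x = 0\<^sub>v ?a" by (rule P0[OF xy(1)])
    show "v = 0\<^sub>v (?a + ?c)"
    proof (rule eq_vecI)
      fix i assume "i < dim_vec (0\<^sub>v (?a + ?c))"
      then have i: "i < ?a + ?c" by simp
      show "v $ i = 0\<^sub>v (?a + ?c) $ i"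
      proof (cases "i < ?a")
        case True
        then have "v $ i = ?x $ i" by simp
        then show ?thesis unfolding x0 using True i by simp
      next
        case False
        then have "?a + (i - ?a) = i" by linarith
        moreover have "?y $ (i - ?a) = v $ (?a + (i - ?a))" using False i by (intro index_vec) linarith
        ultimately have "v $ i = ?y $ (i - ?a)" by metis
        then show ?thesis unfolding y0 using False i by simp
      qed
    qed (use v in simp)
  qed
  \<comment> \<open>The projection \<open>1 - S * Q\<close> maps into the kernel of
    \<open>Q\<close>, which is the image of \<open>P\<close>.\<close>
  have "\<forall>j. \<exists>x. j < ?b \<longrightarrow> x \<in> carrier_vec ?a \<and> P *\<^sub>v x = unit_vec ?b j - S *\<^sub>v (Q *\<^sub>v unit_vec ?b j)"
  proof (intro allI)
    fix j
    let ?u = "unit_vec ?b j :: 'k vec"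
    have "Q *\<^sub>v (?u - S *\<^sub>v (Q *\<^sub>v ?u)) = Q *\<^sub>v ?u - Q *\<^sub>v (S *\<^sub>v (Q *\<^sub>v ?u))"
      by (rule mult_minus_distrib_mat_vec[OF Q]) (use S Q in auto)
    also have "Q *\<^sub>v (S *\<^sub>v (Q *\<^sub>v ?u)) = Q * S *\<^sub>v (Q *\<^sub>v ?u)"
      by (rule assoc_mult_mat_vec[OF Q S, symmetric]) (use Q in simp)
    finally have "Q *\<^sub>v (?u - S *\<^sub>v (Q *\<^sub>v ?u)) = 0\<^sub>v ?c" using Q QS by simp
    then have "?u - S *\<^sub>v (Q *\<^sub>v ?u) \<in> (\<lambda>v. P *\<^sub>v v) ` carrier_vec ?a" unfolding ex using S Q by simp
    then show "\<exists>x. j < ?b \<longrightarrow> x \<in> carrier_vec ?a \<and> P *\<^sub>v x = ?u - S *\<^sub>v (Q *\<^sub>v ?u)" by (metis imageE)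
  qed
  then obtain x where x: "\<And>j. j < ?b \<Longrightarrow> x j \<in> carrier_vec ?a"
    "\<And>j. j < ?b \<Longrightarrow> P *\<^sub>v x j = unit_vec ?b j - S *\<^sub>v (Q *\<^sub>v unit_vec ?b j)" by metis
  define X where "X = mat ?a ?b (\<lambda>(i, j). x j $ i)"
  have X: "X \<in> carrier_mat ?a ?b" by (simp add: X_def)
  have colX: "col X j = x j" if "j < ?b" for j by (rule eq_vecI) (use that x(1)[OF that] in \<open>auto simp: X_def\<close>)
  have PX: "P * X = 1\<^sub>m ?b - S * Q"
  proof (rule eq_matI)
    fix i j assume "i < dim_row (1\<^sub>m ?b - S * Q)" "j < dim_col (1\<^sub>m ?b - S * Q)"
    then have ij: "i < ?b" "j < ?b" using S Q by auto
    have "(P * X) $$ (i, j) = (P *\<^sub>v x j) $ i" using ij P X colX[OF ij(2)] by simp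
    moreover have "Q *\<^sub>v unit_vec ?b j = col Q j"
      by (rule eq_vecI) (use ij Q in \<open>auto simp: scalar_prod_right_unit\<close>)
    ultimately show "(P * X) $$ (i, j) = (1\<^sub>m ?b - S * Q) $$ (i, j)" using x(2)[OF ij(2)] ij S Q by simp
  qed (use P X S Q in auto)
  have le2: "?b \<le> ?a + ?c"
  proof (rule inj_mat_dim_le)
    let ?W = "mat (?a + ?c) ?b (\<lambda>(i, j). if i < ?a then X $$ (i, j) else Q $$ (i - ?a, j))"
    show W: "?W \<in> carrier_mat (?a + ?c) ?b" by simp
    fix v assume v: "v \<in> carrier_vec ?b" and Wv: "?W *\<^sub>v v = 0\<^sub>v (?a + ?c)"
    have Xv: "X *\<^sub>v v = 0\<^sub>v ?a"
    proof (rule eq_vecI)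
      fix i assume "i < dim_vec (0\<^sub>v ?a)"
      then have i: "i < ?a" "i < ?a + ?c" by auto
      have "(X *\<^sub>v v) $ i = (?W *\<^sub>v v) $ i"
        unfolding mat_vec_entry[OF X v i(1)] mat_vec_entry[OF W v i(2)] by (rule sum.cong) (use i in auto)
      then show "(X *\<^sub>v v) $ i = 0\<^sub>v ?a $ i" unfolding Wv using i by simp
    qed (use X in simp)
    have Qv: "Q *\<^sub>v v = 0\<^sub>v ?c"
    proof (rule eq_vecI)
      fix i assume "i < dim_vec (0\<^sub>v ?c)"
      then have i: "i < ?c" "?a + i < ?a + ?c" by auto
      have "(Q *\<^sub>v v) $ i = (?W *\<^sub>v v) $ (?a + i)"
        unfolding mat_vec_entry[OF Q v i(1)] mat_vec_entry[OF W v i(2)] by (rule sum.cong) (use i in auto)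
      then show "(Q *\<^sub>v v) $ i = 0\<^sub>v ?c $ i" unfolding Wv using i by simp
    qed (use Q in simp)
    have "0\<^sub>v ?b = P *\<^sub>v (X *\<^sub>v v)" by (simp add: Xv mat_mult_zero_vec[OF P])
    also have "\<dots> = (1\<^sub>m ?b - S * Q) *\<^sub>v v" unfolding PX[symmetric] by (rule assoc_mult_mat_vec[OF P X v, symmetric])
    also have "\<dots> = 1\<^sub>m ?b *\<^sub>v v - S * Q *\<^sub>v v" by (rule minus_mult_distrib_mat_vec) (use S Q v in auto)
    also have "S * Q *\<^sub>v v = 0\<^sub>v ?b" using assoc_mult_mat_vec[OF S Q v] mat_mult_zero_vec[OF S] by (simp add: Qv)
    finally show "v = 0\<^sub>v ?b" using v by simp
  qed
  show ?thesis using le1 le2 by simp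
qed

lemma virtual_dim_superset:
  assumes "finite B" "Poly_Mapping.keys c \<subseteq> B"
  shows "virtual_dim G c = (\<Sum>\<rho>\<in>B. Poly_Mapping.lookup c \<rho> * int (rep_dim G \<rho>))"
  unfolding virtual_dim_def by (rule sum.mono_neutral_left) (use assms in \<open>auto simp: in_keys_iff\<close>)

lemma virtual_dim_add: "virtual_dim G (c + d) = virtual_dim G c + virtual_dim G d"
proof -
  let ?B = "Poly_Mapping.keys c \<union> Poly_Mapping.keys d"
  have "Poly_Mapping.keys (c + d) \<subseteq> ?B" by (rule Poly_Mapping.keys_add)
  then show ?thesis
    by (simp add: virtual_dim_superset[of ?B] lookup_add distrib_right sum.distrib)
qed

lemma virtual_dim_uminus: "virtual_dim G (- c) = - virtual_dim G c"
  using virtual_dim_add[of G c "- c"] by (simp add: virtual_dim_def)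

lemma virtual_dim_of: "virtual_dim G (frag_of \<rho>) = int (rep_dim G \<rho>)"
  by (simp add: virtual_dim_def)

lemma keys_ses_relation:
  assumes "\<rho> \<in> S" "\<rho>' \<in> S" "\<rho>'' \<in> S"
  shows "Poly_Mapping.keys (frag_of \<rho> - frag_of \<rho>' - frag_of \<rho>'') \<subseteq> S"
  using assms keys_diff[of "frag_of \<rho> - frag_of \<rho>'" "frag_of \<rho>''"] keys_diff[of "frag_of \<rho>" "frag_of \<rho>'"] by auto

lemma ses_relations_carrier: "ses_relations G T \<subseteq> carrier (free_Abelian_group (reps G T))"
  unfolding ses_relations_def
proof (rule group.generate_incl)
  show "{frag_of \<rho> - frag_of \<rho>' - frag_of \<rho>'' | \<rho> \<rho>' \<rho>''.
      \<rho> \<in> reps G T \<and> \<rho>' \<in> reps G T \<and> \<rho>'' \<in> reps G T \<and> rep_ses G \<rho>' \<rho> \<rho>''} \<subseteq> carrier (free_Abelian_group (reps G T))"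
  proof
    fix c
    assume "c \<in> {frag_of \<rho> - frag_of \<rho>' - frag_of \<rho>'' | \<rho> \<rho>' \<rho>''.
      \<rho> \<in> reps G T \<and> \<rho>' \<in> reps G T \<and> \<rho>'' \<in> reps G T \<and> rep_ses G \<rho>' \<rho> \<rho>''}"
    then obtain \<rho> \<rho>' \<rho>'' where c: "c = frag_of \<rho> - frag_of \<rho>' - frag_of \<rho>''" "\<rho> \<in> reps G T" "\<rho>' \<in> reps G T" "\<rho>'' \<in> reps G T"
      by blast
    show "c \<in> carrier (free_Abelian_group (reps G T))"
      unfolding carrier_free_Abelian_group_iff c(1) by (rule keys_ses_relation[OF c(2-4)])
  qed
qed simp

text \<open>Makes the virtual dimension constant on the cosets that form \<open>R[G]\<close>;
  \<open>augmentation_ideal\<close> applies \<open>the_elem\<close> to its set of values on a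
  coset.\<close>

lemma ses_relations_dim:
  fixes c :: "('g \<Rightarrow> 'k::field mat) \<Rightarrow>\<^sub>0 int"
  assumes "c \<in> ses_relations G T"
  shows "virtual_dim G c = 0"
proof -
  let ?A = "free_Abelian_group (reps G T :: ('g \<Rightarrow> 'k mat) set)"
  have z: "virtual_dim G (frag_of \<rho> - frag_of \<rho>' - frag_of \<rho>'') = 0" if "rep_ses G \<rho>' \<rho> \<rho>''"
    for \<rho> \<rho>' \<rho>'' :: "'g \<Rightarrow> 'k mat"
    using rep_ses_dim[OF that] virtual_dim_add[of G "frag_of \<rho> + - frag_of \<rho>'" "- frag_of \<rho>''"] virtual_dim_add[of G "frag_of \<rho>" "- frag_of \<rho>'"]
    by (simp add: virtual_dim_of virtual_dim_uminus)
  from assms show ?thesis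
    unfolding ses_relations_def
  proof (induction c rule: generate.induct)
    case one
    then show ?case by (simp add: virtual_dim_def)
  next
    case (incl h)
    then show ?case using z by blast
  next
    case (inv h)
    then obtain \<rho> \<rho>' \<rho>'' where h: "h = frag_of \<rho> - frag_of \<rho>' - frag_of \<rho>''" "\<rho> \<in> reps G T" "\<rho>' \<in> reps G T" "\<rho>'' \<in> reps G T" "rep_ses G \<rho>' \<rho> \<rho>''"
      by blast
    \<comment> \<open>The support condition is what identifies the inverse in the free Abelian group
      with the negative.\<close>
    have "Poly_Mapping.keys h \<subseteq> reps G T" unfolding h(1) by (rule keys_ses_relation[OF h(2-4)])
    then have "inv\<^bsub>?A\<^esub> h = - h" by (rule inv_free_Abelian_group)
    then show ?case using z[OF h(5)] virtual_dim_uminus[of G h] h(1) by simp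
  next
    case (eng h1 h2)
    then show ?case by (simp add: virtual_dim_add)
  qed
qed

lemma (in comm_group) finprod_int_pow:
  assumes "finite A" "y \<in> carrier G"
  shows "(\<Otimes>i\<in>A. y [^] (f i :: int)) = y [^] (\<Sum>i\<in>A. f i)"
  using assms(1) by (induction A rule: finite_induct) (use assms(2) in \<open>auto simp: int_pow_mult\<close>)

section \<open>Permutations of l-BARs and the action on root monomials\<close>

lemma lbar_perm_bij:
  assumes "is_lbar l G T \<eta>" "g \<in> carrier G"
  shows "bij_betw (lbar_perm \<eta> g) (bB \<eta>) (bB \<eta>)"
proof -
  have "bhom \<eta> g \<in> aff_aut_set l \<eta>"
    using assms by (auto simp: is_lbar_def hom_def aff_aut_def)
  then show ?thesis by (auto simp: aff_aut_set_def lbar_perm_def)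
qed

text \<open>Composition in the automorphism group is restricted to the carrier of the module, which
  is why \<open>b\<close> is first shown to lie there.\<close>

lemma lbar_perm_mult:
  assumes \<eta>: "is_lbar l G T \<eta>" and "g \<in> carrier G" "h \<in> carrier G" "b \<in> bB \<eta>"
  shows "lbar_perm \<eta> (g \<otimes>\<^bsub>G\<^esub> h) b = lbar_perm \<eta> g (lbar_perm \<eta> h b)"
proof -
  have "b \<in> carrier (bF \<eta>)"
    using \<eta> assms(4) by (auto simp: is_lbar_def based_affine_module_def free_basis_def)
  moreover have "bhom \<eta> (g \<otimes>\<^bsub>G\<^esub> h) = bhom \<eta> g \<otimes>\<^bsub>aff_aut l \<eta>\<^esub> bhom \<eta> h"
    using \<eta> assms(2,3) by (simp add: is_lbar_def hom_def)
  ultimately show ?thesis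
    by (simp add: lbar_perm_def aff_aut_def compose_def split: prod.splits)
qed

lemma laurent_exponents_zero: "0 \<in> laurent_exponents l V"
  by (simp add: laurent_exponents_def)

lemma laurent_exponents_sum:
  "finite A \<Longrightarrow> (\<And>v. v \<in> A \<Longrightarrow> f v \<in> laurent_exponents l V) \<Longrightarrow> (\<Sum>v\<in>A. f v) \<in> laurent_exponents l V"
  by (induction A rule: finite_induct) (auto intro: laurent_exponents_add laurent_exponents_zero)

lemma laurent_exponents_single:
  assumes "v \<in> V" "q * of_nat (l ^ s) \<in> \<int>"
  shows "Poly_Mapping.single v q \<in> laurent_exponents l V"
  using assms by (auto simp: laurent_exponents_def lookup_single when_def)

lemma laurent_ring_sum:
  assumes "finite A" "\<And>e. e \<in> A \<Longrightarrow> f e \<in> carrier (laurent_ring l V)"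
  shows "(\<Sum>e\<in>A. f e) \<in> carrier (laurent_ring l V)"
  using assms
proof (induction A rule: finite_induct)
  case (insert x A)
  then show ?case using Poly_Mapping.keys_add[of "f x" "sum f A"] by (auto simp: laurent_ring_def)
qed (simp add: laurent_ring_def)

lemma laurent_act_closed:
  assumes \<sigma>: "\<And>v. v \<in> V \<Longrightarrow> \<sigma> v \<in> V" and p: "p \<in> carrier (laurent_ring l V)"
  shows "laurent_act l \<zeta> \<sigma> c p \<in> carrier (laurent_ring l V)"
  unfolding laurent_act_def
proof (rule laurent_ring_sum)
  fix e assume "e \<in> Poly_Mapping.keys p"
  then have e: "e \<in> laurent_exponents l V" using p by (auto simp: laurent_ring_def)
  have "(\<Sum>v\<in>Poly_Mapping.keys e. Poly_Mapping.single (\<sigma> v) (Poly_Mapping.lookup e v)) \<in> laurent_exponents l V"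
  proof (rule laurent_exponents_sum)
    fix v assume v: "v \<in> Poly_Mapping.keys e"
    then have "v \<in> V" using e by (auto simp: laurent_exponents_def)
    obtain s where "Poly_Mapping.lookup e v * of_nat (l ^ s) \<in> \<int>" using e unfolding laurent_exponents_def by blast
    with \<sigma>[OF \<open>v \<in> V\<close>] show "Poly_Mapping.single (\<sigma> v) (Poly_Mapping.lookup e v) \<in> laurent_exponents l V"
      by (rule laurent_exponents_single)
  qed simp
  then show "Poly_Mapping.single (\<Sum>v\<in>Poly_Mapping.keys e. Poly_Mapping.single (\<sigma> v) (Poly_Mapping.lookup e v)) x
      \<in> carrier (laurent_ring l V)" for x
    by (simp add: laurent_ring_def)
qed simp

lemma laurent_act_const: "laurent_act l \<zeta> \<sigma> c (laurent_const a) = laurent_const a"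
  by (simp add: laurent_act_def laurent_const_def)

text \<open>\<open>root_char\<close> uses the least level that clears the denominator. For
  \<open>1 / l ^ s\<close> this is \<open>s\<close> itself, as a smaller level leaves a number
  strictly between 0 and 1.\<close>

lemma root_char_root:
  assumes "l > 1"
  shows "root_char l \<zeta> (1 / of_nat (l ^ s)) x = \<zeta> s powi x s"
proof -
  let ?q = "1 / of_nat (l ^ s) :: rat"
  have pos: "(of_nat (l ^ n) :: rat) > 0" for n using assms by simp
  have "(LEAST s'. ?q * of_nat (l ^ s') \<in> \<int>) = s"
  proof (rule Least_equality)
    show "?q * of_nat (l ^ s) \<in> \<int>" using pos[of s] by simp
    fix s' assume a: "?q * of_nat (l ^ s') \<in> \<int>"
    show "s \<le> s'"
    proof (rule ccontr)
      assume "\<not> s \<le> s'"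
      then have "l ^ s' < l ^ s" using assms by (simp add: power_strict_increasing)
      then have "(of_nat (l ^ s') :: rat) < of_nat (l ^ s)" by (simp only: of_nat_less_iff)
      then have lt: "?q * of_nat (l ^ s') < 1" using pos[of s] by (simp add: field_simps)
      have gt: "?q * of_nat (l ^ s') > 0" using pos[of s] pos[of s'] by (intro mult_pos_pos) simp_all
      obtain z where z: "?q * of_nat (l ^ s') = of_int z" using a by (elim Ints_cases)
      from lt gt have "(0::rat) < of_int z" "(of_int z :: rat) < 1" unfolding z by auto
      then show False by simp
    qed
  qed
  moreover have "\<lfloor>?q * of_nat (l ^ s)\<rfloor> = 1" using pos[of s] by simp
  ultimately show ?thesis by (simp only: root_char_def Let_def mult_1)
qed

text \<open>The roots of the variables are permuted and scaled by the same factors as the basis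
  vectors under \<open>lbar_rep\<close>. This match makes them the units for the rescaling.\<close>

lemma laurent_act_root:
  assumes "l > 1"
  shows "laurent_act l \<zeta> \<sigma> c (Poly_Mapping.single (Poly_Mapping.single v (1 / of_nat (l ^ s))) 1)
    = Poly_Mapping.single 0 (\<zeta> s powi c (\<sigma> v) s) * Poly_Mapping.single (Poly_Mapping.single (\<sigma> v) (1 / of_nat (l ^ s))) 1"
proof -
  have "(1 / of_nat (l ^ s) :: rat) \<noteq> 0" using assms by simp
  then show ?thesis
    using root_char_root[OF assms, of \<zeta> s "c (\<sigma> v)"] assms
    by (auto simp: laurent_act_def mult_single simp del: of_nat_power)
qed

theorem proposition5p7:
  fixes l :: nat
    and G :: "'g monoid" and T :: "'g topology"
    and \<zeta> :: "nat \<Rightarrow> 'k::alg_closed_field"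
    and \<eta> :: "('g, 'k) EG_index \<Rightarrow> ('g, 'f, 'x) lbar"
  assumes "prime l" and "l \<noteq> CHAR('k)"
    and "compatible_roots l \<zeta>"
    and "profinite_l_grp l G T" and "totally_torsion_free G T"
    and "EG_choice l G T \<zeta> \<eta>"
  shows "\<forall>n. ideal_times_KG G T (EG_ring l G T \<eta>) laurent_const (EG_act l \<zeta> \<eta>) n
               (augmentation_ideal G T :: (('g \<Rightarrow> 'k mat) \<Rightarrow>\<^sub>0 int) set set)
             = {\<one>\<^bsub>KG_group G T (EG_ring l G T \<eta>) (EG_act l \<zeta> \<eta>) n\<^esub>}"
proof
  fix n
  define I where "I = (EG_indices G T :: ('g, 'k) EG_index set)"
  define W where "W = (SIGMA i:I. bB (\<eta> i))"
  define R where "R = (EG_ring l G T \<eta> :: (('g, 'k) EG_index \<times> 'f, 'k) laurent ring)"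
  define ract where "ract = EG_act l \<zeta> \<eta>"
  have RW: "R = laurent_ring l W" by (simp add: R_def EG_ring_def torus_prod_ring_def W_def I_def)
  have l: "l > 1" using \<open>prime l\<close> prime_gt_1_nat by blast
  have grp: "group G" and top: "topspace T = carrier G"
    using \<open>profinite_l_grp l G T\<close> by (auto simp: profinite_l_grp_def profinite_grp_def topological_grp_def)
  have fin: "\<exists>r. card (rcosets\<^bsub>G\<^esub> N) = l ^ r" if "N \<lhd> G" "openin T N" for N
    using \<open>profinite_l_grp l G T\<close> that by (auto simp: profinite_l_grp_def)
  have lbar: "is_lbar l G T (\<eta> i)" if "i \<in> I" for i
    using \<open>EG_choice l G T \<zeta> \<eta>\<close> that by (auto simp: EG_choice_def I_def EG_indices_def)
  let ?\<sigma> = "\<lambda>g (i, b). (i, lbar_perm (\<eta> i) g b)"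
  have \<sigma>: "?\<sigma> g v \<in> W" if "g \<in> carrier G" "v \<in> W" for g v
    using that lbar_perm_bij[OF lbar \<open>g \<in> carrier G\<close>] by (auto simp: W_def bij_betw_def)
  interpret equivariant_algebra G T R ract "laurent_const :: 'k \<Rightarrow> (('g, 'k) EG_index \<times> 'f, 'k) laurent"
  proof (intro equivariant_algebra.intro equivariant_ring.intro equivariant_algebra_axioms.intro)
    show "group G" "topspace T = carrier G" by fact+
    show "cring R" unfolding RW by (rule cring_laurent_ring)
    show "ract g a \<in> carrier R" if "g \<in> carrier G" "a \<in> carrier R" for g a
      unfolding ract_def EG_act_def torus_prod_act_def RW
      by (rule laurent_act_closed) (use \<sigma>[OF that(1)] that(2) in \<open>auto simp: RW\<close>)
    show "ract g (laurent_const c) = laurent_const c" if "g \<in> carrier G" for g c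
      unfolding ract_def EG_act_def torus_prod_act_def by (rule laurent_act_const)
    show "laurent_const c \<in> carrier R" for c
      by (simp add: RW laurent_ring_def laurent_const_def laurent_exponents_zero)
  qed (simp_all add: RW laurent_ring_def laurent_const_def single_add mult_single)
  \<comment> \<open>As \<open>l\<close> is prime and differs from the characteristic, a vanishing
    power of \<open>l\<close> would force characteristic 1.\<close>
  have char: "of_nat (l ^ r) \<noteq> (0 :: 'k)" for r
  proof
    assume "of_nat (l ^ r) = (0 :: 'k)"
    then have "of_nat l = (0 :: 'k)" by simp
    then have "CHAR('k) dvd l" by (simp add: of_nat_eq_0_iff_char_dvd)
    then have "CHAR('k) = 1" using \<open>prime l\<close> \<open>l \<noteq> CHAR('k)\<close> prime_nat_iff by metis
    then show False by simp
  qed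
  \<comment> \<open>The factor of \<open>EG_ring\<close> that belongs to the isomorphism class of
    \<rho> supplies both a monomial form of \<rho> and the units that absorb its scalars.\<close>
  have monomial: "\<exists>\<pi>\<in>reps G T. dm \<pi> = dm \<rho> \<and> (\<forall>g\<in>carrier G. \<forall>i<dm \<rho>. (\<Sum>j<dm \<rho>. \<pi> g $$ (i, j)) = 1)
      \<and> (\<forall>y\<in>carrier (K_group C n). K_map C (tobj \<rho>) (tmor \<rho>) n y = K_map C (tobj \<pi>) (tmor \<pi>) n y)"
    if \<rho>: "\<rho> \<in> reps G T" for \<rho> :: "'g \<Rightarrow> 'k mat"
  proof -
    define \<alpha> where "\<alpha> = rep_iso G T `` {\<rho>}"
    have \<alpha>: "\<alpha> \<in> rep_classes G T" unfolding rep_classes_def \<alpha>_def by (rule quotientI[OF \<rho>])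
    let ?\<eta> = "\<eta> (Inr \<alpha>)"
    have I: "Inr \<alpha> \<in> I" using \<alpha> by (auto simp: I_def EG_indices_def)
    obtain s bs where bs: "distinct bs" "set bs = bB ?\<eta>" and r: "lbar_rep l \<zeta> ?\<eta> s bs \<in> \<alpha>"
      using \<open>EG_choice l G T \<zeta> \<eta>\<close> \<alpha> unfolding EG_choice_def by blast
    let ?r = "lbar_rep l \<zeta> ?\<eta> s bs"
    obtain P where P: "intertwiner G \<rho> ?r P" "invertible_mat P" and rr: "?r \<in> reps G T"
      using r unfolding \<alpha>_def rep_iso_def by blast
    obtain Q where Q: "P * Q = 1\<^sub>m (dim_row P)" "Q * P = 1\<^sub>m (dim_row Q)" and sq: "dim_col P = dim_row P"
      using P(2) unfolding invertible_mat_def inverts_mat_def square_mat.simps by (elim conjE exE) (rule that)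
    have PM: "P \<in> carrier_mat (dm ?r) (dm \<rho>)" using P(1) by (simp add: intertwiner_def)
    have d: "dm ?r = dm \<rho>" using PM sq by simp
    have "dim_row Q = dim_col P" using arg_cong[OF Q(2), of dim_col] by simp
    moreover have "dim_col Q = dim_row P" using arg_cong[OF Q(1), of dim_col] by simp
    ultimately have QM: "Q \<in> carrier_mat (dm \<rho>) (dm \<rho>)" using carrier_matD[OF PM] d by (intro carrier_matI) metis+
    have K1: "K_map C (tobj \<rho>) (tmor \<rho>) n y = K_map C (tobj ?r) (tmor ?r) n y" if "y \<in> carrier (K_group C n)" for y
      by (rule K_map_tensor_iso[OF \<rho> rr refl d _ QM _ _ _ that, of P])
        (use PM d Q QM P(1) in \<open>auto simp: intertwiner_def\<close>)
    \<comment> \<open>Roots of the variables of this factor, taken at the level \<open>s\<close> at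
      which \<open>lbar_rep\<close> takes its roots of unity.\<close>
    let ?t = "\<lambda>b. Poly_Mapping.single (Poly_Mapping.single (Inr \<alpha>, b) (1 / of_nat (l ^ s))) 1 :: (('g, 'k) EG_index \<times> 'f, 'k) laurent"
    let ?t' = "\<lambda>b. Poly_Mapping.single (Poly_Mapping.single (Inr \<alpha>, b) (- 1 / of_nat (l ^ s))) 1 :: (('g, 'k) EG_index \<times> 'f, 'k) laurent"
    let ?\<omega> = "\<lambda>g b. \<zeta> s powi lbar_coord l ?\<eta> g b s"
    have z: "\<zeta> s \<noteq> 0"
    proof
      assume "\<zeta> s = 0"
      moreover have "\<zeta> s ^ (l ^ s) = 1" using \<open>compatible_roots l \<zeta>\<close> by (simp add: compatible_roots_def)
      ultimately show False using l by (simp add: power_0_left)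
    qed
    have inW: "(Inr \<alpha>, b) \<in> W" if "b \<in> set bs" for b using that bs I by (simp add: W_def)
    obtain \<pi> where \<pi>: "\<pi> \<in> reps G T" "dm \<pi> = dm ?r"
      "\<And>g i. g \<in> carrier G \<Longrightarrow> i < dm ?r \<Longrightarrow> (\<Sum>j<dm ?r. \<pi> g $$ (i, j)) = 1"
      "\<And>n y. y \<in> carrier (K_group C n) \<Longrightarrow> K_map C (tobj ?r) (tmor ?r) n y = K_map C (tobj \<pi>) (tmor \<pi>) n y"
    proof (rule K_map_tensor_monomial[of bs "lbar_perm ?\<eta>" ?\<omega> ?r ?t ?t'])
      show "distinct bs" by (rule bs)
      show "bij_betw (lbar_perm ?\<eta> g) (set bs) (set bs)" if "g \<in> carrier G" for g
        unfolding bs(2) by (rule lbar_perm_bij[OF lbar[OF I] that])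
      show "lbar_perm ?\<eta> (g \<otimes>\<^bsub>G\<^esub> h) b = lbar_perm ?\<eta> g (lbar_perm ?\<eta> h b)"
        if "g \<in> carrier G" "h \<in> carrier G" "b \<in> set bs" for g h b
        by (rule lbar_perm_mult[OF lbar[OF I] that(1,2)]) (use that bs in simp)
      show "?\<omega> g b \<noteq> 0" for g b using z by simp
      show "?r \<in> reps G T" by (rule rr)
      show "?r g = mat (length bs) (length bs) (\<lambda>(i, j). if bs ! i = lbar_perm ?\<eta> g (bs ! j) then ?\<omega> g (bs ! i) else 0)" for g
        by (simp add: lbar_rep_def)
      have q: "of_nat (l ^ s) \<noteq> (0 :: rat)" using l by simp
      show "?t b \<in> carrier R" if "b \<in> set bs" for b
        using laurent_exponents_single[OF inW[OF that], of "1 / of_nat (l ^ s)" l s] q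
        by (simp add: RW laurent_ring_def)
      show "?t' b \<in> carrier R" if "b \<in> set bs" for b
        using laurent_exponents_single[OF inW[OF that], of "- 1 / of_nat (l ^ s)" l s] q
        by (simp add: RW laurent_ring_def)
      show "?t b \<otimes>\<^bsub>R\<^esub> ?t' b = \<one>\<^bsub>R\<^esub>" for b
        by (simp add: RW laurent_ring_def mult_single single_add[symmetric])
      show "ract g (?t b) = laurent_const (?\<omega> g (lbar_perm ?\<eta> g b)) \<otimes>\<^bsub>R\<^esub> ?t (lbar_perm ?\<eta> g b)" for g b
        unfolding ract_def EG_act_def torus_prod_act_def laurent_act_root[OF l]
        by (simp add: RW laurent_ring_def laurent_const_def)
    qed (rule that)
    show ?thesis using \<pi> d K1 by (intro bexI[of _ \<pi>]) auto
  qed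
  interpret K: comm_group "K_group C n" by (rule K_group_comm_group)
  \<comment> \<open>Each step splits off one factor \<open>y\<close> and lowers the dimension by
    one. The complement is an arbitrary representation again, so it is made monomial anew, with its
    own l-BAR.\<close>
  have dim: "K_map C (tobj \<rho>) (tmor \<rho>) n y = y [^]\<^bsub>K_group C n\<^esub> dm \<rho>"
    if "\<rho> \<in> reps G T" and y: "y \<in> carrier (K_group C n)" for \<rho> :: "'g \<Rightarrow> 'k mat" and y
    using that(1)
  proof (induction "dm \<rho>" arbitrary: \<rho>)
    case 0
    then show ?case using K_map_tensor_zero_dim[OF 0(2) _ y] by simp
  next
    case (Suc e)
    obtain \<pi> where \<pi>: "\<pi> \<in> reps G T" "dm \<pi> = dm \<rho>" "\<forall>g\<in>carrier G. \<forall>i<dm \<rho>. (\<Sum>j<dm \<rho>. \<pi> g $$ (i, j)) = 1"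
      "K_map C (tobj \<rho>) (tmor \<rho>) n y = K_map C (tobj \<pi>) (tmor \<pi>) n y"
      using monomial[OF Suc.prems] y by blast
    have "l > 0" using l by simp
    note card = rep_image_card[OF \<pi>(1) fin this]
    \<comment> \<open>The order of the image is a power of \<open>l\<close> and hence invertible in
      \<open>k\<close>.\<close>
    have c0: "of_nat (card (\<pi> ` carrier G)) \<noteq> (0 :: 'k)" using card(2) char by metis
    have d: "dm \<pi> = Suc e" using \<pi>(2) Suc.hyps(2) by simp
    obtain \<sigma> where \<sigma>: "\<sigma> \<in> reps G T" "dm \<sigma> = e"
      "\<And>n y. y \<in> carrier (K_group C n) \<Longrightarrow>
        K_map C (tobj \<pi>) (tmor \<pi>) n y = y \<otimes>\<^bsub>K_group C n\<^esub> K_map C (tobj \<sigma>) (tmor \<sigma>) n y"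
      by (rule K_map_tensor_fixed_vector[OF \<pi>(1) d _ card(1) c0]) (use \<pi>(2,3) d in auto)
    have "K_map C (tobj \<rho>) (tmor \<rho>) n y = y \<otimes>\<^bsub>K_group C n\<^esub> y [^]\<^bsub>K_group C n\<^esub> e"
      using \<pi>(4) \<sigma>(3)[OF y] Suc.hyps(1)[of \<sigma>] \<sigma>(1,2) by simp
    \<comment> \<open>A power takes its new factor on the right, so commutativity is used.\<close>
    also have "\<dots> = y [^]\<^bsub>K_group C n\<^esub> Suc e" using y by (simp add: K.m_comm)
    finally show ?case using Suc.hyps(2) by simp
  qed
  let ?act = "\<lambda>c y. virtual_rep_act G T R (laurent_const :: 'k \<Rightarrow> _) ract n c y"
  \<comment> \<open>Powers of one element are multiplied by adding exponents, and the sum of these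
    exponents is the virtual dimension.\<close>
  have act: "?act c y = y [^]\<^bsub>K_group C n\<^esub> virtual_dim G c"
    if c: "Poly_Mapping.keys c \<subseteq> reps G T" and y: "y \<in> carrier (K_group C n)" for c y
  proof -
    have "?act c y = (\<Otimes>\<^bsub>K_group C n\<^esub>\<rho>\<in>Poly_Mapping.keys c. y [^]\<^bsub>K_group C n\<^esub> (Poly_Mapping.lookup c \<rho> * int (dm \<rho>)))"
      unfolding virtual_rep_act_def KG_group_def
    proof (rule K.finprod_cong')
      fix \<rho> assume "\<rho> \<in> Poly_Mapping.keys c"
      then have "\<rho> \<in> reps G T" using c by blast
      from dim[OF this y] show "K_map C (tobj \<rho>) (tmor \<rho>) n y [^]\<^bsub>K_group C n\<^esub> Poly_Mapping.lookup c \<rho>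
          = y [^]\<^bsub>K_group C n\<^esub> (Poly_Mapping.lookup c \<rho> * int (dm \<rho>))"
        using y by (simp add: K.int_pow_pow int_pow_int[symmetric] mult.commute)
    qed (use y in auto)
    also have "\<dots> = y [^]\<^bsub>K_group C n\<^esub> virtual_dim G c"
      unfolding virtual_dim_def by (rule K.finprod_int_pow[OF _ y]) simp
    finally show ?thesis .
  qed
  let ?A = "free_Abelian_group (reps G T :: ('g \<Rightarrow> 'k mat) set)" and ?S = "ses_relations G T :: (('g \<Rightarrow> 'k mat) \<Rightarrow>\<^sub>0 int) set"
  have trivial: "rep_ring_act G T R (laurent_const :: 'k \<Rightarrow> _) ract n r y = \<one>\<^bsub>K_group C n\<^esub>"
    if r: "r \<in> augmentation_ideal G T" and y: "y \<in> carrier (K_group C n)" for r and y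
  proof -
    have "r \<in> carrier (?A Mod ?S)" using r by (simp add: augmentation_ideal_def rep_ring_def Let_def)
    then obtain c where c: "Poly_Mapping.keys c \<subseteq> reps G T" "r = ?S #>\<^bsub>?A\<^esub> c"
      by (auto simp: FactGroup_def RCOSETS_def)
    \<comment> \<open>All representatives of the class are supported on representations and share
      one virtual dimension, so the action through representatives has a single value.\<close>
    have el: "Poly_Mapping.keys d \<subseteq> reps G T \<and> virtual_dim G d = virtual_dim G c" if d: "d \<in> r" for d
    proof -
      obtain s where s: "s \<in> ?S" "d = s + c" using d c(2) by (auto simp: r_coset_def)
      then have "Poly_Mapping.keys s \<subseteq> reps G T" using ses_relations_carrier[of G T] unfolding carrier_free_Abelian_group_iff[symmetric] by blast
      then have "Poly_Mapping.keys d \<subseteq> reps G T" using c(1) Poly_Mapping.keys_add[of s c] s(2) by blast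
      then show ?thesis using s ses_relations_dim[OF s(1)] by (simp add: virtual_dim_add)
    qed
    have "0 \<in> ?S" unfolding ses_relations_def using generate.one[of ?A] by simp
    then have ne: "r \<noteq> {}" using c(2) by (auto simp: r_coset_def)
    have "virtual_dim G ` r = {virtual_dim G c}" using el ne by auto
    then have "virtual_dim G c = 0" using r by (simp add: augmentation_ideal_def)
    then have "?act d y = \<one>\<^bsub>K_group C n\<^esub>" if "d \<in> r" for d using act[OF _ y, of d] el[OF that] by simp
    then have "(\<lambda>d. ?act d y) ` r = {\<one>\<^bsub>K_group C n\<^esub>}" using ne by auto
    then show ?thesis by (simp add: rep_ring_act_def)
  qed
  let ?X = "{rep_ring_act G T R (laurent_const :: 'k \<Rightarrow> _) ract n r y | r y. r \<in> augmentation_ideal G T \<and> y \<in> carrier (K_group C n)}"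
  have "generate (K_group C n) ?X = {\<one>\<^bsub>K_group C n\<^esub>}"
  proof
    show "{\<one>\<^bsub>K_group C n\<^esub>} \<subseteq> generate (K_group C n) ?X" by (simp add: generate.one)
    show "generate (K_group C n) ?X \<subseteq> {\<one>\<^bsub>K_group C n\<^esub>}"
    proof
      fix z assume "z \<in> generate (K_group C n) ?X"
      then show "z \<in> {\<one>\<^bsub>K_group C n\<^esub>}"
        by (induction z rule: generate.induct) (use trivial in auto)
    qed
  qed
  then show "ideal_times_KG G T (EG_ring l G T \<eta>) laurent_const (EG_act l \<zeta> \<eta>) n
               (augmentation_ideal G T :: (('g \<Rightarrow> 'k mat) \<Rightarrow>\<^sub>0 int) set set)
             = {\<one>\<^bsub>KG_group G T (EG_ring l G T \<eta>) (EG_act l \<zeta> \<eta>) n\<^esub>}"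
    unfolding ideal_times_KG_def KG_group_def R_def ract_def .
qed

end
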